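(* Let $k$ be an algebraically closed field and let $\Lambda$ and $\Gamma$ be two finite dimensional basic indecomposable hereditary $k$-algebras. If $\rho:\mathsf{s\tau\text{-}tilt}(\Lambda)\to \mathsf{s\tau\text{-}tilt}(\Gamma)$ is a poset isomorphism, then the restriction of $\rho$ to $\mathsf{tilt}(\Lambda)\subset \mathsf{s\tau\text{-}tilt}(\Lambda)$ has image $\mathsf{tilt}(\Gamma)$ and induces a poset isomorphism $\rho|_{\mathsf{tilt}(\Lambda)}:\mathsf{tilt}(\Lambda)\simeq \mathsf{tilt}(\Gamma)$.
   Context: Let $\Lambda$ be a finite dimensional algebra over an algebraically closed field $k$, basic and indecomposable (as an algebra). Modules are finitely generated right modules, $\tau$ is the Auslander-Reiten translation of $\operatorname{mod}\Lambda$, and $|M|$ is the number of pairwise non-isomorphic indecomposable direct summands of $M$. A module is basic if its indecomposable direct summands are pairwise non-isomorphic; $\mathsf{add}\,M$ is the class of direct summands of finite direct sums of copies of $M$. Tilting modules: a $\Lambda$-module $T$ is tilting if $\mathrm{pd}\,T\le 1$, $\operatorname{Ext}^1_\Lambda(T,T)=0$ and $|T|=|\Lambda|$. $\mathsf{tilt}(\Lambda)$ is the set of isomorphism classes of basic tilting modules, partially ordered by $T_1\le T_2$ iff $T_1^{\perp_1}\subset T_2^{\perp_1}$, where $M^{\perp_1}=\{X\in\operatorname{mod}\Lambda\mid \operatorname{Ext}^1_\Lambda(M,X)=0\}$ (equivalently, $T_2\ge T_1$ iff $\operatorname{Ext}^1_\Lambda(T_2,T_1)=0$). Support $\tau$-tilting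 modules: a pair $(M,P)$ of a $\Lambda$-module $M$ and a projective $\Lambda$-module $P$ is a support $\tau$-tilting pair if $\operatorname{Hom}_\Lambda(M,\tau M)=0$, $\operatorname{Hom}_\Lambda(P,M)=0$ and $|M|+|P|=|\Lambda|$; then $M$ is called a support $\tau$-tilting module. For basic $M$ the basic projective $P$ is unique up to isomorphism. $\mathsf{s\tau\text{-}tilt}(\Lambda)$ is the set of isomorphism classes of basic support $\tau$-tilting modules, partially ordered by: for support $\tau$-tilting pairs $(M,P)$, $(M',P')$ with $M,M',P,P'$ basic, $M\le M'$ iff $\operatorname{Hom}_\Lambda(M,\tau M')=0$ and $\mathsf{add}\,P'\subset \mathsf{add}\,P$. When $\Lambda$ is hereditary, $\Lambda\cong kQ$ for a finite connected acyclic quiver $Q$, and $\mathsf{s\tau\text{-}tilt}(\Lambda)$ coincides with the set of isomorphism classes of basic support tilting modules, i.e. basic modules $M$ that are tilting as modules over $kQ(M)$, where $Q(M)$ is the full subquiver of $Q$ on the support of $M$; the order becomes $M\ge M'$ iff $\operatorname{Ext}^1_\Lambda(M,M')=0$ and $Q(M')_0\subset Q(M)_0$. Then $\mathsf{tilt}(\Lambda)$ is the subposet of $\mathsf{s\tau\text{-}tilt}(\Lambda)$ of those $M$ with $Q(M)=Q$. *)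

theory Defs
  imports Complex_Main
    "HOL-Library.Function_Algebras"
    "HOL-Computational_Algebra.Polynomial"
begin

section \<open>Right modules over a ring\<close>

text \<open>
  The additive group of a module is a subgroup of an ambient additive group, so a module consists
  of a carrier and a right action. Addition on function types is pointwise
  (\<^theory>\<open>HOL-Library.Function_Algebras\<close>). The action is irrelevant outside the carrier.
\<close>

record ('a, 'm) rmod =
  carr :: "'m set"
  act :: "'m \<Rightarrow> 'a \<Rightarrow> 'm"

locale right_module =
  fixes M :: "('a::ring_1, 'm::ab_group_add) rmod"
  assumes zero_closed: "0 \<in> carr M"
    and add_closed: "x \<in> carr M \<Longrightarrow> y \<in> carr M \<Longrightarrow> x + y \<in> carr M"
    and uminus_closed: "x \<in> carr M \<Longrightarrow> - x \<in> carr M"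
    and act_closed: "x \<in> carr M \<Longrightarrow> act M x a \<in> carr M"
    and act_add_left: "x \<in> carr M \<Longrightarrow> y \<in> carr M \<Longrightarrow> act M (x + y) a = act M x a + act M y a"
    and act_add_right: "x \<in> carr M \<Longrightarrow> act M x (a + b) = act M x a + act M x b"
    and act_mult: "x \<in> carr M \<Longrightarrow> act M x (a * b) = act M (act M x a) b"
    and act_one: "x \<in> carr M \<Longrightarrow> act M x 1 = x"

definition regular :: "('a::ring_1, 'a) rmod" where
  "regular = \<lparr>carr = UNIV, act = (*)\<rparr>"

definition submod :: "('a, 'm) rmod \<Rightarrow> 'm set \<Rightarrow> ('a, 'm) rmod" where
  "submod M U = \<lparr>carr = U, act = act M\<rparr>"

definition submodule :: "'m set \<Rightarrow> ('a::ring_1, 'm::ab_group_add) rmod \<Rightarrow> bool" where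
  "submodule U M \<longleftrightarrow> U \<subseteq> carr M \<and> right_module (submod M U)"

definition fin_gen :: "('a::ring_1, 'm::ab_group_add) rmod \<Rightarrow> bool" where
  "fin_gen M \<longleftrightarrow> (\<exists>B. finite B \<and> B \<subseteq> carr M \<and> (\<forall>U. submodule U M \<and> B \<subseteq> U \<longrightarrow> U = carr M))"

text \<open>
  Homomorphisms are normalised to be zero outside the carrier of the source. Thus they are equal
  as functions iff they are equal as homomorphisms, they form a subgroup of the function space,
  and their composition is ordinary composition of functions.
\<close>

definition hom :: "('a::ring_1, 'm::ab_group_add) rmod \<Rightarrow> ('a, 'n::ab_group_add) rmod \<Rightarrow> ('m \<Rightarrow> 'n) set"
  where
  "hom M N = {f. (\<forall>x\<in>carr M. f x \<in> carr N) \<and>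
                 (\<forall>x\<in>carr M. \<forall>y\<in>carr M. f (x + y) = f x + f y) \<and>
                 (\<forall>x\<in>carr M. \<forall>a. f (act M x a) = act N (f x) a) \<and>
                 (\<forall>x. x \<notin> carr M \<longrightarrow> f x = 0)}"

definition epi :: "('a::ring_1, 'm::ab_group_add) rmod \<Rightarrow> ('a, 'n::ab_group_add) rmod \<Rightarrow> ('m \<Rightarrow> 'n) \<Rightarrow> bool"
  where "epi M N f \<longleftrightarrow> f \<in> hom M N \<and> f ` carr M = carr N"

definition ker :: "('a, 'm) rmod \<Rightarrow> ('m \<Rightarrow> 'n::zero) \<Rightarrow> 'm set" where
  "ker M f = {x \<in> carr M. f x = 0}"

definition iso_mod :: "('a::ring_1, 'm::ab_group_add) rmod \<Rightarrow> ('a, 'n::ab_group_add) rmod \<Rightarrow> bool" where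
  "iso_mod M N \<longleftrightarrow> (\<exists>f\<in>hom M N. bij_betw f (carr M) (carr N))"

definition internal_sum :: "('a::ring_1, 'm::ab_group_add) rmod \<Rightarrow> 'm set \<Rightarrow> 'm set \<Rightarrow> bool" where
  "internal_sum M U V \<longleftrightarrow> submodule U M \<and> submodule V M \<and> U \<inter> V = {0} \<and>
     carr M = {u + v | u v. u \<in> U \<and> v \<in> V}"

definition indecomposable :: "('a::ring_1, 'm::ab_group_add) rmod \<Rightarrow> bool" where
  "indecomposable M \<longleftrightarrow> carr M \<noteq> {0} \<and> (\<forall>U V. internal_sum M U V \<longrightarrow> U = {0} \<or> V = {0})"

definition is_summand :: "('a::ring_1, 'n::ab_group_add) rmod \<Rightarrow> ('a, 'm::ab_group_add) rmod \<Rightarrow> bool" where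
  "is_summand X M \<longleftrightarrow> (\<exists>U V. internal_sum M U V \<and> iso_mod X (submod M U))"

text \<open>The external direct sum of a list of modules.\<close>

definition dsum :: "('a, 'm::ab_group_add) rmod list \<Rightarrow> ('a, nat \<Rightarrow> 'm) rmod" where
  "dsum Ms = \<lparr>carr = {x. (\<forall>i<length Ms. x i \<in> carr (Ms ! i)) \<and> (\<forall>i\<ge>length Ms. x i = 0)},
              act = (\<lambda>x a i. if i < length Ms then act (Ms ! i) (x i) a else 0)\<rparr>"


section \<open>Finite dimensional algebras and their module categories\<close>

text \<open>
  An algebra is a type \<^typ>\<open>'a\<close> of class \<^class>\<open>ring_1\<close> (so \<open>0 \<noteq> 1\<close>) with a scalar multiplication
  \<open>s\<close>. In all definitions below the parameter \<open>s\<close> stands for the algebra.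
\<close>

definition fd_algebra :: "('k::field \<Rightarrow> 'a::ring_1 \<Rightarrow> 'a) \<Rightarrow> bool" where
  "fd_algebra s \<longleftrightarrow> (\<exists>B. finite_dimensional_vector_space s B) \<and>
     (\<forall>c x y. s c (x * y) = s c x * y \<and> s c (x * y) = x * s c y)"

text \<open>
  The finitely generated right modules whose underlying vector space is a subspace of
  \<open>k\<^sup>\<nat>\<close>. Finitely generated modules over a finite dimensional algebra are finite dimensional, so
  each of them is isomorphic to one of these. The last condition says that the vector space
  structure induced by the algebra is the one of \<open>k\<^sup>\<nat>\<close>.
\<close>

definition mods :: "('k::field \<Rightarrow> 'a::ring_1 \<Rightarrow> 'a) \<Rightarrow> ('a, nat \<Rightarrow> 'k) rmod set" where
  "mods s = {M. right_module M \<and> fin_gen M \<and>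
                (\<forall>x\<in>carr M. \<forall>c. act M x (s c 1) = (\<lambda>i. c * x i))}"

definition iso_class ::
  "('k::field \<Rightarrow> 'a::ring_1 \<Rightarrow> 'a) \<Rightarrow> ('a, 'm::ab_group_add) rmod \<Rightarrow> ('a, nat \<Rightarrow> 'k) rmod set" where
  "iso_class s M = {N \<in> mods s. iso_mod M N}"

definition projective ::
  "('k::field \<Rightarrow> 'a::ring_1 \<Rightarrow> 'a) \<Rightarrow> ('a, 'm::ab_group_add) rmod \<Rightarrow> bool" where
  "projective s P \<longleftrightarrow>
     (\<forall>X\<in>mods s. \<forall>Y\<in>mods s. \<forall>g f. epi X Y g \<and> f \<in> hom P Y \<longrightarrow> (\<exists>h\<in>hom P X. g \<circ> h = f))"

definition projs :: "('k::field \<Rightarrow> 'a::ring_1 \<Rightarrow> 'a) \<Rightarrow> ('a, nat \<Rightarrow> 'k) rmod set" where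
  "projs s = {P \<in> mods s. projective s P}"

text \<open>\<open>|M|\<close>, the number of isomorphism classes of indecomposable direct summands of \<open>M\<close>.\<close>

definition num_summands ::
  "('k::field \<Rightarrow> 'a::ring_1 \<Rightarrow> 'a) \<Rightarrow> ('a, 'm::ab_group_add) rmod \<Rightarrow> nat" where
  "num_summands s M = card {iso_class s X | X. X \<in> mods s \<and> indecomposable X \<and> is_summand X M}"

definition basic ::
  "('k::field \<Rightarrow> 'a::ring_1 \<Rightarrow> 'a) \<Rightarrow> ('a, 'm::ab_group_add) rmod \<Rightarrow> bool" where
  "basic s M \<longleftrightarrow>
     (\<forall>Xs. (\<forall>X\<in>set Xs. X \<in> mods s \<and> indecomposable X) \<and> iso_mod M (dsum Xs) \<longrightarrow>
           (\<forall>i<length Xs. \<forall>j<length Xs. i \<noteq> j \<longrightarrow> \<not> iso_mod (Xs ! i) (Xs ! j)))"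

definition add_cl ::
  "('k::field \<Rightarrow> 'a::ring_1 \<Rightarrow> 'a) \<Rightarrow> ('a, nat \<Rightarrow> 'k) rmod \<Rightarrow> ('a, nat \<Rightarrow> 'k) rmod set" where
  "add_cl s M = {X \<in> mods s. \<exists>n. is_summand X (dsum (replicate n M))}"

definition basic_algebra :: "('k::field \<Rightarrow> 'a::ring_1 \<Rightarrow> 'a) \<Rightarrow> bool" where
  "basic_algebra s \<longleftrightarrow> basic s (regular :: ('a, 'a) rmod)"

definition two_sided_ideal :: "'a::ring_1 set \<Rightarrow> bool" where
  "two_sided_ideal I \<longleftrightarrow> submodule I regular \<and> (\<forall>a. \<forall>x\<in>I. a * x \<in> I)"

text \<open>
  A decomposition of a ring as a product of two rings is the same as a decomposition as a direct
  sum of two two-sided ideals (which are closed under scalars, as \<open>s c x = x * s c 1\<close>).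
\<close>

definition indecomposable_algebra :: "('k::field \<Rightarrow> 'a::ring_1 \<Rightarrow> 'a) \<Rightarrow> bool" where
  "indecomposable_algebra s \<longleftrightarrow>
     (\<forall>I J :: 'a set. two_sided_ideal I \<and> two_sided_ideal J \<and> I \<inter> J = {0} \<and>
        {x + y | x y. x \<in> I \<and> y \<in> J} = UNIV \<longrightarrow> I = {0} \<or> J = {0})"

definition hereditary_algebra :: "('k::field \<Rightarrow> 'a::ring_1 \<Rightarrow> 'a) \<Rightarrow> bool" where
  "hereditary_algebra s \<longleftrightarrow>
     (\<forall>I :: 'a set. submodule I regular \<longrightarrow> projective s (submod regular I))"


section \<open>Extensions, projective dimension and the Auslander-Reiten translation\<close>

text \<open>The first terms \<open>P2 \<rightarrow> P1 \<rightarrow> P0 \<rightarrow> M \<rightarrow> 0\<close> of a projective resolution of \<open>M\<close>.\<close>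

definition proj_resolution where
  "proj_resolution s M P2 P1 P0 d2 d1 e \<longleftrightarrow>
     P2 \<in> projs s \<and> P1 \<in> projs s \<and> P0 \<in> projs s \<and>
     d2 \<in> hom P2 P1 \<and> d1 \<in> hom P1 P0 \<and> epi P0 M e \<and>
     d2 ` carr P2 = ker P1 d1 \<and> d1 ` carr P1 = ker P0 e"

text \<open>
  \<open>Ext\<^sup>1(M, N) = 0\<close>: the complex \<open>Hom(P0, N) \<rightarrow> Hom(P1, N) \<rightarrow> Hom(P2, N)\<close> is exact in the middle.
  This does not depend on the resolution.
\<close>

definition Ext1_zero ::
  "('k::field \<Rightarrow> 'a::ring_1 \<Rightarrow> 'a) \<Rightarrow> ('a, nat \<Rightarrow> 'k) rmod \<Rightarrow> ('a, nat \<Rightarrow> 'k) rmod \<Rightarrow> bool" where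
  "Ext1_zero s M N \<longleftrightarrow>
     (\<exists>P2 P1 P0 d2 d1 e. proj_resolution s M P2 P1 P0 d2 d1 e \<and>
        {g \<in> hom P1 N. g \<circ> d2 = 0} = {h \<circ> d1 | h. h \<in> hom P0 N})"

definition pd_le_1 ::
  "('k::field \<Rightarrow> 'a::ring_1 \<Rightarrow> 'a) \<Rightarrow> ('a, nat \<Rightarrow> 'k) rmod \<Rightarrow> bool" where
  "pd_le_1 s M \<longleftrightarrow>
     (\<exists>P1\<in>projs s. \<exists>P0\<in>projs s. \<exists>d\<in>hom P1 P0. \<exists>e.
        epi P0 M e \<and> d ` carr P1 = ker P0 e \<and> inj_on d (carr P1))"

definition superfluous :: "'m set \<Rightarrow> ('a::ring_1, 'm::ab_group_add) rmod \<Rightarrow> bool" where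
  "superfluous K M \<longleftrightarrow> submodule K M \<and>
     (\<forall>U. submodule U M \<and> {u + x | u x. u \<in> U \<and> x \<in> K} = carr M \<longrightarrow> U = carr M)"

definition projective_cover ::
  "('k::field \<Rightarrow> 'a::ring_1 \<Rightarrow> 'a) \<Rightarrow> ('a, nat \<Rightarrow> 'k) rmod \<Rightarrow> ('a, nat \<Rightarrow> 'k) rmod \<Rightarrow>
     ((nat \<Rightarrow> 'k) \<Rightarrow> nat \<Rightarrow> 'k) \<Rightarrow> bool" where
  "projective_cover s P M e \<longleftrightarrow> P \<in> projs s \<and> epi P M e \<and> superfluous (ker P e) P"

definition min_presentation ::
  "('k::field \<Rightarrow> 'a::ring_1 \<Rightarrow> 'a) \<Rightarrow> ('a, nat \<Rightarrow> 'k) rmod \<Rightarrow>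
     ('a, nat \<Rightarrow> 'k) rmod \<times> ('a, nat \<Rightarrow> 'k) rmod \<times>
     ((nat \<Rightarrow> 'k) \<Rightarrow> nat \<Rightarrow> 'k) \<times> ((nat \<Rightarrow> 'k) \<Rightarrow> nat \<Rightarrow> 'k) \<Rightarrow> bool" where
  "min_presentation s M = (\<lambda>(P1, P0, d, e).
     projective_cover s P0 M e \<and> projective_cover s P1 (submod P0 (ker P0 e)) d)"

text \<open>
  The right module \<open>D (Coker (Hom(P0, \<Lambda>) \<rightarrow> Hom(P1, \<Lambda>)))\<close> for \<open>d: P1 \<rightarrow> P0\<close>, where
  \<open>D = Hom\<^sub>k(-, k)\<close>. The dual of the cokernel consists of the linear forms on the left module
  \<open>Hom(P1, \<Lambda>)\<close> that vanish on the image of \<open>g \<mapsto> g \<circ> d\<close>. As for homomorphisms, they are normalised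
  to be zero outside \<open>Hom(P1, \<Lambda>)\<close>.
\<close>

definition D_coker ::
  "('k::field \<Rightarrow> 'a::ring_1 \<Rightarrow> 'a) \<Rightarrow> ('a, nat \<Rightarrow> 'k) rmod \<Rightarrow> ('a, nat \<Rightarrow> 'k) rmod \<Rightarrow>
     ((nat \<Rightarrow> 'k) \<Rightarrow> nat \<Rightarrow> 'k) \<Rightarrow> ('a, ((nat \<Rightarrow> 'k) \<Rightarrow> 'a) \<Rightarrow> 'k) rmod" where
  "D_coker s P1 P0 d =
     \<lparr>carr = {\<phi>. (\<forall>g\<in>hom P1 regular. \<forall>h\<in>hom P1 regular. \<phi> (g + h) = \<phi> g + \<phi> h) \<and>
                  (\<forall>c. \<forall>g\<in>hom P1 regular. \<phi> (\<lambda>x. s c (g x)) = c * \<phi> g) \<and>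
                  (\<forall>g. g \<notin> hom P1 regular \<longrightarrow> \<phi> g = 0) \<and>
                  (\<forall>g\<in>hom P0 regular. \<phi> (g \<circ> d) = 0)},
      act = (\<lambda>\<phi> a g. if g \<in> hom P1 regular then \<phi> (\<lambda>x. a * g x) else 0)\<rparr>"

text \<open>
  The translation \<open>\<tau> M = D Tr M\<close>. Minimal projective presentations exist and are unique up to
  isomorphism.
\<close>

definition tau ::
  "('k::field \<Rightarrow> 'a::ring_1 \<Rightarrow> 'a) \<Rightarrow> ('a, nat \<Rightarrow> 'k) rmod \<Rightarrow>
     ('a, ((nat \<Rightarrow> 'k) \<Rightarrow> 'a) \<Rightarrow> 'k) rmod" where
  "tau s M = (let (P1, P0, d, e) = (SOME p. min_presentation s M p) in D_coker s P1 P0 d)"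


section \<open>The posets of tilting and of support tau-tilting modules\<close>

definition tilting ::
  "('k::field \<Rightarrow> 'a::ring_1 \<Rightarrow> 'a) \<Rightarrow> ('a, nat \<Rightarrow> 'k) rmod \<Rightarrow> bool" where
  "tilting s T \<longleftrightarrow> T \<in> mods s \<and> pd_le_1 s T \<and> Ext1_zero s T T \<and>
     num_summands s T = num_summands s (regular :: ('a, 'a) rmod)"

definition perp1 ::
  "('k::field \<Rightarrow> 'a::ring_1 \<Rightarrow> 'a) \<Rightarrow> ('a, nat \<Rightarrow> 'k) rmod \<Rightarrow> ('a, nat \<Rightarrow> 'k) rmod set" where
  "perp1 s M = {X \<in> mods s. Ext1_zero s M X}"

definition tilt :: "('k::field \<Rightarrow> 'a::ring_1 \<Rightarrow> 'a) \<Rightarrow> ('a, nat \<Rightarrow> 'k) rmod set set" where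
  "tilt s = {iso_class s T | T. tilting s T \<and> basic s T}"

definition tilt_le ::
  "('k::field \<Rightarrow> 'a::ring_1 \<Rightarrow> 'a) \<Rightarrow>
     ('a, nat \<Rightarrow> 'k) rmod set \<Rightarrow> ('a, nat \<Rightarrow> 'k) rmod set \<Rightarrow> bool" where
  "tilt_le s A B \<longleftrightarrow> (\<exists>T1\<in>A. \<exists>T2\<in>B. perp1 s T1 \<subseteq> perp1 s T2)"

definition stau_pair ::
  "('k::field \<Rightarrow> 'a::ring_1 \<Rightarrow> 'a) \<Rightarrow> ('a, nat \<Rightarrow> 'k) rmod \<Rightarrow> ('a, nat \<Rightarrow> 'k) rmod \<Rightarrow> bool" where
  "stau_pair s M P \<longleftrightarrow> M \<in> mods s \<and> P \<in> projs s \<and>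
     hom M (tau s M) = {0} \<and> hom P M = {0} \<and>
     num_summands s M + num_summands s P = num_summands s (regular :: ('a, 'a) rmod)"

definition stau_tilting ::
  "('k::field \<Rightarrow> 'a::ring_1 \<Rightarrow> 'a) \<Rightarrow> ('a, nat \<Rightarrow> 'k) rmod \<Rightarrow> bool" where
  "stau_tilting s M \<longleftrightarrow> (\<exists>P. stau_pair s M P)"

definition stau_tilt :: "('k::field \<Rightarrow> 'a::ring_1 \<Rightarrow> 'a) \<Rightarrow> ('a, nat \<Rightarrow> 'k) rmod set set" where
  "stau_tilt s = {iso_class s M | M. stau_tilting s M \<and> basic s M}"

definition stau_le ::
  "('k::field \<Rightarrow> 'a::ring_1 \<Rightarrow> 'a) \<Rightarrow>
     ('a, nat \<Rightarrow> 'k) rmod set \<Rightarrow> ('a, nat \<Rightarrow> 'k) rmod set \<Rightarrow> bool" where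
  "stau_le s A B \<longleftrightarrow>
     (\<exists>M\<in>A. \<exists>M'\<in>B. \<exists>P P'. stau_pair s M P \<and> stau_pair s M' P' \<and>
        basic s M \<and> basic s M' \<and> basic s P \<and> basic s P' \<and>
        hom M (tau s M') = {0} \<and> add_cl s P' \<subseteq> add_cl s P)"

definition poset_iso ::
  "'x set \<Rightarrow> ('x \<Rightarrow> 'x \<Rightarrow> bool) \<Rightarrow> 'y set \<Rightarrow> ('y \<Rightarrow> 'y \<Rightarrow> bool) \<Rightarrow> ('x \<Rightarrow> 'y) \<Rightarrow> bool" where
  "poset_iso A leA B leB f \<longleftrightarrow> bij_betw f A B \<and> (\<forall>x\<in>A. \<forall>y\<in>A. leA x y \<longleftrightarrow> leB (f x) (f y))"

end

theory Submission
  imports Defs "HOL-Library.Nat_Bijection"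
begin

text \<open>
  For a hereditary algebra the support tau-tilting modules are the basic modules \<open>M\<close> with
  \<open>Ext\<^sup>1(M, M) = 0\<close> that have as many summands as vertices in their support, and the tilting modules
  are those whose support is everything. The order is \<open>M \<le> N\<close> iff \<open>Ext\<^sup>1(N, M) = 0\<close> and the support of
  \<open>M\<close> is contained in that of \<open>N\<close>. Hence the atoms are the simple modules \<open>S\<^sub>i\<close>. If \<open>M\<close> is not supported
  at \<open>i\<close>, then \<open>M\<close> is filtered by the \<open>S\<^sub>j\<close> with \<open>j \<noteq> i\<close>, so it lies below every upper bound of these
  \<open>S\<^sub>j\<close>. Conversely \<open>\<Lambda>/(e\<^sub>i)\<close> is such an upper bound and is not supported at \<open>i\<close>. Thus a support
  tau-tilting module is tilting iff, for every atom, it does not lie below all upper bounds of the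
  other atoms, which is a condition on the poset alone. On tilting modules the two orders agree,
  because \<open>Ext\<^sup>1(T, X) = 0\<close> forces \<open>X\<close> to be a quotient of a power of \<open>T\<close>.

  All of this rests on the bound for the number of summands of a rigid module: by the
  Happel-Ringel lemma the matrix \<open>dim Hom(M\<^sub>k, M\<^sub>l)\<close> of its summands is triangular for a suitable
  order, and it factors through the dimensions \<open>dim Hom(P\<^sub>i, M\<^sub>l)\<close>.
\<close>

section \<open>Finite dimensional subspaces\<close>

text \<open>No quiver, no Ext functor and no long exact sequence is constructed. The hereditary
  property enters only through the fact that submodules of projectives are projective.
  \<open>Ext0\<close> stands in for the vanishing of Ext: it asks that maps extend from the kernel
  of an epimorphism onto \<open>M\<close>, so exact-sequence arguments turn into explicit extensions
  and liftings. The summands of a rigid module are never ordered as a whole. It suffices that every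
  nonempty set of them has a source, a member receiving no nonzero map from the others: pairing a
  linear relation between index vectors with a source of the set of nonzero coefficients isolates
  one coefficient. The same vectors show that nothing nonzero is orthogonal to a tilting module for
  both Hom and Ext, which is why it generates. Joins of atoms are not shown to exist; the criterion
  quantifies over all upper bounds. All modules have to be subspaces of \<open>k^N\<close>.
  Therefore quotients are realised on complements, direct sums pass through a pairing function, and
  modules with another carrier type, such as right ideals, are replaced by isomorphic
  copies.\<close>

text \<open>
  A copy of \<^locale>\<open>vector_space\<close>: the interpretation of the latter for real vector spaces would
  capture the unqualified names of all new constants and facts.
\<close>

locale vspace = vector_space scale for scale :: "'a::field \<Rightarrow> 'b::ab_group_add \<Rightarrow> 'b"
begin

text \<open>The ambient space is infinite-dimensional, and \<open>dim\<close> is 0 for a subspace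
  with an infinite basis, so finiteness has to be carried by the subspace itself.\<close>

definition fin_dim :: "'b set \<Rightarrow> bool" where
  "fin_dim V \<longleftrightarrow> subspace V \<and> (\<exists>B. finite B \<and> V \<subseteq> span B)"

lemma fin_dim_basis:
  assumes "fin_dim V"
  obtains B where "finite B" "B \<subseteq> V" "independent B" "span B = V" "card B = dim V"
proof -
  obtain C where C: "finite C" "V \<subseteq> span C" and V: "subspace V"
    using assms unfolding fin_dim_def by blast
  obtain B where B: "B \<subseteq> V" "independent B" "V \<subseteq> span B" "card B = dim V"
    by (rule basis_exists)
  have "B \<subseteq> span C" using B C by blast
  then have "finite B" using independent_span_bound[OF C(1) B(2)] by blast
  moreover have "span B = V" using B V span_minimal[OF B(1) V] by blast
  ultimately show thesis using that B by blast
qed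

lemma fin_dim_subset:
  assumes "fin_dim V" "subspace W" "W \<subseteq> V"
  shows "fin_dim W"
  using assms unfolding fin_dim_def by blast

lemma fin_dim_mono:
  assumes "fin_dim V" "W \<subseteq> V"
  shows "dim W \<le> dim V"
proof -
  obtain B where "finite B" "span B = V" "card B = dim V"
    using fin_dim_basis[OF assms(1)] by metis
  then show ?thesis using dim_le_card[of W B] assms(2) by simp
qed

lemma fin_dim_eq:
  assumes V: "fin_dim V" and W: "subspace W" "W \<subseteq> V" and eq: "dim V \<le> dim W"
  shows "W = V"
proof (rule ccontr)
  assume "W \<noteq> V"
  then obtain x where x: "x \<in> V" "x \<notin> W" using W by blast
  obtain B where B: "finite B" "B \<subseteq> W" "independent B" "span B = W" "card B = dim W"
    using fin_dim_basis[OF fin_dim_subset[OF V W]] by metis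
  obtain C where C: "finite C" "span C = V" "card C = dim V"
    using fin_dim_basis[OF V] by metis
  have "x \<notin> span B" using x B by simp
  then have ind: "independent (insert x B)" using B independent_insertI by blast
  have "insert x B \<subseteq> span C" using B C W x by auto
  then have "card (insert x B) \<le> card C" using independent_span_bound[OF C(1) ind] by blast
  moreover have "x \<notin> B" using x B by blast
  ultimately show False using B C eq by simp
qed

lemma dim_zero_iff:
  assumes "fin_dim V"
  shows "dim V = 0 \<longleftrightarrow> V = {0}"
proof
  assume d: "dim V = 0"
  have "subspace {0}" by (simp add: subspace_def)
  moreover have "{0} \<subseteq> V" using assms unfolding fin_dim_def subspace_def by auto
  ultimately have "{0} = V" using fin_dim_eq[OF assms] d by (metis bot_nat_0.extremum)
  then show "V = {0}" by simp
next
  assume "V = {0}"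
  then show "dim V = 0" using dim_le_card[of V "{}"] by simp
qed

text \<open>By uniqueness of representations, the coordinates of \<open>x\<close> over
  \<open>C\<close> are supported on \<open>B\<close> and also on \<open>C - B\<close>, so they
  vanish.\<close>

lemma span_disjoint:
  assumes "independent C" "B \<subseteq> C" "x \<in> span B" "x \<in> span (C - B)"
  shows "x = 0"
proof -
  have xC: "x \<in> span C" using assms span_mono by blast
  have "representation C x b = 0" for b
  proof -
    have 1: "representation C x = representation B x"
      using representation_extend[OF assms(1,3,2)] .
    have 2: "representation C x = representation (C - B) x"
      using representation_extend[OF assms(1,4)] by blast
    show ?thesis
    proof (cases "b \<in> B")
      case True
      then show ?thesis using 2 representation_ne_zero[of "C - B" x b] by auto
    next
      case False
      then show ?thesis using 1 representation_ne_zero[of B x b] by auto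
    qed
  qed
  then show ?thesis using sum_nonzero_representation_eq[OF assms(1) xC] by simp
qed

lemma subspace_complement:
  assumes "subspace U" "subspace V" "U \<subseteq> V"
  obtains W where "subspace W" "W \<subseteq> V" "U \<inter> W = {0}" "\<And>v. v \<in> V \<Longrightarrow> \<exists>u\<in>U. \<exists>w\<in>W. v = u + w"
proof -
  obtain B where B: "B \<subseteq> U" "independent B" "U \<subseteq> span B" "card B = dim U"
    by (rule basis_exists)
  have BV: "B \<subseteq> V" using B assms by blast
  obtain C where C: "B \<subseteq> C" "C \<subseteq> V" "independent C" "V \<subseteq> span C"
    by (rule maximal_independent_subset_extend[OF BV B(2)])
  have U: "U = span B" using B(3) span_minimal[OF B(1) assms(1)] by (rule antisym)
  have CB: "C - B \<subseteq> V" using C(2) by blast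
  have 1: "span (C - B) \<subseteq> V" by (rule span_minimal[OF CB assms(2)])
  have 2: "U \<inter> span (C - B) = {0}"
    unfolding U using span_disjoint[OF C(3,1)] span_zero by auto
  have 3: "\<exists>u\<in>U. \<exists>w\<in>span (C - B). v = u + w" if "v \<in> V" for v
  proof -
    have "B \<union> (C - B) = C" using C(1) by blast
    then have "v \<in> span (B \<union> (C - B))" using that C(4) by auto
    then show ?thesis unfolding span_Un U by auto
  qed
  show thesis by (rule that[OF subspace_span 1 2 3])
qed

end

section \<open>Maps that are linear on a subspace\<close>

locale vspace_pair = vs1: vspace s1 + vs2: vspace s2
  for s1 :: "'a::field \<Rightarrow> 'b::ab_group_add \<Rightarrow> 'b"
    and s2 :: "'a::field \<Rightarrow> 'c::ab_group_add \<Rightarrow> 'c"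
begin

sublocale vector_space_pair s1 s2 ..

text \<open>Homomorphisms are zero off the carrier and hence linear only on it;
  \<open>linear_on_extend\<close> replaces them by globally linear maps that agree there.\<close>

definition linear_on :: "'b set \<Rightarrow> ('b \<Rightarrow> 'c) \<Rightarrow> bool" where
  "linear_on V f \<longleftrightarrow> (\<forall>x\<in>V. \<forall>y\<in>V. f (x + y) = f x + f y) \<and> (\<forall>x\<in>V. \<forall>c. f (s1 c x) = s2 c (f x))"

lemma linear_on_extend:
  assumes V: "vs1.subspace V" and f: "linear_on V f"
  obtains g where "Vector_Spaces.linear s1 s2 g" "\<And>x. x \<in> V \<Longrightarrow> g x = f x"
proof -
  obtain B where B: "B \<subseteq> V" "vs1.independent B" "V \<subseteq> vs1.span B" "card B = vs1.dim V"
    by (rule vs1.basis_exists)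
  obtain g where g: "Vector_Spaces.linear s1 s2 g" "\<And>x. x \<in> B \<Longrightarrow> g x = f x"
    using linear_independent_extend[OF B(2)] by blast
  interpret g: Vector_Spaces.linear s1 s2 g by (rule g(1))
  have "x \<in> V \<and> g x = f x" if "x \<in> vs1.span B" for x
    using that
  proof (induction rule: vs1.span_induct_alt)
    case base
    have z: "0 \<in> V" using V vs1.subspace_0 by blast
    have "f (0 + 0) = f 0 + f 0" using f z unfolding linear_on_def by blast
    then show ?case using z g.zero by simp
  next
    case (step c x y)
    then have x: "x \<in> V" "s1 c x \<in> V" "y \<in> V" "s1 c x + y \<in> V"
      using B V vs1.subspace_scale vs1.subspace_add by blast+
    moreover have "f (s1 c x + y) = s2 c (f x) + f y"
      using f x unfolding linear_on_def by simp
    moreover have "g (s1 c x + y) = s2 c (g x) + g y" by (simp add: g.add g.scale)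
    ultimately show ?case using step g(2) by simp
  qed
  then show thesis using that[OF g(1)] B by blast
qed

lemma linear_on_span_image:
  assumes f: "linear_on V f" and V: "vs1.subspace V" and B: "B \<subseteq> V" and x: "x \<in> vs1.span B"
  shows "f x \<in> vs2.span (f ` B)"
proof -
  obtain g where g: "Vector_Spaces.linear s1 s2 g" "\<And>x. x \<in> V \<Longrightarrow> g x = f x"
    using linear_on_extend[OF V f] by metis
  interpret g: Vector_Spaces.linear s1 s2 g by (rule g(1))
  have "x \<in> V" using vs1.span_minimal[OF B V] x by blast
  then have "f x = g x" using g by simp
  also have "\<dots> \<in> g ` vs1.span B" using x by blast
  also have "\<dots> = vs2.span (g ` B)" by (simp add: g.span_image)
  also have "g ` B = f ` B" using g B by (intro image_cong) auto
  finally show ?thesis .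
qed

text \<open>A basis \<open>B\<close> of the kernel is extended to a basis \<open>C\<close> of
  \<open>V\<close>. The global extension \<open>g\<close> of \<open>f\<close> is injective on the
  span of \<open>C - B\<close>, so \<open>C - B\<close> goes bijectively to a basis of the
  image.\<close>

lemma rank_nullity:
  assumes V: "vs1.fin_dim V" and f: "linear_on V f"
  shows "vs2.fin_dim (f ` V)" "vs1.fin_dim {x \<in> V. f x = 0}"
    "vs1.dim V = vs1.dim {x \<in> V. f x = 0} + vs2.dim (f ` V)"
proof -
  have sV: "vs1.subspace V" using V unfolding vs1.fin_dim_def by blast
  obtain g where g: "Vector_Spaces.linear s1 s2 g" "\<And>x. x \<in> V \<Longrightarrow> g x = f x"
    using linear_on_extend[OF sV f] by metis
  interpret g: Vector_Spaces.linear s1 s2 g by (rule g(1))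
  define K where "K = {x \<in> V. f x = 0}"
  have Kg: "K = V \<inter> {x. g x = 0}" unfolding K_def using g by auto
  have sK: "vs1.subspace K"
    unfolding Kg using sV g.subspace_kernel by (simp add: vs1.subspace_inter)
  have fK: "vs1.fin_dim K" using vs1.fin_dim_subset[OF V sK] K_def by blast
  then show "vs1.fin_dim {x \<in> V. f x = 0}" unfolding K_def .
  have im: "f ` V = g ` V" using g by (intro image_cong) auto
  obtain B where B: "finite B" "B \<subseteq> K" "vs1.independent B" "vs1.span B = K" "card B = vs1.dim K"
    using vs1.fin_dim_basis[OF fK] by metis
  have BV: "B \<subseteq> V" using B(2) K_def by blast
  obtain C where C: "B \<subseteq> C" "C \<subseteq> V" "vs1.independent C" "V \<subseteq> vs1.span C"
    by (rule vs1.maximal_independent_subset_extend[OF BV B(3)])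
  obtain D where D: "finite D" "V \<subseteq> vs1.span D" using V unfolding vs1.fin_dim_def by blast
  have fC: "finite C" using vs1.independent_span_bound[OF D(1) C(3)] C D by blast
  have dV: "vs1.dim V = card C" using vs1.basis_card_eq_dim[OF C(2,4,3)] by simp
  have VC: "vs1.span C = V" using C vs1.span_minimal[OF C(2) sV] by blast
  have spV: "vs1.span (C - B) \<subseteq> V" using C vs1.span_minimal[OF _ sV] by blast
  have inj: "inj_on g (vs1.span (C - B))"
  proof (rule inj_onI)
    fix x y assume xy: "x \<in> vs1.span (C - B)" "y \<in> vs1.span (C - B)" "g x = g y"
    have d: "x - y \<in> vs1.span (C - B)" using xy vs1.span_diff by blast
    have "g (x - y) = 0" using xy by (simp add: g.diff)
    then have "x - y \<in> vs1.span B" using d spV unfolding B(4) Kg by blast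
    then have "x - y = 0" using vs1.span_disjoint[OF C(3,1)] d by blast
    then show "x = y" by simp
  qed
  have indC: "vs1.independent (C - B)" using C vs1.independent_mono by blast
  have ind: "vs2.independent (g ` (C - B))" using g.independent_injective_image[OF indC inj] .
  have gB: "g b = 0" if "b \<in> B" for b using that B(2) Kg by blast
  have "g ` V = vs2.span (g ` C)" using VC g.span_image by metis
  also have "\<dots> = vs2.span (g ` (C - B))"
  proof (rule antisym)
    have "g ` C \<subseteq> vs2.span (g ` (C - B))"
    proof
      fix y assume "y \<in> g ` C"
      then obtain c where "c \<in> C" "y = g c" by blast
      then show "y \<in> vs2.span (g ` (C - B))"
        by (cases "c \<in> B") (auto simp: gB vs2.span_zero intro: vs2.span_base)
    qed
    then show "vs2.span (g ` C) \<subseteq> vs2.span (g ` (C - B))"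
      by (rule vs2.span_minimal) (rule vs2.subspace_span)
    show "vs2.span (g ` (C - B)) \<subseteq> vs2.span (g ` C)" by (intro vs2.span_mono) blast
  qed
  finally have sp: "g ` V = vs2.span (g ` (C - B))" .
  show "vs2.fin_dim (f ` V)"
    unfolding im vs2.fin_dim_def sp
    by (intro conjI exI[of _ "g ` (C - B)"] vs2.subspace_span order.refl) (use fC in simp)
  have "vs2.dim (g ` V) = card (g ` (C - B))" unfolding sp using vs2.dim_span_eq_card_independent[OF ind] .
  also have "\<dots> = card (C - B)"
    using card_image[OF inj_on_subset[OF inj vs1.span_superset]] .
  also have "\<dots> = card C - card B" using card_Diff_subset[OF B(1) C(1)] .
  finally show "vs1.dim V = vs1.dim {x \<in> V. f x = 0} + vs2.dim (f ` V)"
    unfolding im K_def[symmetric] dV B(5)[symmetric] using card_mono[OF fC C(1)] by simp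
qed

end

definition fscale :: "'k::field \<Rightarrow> ('i \<Rightarrow> 'k) \<Rightarrow> 'i \<Rightarrow> 'k" where
  "fscale c x = (\<lambda>i. c * x i)"

text \<open>Normalised homomorphisms are functions into \<open>k^N\<close>, so with this scalar
  multiplication Hom spaces are subspaces of a function space and the results on \<open>dim\<close>
  apply to them.\<close>

definition hscale :: "'k::field \<Rightarrow> ('m \<Rightarrow> 'i \<Rightarrow> 'k) \<Rightarrow> 'm \<Rightarrow> 'i \<Rightarrow> 'k" where
  "hscale c f = (\<lambda>x. fscale c (f x))"

global_interpretation V: vspace fscale
  by unfold_locales (auto simp: fscale_def fun_eq_iff algebra_simps)

global_interpretation H: vspace hscale
  by unfold_locales (auto simp: hscale_def fscale_def fun_eq_iff algebra_simps)

global_interpretation VV: vspace_pair fscale fscale ..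

global_interpretation HH: vspace_pair hscale hscale ..

text \<open>Gaussian elimination: a vector \<open>g p\<close> with nonzero coordinate
  \<open>i\<close> is the pivot, and \<open>h\<close> consists of the other vectors with that
  coordinate cleared. The coefficients are real because index vectors are differences of
  multiplicities.\<close>

lemma nontrivial_relation:
  fixes g :: "'a \<Rightarrow> 'b \<Rightarrow> real"
  assumes "finite I" "finite K" "card I < card K"
  shows "\<exists>a. (\<exists>k\<in>K. a k \<noteq> 0) \<and> (\<forall>i\<in>I. (\<Sum>k\<in>K. a k * g k i) = 0)"
  using assms
proof (induction I arbitrary: K g rule: finite_induct)
  case empty
  then obtain k where "k \<in> K" by fastforce
  then show ?case by (intro exI[of _ "\<lambda>_. 1"]) auto
next
  case (insert i I)
  show ?case
  proof (cases "\<exists>k\<in>K. g k i \<noteq> 0")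
    case False
    have "card I < card K" using insert by simp
    then obtain a where "\<exists>k\<in>K. a k \<noteq> 0" "\<forall>i\<in>I. (\<Sum>k\<in>K. a k * g k i) = 0"
      using insert.IH[OF insert.prems(1)] by blast
    then show ?thesis using False by (intro exI[of _ a]) auto
  next
    case True
    then obtain p where p: "p \<in> K" "g p i \<noteq> 0" by blast
    define h where "h = (\<lambda>k j. g k j - g k i / g p i * g p j)"
    have cK: "card I < card (K - {p})" using insert p by simp
    obtain a where a: "\<exists>k\<in>K - {p}. a k \<noteq> 0" "\<forall>j\<in>I. (\<Sum>k\<in>K - {p}. a k * h k j) = 0"
      using insert.IH[of "K - {p}" h] cK insert.prems by blast
    \<comment> \<open>The pivot's coefficient makes the combination of the \<open>g k\<close> equal
      to that of the reduced vectors \<open>h k\<close> in every coordinate.\<close>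
    define b where "b = (\<lambda>k. if k = p then - (\<Sum>k\<in>K - {p}. a k * g k i) / g p i else a k)"
    have sb: "(\<Sum>k\<in>K. b k * g k j) = (\<Sum>k\<in>K - {p}. a k * h k j)" for j
    proof -
      have "(\<Sum>k\<in>K. b k * g k j) = b p * g p j + (\<Sum>k\<in>K - {p}. b k * g k j)"
        using p insert.prems by (simp add: sum.remove)
      also have "(\<Sum>k\<in>K - {p}. b k * g k j) = (\<Sum>k\<in>K - {p}. a k * g k j)"
        by (intro sum.cong) (auto simp: b_def)
      also have "b p * g p j = - ((\<Sum>k\<in>K - {p}. a k * g k i) * (g p j / g p i))"
        by (simp add: b_def)
      also have "(\<Sum>k\<in>K - {p}. a k * g k i) * (g p j / g p i) =
          (\<Sum>k\<in>K - {p}. a k * (g k i / g p i * g p j))"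
        unfolding sum_distrib_right by (intro sum.cong) auto
      finally show ?thesis unfolding h_def right_diff_distrib sum_subtractf by linarith
    qed
    have "h k i = 0" for k using p by (simp add: h_def)
    then have "\<forall>j\<in>insert i I. (\<Sum>k\<in>K. b k * g k j) = 0" unfolding sb using a by auto
    moreover have "\<exists>k\<in>K. b k \<noteq> 0" using a by (auto simp: b_def)
    ultimately show ?thesis by blast
  qed
qed

section \<open>Modules and homomorphisms\<close>

lemmas [simp] = right_module.zero_closed right_module.add_closed right_module.uminus_closed
  right_module.act_closed
lemmas act_simps = right_module.act_add_left right_module.act_add_right right_module.act_mult
  right_module.act_one

lemma act_zero_left [simp]:
  assumes "right_module M" shows "act M 0 a = 0"
proof -
  have "act M (0 + 0) a = act M 0 a + act M 0 a"
    using right_module.act_add_left[OF assms, of 0 0 a] assms by simp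
  then show ?thesis by simp
qed

lemma act_zero_right [simp]:
  assumes "right_module M" "x \<in> carr M" shows "act M x 0 = 0"
proof -
  have "act M x (0 + 0) = act M x 0 + act M x 0"
    using right_module.act_add_right[OF assms, of 0 0] by simp
  then show ?thesis by simp
qed

lemma act_uminus:
  assumes "right_module M" "x \<in> carr M" shows "act M (- x) a = - act M x a"
proof -
  have "act M (x + - x) a = act M x a + act M (- x) a"
    using assms right_module.act_add_left[of M x "- x" a] by simp
  then show ?thesis using assms by (simp add: eq_neg_iff_add_eq_0 add.commute)
qed

lemma diff_closed [simp]:
  assumes "right_module M" "x \<in> carr M" "y \<in> carr M" shows "x - y \<in> carr M"
  using assms right_module.add_closed[of M x "- y"] by simp

lemma sum_closed:
  assumes "right_module M" "\<And>i. i \<in> S \<Longrightarrow> f i \<in> carr M" shows "(\<Sum>i\<in>S. f i) \<in> carr M"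
  using assms(2) by (induction S rule: infinite_finite_induct) (auto simp: assms(1))

section \<open>Submodules\<close>

lemma carr_submod [simp]: "carr (submod M U) = U" and act_submod [simp]: "act (submod M U) = act M"
  by (simp_all add: submod_def)

lemma submod_carr [simp]: "submod M (carr M) = (M :: ('a, 'm) rmod)"
  by (simp add: submod_def)

lemma submod_submod [simp]: "submod (submod M U) W = submod M W"
  by (simp add: submod_def)

text \<open>Negatives need no separate check, because \<open>-x\<close> is the action of
  \<open>-1\<close> on \<open>x\<close>.\<close>

lemma submoduleI:
  assumes M: "right_module M" and "U \<subseteq> carr M" "0 \<in> U"
    "\<And>x y. x \<in> U \<Longrightarrow> y \<in> U \<Longrightarrow> x + y \<in> U" "\<And>x a. x \<in> U \<Longrightarrow> act M x a \<in> U"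
  shows "submodule U M"
proof -
  have "- x \<in> U" if "x \<in> U" for x
  proof -
    have x: "x \<in> carr M" using that assms by blast
    have "act M x (1 + - 1) = act M x 1 + act M x (- 1)"
      using right_module.act_add_right[OF M x] .
    then have "- x = act M x (- 1)"
      using M x by (simp add: right_module.act_one eq_neg_iff_add_eq_0 add.commute minus_unique)
    then show ?thesis using assms that by simp
  qed
  then show ?thesis
    unfolding submodule_def using assms
    by (auto intro!: right_module.intro simp: act_simps subset_iff)
qed

lemma submodule_right_module: "submodule U M \<Longrightarrow> right_module (submod M U)"
  and submodule_subset: "submodule U M \<Longrightarrow> U \<subseteq> carr M"
  by (simp_all add: submodule_def)

lemma submodule_in: "submodule U M \<Longrightarrow> x \<in> U \<Longrightarrow> x \<in> carr M"
  using submodule_subset by blast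

lemma submodule_zero: "submodule U M \<Longrightarrow> 0 \<in> U"
  and submodule_add: "submodule U M \<Longrightarrow> x \<in> U \<Longrightarrow> y \<in> U \<Longrightarrow> x + y \<in> U"
  and submodule_uminus: "submodule U M \<Longrightarrow> x \<in> U \<Longrightarrow> - x \<in> U"
  and submodule_diff: "submodule U M \<Longrightarrow> x \<in> U \<Longrightarrow> y \<in> U \<Longrightarrow> x - y \<in> U"
  and submodule_act: "submodule U M \<Longrightarrow> x \<in> U \<Longrightarrow> act M x a \<in> U"
  by (metis carr_submod act_submod submodule_right_module right_module.zero_closed
      right_module.add_closed right_module.uminus_closed diff_closed right_module.act_closed)+

lemma submodule_trans:
  assumes "submodule U M" "submodule W (submod M U)" shows "submodule W M"
  using assms unfolding submodule_def by auto

lemma submodule_submod: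
  assumes "submodule W M" "W \<subseteq> U" shows "submodule W (submod M U)"
  using assms unfolding submodule_def by auto

lemma submodule_carr [simp]: "right_module M \<Longrightarrow> submodule (carr M) M"
  by (simp add: submodule_def)

lemma submodule_zero_set [simp]: "right_module M \<Longrightarrow> submodule {0} M"
  by (rule submoduleI) auto

section \<open>Homomorphisms, kernels and images\<close>

lemma homI:
  assumes "\<And>x. x \<in> carr M \<Longrightarrow> f x \<in> carr N"
    "\<And>x y. x \<in> carr M \<Longrightarrow> y \<in> carr M \<Longrightarrow> f (x + y) = f x + f y"
    "\<And>x a. x \<in> carr M \<Longrightarrow> f (act M x a) = act N (f x) a"
    "\<And>x. x \<notin> carr M \<Longrightarrow> f x = 0"
  shows "f \<in> hom M N"
  using assms by (simp add: hom_def)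

lemma hom_in [simp]: "f \<in> hom M N \<Longrightarrow> x \<in> carr M \<Longrightarrow> f x \<in> carr N"
  and hom_add: "f \<in> hom M N \<Longrightarrow> x \<in> carr M \<Longrightarrow> y \<in> carr M \<Longrightarrow> f (x + y) = f x + f y"
  and hom_act: "f \<in> hom M N \<Longrightarrow> x \<in> carr M \<Longrightarrow> f (act M x a) = act N (f x) a"
  and hom_out: "f \<in> hom M N \<Longrightarrow> x \<notin> carr M \<Longrightarrow> f x = 0"
  by (simp_all add: hom_def)

lemma hom_eqI:
  assumes "f \<in> hom M N" "g \<in> hom M N" "\<And>x. x \<in> carr M \<Longrightarrow> f x = g x" shows "f = g"
proof
  fix x show "f x = g x" using assms by (cases "x \<in> carr M") (auto simp: hom_out)
qed

lemma hom_zero: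
  assumes "right_module M" "f \<in> hom M N" shows "f 0 = 0"
proof -
  have "f (0 + 0) = f 0 + f 0" using assms by (intro hom_add) auto
  then show ?thesis by simp
qed

lemma hom_uminus:
  assumes "right_module M" "f \<in> hom M N" "x \<in> carr M" shows "f (- x) = - f x"
proof -
  have "f (x + - x) = f x + f (- x)" using assms by (intro hom_add) auto
  then show ?thesis using assms by (simp add: hom_zero eq_neg_iff_add_eq_0 add.commute)
qed

lemma hom_diff:
  assumes "right_module M" "f \<in> hom M N" "x \<in> carr M" "y \<in> carr M" shows "f (x - y) = f x - f y"
  using hom_add[OF assms(2,3), of "- y"] assms by (simp add: hom_uminus)

lemma hom_sum:
  assumes "right_module M" "f \<in> hom M N" "\<And>i. i \<in> S \<Longrightarrow> g i \<in> carr M"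
  shows "f (\<Sum>i\<in>S. g i) = (\<Sum>i\<in>S. f (g i))"
  using assms(3)
  by (induction S rule: infinite_finite_induct)
    (auto simp: assms(1) hom_zero[OF assms(1,2)] hom_add[OF assms(2)] sum_closed)

text \<open>Brings a map into the normal form required by \<open>hom\<close>, zero off its source;
  inclusions of submodules and identities then belong to \<open>hom\<close> as well.\<close>

definition rst :: "'m set \<Rightarrow> ('m \<Rightarrow> 'n::zero) \<Rightarrow> 'm \<Rightarrow> 'n" where
  "rst U f = (\<lambda>x. if x \<in> U then f x else 0)"

definition idm :: "('a, 'm::zero) rmod \<Rightarrow> 'm \<Rightarrow> 'm" where
  "idm M = rst (carr M) (\<lambda>x. x)"

lemma rst_in [simp]: "x \<in> U \<Longrightarrow> rst U f x = f x" by (simp add: rst_def)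

lemma idm_in [simp]: "x \<in> carr M \<Longrightarrow> idm M x = x" by (simp add: idm_def)

lemma rst_homI:
  assumes "right_module M" "\<And>x. x \<in> carr M \<Longrightarrow> f x \<in> carr N"
    "\<And>x y. x \<in> carr M \<Longrightarrow> y \<in> carr M \<Longrightarrow> f (x + y) = f x + f y"
    "\<And>x a. x \<in> carr M \<Longrightarrow> f (act M x a) = act N (f x) a"
  shows "rst (carr M) f \<in> hom M N"
  using assms by (intro homI) (auto simp: rst_def)

lemma hom_idm [simp]: "right_module M \<Longrightarrow> idm M \<in> hom M M"
  unfolding idm_def by (rule rst_homI) auto

lemma hom_idm_sub:
  assumes "submodule U M" shows "idm (submod M U) \<in> hom (submod M U) M"
  unfolding idm_def
  by (rule rst_homI) (use assms submodule_right_module[OF assms] submodule_subset[OF assms] in auto)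

lemma hom_rst:
  assumes "f \<in> hom M N" "submodule U M" shows "rst U f \<in> hom (submod M U) N"
proof -
  have "rst (carr (submod M U)) f \<in> hom (submod M U) N"
    using assms submodule_subset[OF assms(2)]
    by (intro rst_homI) (auto simp: submodule_right_module hom_add hom_act subset_iff)
  then show ?thesis by simp
qed

lemma hom_comp:
  assumes "right_module N" "f \<in> hom M N" "g \<in> hom N K" shows "g \<circ> f \<in> hom M K"
  using assms by (intro homI) (auto simp: hom_add hom_act hom_out hom_zero[OF assms(1,3)])

lemma hom_comp_in:
  assumes "right_module N" "f \<in> hom M N" "g \<in> hom N K" shows "(\<lambda>x. g (f x)) \<in> hom M K"
  using hom_comp[OF assms] by (simp add: comp_def)

lemma hom_corestrict:
  assumes "f \<in> hom M N" "\<And>x. x \<in> carr M \<Longrightarrow> f x \<in> U" shows "f \<in> hom M (submod N U)"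
  using assms by (intro homI) (auto simp: hom_add hom_act hom_out)

lemma hom_submod_ext:
  assumes "f \<in> hom M (submod N U)" "U \<subseteq> carr N" shows "f \<in> hom M N"
  using assms hom_in[OF assms(1)] by (intro homI) (auto simp: hom_add hom_act hom_out)

lemma hom_0 [simp]: "right_module N \<Longrightarrow> (\<lambda>_. 0) \<in> hom M N"
  by (intro homI) auto

lemma hom_plus:
  assumes "right_module N" "f \<in> hom M N" "g \<in> hom M N" shows "(\<lambda>x. f x + g x) \<in> hom M N"
  using assms by (intro homI) (auto simp: hom_add hom_act hom_out right_module.act_add_left)

lemma hom_neg:
  assumes "right_module N" "f \<in> hom M N" shows "(\<lambda>x. - f x) \<in> hom M N"
  using assms by (intro homI) (auto simp: hom_add hom_act hom_out act_uminus)

lemma hom_minus: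
  assumes "right_module N" "f \<in> hom M N" "g \<in> hom M N" shows "(\<lambda>x. f x - g x) \<in> hom M N"
  using hom_plus[OF assms(1,2) hom_neg[OF assms(1,3)]] by simp

lemma hom_sum_fun:
  assumes "right_module N" "\<And>i. i \<in> S \<Longrightarrow> f i \<in> hom M N" shows "(\<lambda>x. \<Sum>i\<in>S. f i x) \<in> hom M N"
  using assms(2)
proof (induction S rule: infinite_finite_induct)
  case (insert i S)
  then have "(\<lambda>x. f i x + (\<Sum>i\<in>S. f i x)) \<in> hom M N" using hom_plus[OF assms(1)] by auto
  then show ?case using insert by simp
qed (auto simp: assms(1))

lemma ker_submodule:
  assumes "right_module M" "right_module N" "f \<in> hom M N" shows "submodule (ker M f) M"
  using assms by (intro submoduleI) (auto simp: ker_def hom_zero hom_add hom_act)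

lemma image_submodule:
  assumes "right_module M" "right_module N" "f \<in> hom M N" "submodule U M"
  shows "submodule (f ` U) N"
proof (rule submoduleI[OF assms(2)])
  show "f ` U \<subseteq> carr N" using assms submodule_in by (auto intro: hom_in)
  show "0 \<in> f ` U" using hom_zero[OF assms(1,3)] submodule_zero[OF assms(4)] by force
  show "x + y \<in> f ` U" if "x \<in> f ` U" "y \<in> f ` U" for x y
    using that hom_add[OF assms(3)] submodule_add[OF assms(4)] submodule_in[OF assms(4)]
    by (smt (verit) imageE imageI)
  show "act N x a \<in> f ` U" if "x \<in> f ` U" for x a
    using that hom_act[OF assms(3)] submodule_act[OF assms(4)] submodule_in[OF assms(4)]
    by (smt (verit) imageE imageI)
qed

lemma preimage_submodule:
  assumes "right_module M" "right_module N" "f \<in> hom M N" "submodule W N"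
  shows "submodule {x \<in> carr M. f x \<in> W} M"
  using assms submodule_zero[OF assms(4)] submodule_add[OF assms(4)] submodule_act[OF assms(4)]
  by (intro submoduleI) (auto simp: hom_zero hom_add hom_act)

lemma inj_on_hom_iff:
  assumes "right_module M" "f \<in> hom M N"
  shows "inj_on f (carr M) \<longleftrightarrow> (\<forall>x\<in>carr M. f x = 0 \<longrightarrow> x = 0)"
proof
  assume "inj_on f (carr M)"
  then show "\<forall>x\<in>carr M. f x = 0 \<longrightarrow> x = 0"
    using assms by (metis hom_zero inj_on_def right_module.zero_closed)
next
  assume a: "\<forall>x\<in>carr M. f x = 0 \<longrightarrow> x = 0"
  show "inj_on f (carr M)"
  proof (rule inj_onI)
    fix x y assume "x \<in> carr M" "y \<in> carr M" "f x = f y"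
    then have "x - y \<in> carr M" "f (x - y) = 0" using assms by (auto simp: hom_diff)
    then have "x - y = 0" using a by blast
    then show "x = y" by simp
  qed
qed

section \<open>Isomorphisms and epimorphisms\<close>

lemma hom_inverse:
  assumes "right_module M" "right_module N" "f \<in> hom M N" "bij_betw f (carr M) (carr N)"
  obtains g where "g \<in> hom N M" "\<forall>x\<in>carr M. g (f x) = x" "\<forall>y\<in>carr N. f (g y) = y"
proof -
  define g where "g = inv_into (carr M) f"
  have g1: "g (f x) = x" if "x \<in> carr M" for x
    using that assms(4) unfolding g_def bij_betw_def by simp
  have g2: "f (g y) = y" "g y \<in> carr M" if "y \<in> carr N" for y
    using that assms(4) unfolding g_def bij_betw_def by (auto simp: f_inv_into_f inv_into_into)
  have inj: "inj_on f (carr M)" using assms(4) bij_betw_def by blast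
  have "rst (carr N) g \<in> hom N M"
  proof (rule rst_homI[OF assms(2)])
    show "g (x + y) = g x + g y" if "x \<in> carr N" "y \<in> carr N" for x y
      using g1[of "g x + g y"] that g2 assms(1) hom_add[OF assms(3)] by simp
    show "g (act N x a) = act M (g x) a" if "x \<in> carr N" for x a
      using g1[of "act M (g x) a"] that g2 assms(1) hom_act[OF assms(3)] by simp
  qed (use g2 in auto)
  moreover have "rst (carr N) g (f x) = x" if "x \<in> carr M" for x
    using that g1 hom_in[OF assms(3)] by simp
  moreover have "f (rst (carr N) g y) = y" if "y \<in> carr N" for y
    using that g2 by simp
  ultimately show thesis using that by blast
qed

lemma iso_modI:
  assumes "f \<in> hom M N" "g \<in> hom N M" "\<forall>x\<in>carr M. g (f x) = x"
    "\<forall>y\<in>carr N. f (g y) = y"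
  shows "iso_mod M N"
proof -
  have "bij_betw f (carr M) (carr N)"
    using assms by (intro bij_betw_byWitness[where f' = g]) auto
  then show ?thesis using assms(1) iso_mod_def by blast
qed

lemma iso_modE:
  assumes "iso_mod M N" "right_module M" "right_module N"
  obtains f g where "f \<in> hom M N" "g \<in> hom N M" "\<forall>x\<in>carr M. g (f x) = x"
    "\<forall>y\<in>carr N. f (g y) = y"
proof -
  obtain f where f: "f \<in> hom M N" "bij_betw f (carr M) (carr N)"
    using assms(1) iso_mod_def by blast
  show thesis by (rule hom_inverse[OF assms(2,3) f]) (rule that[OF f(1)])
qed

lemma iso_mod_refl: "right_module M \<Longrightarrow> iso_mod M M"
  by (rule iso_modI[of "idm M" _ _ "idm M"]) auto

lemma iso_mod_sym:
  assumes "iso_mod M N" "right_module M" "right_module N" shows "iso_mod N M"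
proof -
  obtain f g where "f \<in> hom M N" "g \<in> hom N M" "\<forall>x\<in>carr M. g (f x) = x"
    "\<forall>y\<in>carr N. f (g y) = y" by (rule iso_modE[OF assms])
  then show ?thesis by (intro iso_modI[of g _ _ f])
qed

lemma iso_mod_trans:
  assumes "iso_mod M N" "iso_mod N K" "right_module N" shows "iso_mod M K"
proof -
  obtain f where f: "f \<in> hom M N" "bij_betw f (carr M) (carr N)" using assms(1) iso_mod_def by blast
  obtain g where g: "g \<in> hom N K" "bij_betw g (carr N) (carr K)" using assms(2) iso_mod_def by blast
  have "bij_betw (g \<circ> f) (carr M) (carr K)" using bij_betw_trans[OF f(2) g(2)] .
  then show ?thesis using hom_comp[OF assms(3) f(1) g(1)] iso_mod_def by blast
qed

lemma epiI: "f \<in> hom M N \<Longrightarrow> (\<And>y. y \<in> carr N \<Longrightarrow> \<exists>x\<in>carr M. f x = y) \<Longrightarrow> epi M N f"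
  unfolding epi_def using hom_in by fast

lemma epi_hom: "epi M N f \<Longrightarrow> f \<in> hom M N"
  by (simp add: epi_def)

lemma epi_surj: "epi M N f \<Longrightarrow> y \<in> carr N \<Longrightarrow> \<exists>x\<in>carr M. f x = y"
  unfolding epi_def by (metis imageE)

lemma epi_comp:
  assumes "right_module N" "epi M N f" "epi N K g" shows "epi M K (\<lambda>x. g (f x))"
proof (rule epiI)
  show "(\<lambda>x. g (f x)) \<in> hom M K" using hom_comp_in[OF assms(1) epi_hom[OF assms(2)] epi_hom[OF assms(3)]] .
  show "\<exists>x\<in>carr M. g (f x) = y" if "y \<in> carr K" for y
    using epi_surj[OF assms(3) that] epi_surj[OF assms(2)] by blast
qed

text \<open>Any preimage under \<open>p\<close> may serve to define \<open>g\<close>, as two of them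
  differ by an element that \<open>p\<close>, and hence \<open>f\<close>, sends to zero.\<close>

lemma epi_factor:
  assumes M: "right_module M" and N: "right_module N" and p: "epi M Q p" and f: "f \<in> hom M N"
    and k: "\<And>x. x \<in> carr M \<Longrightarrow> p x = 0 \<Longrightarrow> f x = 0"
  obtains g where "g \<in> hom Q N" "\<forall>x\<in>carr M. g (p x) = f x"
proof -
  have ph: "p \<in> hom M Q" using p epi_hom by blast
  have wd: "f x = f y" if "x \<in> carr M" "y \<in> carr M" "p x = p y" for x y
  proof -
    have "p (x - y) = 0" using that hom_diff[OF M ph] by simp
    then have "f (x - y) = 0" using k that M by simp
    then show ?thesis using that hom_diff[OF M f] by simp
  qed
  define c where "c = (\<lambda>y. SOME x. x \<in> carr M \<and> p x = y)"
  have c: "c y \<in> carr M \<and> p (c y) = y" if "y \<in> carr Q" for y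
    unfolding c_def using epi_surj[OF p that] by (rule someI2_bex) auto
  define g where "g = rst (carr Q) (\<lambda>y. f (c y))"
  have gp: "g (p x) = f x" if "x \<in> carr M" for x
  proof -
    have "p x \<in> carr Q" using that ph by simp
    then have "g (p x) = f (c (p x))" by (simp add: g_def)
    also have "\<dots> = f x" using wd[of "c (p x)" x] c[OF \<open>p x \<in> carr Q\<close>] that by blast
    finally show ?thesis .
  qed
  have "g \<in> hom Q N"
  proof (rule homI)
    show "g y \<in> carr N" if "y \<in> carr Q" for y
      using epi_surj[OF p that] gp hom_in[OF f] by metis
    show "g (y + z) = g y + g z" if yz: "y \<in> carr Q" "z \<in> carr Q" for y z
    proof -
      obtain x x' where x: "x \<in> carr M" "p x = y" "x' \<in> carr M" "p x' = z"
        using epi_surj[OF p] yz by metis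
      then have "y + z = p (x + x')" using hom_add[OF ph] by simp
      then show ?thesis using gp x M hom_add[OF f] by (metis right_module.add_closed)
    qed
    show "g (act Q y a) = act N (g y) a" if y: "y \<in> carr Q" for y a
    proof -
      obtain x where x: "x \<in> carr M" "p x = y" using epi_surj[OF p] y by metis
      then have "act Q y a = p (act M x a)" using hom_act[OF ph] by simp
      then show ?thesis using gp x M hom_act[OF f] by (metis right_module.act_closed)
    qed
    show "g y = 0" if "y \<notin> carr Q" for y using that by (simp add: g_def rst_def)
  qed
  then show thesis using that gp by blast
qed

section \<open>Direct sums\<close>

text \<open>Direct summands expressed through maps. Unlike \<open>is_summand\<close>, this form
  composes directly; \<open>is_summand_iff\<close> shows that the two agree.\<close>

definition retract :: "('a::ring_1, 'n::ab_group_add) rmod \<Rightarrow> ('a, 'm::ab_group_add) rmod \<Rightarrow> bool" where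
  "retract X M \<longleftrightarrow> (\<exists>i\<in>hom X M. \<exists>p\<in>hom M X. \<forall>x\<in>carr X. p (i x) = x)"

lemma retractI:
  "i \<in> hom X M \<Longrightarrow> p \<in> hom M X \<Longrightarrow> \<forall>x\<in>carr X. p (i x) = x \<Longrightarrow> retract X M"
  unfolding retract_def by blast

lemma retractE:
  assumes "retract X M"
  obtains i p where "i \<in> hom X M" "p \<in> hom M X" "\<forall>x\<in>carr X. p (i x) = x"
  using assms unfolding retract_def by blast

lemma retract_trans:
  assumes "retract X Y" "retract Y Z" "right_module Y"
  shows "retract X Z"
proof -
  obtain i p where a: "i \<in> hom X Y" "p \<in> hom Y X" "\<forall>x\<in>carr X. p (i x) = x"
    using assms(1) unfolding retract_def by blast
  obtain j q where b: "j \<in> hom Y Z" "q \<in> hom Z Y" "\<forall>x\<in>carr Y. q (j x) = x"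
    using assms(2) unfolding retract_def by blast
  show ?thesis
    by (rule retractI[OF hom_comp_in[OF assms(3) a(1) b(1)] hom_comp_in[OF assms(3) b(2) a(2)]])
      (use a b in auto)
qed

lemma iso_retract:
  assumes "iso_mod X M" "right_module X" "right_module M" shows "retract X M"
  by (rule iso_modE[OF assms]) (rule retractI)

lemma internal_sum_projections:
  assumes M: "right_module M" and UV: "internal_sum M U V"
  obtains p q where "p \<in> hom M (submod M U)" "q \<in> hom M (submod M V)"
    "\<forall>x\<in>carr M. x = p x + q x" "\<forall>u\<in>U. p u = u \<and> q u = 0"
    "\<forall>v\<in>V. p v = 0 \<and> q v = v"
proof -
  have U: "submodule U M" and V: "submodule V M" and int: "U \<inter> V = {0}"
    and car: "carr M = {u + v | u v. u \<in> U \<and> v \<in> V}"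
    using UV unfolding internal_sum_def by auto
  have uniq: "u = u' \<and> v = v'" if "u \<in> U" "u' \<in> U" "v \<in> V" "v' \<in> V" "u + v = u' + v'" for u u' v v'
  proof -
    have e: "u - u' = v' - v" using that by (simp add: algebra_simps)
    then have "u - u' \<in> U \<inter> V"
      using submodule_diff[OF U that(1,2)] submodule_diff[OF V that(4,3)] by simp
    then show ?thesis using int e by simp
  qed
  define P where "P = (\<lambda>x. THE u. u \<in> U \<and> x - u \<in> V)"
  have P: "P (u + v) = u" if "u \<in> U" "v \<in> V" for u v
    unfolding P_def
  proof (rule the_equality)
    show "u \<in> U \<and> u + v - u \<in> V" using that by simp
    fix w assume w: "w \<in> U \<and> u + v - w \<in> V"
    have "w + (u + v - w) = u + v" by simp
    then show "w = u" using uniq[of w u "u + v - w" v] w that by blast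
  qed
  have Uin: "u \<in> U \<Longrightarrow> u \<in> carr M" and Vin: "v \<in> V \<Longrightarrow> v \<in> carr M" for u v
    using submodule_in U V by blast+
  have ph: "rst (carr M) P \<in> hom M (submod M U)"
  proof (rule rst_homI[OF M])
    fix x assume "x \<in> carr M"
    then obtain u v where x: "x = u + v" "u \<in> U" "v \<in> V" using car by blast
    show "P x \<in> carr (submod M U)" using x P by simp
    show "P (act M x a) = act (submod M U) (P x) a" for a
      using x P[of "act M u a" "act M v a"] P M Uin Vin submodule_act[OF U] submodule_act[OF V]
      by (simp add: right_module.act_add_left)
    fix y assume "y \<in> carr M"
    then obtain u' v' where y: "y = u' + v'" "u' \<in> U" "v' \<in> V" using car by blast
    have "x + y = (u + u') + (v + v')" using x y by (simp add: algebra_simps)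
    then show "P (x + y) = P x + P y" using x y P submodule_add U V by metis
  qed
  have qh: "rst (carr M) (\<lambda>x. x - P x) \<in> hom M (submod M V)"
  proof -
    have "(\<lambda>x. idm M x - rst (carr M) P x) \<in> hom M M"
      using hom_minus[OF M hom_idm[OF M] hom_submod_ext[OF ph submodule_subset[OF U]]] .
    moreover have "(\<lambda>x. idm M x - rst (carr M) P x) = rst (carr M) (\<lambda>x. x - P x)"
      by (auto simp: fun_eq_iff rst_def idm_def)
    ultimately have h: "rst (carr M) (\<lambda>x. x - P x) \<in> hom M M" by simp
    have "x - P x \<in> V" if "x \<in> carr M" for x
      using that P car by auto
    then show ?thesis using hom_corestrict[OF h] by simp
  qed
  show thesis
  proof (rule that[OF ph qh]; intro ballI)
    show "x = rst (carr M) P x + rst (carr M) (\<lambda>x. x - P x) x" if "x \<in> carr M" for x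
      using that by simp
    show "rst (carr M) P u = u \<and> rst (carr M) (\<lambda>x. x - P x) u = 0" if "u \<in> U" for u
      using that P[of u 0] Uin submodule_zero[OF V] by simp
    show "rst (carr M) P v = 0 \<and> rst (carr M) (\<lambda>x. x - P x) v = v" if "v \<in> V" for v
      using that P[of 0 v] Vin submodule_zero[OF U] by simp
  qed
qed

text \<open>The decomposition is \<open>x = e x + (x - e x)\<close>. It turns summands given by maps
  into internal sums, and it shows that an indecomposable module has no idempotents besides zero and
  the identity.\<close>

lemma idempotent_internal_sum:
  assumes M: "right_module M" and e: "e \<in> hom M M" and id: "\<And>x. x \<in> carr M \<Longrightarrow> e (e x) = e x"
  shows "internal_sum M (e ` carr M) (ker M e)"
  unfolding internal_sum_def
proof (intro conjI)
  show "submodule (e ` carr M) M" using image_submodule[OF M M e] M by simp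
  show "submodule (ker M e) M" using ker_submodule[OF M M e] .
  show "e ` carr M \<inter> ker M e = {0}"
    using id hom_zero[OF M e] M by (force simp: ker_def)
  have "x \<in> {u + v |u v. u \<in> e ` carr M \<and> v \<in> ker M e}" if "x \<in> carr M" for x
  proof -
    have "x - e x \<in> ker M e" using that M e id by (simp add: ker_def hom_diff)
    moreover have "x = e x + (x - e x)" by simp
    ultimately show ?thesis using that by blast
  qed
  then show "carr M = {u + v |u v. u \<in> e ` carr M \<and> v \<in> ker M e}"
    using M e by (auto simp: ker_def)
qed

lemma is_summand_iff:
  assumes X: "right_module X" and M: "right_module M"
  shows "is_summand X M \<longleftrightarrow> retract X M"
proof
  assume "is_summand X M"
  then obtain U V where UV: "internal_sum M U V" and iso: "iso_mod X (submod M U)"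
    unfolding is_summand_def by blast
  have U: "submodule U M" using UV unfolding internal_sum_def by blast
  obtain p q where p: "p \<in> hom M (submod M U)" "q \<in> hom M (submod M V)"
    "\<forall>x\<in>carr M. x = p x + q x" "\<forall>u\<in>U. p u = u \<and> q u = 0"
    "\<forall>v\<in>V. p v = 0 \<and> q v = v"
    by (rule internal_sum_projections[OF M UV])
  have "retract (submod M U) M"
    by (rule retractI[OF hom_idm_sub[OF U] p(1)]) (simp add: p(4))
  then show "retract X M"
    using retract_trans[OF iso_retract[OF iso X]] submodule_right_module[OF U] by blast
next
  assume "retract X M"
  then obtain i p where i: "i \<in> hom X M" and p: "p \<in> hom M X" and pi: "\<forall>x\<in>carr X. p (i x) = x"
    unfolding retract_def by blast
  define e where "e = (\<lambda>x. i (p x))"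
  have e: "e \<in> hom M M" unfolding e_def using hom_comp_in[OF X p i] .
  have isum: "internal_sum M (e ` carr M) (ker M e)"
    by (rule idempotent_internal_sum[OF M e]) (use pi p in \<open>auto simp: e_def\<close>)
  have im: "e ` carr M = i ` carr X"
  proof
    show "e ` carr M \<subseteq> i ` carr X" unfolding e_def using p by auto
    show "i ` carr X \<subseteq> e ` carr M"
    proof
      fix y assume "y \<in> i ` carr X"
      then obtain x where "x \<in> carr X" "y = i x" by blast
      then have "y = e (i x)" "i x \<in> carr M" unfolding e_def using pi i by auto
      then show "y \<in> e ` carr M" by blast
    qed
  qed
  have "i \<in> hom X (submod M (e ` carr M))"
    using hom_corestrict[OF i] im by blast
  moreover have "inj_on i (carr X)" by (rule inj_on_inverseI[of _ p]) (use pi in simp)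
  ultimately have "iso_mod X (submod M (e ` carr M))"
    unfolding iso_mod_def bij_betw_def using im by auto
  then show "is_summand X M" using isum unfolding is_summand_def by blast
qed

text \<open>A decomposition given by inclusions and projections of \<open>M\<close> itself. The
  carrier of \<open>dsum Xs\<close> has another type and so never lies in \<open>mods s\<close>;
  here no external sum is involved.\<close>

definition biprod ::
  "('a::ring_1, 'm::ab_group_add) rmod \<Rightarrow> ('a, 'n::ab_group_add) rmod list \<Rightarrow>
    (nat \<Rightarrow> 'n \<Rightarrow> 'm) \<Rightarrow> (nat \<Rightarrow> 'm \<Rightarrow> 'n) \<Rightarrow> bool" where
  "biprod M Xs i p \<longleftrightarrow>
     (\<forall>j<length Xs. i j \<in> hom (Xs ! j) M \<and> p j \<in> hom M (Xs ! j)) \<and>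
     (\<forall>j<length Xs. \<forall>l<length Xs. \<forall>x\<in>carr (Xs ! j). p l (i j x) = (if l = j then x else 0)) \<and>
     (\<forall>x\<in>carr M. x = (\<Sum>j<length Xs. i j (p j x)))"

lemma biprodD:
  assumes "biprod M Xs i p"
  shows "j < length Xs \<Longrightarrow> i j \<in> hom (Xs ! j) M" "j < length Xs \<Longrightarrow> p j \<in> hom M (Xs ! j)"
    "j < length Xs \<Longrightarrow> l < length Xs \<Longrightarrow> x \<in> carr (Xs ! j) \<Longrightarrow> p l (i j x) = (if l = j then x else 0)"
    "y \<in> carr M \<Longrightarrow> y = (\<Sum>j<length Xs. i j (p j y))"
  using assms unfolding biprod_def by blast+

lemma biprod_retract: "biprod M Xs i p \<Longrightarrow> j < length Xs \<Longrightarrow> retract (Xs ! j) M"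
  by (rule retractI[of "i j" _ _ "p j"]) (simp_all add: biprodD)

lemma sum_fun_apply: "(\<Sum>j\<in>S. f j) x = (\<Sum>j\<in>S. f j x)"
  by (induction S rule: infinite_finite_induct) auto

lemma right_module_dsum:
  assumes "\<And>X. X \<in> set Xs \<Longrightarrow> right_module X" shows "right_module (dsum Xs)"
  using assms by unfold_locales (auto simp: dsum_def fun_eq_iff act_simps)

lemma biprod_dsum:
  assumes Xs: "\<And>X. X \<in> set Xs \<Longrightarrow> right_module X"
  shows "biprod (dsum Xs) Xs (\<lambda>j. rst (carr (Xs ! j)) (\<lambda>x l. if l = j then x else 0))
    (\<lambda>j. rst (carr (dsum Xs)) (\<lambda>x. x j))"
  unfolding biprod_def
proof (intro conjI allI impI ballI)
  fix j assume j: "j < length Xs"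
  then have X: "right_module (Xs ! j)" using Xs by simp
  show "rst (carr (Xs ! j)) (\<lambda>x l. if l = j then x else 0) \<in> hom (Xs ! j) (dsum Xs)"
    using j by (intro rst_homI[OF X]) (auto simp: dsum_def fun_eq_iff Xs)
  show "rst (carr (dsum Xs)) (\<lambda>x. x j) \<in> hom (dsum Xs) (Xs ! j)"
    using j by (intro rst_homI[OF right_module_dsum[OF Xs]]) (auto simp: dsum_def)
  fix l x assume "l < length Xs" "x \<in> carr (Xs ! j)"
  then show "rst (carr (dsum Xs)) (\<lambda>x. x l) (rst (carr (Xs ! j)) (\<lambda>x l. if l = j then x else 0) x)
      = (if l = j then x else 0)"
    using j by (auto simp: dsum_def rst_def Xs)
next
  fix x assume x: "x \<in> carr (dsum Xs)"
  have "(\<Sum>j<length Xs. rst (carr (Xs ! j)) (\<lambda>x l. if l = j then x else 0) (x j)) l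
    = (\<Sum>j<length Xs. if l = j then x j else 0)" for l
    unfolding sum_fun_apply using x by (intro sum.cong) (auto simp: dsum_def)
  also have "(\<Sum>j<length Xs. if l = j then x j else 0) = x l" for l
    using x by (auto simp: dsum_def)
  finally show "x = (\<Sum>j<length Xs. rst (carr (Xs ! j)) (\<lambda>x l. if l = j then x else 0)
      (rst (carr (dsum Xs)) (\<lambda>x. x j) x))"
    using x by (simp add: fun_eq_iff)
qed

lemma biprod_iso:
  assumes b: "biprod M Xs i p" and f: "f \<in> hom M N" "g \<in> hom N M"
    "\<forall>x\<in>carr M. g (f x) = x" "\<forall>y\<in>carr N. f (g y) = y"
    and M: "right_module M"
  shows "biprod N Xs (\<lambda>j x. f (i j x)) (\<lambda>j y. p j (g y))"
  unfolding biprod_def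
proof (intro conjI allI impI ballI)
  fix j assume j: "j < length Xs"
  show "(\<lambda>x. f (i j x)) \<in> hom (Xs ! j) N" using hom_comp_in[OF M biprodD(1)[OF b j] f(1)] .
  show "(\<lambda>y. p j (g y)) \<in> hom N (Xs ! j)" using hom_comp_in[OF M f(2) biprodD(2)[OF b j]] .
  fix l x assume "l < length Xs" "x \<in> carr (Xs ! j)"
  then show "p l (g (f (i j x))) = (if l = j then x else 0)"
    using biprodD(3)[OF b j] hom_in[OF biprodD(1)[OF b j]] f(3) by simp
next
  fix y assume y: "y \<in> carr N"
  then have "y = f (\<Sum>j<length Xs. i j (p j (g y)))" using f biprodD(4)[OF b, of "g y"] by simp
  also have "\<dots> = (\<Sum>j<length Xs. f (i j (p j (g y))))"
    by (rule hom_sum[OF M f(1)]) (use y f in \<open>auto intro!: hom_in[OF biprodD(1)[OF b]] hom_in[OF biprodD(2)[OF b]]\<close>)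
  finally show "y = (\<Sum>j<length Xs. f (i j (p j (g y))))" .
qed

lemma biprod_hom:
  assumes b: "biprod M Xs i p" and c: "biprod N Xs j q" and N: "right_module N"
    and Xs: "\<And>X. X \<in> set Xs \<Longrightarrow> right_module X"
  shows "(\<lambda>x. \<Sum>l<length Xs. j l (p l x)) \<in> hom M N"
proof (rule hom_sum_fun[OF N])
  fix l assume "l \<in> {..<length Xs}"
  then show "(\<lambda>x. j l (p l x)) \<in> hom M N"
    by (intro hom_comp_in[OF _ biprodD(2)[OF b] biprodD(1)[OF c]]) (auto intro: Xs)
qed

lemma biprod_hom_inverse:
  assumes b: "biprod M Xs i p" and c: "biprod N Xs j q" and N: "right_module N"
    and x: "x \<in> carr M"
  shows "(\<Sum>l<length Xs. i l (q l (\<Sum>l<length Xs. j l (p l x)))) = x"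
proof -
  have "q l (\<Sum>l<length Xs. j l (p l x)) = p l x" if l: "l < length Xs" for l
  proof -
    have "q l (\<Sum>l<length Xs. j l (p l x)) = (\<Sum>l'<length Xs. q l (j l' (p l' x)))"
      by (rule hom_sum[OF N biprodD(2)[OF c l]])
        (use x in \<open>auto intro!: hom_in[OF biprodD(1)[OF c]] hom_in[OF biprodD(2)[OF b]]\<close>)
    also have "\<dots> = (\<Sum>l'<length Xs. if l' = l then p l' x else 0)"
      by (intro sum.cong refl)
        (use x l in \<open>auto simp: biprodD(3)[OF c _ l] hom_in[OF biprodD(2)[OF b]]\<close>)
    finally show ?thesis using l by simp
  qed
  then show ?thesis using biprodD(4)[OF b x] by simp
qed

lemma biprod_unique:
  assumes b: "biprod M Xs i p" and c: "biprod N Xs j q" and M: "right_module M" and N: "right_module N"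
    and Xs: "\<And>X. X \<in> set Xs \<Longrightarrow> right_module X"
  shows "iso_mod M N"
  by (rule iso_modI[OF biprod_hom[OF b c N] biprod_hom[OF c b M]])
    (auto intro: Xs biprod_hom_inverse[OF b c N] biprod_hom_inverse[OF c b M])

text \<open>Lets the decompositions in the definition of \<open>basic\<close> be handled as
  biproducts.\<close>

lemma iso_dsum_iff:
  assumes M: "right_module M" and Xs: "\<And>X. X \<in> set Xs \<Longrightarrow> right_module X"
  shows "iso_mod M (dsum Xs) \<longleftrightarrow> (\<exists>i p. biprod M Xs i p)"
proof
  assume "iso_mod M (dsum Xs)"
  then obtain f g where fg: "f \<in> hom M (dsum Xs)" "g \<in> hom (dsum Xs) M" "\<forall>x\<in>carr M. g (f x) = x"
    "\<forall>y\<in>carr (dsum Xs). f (g y) = y"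
    by (rule iso_modE[OF _ M right_module_dsum]) (rule Xs)
  show "\<exists>i p. biprod M Xs i p"
    using fg biprod_iso[OF biprod_dsum fg(2,1) _ _ right_module_dsum] Xs by blast
next
  assume "\<exists>i p. biprod M Xs i p"
  then show "iso_mod M (dsum Xs)"
    by (elim exE) (rule biprod_unique[OF _ biprod_dsum M right_module_dsum], auto intro: Xs)
qed

lemma sum_lessThan_add:
  "(\<Sum>j<n + m. f j) = (\<Sum>j<n. f j) + (\<Sum>j<m. f (n + j))" for f :: "nat \<Rightarrow> 'a::comm_monoid_add"
  by (induction m) (auto simp: add.assoc)

lemma biprod_append:
  assumes M: "right_module M" and UV: "internal_sum M U V"
    and b: "biprod (submod M U) Xs i p" and c: "biprod (submod M V) Ys j q"
    and Xs: "\<And>X. X \<in> set Xs \<Longrightarrow> right_module X" and Ys: "\<And>X. X \<in> set Ys \<Longrightarrow> right_module X"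
  shows "\<exists>i p. biprod M (Xs @ Ys) i p"
proof -
  have U: "submodule U M" and V: "submodule V M" using UV unfolding internal_sum_def by auto
  obtain e f where e: "e \<in> hom M (submod M U)" "f \<in> hom M (submod M V)"
    "\<forall>x\<in>carr M. x = e x + f x" "\<forall>u\<in>U. e u = u \<and> f u = 0"
    "\<forall>v\<in>V. e v = 0 \<and> f v = v"
    by (rule internal_sum_projections[OF M UV])
  note rU = submodule_right_module[OF U] and rV = submodule_right_module[OF V]
  let ?n = "length Xs"
  define i' where "i' = (\<lambda>l. if l < ?n then i l else j (l - ?n))"
  define p' where "p' = (\<lambda>l x. if l < ?n then p l (e x) else q (l - ?n) (f x))"
  have iU: "i l x \<in> U" if "l < ?n" "x \<in> carr (Xs ! l)" for l x
    using hom_in[OF biprodD(1)[OF b that(1)] that(2)] by simp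
  have jV: "j l x \<in> V" if "l < length Ys" "x \<in> carr (Ys ! l)" for l x
    using hom_in[OF biprodD(1)[OF c that(1)] that(2)] by simp
  have p0: "p l 0 = 0" if "l < ?n" for l using hom_zero[OF rU biprodD(2)[OF b that]] .
  have q0: "q l 0 = 0" if "l < length Ys" for l using hom_zero[OF rV biprodD(2)[OF c that]] .
  have "biprod M (Xs @ Ys) i' p'"
    unfolding biprod_def
  proof (intro conjI allI impI ballI)
    fix l assume l: "l < length (Xs @ Ys)"
    show "i' l \<in> hom ((Xs @ Ys) ! l) M"
      using l unfolding i'_def nth_append
      by (auto intro: hom_submod_ext[OF biprodD(1)[OF b] submodule_subset[OF U]]
          hom_submod_ext[OF biprodD(1)[OF c] submodule_subset[OF V]])
    show "p' l \<in> hom M ((Xs @ Ys) ! l)"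
      using l unfolding p'_def nth_append
      by (auto intro: hom_comp_in[OF rU e(1) biprodD(2)[OF b]] hom_comp_in[OF rV e(2) biprodD(2)[OF c]])
    fix k x assume k: "k < length (Xs @ Ys)" and x: "x \<in> carr ((Xs @ Ys) ! l)"
    show "p' k (i' l x) = (if k = l then x else 0)"
    proof (cases "l < ?n")
      case True
      then have "x \<in> carr (Xs ! l)" using x by (simp add: nth_append)
      then show ?thesis
        using True k bspec[OF e(4) iU[OF True]] biprodD(3)[OF b True, of k] q0
        by (auto simp: p'_def i'_def)
    next
      case False
      then have ll: "l - ?n < length Ys" using l by simp
      moreover have xx: "x \<in> carr (Ys ! (l - ?n))" using x False by (simp add: nth_append)
      ultimately show ?thesis
        using False k bspec[OF e(5) jV[OF ll xx]] biprodD(3)[OF c ll, of "k - ?n"] p0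
        by (auto simp: p'_def i'_def)
    qed
  next
    fix x assume x: "x \<in> carr M"
    have "e x = (\<Sum>l<?n. i l (p l (e x)))"
      using biprodD(4)[OF b, of "e x"] hom_in[OF e(1) x] by simp
    moreover have "f x = (\<Sum>l<length Ys. j l (q l (f x)))"
      using biprodD(4)[OF c, of "f x"] hom_in[OF e(2) x] by simp
    ultimately show "x = (\<Sum>l<length (Xs @ Ys). i' l (p' l x))"
      using bspec[OF e(3) x] by (simp add: sum_lessThan_add i'_def p'_def)
  qed
  then show ?thesis by blast
qed

text \<open>The means of moving a module to the carrier type of \<open>mods s\<close>: any injective
  additive map on the carrier will do.\<close>

definition transport :: "('m \<Rightarrow> 'n) \<Rightarrow> ('a, 'm) rmod \<Rightarrow> ('a, 'n) rmod" where
  "transport f M = \<lparr>carr = f ` carr M, act = (\<lambda>y a. f (act M (inv_into (carr M) f y) a))\<rparr>"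

lemma transport:
  fixes M :: "('a::ring_1, 'm::ab_group_add) rmod" and f :: "'m \<Rightarrow> 'n::ab_group_add"
  assumes M: "right_module M" and inj: "inj_on f (carr M)"
    and add: "\<And>x y. x \<in> carr M \<Longrightarrow> y \<in> carr M \<Longrightarrow> f (x + y) = f x + f y"
  shows "right_module (transport f M)" "rst (carr M) f \<in> hom M (transport f M)"
    "iso_mod M (transport f M)"
    "\<And>x a. x \<in> carr M \<Longrightarrow> act (transport f M) (f x) a = f (act M x a)"
proof -
  let ?T = "transport f M"
  have c: "carr ?T = f ` carr M" by (simp add: transport_def)
  show a: "act ?T (f x) a = f (act M x a)" if "x \<in> carr M" for x a
    using that inj by (simp add: transport_def)
  have z: "f 0 = 0" using add[of 0 0] M by simp
  have u: "- f x = f (- x)" if "x \<in> carr M" for x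
    using add[of x "- x"] that M z by (simp add: minus_unique)
  show T: "right_module ?T"
  proof
    show "0 \<in> carr ?T" unfolding c using imageI[of 0 "carr M" f] z M by simp
    show "x + y \<in> carr ?T" if "x \<in> carr ?T" "y \<in> carr ?T" for x y
      using that unfolding c using M by (auto simp flip: add)
    show "- x \<in> carr ?T" if "x \<in> carr ?T" for x
      using that unfolding c using u M by (auto intro!: imageI)
    show "act ?T x a \<in> carr ?T" if "x \<in> carr ?T" for x a
      using that unfolding c using a M by auto
    show "act ?T (x + y) b = act ?T x b + act ?T y b" if xy: "x \<in> carr ?T" "y \<in> carr ?T" for x y b
    proof -
      obtain x' y' where "x' \<in> carr M" "y' \<in> carr M" "x = f x'" "y = f y'" using xy unfolding c by blast
      then show ?thesis using a[of "x' + y'"] a M add by (simp add: right_module.act_add_left)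
    qed
    show "act ?T x (b + b') = act ?T x b + act ?T x b'" if "x \<in> carr ?T" for x b b'
      using that unfolding c using a M add by (auto simp: right_module.act_add_right)
    show "act ?T x (b * b') = act ?T (act ?T x b) b'" if "x \<in> carr ?T" for x b b'
      using that unfolding c using a M by (auto simp: right_module.act_mult)
    show "act ?T x 1 = x" if "x \<in> carr ?T" for x
      using that unfolding c using a M by (auto simp: right_module.act_one)
  qed
  show h: "rst (carr M) f \<in> hom M ?T"
    by (rule rst_homI[OF M]) (auto simp: c add a)
  have "bij_betw (rst (carr M) f) (carr M) (carr ?T)"
    unfolding bij_betw_def c using inj by (auto simp: inj_on_def)
  then show "iso_mod M ?T" using h iso_mod_def by blast
qed

section \<open>Modules over a finite dimensional algebra\<close>

lemma right_module_regular: "right_module (regular :: ('a::ring_1, 'a) rmod)"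
  by unfold_locales (auto simp: regular_def algebra_simps)

definition dm :: "('a, nat \<Rightarrow> 'k::field) rmod \<Rightarrow> nat" where
  "dm M = V.dim (carr M)"

definition dhom :: "('a::ring_1, nat \<Rightarrow> 'k::field) rmod \<Rightarrow> ('a, nat \<Rightarrow> 'k) rmod \<Rightarrow> nat" where
  "dhom M N = H.dim (hom M N)"

locale fd_alg =
  fixes s :: "'k::field \<Rightarrow> 'a::ring_1 \<Rightarrow> 'a"
  assumes fd: "fd_algebra s"
begin

sublocale A: vspace s
proof -
  obtain B where "finite_dimensional_vector_space s B" using fd unfolding fd_algebra_def by blast
  then interpret finite_dimensional_vector_space s B .
  show "vspace s" ..
qed

lemma algebra_basis: obtains B where "finite B" "A.independent B" "A.span B = UNIV"
proof -
  obtain B where "finite_dimensional_vector_space s B" using fd unfolding fd_algebra_def by blast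
  then interpret finite_dimensional_vector_space s B .
  show thesis using that finite_Basis independent_Basis span_Basis by blast
qed

lemma scale_left: "s c 1 * x = s c x" and scale_right: "x * s c 1 = s c x"
proof -
  have "s c (x * y) = s c x * y \<and> s c (x * y) = x * s c y" for x y
    using fd unfolding fd_algebra_def by blast
  from this[of 1 x] this[of x 1] show "s c 1 * x = s c x" "x * s c 1 = s c x" by auto
qed

text \<open>Membership in \<open>mods s\<close> up to finite generation, which \<open>modsI\<close>
  derives from a finite spanning set.\<close>

definition kmod :: "('a, nat \<Rightarrow> 'k) rmod \<Rightarrow> bool" where
  "kmod M \<longleftrightarrow> right_module M \<and> (\<forall>x\<in>carr M. \<forall>c. act M x (s c 1) = fscale c x)"

lemma kmod_mods: "M \<in> mods s \<Longrightarrow> kmod M"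
  unfolding mods_def kmod_def fscale_def by blast

lemma kmod_rmod: "kmod M \<Longrightarrow> right_module M"
  unfolding kmod_def by blast

lemma mods_rmod [simp]: "M \<in> mods s \<Longrightarrow> right_module M"
  unfolding mods_def by blast

lemma kmod_scale: "kmod M \<Longrightarrow> x \<in> carr M \<Longrightarrow> act M x (s c 1) = fscale c x"
  unfolding kmod_def by blast

lemma kmod_subspace: "kmod M \<Longrightarrow> V.subspace (carr M)"
  unfolding V.subspace_def using kmod_rmod kmod_scale
  by (metis right_module.zero_closed right_module.add_closed right_module.act_closed)

lemma act_fscale:
  assumes "kmod M" "x \<in> carr M" shows "act M (fscale c x) a = fscale c (act M x a)"
proof -
  have M: "right_module M" using assms kmod_rmod by blast
  have "act M (fscale c x) a = act M x (s c 1 * a)"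
    using assms kmod_scale[OF assms] right_module.act_mult[OF M assms(2)] by simp
  also have "\<dots> = act M x (a * s c 1)" by (simp add: scale_left scale_right)
  also have "\<dots> = act M (act M x a) (s c 1)" by (rule right_module.act_mult[OF M assms(2)])
  also have "\<dots> = fscale c (act M x a)" using kmod_scale[OF assms(1)] M assms(2) by simp
  finally show ?thesis .
qed

lemma act_s:
  assumes "kmod M" "x \<in> carr M" shows "act M x (s c a) = fscale c (act M x a)"
proof -
  have M: "right_module M" using assms kmod_rmod by blast
  have "act M x (s c a) = act M (act M x a) (s c 1)"
    using right_module.act_mult[OF M assms(2)] scale_right by metis
  then show ?thesis using kmod_scale[OF assms(1)] M assms(2) by simp
qed

lemma hom_fscale:
  assumes "kmod M" "kmod N" "f \<in> hom M N" "x \<in> carr M" shows "f (fscale c x) = fscale c (f x)"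
  using kmod_scale[OF assms(1,4)] kmod_scale[OF assms(2), of "f x"] hom_act[OF assms(3,4)]
    hom_in[OF assms(3,4)] by metis

lemma hom_linear_on:
  assumes "kmod M" "kmod N" "f \<in> hom M N" shows "VV.linear_on (carr M) f"
  unfolding VV.linear_on_def using assms by (auto simp: hom_add[OF assms(3)] hom_fscale)

lemma submodule_subspace:
  assumes "kmod M" "submodule U M" shows "V.subspace U"
  unfolding V.subspace_def
  using submodule_zero[OF assms(2)] submodule_add[OF assms(2)] submodule_act[OF assms(2)]
    submodule_in[OF assms(2)] kmod_scale[OF assms(1)] by metis

lemma modsI:
  assumes k: "kmod M" and B: "finite B" "carr M \<subseteq> V.span B"
  shows "M \<in> mods s"
proof -
  have "V.fin_dim (carr M)" unfolding V.fin_dim_def using kmod_subspace[OF k] B by blast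
  then obtain C where C: "finite C" "C \<subseteq> carr M" "V.independent C" "V.span C = carr M"
    "card C = V.dim (carr M)" by (rule V.fin_dim_basis)
  have "U = carr M" if "submodule U M" "C \<subseteq> U" for U
    using V.span_minimal[OF that(2) submodule_subspace[OF k that(1)]] C submodule_subset[OF that(1)]
    by blast
  then have "fin_gen M" unfolding fin_gen_def using C by blast
  then show ?thesis using k unfolding mods_def kmod_def fscale_def by blast
qed

text \<open>Finitely many generators times a finite basis of the algebra give a spanning set: its
  span is closed under the action, because a product of algebra elements is again a combination of
  basis elements.\<close>

lemma mods_fin_dim:
  assumes "M \<in> mods s" shows "V.fin_dim (carr M)"
proof -
  have k: "kmod M" and M: "right_module M" using assms kmod_mods by auto
  obtain G where G: "finite G" "G \<subseteq> carr M" "\<forall>U. submodule U M \<and> G \<subseteq> U \<longrightarrow> U = carr M"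
    using assms unfolding mods_def fin_gen_def by auto
  obtain B where B: "finite B" "A.independent B" "A.span B = UNIV" by (rule algebra_basis)
  define S where "S = (\<lambda>(g, b). act M g b) ` (G \<times> B)"
  have S: "S \<subseteq> carr M" unfolding S_def using G M by auto
  have span: "V.span S \<subseteq> carr M" using V.span_minimal[OF S kmod_subspace[OF k]] .
  have act: "act M g a \<in> V.span S" if g: "g \<in> G" for g a
  proof -
    have "a \<in> A.span B" using B by simp
    then show ?thesis
    proof (induction rule: A.span_induct_alt)
      case base
      have "g \<in> carr M" using g G by blast
      then show ?case using V.span_zero[of S] by (simp only: act_zero_right[OF M])
    next
      case (step c b y)
      have gc: "g \<in> carr M" using g G by blast
      have "act M g b \<in> S" using g step unfolding S_def by force
      then have "fscale c (act M g b) + act M g y \<in> V.span S"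
        by (intro V.span_add V.span_scale V.span_base step)
      then show ?case by (simp only: right_module.act_add_right[OF M gc] act_s[OF k gc])
    qed
  qed
  have "submodule (V.span S) M"
  proof (rule submoduleI[OF M span V.span_zero V.span_add])
    fix x a assume "x \<in> V.span S"
    then have "x \<in> carr M \<and> act M x a \<in> V.span S"
    proof (induction rule: V.span_induct_alt)
      case base
      show ?case
        using V.span_zero[of S] by (simp only: act_zero_left[OF M] right_module.zero_closed[OF M] simp_thms)
    next
      case (step c x y)
      obtain g b where x: "x = act M g b" "g \<in> G" using step unfolding S_def by auto
      have gc: "g \<in> carr M" using x G by blast
      have xc: "x \<in> carr M" using x gc M by simp
      have yc: "y \<in> carr M" using step by blast
      have cx: "fscale c x \<in> carr M" by (rule V.subspace_scale[OF kmod_subspace[OF k] xc])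
      have "act M x a = act M g (b * a)" using x right_module.act_mult[OF M gc] by simp
      then have "act M x a \<in> V.span S" using act x by simp
      then have "fscale c (act M x a) + act M y a \<in> V.span S"
        using step by (intro V.span_add V.span_scale) auto
      then show ?case
        using right_module.add_closed[OF M cx yc]
        by (simp only: right_module.act_add_left[OF M cx yc] act_fscale[OF k xc] simp_thms)
    qed
    then show "act M x a \<in> V.span S" by blast
  qed
  moreover have "G \<subseteq> V.span S"
  proof
    fix g assume "g \<in> G"
    then show "g \<in> V.span S" using act[of g 1] right_module.act_one[OF M, of g] G by auto
  qed
  ultimately have "V.span S = carr M" using G(3) by blast
  moreover have "finite S" unfolding S_def using G B by simp
  ultimately show ?thesis unfolding V.fin_dim_def by (metis V.subspace_span order_refl)
qed

lemma submod_mods [simp]: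
  assumes M: "M \<in> mods s" and U: "submodule U M" shows "submod M U \<in> mods s"
proof -
  obtain B where "finite B" "carr M \<subseteq> V.span B" using mods_fin_dim[OF M] V.fin_dim_def by blast
  moreover have "kmod (submod M U)"
    unfolding kmod_def
    using submodule_right_module[OF U] submodule_in[OF U] kmod_scale[OF kmod_mods[OF M]] by auto
  ultimately show ?thesis using modsI[of "submod M U" B] submodule_subset[OF U] by simp
qed

lemma hom_linear: "M \<in> mods s \<Longrightarrow> N \<in> mods s \<Longrightarrow> f \<in> hom M N \<Longrightarrow> VV.linear_on (carr M) f"
  using hom_linear_on kmod_mods by blast

section \<open>Dimension counts\<close>

lemma dm_sub_le: "M \<in> mods s \<Longrightarrow> submodule U M \<Longrightarrow> dm (submod M U) \<le> dm M"
  unfolding dm_def carr_submod by (rule V.fin_dim_mono[OF mods_fin_dim submodule_subset])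

lemma dm_sub_eq:
  assumes "M \<in> mods s" "submodule U M" "dm M \<le> dm (submod M U)" shows "U = carr M"
  using V.fin_dim_eq[OF mods_fin_dim[OF assms(1)] submodule_subspace[OF kmod_mods assms(2)]
      submodule_subset[OF assms(2)]] assms unfolding dm_def by simp

lemma dm_sub_less:
  assumes "M \<in> mods s" "submodule U M" "U \<noteq> carr M" shows "dm (submod M U) < dm M"
  using dm_sub_eq[OF assms(1,2)] assms(3) by linarith

lemma dm_zero_iff: "M \<in> mods s \<Longrightarrow> dm M = 0 \<longleftrightarrow> carr M = {0}"
  unfolding dm_def using V.dim_zero_iff[OF mods_fin_dim] .

lemma dm_rank:
  assumes "M \<in> mods s" "N \<in> mods s" "f \<in> hom M N"
  shows "dm M = dm (submod M (ker M f)) + dm (submod N (f ` carr M))"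
  using VV.rank_nullity(3)[OF mods_fin_dim[OF assms(1)] hom_linear[OF assms]]
  unfolding dm_def ker_def by simp

lemma dm_epi: "M \<in> mods s \<Longrightarrow> N \<in> mods s \<Longrightarrow> epi M N f \<Longrightarrow> dm M = dm (submod M (ker M f)) + dm N"
  using dm_rank[of M N f] unfolding epi_def by auto

lemma ker_zero_iff:
  assumes "right_module M" "f \<in> hom M N"
  shows "ker M f = {0} \<longleftrightarrow> inj_on f (carr M)"
  unfolding inj_on_hom_iff[OF assms] ker_def using hom_zero[OF assms] assms(1) by auto

lemma dm_inj:
  assumes "M \<in> mods s" "N \<in> mods s" "f \<in> hom M N" "inj_on f (carr M)"
  shows "dm M = dm (submod N (f ` carr M))" "dm M \<le> dm N"
proof -
  have M: "right_module M" and N: "right_module N" using assms by auto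
  have "ker M f = {0}" using ker_zero_iff[OF M assms(3)] assms(4) by blast
  then have "dm (submod M (ker M f)) = 0"
    using dm_zero_iff[OF submod_mods[OF assms(1) ker_submodule[OF M N assms(3)]]] by simp
  then show a: "dm M = dm (submod N (f ` carr M))" using dm_rank[OF assms(1-3)] by simp
  then show "dm M \<le> dm N"
    using dm_sub_le[OF assms(2) image_submodule[OF M N assms(3) submodule_carr[OF M]]] by simp
qed

lemma inj_surj:
  assumes "M \<in> mods s" "N \<in> mods s" "f \<in> hom M N" "inj_on f (carr M)" "dm N \<le> dm M"
  shows "bij_betw f (carr M) (carr N)"
proof -
  have M: "right_module M" and N: "right_module N" using assms by auto
  have "f ` carr M = carr N"
    using dm_sub_eq[OF assms(2) image_submodule[OF M N assms(3) submodule_carr[OF M]]]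
      dm_inj(1)[OF assms(1-4)] assms(5) by simp
  then show ?thesis using assms(4) unfolding bij_betw_def by blast
qed

lemma epi_inj:
  assumes "M \<in> mods s" "N \<in> mods s" "epi M N f" "dm M \<le> dm N"
  shows "bij_betw f (carr M) (carr N)"
proof -
  have M: "right_module M" and N: "right_module N" and f: "f \<in> hom M N" using assms epi_hom by auto
  have "dm (submod M (ker M f)) = 0" using dm_epi[OF assms(1-3)] assms(4) by simp
  then have "ker M f = {0}"
    using dm_zero_iff[OF submod_mods[OF assms(1) ker_submodule[OF M N f]]] by simp
  then have "inj_on f (carr M)" using ker_zero_iff[OF M f] by blast
  then show ?thesis using assms(3) unfolding bij_betw_def epi_def by blast
qed

lemma dm_iso:
  assumes "M \<in> mods s" "N \<in> mods s" "iso_mod M N" shows "dm M = dm N"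
proof -
  obtain f where f: "f \<in> hom M N" "bij_betw f (carr M) (carr N)"
    using assms(3) iso_mod_def by blast
  then have "f ` carr M = carr N" "inj_on f (carr M)" unfolding bij_betw_def by auto
  then show ?thesis using dm_inj(1)[OF assms(1,2) f(1)] by simp
qed

text \<open>A set of cosets would not lie in \<open>k^N\<close>, so the quotient lives on a vector
  space complement \<open>W\<close> of \<open>U\<close>: one acts in \<open>M\<close> and then
  projects to \<open>W\<close> along \<open>U\<close>.\<close>

lemma quotient:
  assumes M: "M \<in> mods s" and U: "submodule U M"
  obtains Q p where "Q \<in> mods s" "epi M Q p" "\<forall>x\<in>carr M. p x = 0 \<longleftrightarrow> x \<in> U"
proof -
  have k: "kmod M" and rM: "right_module M" using M kmod_mods by auto
  obtain W where W: "V.subspace W" "W \<subseteq> carr M" "U \<inter> W = {0}"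
    and dec: "\<And>v. v \<in> carr M \<Longrightarrow> \<exists>u\<in>U. \<exists>w\<in>W. v = u + w"
    by (rule V.subspace_complement[OF submodule_subspace[OF k U] kmod_subspace[OF k]
        submodule_subset[OF U]]) blast
  note Uz = submodule_zero[OF U] and Ua = submodule_add[OF U] and Ud = submodule_diff[OF U]
    and Uact = submodule_act[OF U] and Um = submodule_uminus[OF U] and Uin = submodule_in[OF U]
  have Win: "w \<in> carr M" if "w \<in> W" for w using W that by blast
  have W0: "0 \<in> W" and Wa: "\<And>x y. x \<in> W \<Longrightarrow> y \<in> W \<Longrightarrow> x + y \<in> W"
    and Wm: "\<And>x. x \<in> W \<Longrightarrow> - x \<in> W" and Wd: "\<And>x y. x \<in> W \<Longrightarrow> y \<in> W \<Longrightarrow> x - y \<in> W"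
    using W(1) V.subspace_0 V.subspace_add V.subspace_neg V.subspace_diff by blast+
  define P where "P = (\<lambda>x. SOME w. w \<in> W \<and> x - w \<in> U)"
  have PW: "P x \<in> W" and PU: "x - P x \<in> U" if "x \<in> carr M" for x
  proof -
    obtain u w where "u \<in> U" "w \<in> W" "x = u + w" using dec[OF \<open>x \<in> carr M\<close>] by blast
    then have "\<exists>w. w \<in> W \<and> x - w \<in> U" by (intro exI[of _ w]) simp
    then have "P x \<in> W \<and> x - P x \<in> U" unfolding P_def by (rule someI_ex)
    then show "P x \<in> W" "x - P x \<in> U" by auto
  qed
  have Peq: "P x = w" if "x \<in> carr M" "w \<in> W" "x - w \<in> U" for x w
  proof -
    have "(x - w) - (x - P x) \<in> U" using Ud[OF that(3) PU[OF that(1)]] .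
    then have "P x - w \<in> U" by simp
    moreover have "P x - w \<in> W" using Wd PW that by blast
    ultimately have "P x - w = 0" using W by blast
    then show ?thesis by simp
  qed
  have Padd: "P (x + y) = P x + P y" if "x \<in> carr M" "y \<in> carr M" for x y
  proof (rule Peq)
    have "(x - P x) + (y - P y) \<in> U" using Ua PU that by blast
    then show "x + y - (P x + P y) \<in> U" by (simp add: algebra_simps)
  qed (use that rM Wa PW in auto)
  have PP: "P w = w" if "w \<in> W" for w
    using Peq[of w w] that Win Uz by simp
  \<comment> \<open>Projecting before acting makes no difference, as the error
    \<open>act M (x - P x) a\<close> stays in \<open>U\<close>. This gives associativity of the new
    action and linearity of the projection.\<close>
  have Pact: "P (act M (P x) a) = P (act M x a)" if x: "x \<in> carr M" for x a
  proof (rule Peq)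
    have Px: "P x \<in> carr M" using PW x Win by blast
    have "act M (x - P x) a \<in> U" using Uact PU x by blast
    then have "act M x a - act M (P x) a \<in> U"
      using right_module.act_add_left[OF rM x, of "- P x" a] Px rM act_uminus[OF rM Px] by simp
    moreover have "act M x a - P (act M x a) \<in> U" using PU x rM by simp
    ultimately have "(act M x a - P (act M x a)) - (act M x a - act M (P x) a) \<in> U"
      using Ud by blast
    then show "act M (P x) a - P (act M x a) \<in> U" by simp
    show "act M (P x) a \<in> carr M" using Px rM by simp
    show "P (act M x a) \<in> W" using PW x rM by simp
  qed
  define Q where "Q = \<lparr>carr = W, act = (\<lambda>w a. P (act M w a))\<rparr>"
  have cQ [simp]: "carr Q = W" and aQ [simp]: "act Q w a = P (act M w a)" for w a
    by (auto simp: Q_def)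
  have rQ: "right_module Q"
  proof
    show "0 \<in> carr Q" using W0 by simp
    fix x y a b assume x: "x \<in> carr Q"
    then have xM: "x \<in> carr M" using Win by simp
    show "- x \<in> carr Q" using x Wm by simp
    show "act Q x a \<in> carr Q" using PW xM rM by simp
    show "act Q x (a + b) = act Q x a + act Q x b"
      using xM rM Padd right_module.act_add_right[OF rM xM] by simp
    show "act Q x (a * b) = act Q (act Q x a) b"
      using xM rM Pact[of "act M x a" b] right_module.act_mult[OF rM xM] by simp
    show "act Q x 1 = x" using x xM PP right_module.act_one[OF rM xM] by simp
    assume y: "y \<in> carr Q"
    then have yM: "y \<in> carr M" using Win by simp
    show "x + y \<in> carr Q" using x y Wa by simp
    show "act Q (x + y) a = act Q x a + act Q y a"
      using xM yM rM Padd right_module.act_add_left[OF rM xM yM] by simp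
  qed
  have "kmod Q" unfolding kmod_def
  proof (intro conjI rQ ballI allI)
    fix x c assume x: "x \<in> carr Q"
    then have "fscale c x \<in> W" using W(1) V.subspace_scale by simp
    then show "act Q x (s c 1) = fscale c x" using x PP kmod_scale[OF k Win] by simp
  qed
  moreover obtain B where "finite B" "carr M \<subseteq> V.span B"
    using mods_fin_dim[OF M] V.fin_dim_def by blast
  ultimately have "Q \<in> mods s" using modsI[of Q B] W by auto
  moreover have "epi M Q (rst (carr M) P)"
  proof (rule epiI)
    show "rst (carr M) P \<in> hom M Q"
      by (rule rst_homI[OF rM]) (use PW Padd Pact in auto)
    show "\<exists>x\<in>carr M. rst (carr M) P x = y" if "y \<in> carr Q" for y
      using that PP Win by (intro bexI[of _ y]) auto
  qed
  moreover have "rst (carr M) P x = 0 \<longleftrightarrow> x \<in> U" if x: "x \<in> carr M" for x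
    using PU[OF x] Peq[OF x W0] x by auto
  ultimately show thesis using that by blast
qed

text \<open>Elements of \<open>dsum\<close> are sequences of sequences; the pairing function on the
  natural numbers embeds them additively into \<open>k^N\<close>.\<close>

definition enc :: "(nat \<Rightarrow> nat \<Rightarrow> 'k) \<Rightarrow> nat \<Rightarrow> 'k" where
  "enc x m = x (fst (prod_decode m)) (snd (prod_decode m))"

lemma inj_enc: "inj enc"
proof (rule injI)
  fix x y :: "nat \<Rightarrow> nat \<Rightarrow> 'k" assume e: "enc x = enc y"
  have "x i j = y i j" for i j
    using fun_cong[OF e, of "prod_encode (i, j)"] by (simp add: enc_def)
  then show "x = y" by (simp add: fun_eq_iff)
qed

lemma mods_if_biprod:
  assumes k: "kmod D" and Xs: "set Xs \<subseteq> mods s" and b: "biprod D Xs i p" shows "D \<in> mods s"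
proof -
  have X: "Xs ! j \<in> mods s" if "j < length Xs" for j using Xs that by auto
  have "\<exists>B. finite B \<and> B \<subseteq> carr (Xs ! j) \<and> V.span B = carr (Xs ! j)" if "j < length Xs" for j
    by (rule V.fin_dim_basis[OF mods_fin_dim[OF X[OF that]]]) auto
  then have "\<forall>j. \<exists>B. j < length Xs \<longrightarrow>
      finite B \<and> B \<subseteq> carr (Xs ! j) \<and> V.span B = carr (Xs ! j)" by blast
  then obtain B where B: "\<And>j. j < length Xs \<Longrightarrow>
      finite (B j) \<and> B j \<subseteq> carr (Xs ! j) \<and> V.span (B j) = carr (Xs ! j)"
    by (metis (no_types))
  let ?C = "\<Union>j<length Xs. i j ` B j"
  have "x \<in> V.span ?C" if x: "x \<in> carr D" for x
  proof -
    have "i j (p j x) \<in> V.span ?C" if j: "j < length Xs" for j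
    proof -
      have "p j x \<in> V.span (B j)" using B[OF j] hom_in[OF biprodD(2)[OF b j] x] by simp
      then have "i j (p j x) \<in> V.span (i j ` B j)"
        using VV.linear_on_span_image[OF hom_linear_on[OF kmod_mods[OF X[OF j]] k biprodD(1)[OF b j]]
            kmod_subspace[OF kmod_mods[OF X[OF j]]], of "B j"] B[OF j] by blast
      moreover have "V.span (i j ` B j) \<subseteq> V.span ?C" using j by (intro V.span_mono) blast
      ultimately show ?thesis by blast
    qed
    then have "(\<Sum>j<length Xs. i j (p j x)) \<in> V.span ?C" by (intro V.span_sum) auto
    then show ?thesis using biprodD(4)[OF b x] by simp
  qed
  then have "carr D \<subseteq> V.span ?C" by blast
  moreover have "finite ?C" using B by auto
  ultimately show ?thesis using modsI[OF k] by blast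
qed

lemma direct_sum:
  assumes Xs: "set Xs \<subseteq> mods s"
  obtains D i p where "D \<in> mods s" "biprod D Xs i p"
proof -
  have rX: "\<And>X. X \<in> set Xs \<Longrightarrow> right_module X" using Xs by auto
  have r: "right_module (dsum Xs)" by (rule right_module_dsum) (rule rX)
  have inj: "inj_on enc (carr (dsum Xs))" using inj_enc inj_on_subset by blast
  have add: "enc (x + y) = enc x + enc y" for x y by (auto simp: enc_def)
  let ?D = "transport enc (dsum Xs)"
  note T = transport[where f = enc and M = "dsum Xs", OF r inj add]
  have "kmod ?D" unfolding kmod_def
  proof (intro conjI T(1) ballI allI)
    fix x c assume "x \<in> carr ?D"
    then obtain y where y: "y \<in> carr (dsum Xs)" "x = enc y" by (auto simp: transport_def)
    have "act (dsum Xs) y (s c 1) i = fscale c (y i)" for i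
    proof (cases "i < length Xs")
      case True
      then have "kmod (Xs ! i)" using Xs by (intro kmod_mods) auto
      then show ?thesis using y True kmod_scale by (simp add: dsum_def)
    next
      case False
      then show ?thesis using y by (auto simp: dsum_def fscale_def)
    qed
    then have "enc (act (dsum Xs) y (s c 1)) = fscale c (enc y)"
      by (simp add: enc_def fscale_def fun_eq_iff)
    then show "act ?D x (s c 1) = fscale c x" using y T(4) by simp
  qed
  moreover have "iso_mod ?D (dsum Xs)" using iso_mod_sym[OF T(3) r T(1)] .
  then obtain i p where "biprod ?D Xs i p" using iso_dsum_iff[OF T(1) rX] by blast
  ultimately show thesis using that mods_if_biprod[OF _ Xs] by blast
qed

text \<open>The regular module has carrier type \<open>'a\<close>; coordinates over a basis
  \<open>bs\<close> of the algebra provide the isomorphic copy in \<open>mods s\<close>.\<close>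

lemma regular_in_mods:
  obtains L where "L \<in> mods s" "iso_mod (regular :: ('a, 'a) rmod) L"
proof -
  obtain B where B: "finite B" "A.independent B" "A.span B = UNIV" by (rule algebra_basis)
  obtain bs where bs: "set bs = B" "distinct bs" using finite_distinct_list[OF B(1)] by blast
  define co where "co = (\<lambda>x i. if i < length bs then A.representation B x (bs ! i) else 0)"
  have add: "co (x + y) = co x + co y" for x y
    using B by (auto simp: co_def fun_eq_iff A.representation_add)
  have sc: "co (s c x) = fscale c (co x)" for c x
    using B by (auto simp: co_def fun_eq_iff A.representation_scale fscale_def)
  have "inj co"
  proof (rule injI)
    fix x y assume e: "co x = co y"
    have "A.representation B x b = A.representation B y b" if "b \<in> B" for b
    proof -
      have "b \<in> set bs" using that bs(1) by simp
      then obtain i where i: "i < length bs" "bs ! i = b" unfolding in_set_conv_nth by blast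
      then show ?thesis using fun_cong[OF e, of i] by (simp add: co_def)
    qed
    then have "(\<Sum>b\<in>B. s (A.representation B x b) b) = (\<Sum>b\<in>B. s (A.representation B y b) b)"
      by (intro sum.cong) auto
    then show "x = y"
      using A.sum_representation_eq[OF B(2) _ B(1) order.refl] B(3) by simp
  qed
  then have inj: "inj_on co (carr regular)" using inj_on_subset by blast
  note T = transport[where f = co and M = regular, OF right_module_regular inj add]
  let ?L = "transport co (regular :: ('a, 'a) rmod)"
  have "kmod ?L" unfolding kmod_def
  proof (intro conjI T(1) ballI allI)
    fix x c assume "x \<in> carr ?L"
    then obtain y where y: "x = co y" "y \<in> carr regular" by (auto simp: transport_def)
    then show "act ?L x (s c 1) = fscale c x"
      using T(4)[OF y(2), of "s c 1"] by (simp add: regular_def scale_right sc)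
  qed
  moreover have "co x \<in> V.span ((\<lambda>i j. if j = i then 1 else 0) ` {..<length bs})" (is "_ \<in> V.span ?E") for x
  proof -
    have "co x = (\<Sum>i<length bs. fscale (co x i) (\<lambda>j. if j = i then 1 else 0))"
    proof
      fix l
      have "(\<Sum>i<length bs. fscale (co x i) (\<lambda>j. if j = i then 1 else 0)) l =
        (\<Sum>i<length bs. if l = i then co x i else 0)"
        unfolding sum_fun_apply by (intro sum.cong) (auto simp: fscale_def)
      also have "\<dots> = co x l" by (simp add: co_def)
      finally show "co x l = (\<Sum>i<length bs. fscale (co x i) (\<lambda>j. if j = i then 1 else 0)) l" by simp
    qed
    also have "\<dots> \<in> V.span ?E"
      by (intro V.span_sum V.span_scale V.span_base) auto
    finally show ?thesis .
  qed
  then have "carr ?L \<subseteq> V.span ?E" by (auto simp: transport_def)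
  ultimately have "?L \<in> mods s" using modsI[of ?L ?E] by blast
  then show thesis using that T(3) by blast
qed

section \<open>Dimensions of spaces of homomorphisms\<close>

lemma hom_subspace:
  assumes "M \<in> mods s" "N \<in> mods s" shows "H.subspace (hom M N)"
proof -
  have N: "right_module N" and kN: "kmod N" and kM: "kmod M" using assms kmod_mods by auto
  have "hscale c f \<in> hom M N" if f: "f \<in> hom M N" for c f
  proof (rule homI)
    show "hscale c f x \<in> carr N" if "x \<in> carr M" for x
      using hom_in[OF f that] kmod_subspace[OF kN] V.subspace_scale by (simp add: hscale_def)
    show "hscale c f (x + y) = hscale c f x + hscale c f y" if "x \<in> carr M" "y \<in> carr M" for x y
      using that hom_add[OF f] by (simp add: hscale_def V.scale_right_distrib)
    show "hscale c f (act M x a) = act N (hscale c f x) a" if "x \<in> carr M" for x a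
      using that hom_act[OF f] act_fscale[OF kN hom_in[OF f that]] by (simp add: hscale_def)
    show "hscale c f x = 0" if "x \<notin> carr M" for x
      using hom_out[OF f that] by (simp add: hscale_def)
  qed
  moreover have "f + g \<in> hom M N" if "f \<in> hom M N" "g \<in> hom M N" for f g
    using hom_plus[OF N that] by (simp add: plus_fun_def)
  moreover have "0 \<in> hom M N" using hom_0[OF N] by (simp add: zero_fun_def)
  ultimately show ?thesis unfolding H.subspace_def by blast
qed

text \<open>The matrix units \<open>E (b, c)\<close> are only linear maps, in general not
  homomorphisms, but their finite-dimensional span contains the Hom space.\<close>

lemma hom_fin_dim:
  assumes M: "M \<in> mods s" and N: "N \<in> mods s" shows "H.fin_dim (hom M N)"
proof -
  obtain B where B: "finite B" "B \<subseteq> carr M" "V.independent B" "V.span B = carr M" "card B = V.dim (carr M)"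
    by (rule V.fin_dim_basis[OF mods_fin_dim[OF M]])
  obtain C where C: "finite C" "C \<subseteq> carr N" "V.independent C" "V.span C = carr N" "card C = V.dim (carr N)"
    by (rule V.fin_dim_basis[OF mods_fin_dim[OF N]])
  define E :: "(nat \<Rightarrow> 'k) \<times> (nat \<Rightarrow> 'k) \<Rightarrow> (nat \<Rightarrow> 'k) \<Rightarrow> nat \<Rightarrow> 'k"
    where "E = (\<lambda>(b, c). rst (carr M) (\<lambda>x. fscale (V.representation B x b) c))"
  have "f \<in> H.span (E ` (B \<times> C))" if f: "f \<in> hom M N" for f
  proof -
    have "f = (\<Sum>b\<in>B. \<Sum>c\<in>C. hscale (V.representation C (f b) c) (E (b, c)))"
    proof
      fix x
      show "f x = (\<Sum>b\<in>B. \<Sum>c\<in>C. hscale (V.representation C (f b) c) (E (b, c))) x"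
      proof (cases "x \<in> carr M")
        case True
        then have "x = (\<Sum>b\<in>B. fscale (V.representation B x b) b)"
          using V.sum_representation_eq[OF B(3) _ B(1) order.refl] B(4) by simp
        then have "f x = f (\<Sum>b\<in>B. fscale (V.representation B x b) b)" by simp
        also have "\<dots> = (\<Sum>b\<in>B. f (fscale (V.representation B x b) b))"
          using B(2) kmod_subspace[OF kmod_mods[OF M]]
          by (intro hom_sum[OF mods_rmod[OF M] f]) (auto intro: V.subspace_scale)
        also have "\<dots> = (\<Sum>b\<in>B. fscale (V.representation B x b) (f b))"
          using B(2) by (intro sum.cong refl hom_fscale[OF kmod_mods[OF M] kmod_mods[OF N] f]) auto
        also have "\<dots> = (\<Sum>b\<in>B. \<Sum>c\<in>C. fscale (V.representation C (f b) c) (fscale (V.representation B x b) c))"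
        proof (rule sum.cong[OF refl])
          fix b assume "b \<in> B"
          then have "f b \<in> V.span C" using C(4) B(2) hom_in[OF f] by auto
          then have "f b = (\<Sum>c\<in>C. fscale (V.representation C (f b) c) c)"
            using V.sum_representation_eq[OF C(3) _ C(1) order.refl] by simp
          then have "fscale (V.representation B x b) (f b)
            = fscale (V.representation B x b) (\<Sum>c\<in>C. fscale (V.representation C (f b) c) c)" by simp
          also have "\<dots> = (\<Sum>c\<in>C. fscale (V.representation C (f b) c) (fscale (V.representation B x b) c))"
            by (simp add: V.scale_sum_right mult.commute)
          finally show "fscale (V.representation B x b) (f b)
            = (\<Sum>c\<in>C. fscale (V.representation C (f b) c) (fscale (V.representation B x b) c))" .
        qed
        finally show ?thesis using True by (simp add: sum_fun_apply hscale_def E_def)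
      next
        case False
        then show ?thesis using hom_out[OF f] by (simp add: sum_fun_apply hscale_def E_def rst_def)
      qed
    qed
    also have "\<dots> \<in> H.span (E ` (B \<times> C))"
      by (intro H.span_sum H.span_scale H.span_base) auto
    finally show ?thesis .
  qed
  then have "hom M N \<subseteq> H.span (E ` (B \<times> C))" by blast
  then show ?thesis
    unfolding H.fin_dim_def using B(1) C(1)
    by (intro conjI exI[of _ "E ` (B \<times> C)"] hom_subspace[OF M N]) auto
qed

lemma dhom_zero_iff: "M \<in> mods s \<Longrightarrow> N \<in> mods s \<Longrightarrow> dhom M N = 0 \<longleftrightarrow> hom M N = {0}"
  unfolding dhom_def using H.dim_zero_iff[OF hom_fin_dim] .

text \<open>Rank and nullity for the restriction of maps from \<open>P\<close> to
  \<open>ker P e\<close>: it is onto by \<open>ext\<close>, and its kernel is the injective image of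
  \<open>hom M X\<close> under composition with \<open>e\<close>. For projective \<open>P\<close>,
  \<open>ext\<close> is the vanishing of Ext.\<close>

lemma dhom_exact:
  assumes P: "P \<in> mods s" and M: "M \<in> mods s" and X: "X \<in> mods s" and e: "epi P M e"
    and ext: "\<And>f. f \<in> hom (submod P (ker P e)) X \<Longrightarrow> \<exists>h\<in>hom P X. \<forall>x\<in>ker P e. h x = f x"
  shows "dhom P X = dhom M X + dhom (submod P (ker P e)) X"
proof -
  have rP: "right_module P" and rM: "right_module M" and rX: "right_module X" using P M X by auto
  have eh: "e \<in> hom P M" using e epi_hom by blast
  let ?K = "ker P e"
  have K: "submodule ?K P" using ker_submodule[OF rP rM eh] .
  let ?r = "rst ?K :: ((nat \<Rightarrow> 'k) \<Rightarrow> nat \<Rightarrow> 'k) \<Rightarrow> (nat \<Rightarrow> 'k) \<Rightarrow> nat \<Rightarrow> 'k"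
  let ?t = "\<lambda>g :: (nat \<Rightarrow> 'k) \<Rightarrow> nat \<Rightarrow> 'k. g \<circ> e"
  have lr: "HH.linear_on (hom P X) ?r"
    unfolding HH.linear_on_def by (auto simp: rst_def hscale_def fun_eq_iff)
  have lt: "HH.linear_on (hom M X) ?t"
    unfolding HH.linear_on_def by (auto simp: hscale_def fun_eq_iff)
  have imr: "?r ` hom P X = hom (submod P ?K) X"
  proof
    show "?r ` hom P X \<subseteq> hom (submod P ?K) X" using hom_rst[OF _ K] by blast
    show "hom (submod P ?K) X \<subseteq> ?r ` hom P X"
    proof
      fix f assume f: "f \<in> hom (submod P ?K) X"
      then obtain h where h: "h \<in> hom P X" "\<forall>x\<in>?K. h x = f x" using ext by blast
      have "f = ?r h"
        by (rule hom_eqI[OF f hom_rst[OF h(1) K]]) (use h in auto)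
      then show "f \<in> ?r ` hom P X" using h by blast
    qed
  qed
  have imt: "?t ` hom M X = {h \<in> hom P X. ?r h = 0}"
  proof
    show "?t ` hom M X \<subseteq> {h \<in> hom P X. ?r h = 0}"
    proof
      fix h assume "h \<in> ?t ` hom M X"
      then obtain g where g: "g \<in> hom M X" "h = g \<circ> e" by blast
      have "rst ?K (g \<circ> e) x = 0" for x using hom_zero[OF rM g(1)] by (simp add: rst_def ker_def)
      then have "rst ?K (g \<circ> e) = 0" by (simp only: fun_eq_iff zero_fun_apply simp_thms)
      then show "h \<in> {h \<in> hom P X. ?r h = 0}" using g hom_comp[OF rM eh g(1)] by simp
    qed
    show "{h \<in> hom P X. ?r h = 0} \<subseteq> ?t ` hom M X"
    proof
      fix h assume "h \<in> {h \<in> hom P X. ?r h = 0}"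
      then have h: "h \<in> hom P X" "?r h = 0" by auto
      have "h x = 0" if "x \<in> carr P" "e x = 0" for x
        using fun_cong[OF h(2), of x] that by (simp add: ker_def rst_def)
      then obtain g where g: "g \<in> hom M X" "\<forall>x\<in>carr P. g (e x) = h x"
        using epi_factor[OF rP rX e h(1)] by blast
      have "h = g \<circ> e"
        by (rule hom_eqI[OF h(1) hom_comp[OF rM eh g(1)]]) (use g in auto)
      then show "h \<in> ?t ` hom M X" using g by blast
    qed
  qed
  have "{g \<in> hom M X. ?t g = 0} = {0}"
  proof -
    have "g = 0" if g: "g \<in> hom M X" "g \<circ> e = 0" for g
    proof
      fix y show "g y = 0 y"
      proof (cases "y \<in> carr M")
        case True
        then obtain x where "x \<in> carr P" "e x = y" using epi_surj[OF e] by blast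
        then show ?thesis using fun_cong[OF g(2), of x] by simp
      qed (use g hom_out in auto)
    qed
    moreover have "0 \<in> hom M X" using H.subspace_0[OF hom_subspace[OF M X]] .
    ultimately show ?thesis by auto
  qed
  then have "H.dim {g \<in> hom M X. ?t g = 0} = 0" using H.dim_le_card[of "{0}" "{}"] by simp
  then have "dhom M X = H.dim {h \<in> hom P X. ?r h = 0}"
    unfolding dhom_def using HH.rank_nullity(3)[OF hom_fin_dim[OF M X] lt] imt by simp
  moreover have "dhom P X = H.dim {h \<in> hom P X. ?r h = 0} + dhom (submod P ?K) X"
    unfolding dhom_def using HH.rank_nullity(3)[OF hom_fin_dim[OF P X] lr] imr by simp
  ultimately show ?thesis by simp
qed

lemma zero_module: obtains Z where "Z \<in> mods s" "carr Z = {0}"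
proof -
  obtain L where L: "L \<in> mods s" using regular_in_mods by blast
  then show thesis using that[of "submod L {0}"] by simp
qed

lemma hom_from_zero: "right_module X \<Longrightarrow> carr Z = {0} \<Longrightarrow> hom Z X = {0}"
proof -
  assume a: "right_module X" "carr Z = {0}"
  have "f = 0" if f: "f \<in> hom Z X" for f
  proof
    have "f (0 + 0) = f 0 + f 0" using hom_add[OF f] a by blast
    then show "f x = 0 x" for x using hom_out[OF f, of x] a by (cases "x = 0") auto
  qed
  moreover have "0 \<in> hom Z X" using hom_0[OF a(1)] by (simp add: zero_fun_def)
  ultimately show ?thesis by blast
qed

lemma dhom_iso:
  assumes "M \<in> mods s" "N \<in> mods s" "X \<in> mods s" "iso_mod M N" shows "dhom M X = dhom N X"
proof -
  have rM: "right_module M" using assms by simp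
  obtain f where f: "f \<in> hom M N" "bij_betw f (carr M) (carr N)"
    using assms(4) iso_mod_def by blast
  have k: "ker M f = {0}" using ker_zero_iff[OF rM f(1)] f(2) by (simp add: bij_betw_def)
  have e: "epi M N f" using f by (simp add: epi_def bij_betw_def)
  have hz: "hom (submod M {0}) X = {0}" by (rule hom_from_zero) (use assms in auto)
  have "\<exists>h\<in>hom M X. \<forall>x\<in>ker M f. h x = g x" if "g \<in> hom (submod M (ker M f)) X" for g
    using that hz k hom_0[of X M] assms(3) by (intro bexI[of _ "\<lambda>_. 0"]) auto
  then have "dhom M X = dhom N X + dhom (submod M (ker M f)) X"
    using dhom_exact[OF assms(1-3) e] by blast
  then show ?thesis unfolding k dhom_def hz using H.dim_le_card[of "{0}" "{}"] by simp
qed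

lemma dhom_internal_sum:
  assumes M: "M \<in> mods s" and X: "X \<in> mods s" and UV: "internal_sum M U V"
  shows "dhom M X = dhom (submod M U) X + dhom (submod M V) X"
proof -
  have rM: "right_module M" using M by simp
  have U: "submodule U M" and V: "submodule V M" using UV unfolding internal_sum_def by auto
  obtain p q where p: "p \<in> hom M (submod M U)" "q \<in> hom M (submod M V)"
    "\<forall>x\<in>carr M. x = p x + q x" "\<forall>u\<in>U. p u = u \<and> q u = 0"
    "\<forall>v\<in>V. p v = 0 \<and> q v = v" by (rule internal_sum_projections[OF rM UV])
  have k: "ker M p = V"
  proof -
    have "x \<in> V" if "x \<in> carr M" "p x = 0" for x
      using bspec[OF p(3) that(1)] that hom_in[OF p(2) that(1)] by simp
    then show ?thesis using p submodule_in[OF V] unfolding ker_def by auto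
  qed
  have e: "epi M (submod M U) p"
    by (rule epiI[OF p(1)]) (use p submodule_in[OF U] in force)
  have "\<exists>h\<in>hom M X. \<forall>x\<in>V. h x = f x" if f: "f \<in> hom (submod M V) X" for f
  proof -
    have "(\<lambda>x. f (q x)) \<in> hom M X" using hom_comp_in[OF submodule_right_module[OF V] p(2) f] .
    then show ?thesis using p by (intro bexI[of _ "\<lambda>x. f (q x)"]) auto
  qed
  then show ?thesis using dhom_exact[OF M _ X e] U M k by simp
qed

end

section \<open>Indecomposable modules and the Krull-Schmidt theorem\<close>

text \<open>Splits off the first summand as a quotient whose kernel is the sum of the others, which
  allows induction over the list of summands.\<close>

lemma biprod_Cons_ker:
  assumes M: "right_module M" and b: "biprod M (X # Xs) i p" and X: "right_module X"
    and Xs: "\<And>Y. Y \<in> set Xs \<Longrightarrow> right_module Y"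
  shows "epi M X (p 0)"
    "biprod (submod M (ker M (p 0))) Xs (\<lambda>j. i (Suc j)) (\<lambda>j. rst (ker M (p 0)) (p (Suc j)))"
proof -
  let ?K = "ker M (p 0)"
  have i0: "i 0 \<in> hom X M" and p0: "p 0 \<in> hom M X"
    using biprodD(1)[OF b, of 0] biprodD(2)[OF b, of 0] by auto
  have K: "submodule ?K M" using ker_submodule[OF M X p0] .
  show "epi M X (p 0)"
  proof (rule epiI[OF p0])
    show "\<exists>x\<in>carr M. p 0 x = y" if "y \<in> carr X" for y
      using biprodD(3)[OF b, of 0 0 y] that hom_in[OF i0 that] by auto
  qed
  have iS: "i (Suc j) \<in> hom (Xs ! j) M" "p (Suc j) \<in> hom M (Xs ! j)" if "j < length Xs" for j
    using biprodD(1)[OF b, of "Suc j"] biprodD(2)[OF b, of "Suc j"] that by auto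
  show "biprod (submod M ?K) Xs (\<lambda>j. i (Suc j)) (\<lambda>j. rst ?K (p (Suc j)))"
    unfolding biprod_def
  proof (intro conjI allI impI ballI)
    fix j assume j: "j < length Xs"
    have iK: "i (Suc j) x \<in> ?K" if "x \<in> carr (Xs ! j)" for x
      using that biprodD(3)[OF b, of "Suc j" 0 x] j hom_in[OF iS(1)[OF j]] by (simp add: ker_def)
    show "i (Suc j) \<in> hom (Xs ! j) (submod M ?K)" using hom_corestrict[OF iS(1)[OF j]] iK by blast
    show "rst ?K (p (Suc j)) \<in> hom (submod M ?K) (Xs ! j)" using hom_rst[OF iS(2)[OF j] K] .
    fix l x assume "l < length Xs" and x: "x \<in> carr (Xs ! j)"
    then show "rst ?K (p (Suc l)) (i (Suc j) x) = (if l = j then x else 0)"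
      using iK[OF x] j biprodD(3)[OF b, of "Suc j" "Suc l" x] by simp
  next
    fix x assume "x \<in> carr (submod M ?K)"
    then have x: "x \<in> carr M" "p 0 x = 0" "x \<in> ?K" by (auto simp: ker_def)
    have "x = (\<Sum>j<Suc (length Xs). i j (p j x))" using biprodD(4)[OF b x(1)] by simp
    also have "\<dots> = i 0 (p 0 x) + (\<Sum>j<length Xs. i (Suc j) (p (Suc j) x))"
      by (rule sum.lessThan_Suc_shift)
    finally show "x = (\<Sum>j<length Xs. i (Suc j) (rst ?K (p (Suc j)) x))"
      using x hom_zero[OF X i0] by simp
  qed
qed

lemma indecomposableD: "indecomposable M \<Longrightarrow> internal_sum M U V \<Longrightarrow> U = {0} \<or> V = {0}"
  and indecomposable_nz: "indecomposable M \<Longrightarrow> carr M \<noteq> {0}"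
  unfolding indecomposable_def by blast+

lemma indecomposable_idempotent:
  assumes M: "right_module M" "indecomposable M" and e: "e \<in> hom M M"
    and id: "\<And>x. x \<in> carr M \<Longrightarrow> e (e x) = e x"
  shows "(\<forall>x\<in>carr M. e x = 0) \<or> (\<forall>x\<in>carr M. e x = x)"
  using indecomposableD[OF M(2) idempotent_internal_sum[OF M(1) e id]]
proof
  assume "e ` carr M = {0}"
  then show ?thesis by blast
next
  assume k: "ker M e = {0}"
  have "e x = x" if "x \<in> carr M" for x
  proof -
    have "x - e x \<in> ker M e" using that M e id by (simp add: ker_def hom_diff[OF M(1) e])
    then show ?thesis unfolding k by simp
  qed
  then show ?thesis by blast
qed

text \<open>With \<open>h\<close> inverse to the composition of \<open>f\<close> and
  \<open>g\<close>, the map \<open>f h g\<close> is an idempotent of \<open>Y\<close>. It is not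
  zero, because \<open>X\<close> is not zero, so it is the identity.\<close>

lemma split_mono_indecomposable:
  assumes X: "right_module X" "carr X \<noteq> {0}" and Y: "right_module Y" "indecomposable Y"
    and f: "f \<in> hom X Y" and g: "g \<in> hom Y X" and gf: "bij_betw (\<lambda>x. g (f x)) (carr X) (carr X)"
  shows "bij_betw f (carr X) (carr Y)"
proof -
  have "(\<lambda>x. g (f x)) \<in> hom X X" using hom_comp_in[OF Y(1) f g] .
  then obtain h where h: "h \<in> hom X X" "\<forall>x\<in>carr X. h (g (f x)) = x" "\<forall>x\<in>carr X. g (f (h x)) = x"
    by (rule hom_inverse[OF X(1) X(1) _ gf])
  define e where "e = (\<lambda>y. f (h (g y)))"
  have e: "e \<in> hom Y Y" unfolding e_def using hom_comp_in[OF X(1) hom_comp_in[OF X(1) g h(1)] f] .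
  have "e (e y) = e y" if "y \<in> carr Y" for y
    unfolding e_def using h(2) hom_in[OF h(1) hom_in[OF g that]] by simp
  then consider "\<forall>y\<in>carr Y. e y = 0" | "\<forall>y\<in>carr Y. e y = y"
    using indecomposable_idempotent[OF Y e] by blast
  then show ?thesis
  proof cases
    case 1
    have "x = 0" if x: "x \<in> carr X" for x
    proof -
      have "e (f x) = f x" unfolding e_def using h(2) x by simp
      then have "f x = 0" using 1 hom_in[OF f x] by simp
      then show ?thesis
        using bspec[OF h(2) x] hom_zero[OF Y(1) g] hom_zero[OF X(1) h(1)] by simp
    qed
    then show ?thesis using X right_module.zero_closed[OF X(1)] by blast
  next
    case 2
    show ?thesis
      by (rule bij_betw_byWitness[where f' = "\<lambda>y. h (g y)"])
        (use 2 h f g in \<open>auto simp: e_def intro!: hom_in[OF h(1)] hom_in[OF g] hom_in[OF f]\<close>)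
  qed
qed

context fd_alg
begin

lemma hom_funpow:
  assumes "right_module M" "f \<in> hom M M" shows "f ^^ Suc n \<in> hom M M"
proof (induction n)
  case (Suc n)
  show ?case unfolding funpow.simps(2)[of "Suc n" f] using hom_comp[OF assms(1) Suc assms(2)] .
qed (use assms in \<open>simp add: comp_def\<close>)

text \<open>For a power \<open>g\<close> of \<open>f\<close> whose image has least dimension,
  \<open>g\<close> maps its image bijectively to itself. So \<open>X\<close> is the sum of image and
  kernel of \<open>g\<close>, and indecomposability leaves only one of them.\<close>

lemma fitting:
  assumes X: "X \<in> mods s" "indecomposable X" and f: "f \<in> hom X X"
  shows "bij_betw f (carr X) (carr X) \<or> (\<exists>n. \<forall>x\<in>carr X. (f ^^ n) x = 0)"
proof -
  have rX: "right_module X" using X by simp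
  \<comment> \<open>Only positive powers: the zeroth power is not zero off the carrier, so in
    general it is not in \<open>hom X X\<close>, and injectivity of a positive power passes to
    \<open>f\<close>.\<close>
  define r where "r = (\<lambda>n. dm (submod X ((f ^^ Suc n) ` carr X)))"
  obtain n where n: "\<And>m. r n \<le> r m"
    using ex_has_least_nat[of "\<lambda>_. True" 0 r] by auto
  define g where "g = f ^^ Suc n"
  have g: "g \<in> hom X X" unfolding g_def using hom_funpow[OF rX f] .
  let ?I = "g ` carr X" and ?K = "ker X g"
  have I: "submodule ?I X" using image_submodule[OF rX rX g submodule_carr[OF rX]] .
  have K: "submodule ?K X" using ker_submodule[OF rX rX g] .
  have gI: "rst ?I g \<in> hom (submod X ?I) X" using hom_rst[OF g I] .
  have gg: "rst ?I g ` ?I = (f ^^ Suc (Suc (n + n))) ` carr X"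
  proof -
    have "rst ?I g ` ?I = (\<lambda>x. g (g x)) ` carr X" by (auto simp: image_image)
    also have "(\<lambda>x. g (g x)) = f ^^ (Suc n + Suc n)" unfolding g_def funpow_add by (simp add: comp_def)
    finally show ?thesis by simp
  qed
  have "dm (submod X ?I) \<le> dm (submod X (rst ?I g ` ?I))"
    using n[of "Suc (n + n)"] unfolding r_def gg[symmetric] g_def[symmetric] .
  then have "dm (submod (submod X ?I) (ker (submod X ?I) (rst ?I g))) = 0"
    using dm_rank[OF submod_mods[OF X(1) I] X(1) gI] by simp
  then have kz: "ker (submod X ?I) (rst ?I g) = {0}"
    using dm_zero_iff[OF submod_mods[OF submod_mods[OF X(1) I]
          ker_submodule[OF submodule_right_module[OF I] rX gI]]] by simp
  have "?I \<inter> ?K \<subseteq> {0}"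
  proof
    fix x assume "x \<in> ?I \<inter> ?K"
    then have "x \<in> ker (submod X ?I) (rst ?I g)" by (simp add: ker_def)
    then show "x \<in> {0}" unfolding kz .
  qed
  moreover have "0 \<in> ?I \<inter> ?K" using submodule_zero[OF I] submodule_zero[OF K] by blast
  ultimately have int: "?I \<inter> ?K = {0}" by blast
  have sub: "rst ?I g ` ?I \<subseteq> ?I" using submodule_in[OF I] by auto
  have im: "submodule (rst ?I g ` ?I) (submod X ?I)"
    using image_submodule[OF submodule_right_module[OF I] rX gI submodule_carr[OF submodule_right_module[OF I]]]
      submodule_submod[OF _ sub] by simp
  have "rst ?I g ` ?I = carr (submod X ?I)"
    by (rule dm_sub_eq[OF submod_mods[OF X(1) I] im])
      (use \<open>dm (submod X ?I) \<le> dm (submod X (rst ?I g ` ?I))\<close> in simp)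
  then have ggI: "g ` ?I = ?I" by (simp add: image_def)
  have "x \<in> {u + v |u v. u \<in> ?I \<and> v \<in> ?K}" if x: "x \<in> carr X" for x
  proof -
    have "g x \<in> g ` ?I" using ggI x by auto
    then obtain y where y: "y \<in> ?I" "g x = g y" by blast
    have yX: "y \<in> carr X" using submodule_in[OF I y(1)] .
    have "x - y \<in> ?K" using y x yX rX g by (simp add: ker_def hom_diff[OF rX g])
    moreover have "x = y + (x - y)" by simp
    ultimately show ?thesis using y by blast
  qed
  moreover have "{u + v |u v. u \<in> ?I \<and> v \<in> ?K} \<subseteq> carr X"
    using rX submodule_in[OF I] submodule_in[OF K] right_module.add_closed[OF rX] by blast
  ultimately have "internal_sum X ?I ?K"
    unfolding internal_sum_def using I K int by blast
  then consider "?I = {0}" | "?K = {0}" using indecomposableD[OF X(2)] by blast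
  then show ?thesis
  proof cases
    case 1
    then have "\<forall>x\<in>carr X. (f ^^ Suc n) x = 0" unfolding g_def by blast
    then show ?thesis by blast
  next
    case 2
    then have ig: "inj_on g (carr X)" using ker_zero_iff[OF rX g] by blast
    have "inj_on f (carr X)"
    proof (rule inj_onI)
      fix x y assume xy: "x \<in> carr X" "y \<in> carr X" "f x = f y"
      then have "g x = g y" unfolding g_def funpow_Suc_right by simp
      then show "x = y" using ig xy unfolding inj_on_def by blast
    qed
    then show ?thesis using inj_surj[OF X(1) X(1) f] by blast
  qed
qed

lemma nilpotent_fixed:
  assumes "\<forall>x\<in>carr X. (f ^^ n) x = 0" "x \<in> carr X" "f x = x" shows "x = 0"
proof -
  have "(f ^^ m) x = x" for m using assms(3) by (induction m) auto
  then show ?thesis using assms by metis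
qed

text \<open>After composition with the inverse \<open>h\<close> of the sum, \<open>f h\<close> and
  \<open>g h\<close> add up to the identity. If \<open>f h\<close> is not bijective, it is nilpotent
  by \<open>fitting\<close>, and then a zero of \<open>g h\<close> would be a fixed point of
  \<open>f h\<close>.\<close>

lemma indecomposable_local:
  assumes X: "X \<in> mods s" "indecomposable X" and f: "f \<in> hom X X" and g: "g \<in> hom X X"
    and fg: "bij_betw (\<lambda>x. f x + g x) (carr X) (carr X)"
  shows "bij_betw f (carr X) (carr X) \<or> bij_betw g (carr X) (carr X)"
proof -
  have rX: "right_module X" using X by simp
  obtain h where h: "h \<in> hom X X" "\<forall>x\<in>carr X. h (f x + g x) = x" "\<forall>x\<in>carr X. f (h x) + g (h x) = x"
    by (rule hom_inverse[OF rX rX hom_plus[OF rX f g] fg])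
  have fh: "(\<lambda>x. f (h x)) \<in> hom X X" using hom_comp_in[OF rX h(1) f] .
  have gh: "(\<lambda>x. g (h x)) \<in> hom X X" using hom_comp_in[OF rX h(1) g] .
  consider "bij_betw (\<lambda>x. f (h x)) (carr X) (carr X)" | n where "\<forall>x\<in>carr X. ((\<lambda>x. f (h x)) ^^ n) x = 0"
    using fitting[OF X fh] by blast
  then show ?thesis
  proof cases
    case 1
    have "f ` carr X = carr X"
    proof
      show "f ` carr X \<subseteq> carr X" using hom_in[OF f] by blast
      have "carr X = f ` h ` carr X" using 1 by (simp add: bij_betw_def image_image)
      also have "\<dots> \<subseteq> f ` carr X" using hom_in[OF h(1)] by (intro image_mono) auto
      finally show "carr X \<subseteq> f ` carr X" .
    qed
    then have "epi X X f" using f epi_def by blast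
    then show ?thesis using epi_inj[OF X(1) X(1)] by blast
  next
    case 2
    have "x = 0" if x: "x \<in> carr X" "g (h x) = 0" for x
      using nilpotent_fixed[OF 2 x(1)] bspec[OF h(3) x(1)] x(2) by simp
    then have "inj_on (\<lambda>x. g (h x)) (carr X)" using inj_on_hom_iff[OF rX gh] by blast
    then have b: "bij_betw (\<lambda>x. g (h x)) (carr X) (carr X)" using inj_surj[OF X(1) X(1) gh] by blast
    have "g ` carr X = carr X"
    proof
      show "g ` carr X \<subseteq> carr X" using hom_in[OF g] by blast
      have "carr X = g ` h ` carr X" using b by (simp add: bij_betw_def image_image)
      also have "\<dots> \<subseteq> g ` carr X" using hom_in[OF h(1)] by (intro image_mono) auto
      finally show "carr X \<subseteq> g ` carr X" .
    qed
    then have "epi X X g" using g epi_def by blast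
    then show ?thesis using epi_inj[OF X(1) X(1)] by blast
  qed
qed

lemma indecomposable_local_sum:
  assumes X: "X \<in> mods s" "indecomposable X" and S: "finite S"
    and f: "\<And>l. l \<in> S \<Longrightarrow> f l \<in> hom X X"
    and b: "bij_betw (\<lambda>x. \<Sum>l\<in>S. f l x) (carr X) (carr X)"
  shows "\<exists>l\<in>S. bij_betw (f l) (carr X) (carr X)"
  using S f b
proof (induction S rule: finite_induct)
  case empty
  then have "carr X \<subseteq> {0}" unfolding bij_betw_def by auto
  then show ?case using indecomposable_nz[OF X(2)] X(1)
    by (metis mods_rmod right_module.zero_closed subset_singletonD empty_iff)
next
  case (insert l S)
  have g: "(\<lambda>x. \<Sum>l\<in>S. f l x) \<in> hom X X" using insert X by (intro hom_sum_fun) auto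
  have "(\<lambda>x. \<Sum>l\<in>insert l S. f l x) = (\<lambda>x. f l x + (\<Sum>l\<in>S. f l x))"
    by (rule ext) (rule sum.insert[OF insert(1,2)])
  then have "bij_betw (\<lambda>x. f l x + (\<Sum>l\<in>S. f l x)) (carr X) (carr X)"
    using insert.prems(2) by (simp only:)
  then show ?case
    using indecomposable_local[OF X _ g, of "f l"] insert by blast
qed

text \<open>The identity of \<open>X\<close> is the sum of its passages through the summands
  \<open>Ys ! l\<close>. By locality one of them is bijective, which makes \<open>X\<close> a
  nonzero retract of an indecomposable module.\<close>

lemma krull_schmidt:
  assumes X: "X \<in> mods s" "indecomposable X" and M: "right_module M" and b: "biprod M Ys i p"
    and Ys: "\<forall>Y\<in>set Ys. Y \<in> mods s \<and> indecomposable Y" and r: "retract X M"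
  shows "\<exists>Y\<in>set Ys. iso_mod X Y"
proof -
  have rX: "right_module X" using X by simp
  obtain j q where jq: "j \<in> hom X M" "q \<in> hom M X" "\<forall>x\<in>carr X. q (j x) = x"
    using r by (rule retractE)
  have Y: "Ys ! l \<in> mods s" "indecomposable (Ys ! l)" "right_module (Ys ! l)" if "l < length Ys" for l
    using Ys that by auto
  have a: "(\<lambda>x. p l (j x)) \<in> hom X (Ys ! l)" if "l < length Ys" for l
    using hom_comp_in[OF M jq(1) biprodD(2)[OF b that]] .
  have c: "(\<lambda>x. q (i l x)) \<in> hom (Ys ! l) X" if "l < length Ys" for l
    using hom_comp_in[OF M biprodD(1)[OF b that] jq(2)] .
  have f: "(\<lambda>x. q (i l (p l (j x)))) \<in> hom X X" if "l < length Ys" for l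
    using hom_comp_in[OF Y(3)[OF that] a[OF that] c[OF that]] .
  have sum: "(\<Sum>l<length Ys. q (i l (p l (j x)))) = x" if x: "x \<in> carr X" for x
  proof -
    have "j x \<in> carr M" using hom_in[OF jq(1) x] .
    then have "q (j x) = q (\<Sum>l<length Ys. i l (p l (j x)))" using biprodD(4)[OF b] by simp
    also have "\<dots> = (\<Sum>l<length Ys. q (i l (p l (j x))))"
      by (rule hom_sum[OF M jq(2)])
        (use \<open>j x \<in> carr M\<close> in \<open>auto intro!: hom_in[OF biprodD(1)[OF b]] hom_in[OF biprodD(2)[OF b]]\<close>)
    finally show ?thesis using jq(3) x by simp
  qed
  have "bij_betw (\<lambda>x. \<Sum>l\<in>{..<length Ys}. q (i l (p l (j x)))) (carr X) (carr X)"
    by (rule bij_betw_byWitness[where f' = "\<lambda>x. x"]) (auto simp: sum)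
  then obtain l where l: "l < length Ys" "bij_betw (\<lambda>x. q (i l (p l (j x)))) (carr X) (carr X)"
    using indecomposable_local_sum[OF X, of "{..<length Ys}" "\<lambda>l x. q (i l (p l (j x)))"] f by auto
  have "bij_betw (\<lambda>x. p l (j x)) (carr X) (carr (Ys ! l))"
    using split_mono_indecomposable[OF rX indecomposable_nz[OF X(2)] Y(3,2) a c] l by simp
  then have "iso_mod X (Ys ! l)" using a[OF l(1)] iso_mod_def by blast
  then show ?thesis using l(1) by auto
qed

lemma decomposition:
  assumes "M \<in> mods s"
  shows "\<exists>Xs i p. (\<forall>X\<in>set Xs. X \<in> mods s \<and> indecomposable X) \<and> biprod M Xs i p"
  using assms
proof (induction "dm M" arbitrary: M rule: less_induct)
  case less
  have rM: "right_module M" using less by simp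
  show ?case
  proof (cases "carr M = {0}")
    case True
    then have "biprod M [] (\<lambda>_ _. 0) (\<lambda>_ _. 0)" unfolding biprod_def by simp
    then show ?thesis by (intro exI[of _ "[]"]) auto
  next
    case nz: False
    show ?thesis
    proof (cases "indecomposable M")
      case True
      have "biprod M [M] (\<lambda>_. idm M) (\<lambda>_. idm M)" unfolding biprod_def using rM by simp
      then show ?thesis using True less by (intro exI[of _ "[M]"]) auto
    next
      case False
      then obtain U V where UV: "internal_sum M U V" "U \<noteq> {0}" "V \<noteq> {0}"
        using nz unfolding indecomposable_def by blast
      have U: "submodule U M" and V: "submodule V M" and int: "U \<inter> V = {0}"
        using UV(1) unfolding internal_sum_def by auto
      have "U \<noteq> carr M" using int UV submodule_subset[OF V] by blast
      then have "dm (submod M U) < dm M" using dm_sub_less[OF less(2) U] by blast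
      then obtain Xs i p where 1: "\<forall>X\<in>set Xs. X \<in> mods s \<and> indecomposable X" "biprod (submod M U) Xs i p"
        using less(1)[of "submod M U"] submod_mods[OF less(2) U] by blast
      have "V \<noteq> carr M" using int UV submodule_subset[OF U] by blast
      then have "dm (submod M V) < dm M" using dm_sub_less[OF less(2) V] by blast
      then obtain Ys j q where 2: "\<forall>X\<in>set Ys. X \<in> mods s \<and> indecomposable X" "biprod (submod M V) Ys j q"
        using less(1)[of "submod M V"] submod_mods[OF less(2) V] by blast
      have "\<exists>i p. biprod M (Xs @ Ys) i p"
        by (rule biprod_append[OF rM UV(1) 1(2) 2(2)]) (use 1 2 in auto)
      then show ?thesis using 1(1) 2(1) by (intro exI[of _ "Xs @ Ys"]) auto
    qed
  qed
qed

section \<open>Isomorphism classes, numbers of summands and basic modules\<close>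

lemma iso_class_self: "X \<in> mods s \<Longrightarrow> X \<in> iso_class s X"
  unfolding iso_class_def by (simp add: iso_mod_refl)

lemma iso_class_eq_iff:
  assumes "X \<in> mods s" "Y \<in> mods s"
  shows "iso_class s X = iso_class s Y \<longleftrightarrow> iso_mod X Y"
proof
  assume "iso_class s X = iso_class s Y"
  then have "Y \<in> iso_class s X" using iso_class_self[OF assms(2)] by simp
  then show "iso_mod X Y" unfolding iso_class_def by blast
next
  assume a: "iso_mod X Y"
  have b: "iso_mod Y X" using iso_mod_sym[OF a] assms by simp
  have "iso_mod X Z \<longleftrightarrow> iso_mod Y Z" for Z :: "('a, nat \<Rightarrow> 'k) rmod"
    using iso_mod_trans[OF a, of Z] iso_mod_trans[OF b, of Z] assms by auto
  then show "iso_class s X = iso_class s Y" unfolding iso_class_def by simp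
qed

lemma num_summands_biprod:
  assumes M: "right_module M" and b: "biprod M Ys i p"
    and Ys: "\<forall>Y\<in>set Ys. Y \<in> mods s \<and> indecomposable Y"
  shows "num_summands s M = card (iso_class s ` set Ys)"
proof -
  have "{iso_class s X | X. X \<in> mods s \<and> indecomposable X \<and> is_summand X M} = iso_class s ` set Ys"
  proof (intro equalityI subsetI)
    fix c assume "c \<in> {iso_class s X | X. X \<in> mods s \<and> indecomposable X \<and> is_summand X M}"
    then obtain X where X: "c = iso_class s X" "X \<in> mods s" "indecomposable X" "is_summand X M" by blast
    have "retract X M" using X is_summand_iff[OF mods_rmod[OF X(2)] M] by blast
    then obtain Y where Y: "Y \<in> set Ys" "iso_mod X Y" using krull_schmidt[OF X(2,3) M b Ys] by blast
    then have "c = iso_class s Y" using iso_class_eq_iff[of X Y] X Ys by auto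
    then show "c \<in> iso_class s ` set Ys" using Y by blast
  next
    fix c assume "c \<in> iso_class s ` set Ys"
    then obtain Y where Y: "Y \<in> set Ys" "c = iso_class s Y" by blast
    then obtain j where j: "j < length Ys" "Ys ! j = Y" unfolding in_set_conv_nth by blast
    have "retract Y M" using biprod_retract[OF b j(1)] j(2) by simp
    then have "is_summand Y M" using is_summand_iff[OF _ M, of Y] Ys Y by auto
    then show "c \<in> {iso_class s X | X. X \<in> mods s \<and> indecomposable X \<and> is_summand X M}"
      using Y Ys by blast
  qed
  then show ?thesis unfolding num_summands_def by simp
qed

lemma num_summands_iso:
  assumes "M \<in> mods s" "right_module N" "iso_mod M N" shows "num_summands s M = num_summands s N"
proof -
  have rM: "right_module M" using assms by simp
  obtain Xs i p where X: "\<forall>X\<in>set Xs. X \<in> mods s \<and> indecomposable X" "biprod M Xs i p"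
    using decomposition[OF assms(1)] by blast
  obtain f g where fg: "f \<in> hom M N" "g \<in> hom N M" "\<forall>x\<in>carr M. g (f x) = x" "\<forall>y\<in>carr N. f (g y) = y"
    by (rule iso_modE[OF assms(3) rM assms(2)])
  have "biprod N Xs (\<lambda>j x. f (i j x)) (\<lambda>j y. p j (g y))"
    by (rule biprod_iso[OF X(2) fg(1,2)]) (use fg rM in auto)
  then show ?thesis
    using num_summands_biprod[OF rM X(2,1)] num_summands_biprod[OF assms(2) _ X(1)] by simp
qed

lemma dm_biprod:
  assumes "M \<in> mods s" "set Xs \<subseteq> mods s" "biprod M Xs i p"
  shows "dm M = (\<Sum>j<length Xs. dm (Xs ! j))"
  using assms
proof (induction Xs arbitrary: M i p)
  case Nil
  have "x = 0" if "x \<in> carr M" for x using biprodD(4)[OF Nil(3) that] by simp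
  moreover have "0 \<in> carr M" using Nil by simp
  ultimately have "carr M = {0}" by blast
  then show ?case using dm_zero_iff[OF Nil(1)] by simp
next
  case (Cons X Xs)
  have r: "right_module M" "right_module X" "\<And>Y. Y \<in> set Xs \<Longrightarrow> right_module Y" using Cons by auto
  note C = biprod_Cons_ker[OF r(1) Cons(4) r(2,3)]
  have K: "submodule (ker M (p 0)) M" using ker_submodule[OF r(1,2) epi_hom[OF C(1)]] .
  have "dm (submod M (ker M (p 0))) = (\<Sum>j<length Xs. dm (Xs ! j))"
    using Cons(1)[OF submod_mods[OF Cons(2) K] _ C(2)] Cons(3) by simp
  moreover have "dm M = dm (submod M (ker M (p 0))) + dm X"
    using dm_epi[OF Cons(2) _ C(1)] Cons(3) by simp
  ultimately show ?case unfolding length_Cons sum.lessThan_Suc_shift by simp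
qed

definition pairwise_noniso :: "('a, nat \<Rightarrow> 'k) rmod list \<Rightarrow> bool" where
  "pairwise_noniso Xs \<longleftrightarrow>
    (\<forall>i<length Xs. \<forall>j<length Xs. i \<noteq> j \<longrightarrow> \<not> iso_mod (Xs ! i) (Xs ! j))"

text \<open>\<open>basic\<close> speaks of all decompositions, while constructions supply one.
  Krull-Schmidt matches each \<open>Ys ! m\<close> with some \<open>Xs ! h m\<close>;
  \<open>h\<close> is injective as the \<open>Ys\<close> are pairwise non-isomorphic, and a
  dimension count replaces the exchange argument for surjectivity.\<close>

lemma basic_biprod:
  assumes M: "M \<in> mods s" and b: "biprod M Ys i p"
    and Ys: "\<forall>Y\<in>set Ys. Y \<in> mods s \<and> indecomposable Y"
  shows "basic s M \<longleftrightarrow> pairwise_noniso Ys"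
proof
  have rM: "right_module M" using M by simp
  assume "basic s M"
  moreover have "iso_mod M (dsum Ys)" using iso_dsum_iff[OF rM, of Ys] b Ys by auto
  ultimately show "pairwise_noniso Ys"
    unfolding basic_def pairwise_noniso_def using Ys by blast
next
  have rM: "right_module M" using M by simp
  assume pn: "pairwise_noniso Ys"
  show "basic s M" unfolding basic_def
  proof (intro allI impI)
    fix Xs k l
    assume a: "(\<forall>X\<in>set Xs. X \<in> mods s \<and> indecomposable X) \<and> iso_mod M (dsum Xs)"
      and k: "k < length Xs" and l: "l < length Xs" and kl: "k \<noteq> l"
    then have Xs: "\<forall>X\<in>set Xs. X \<in> mods s \<and> indecomposable X" by blast
    then obtain j q where c: "biprod M Xs j q" using iso_dsum_iff[OF rM, of Xs] a by auto
    have "\<exists>n<length Xs. iso_mod (Ys ! m) (Xs ! n)" if m: "m < length Ys" for m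
    proof -
      have "\<exists>Y\<in>set Xs. iso_mod (Ys ! m) Y"
        using krull_schmidt[OF _ _ rM c Xs biprod_retract[OF b m]] Ys m by auto
      then show ?thesis by (metis in_set_conv_nth)
    qed
    then obtain h where h: "\<And>m. m < length Ys \<Longrightarrow> h m < length Xs \<and> iso_mod (Ys ! m) (Xs ! h m)"
      by metis
    have mY: "Ys ! m \<in> mods s" if "m < length Ys" for m using Ys that by auto
    have mX: "Xs ! m \<in> mods s" if "m < length Xs" for m using Xs that by auto
    have iso: "iso_mod (Ys ! m) (Ys ! n)"
      if "m < length Ys" "n < length Ys" "iso_mod (Xs ! h m) (Xs ! h n)" for m n
    proof -
      have "iso_mod (Xs ! h n) (Ys ! n)"
        using iso_mod_sym[of "Ys ! n" "Xs ! h n"] h[OF that(2)] mY[OF that(2)] mX by auto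
      then have "iso_mod (Xs ! h m) (Ys ! n)"
        using iso_mod_trans[OF that(3), of "Ys ! n"] mX h[OF that(2)] by auto
      then show ?thesis
        using iso_mod_trans[of "Ys ! m" "Xs ! h m" "Ys ! n"] h[OF that(1)] mX by auto
    qed
    have "inj_on h {..<length Ys}"
    proof (rule inj_onI)
      fix m n assume mn: "m \<in> {..<length Ys}" "n \<in> {..<length Ys}" "h m = h n"
      have "iso_mod (Xs ! h m) (Xs ! h n)"
        using mn h mX by (auto intro!: iso_mod_refl mods_rmod)
      then have "iso_mod (Ys ! m) (Ys ! n)" using iso mn by auto
      then show "m = n" using pn mn unfolding pairwise_noniso_def by auto
    qed
    then have "(\<Sum>n\<in>h ` {..<length Ys}. dm (Xs ! n)) = (\<Sum>m<length Ys. dm (Xs ! h m))"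
      by (simp add: sum.reindex)
    also have "\<dots> = (\<Sum>m<length Ys. dm (Ys ! m))"
    proof (rule sum.cong[OF refl])
      fix m assume "m \<in> {..<length Ys}"
      then have m: "m < length Ys" by simp
      then show "dm (Xs ! h m) = dm (Ys ! m)" using dm_iso[OF mY[OF m] mX] h[OF m] by auto
    qed
    also have "\<dots> = dm M" by (rule dm_biprod[OF M _ b, symmetric]) (use Ys in blast)
    also have "\<dots> = (\<Sum>n<length Xs. dm (Xs ! n))" by (rule dm_biprod[OF M _ c]) (use Xs in blast)
    finally have sums: "(\<Sum>n\<in>h ` {..<length Ys}. dm (Xs ! n)) = (\<Sum>n<length Xs. dm (Xs ! n))" .
    have sub: "h ` {..<length Ys} \<subseteq> {..<length Xs}" using h by auto
    \<comment> \<open>A summand missed by \<open>h\<close> would have dimension 0, because the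
      matched ones already exhaust the dimension of \<open>M\<close>.\<close>
    have "n \<in> h ` {..<length Ys}" if n: "n < length Xs" for n
    proof (rule ccontr)
      assume out: "n \<notin> h ` {..<length Ys}"
      have "(\<Sum>n\<in>h ` {..<length Ys}. dm (Xs ! n)) + dm (Xs ! n)
          = (\<Sum>n\<in>insert n (h ` {..<length Ys}). dm (Xs ! n))" using out by simp
      also have "\<dots> \<le> (\<Sum>n<length Xs. dm (Xs ! n))"
        by (rule sum_mono2) (use sub n in auto)
      finally have "dm (Xs ! n) = 0" using sums by simp
      then show False
        using dm_zero_iff[OF mX[OF n]] indecomposable_nz[of "Xs ! n"] Xs n by auto
    qed
    then obtain k' l' where kl': "k' < length Ys" "l' < length Ys" "h k' = k" "h l' = l"
      using k l by blast
    show "\<not> iso_mod (Xs ! k) (Xs ! l)"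
    proof
      assume "iso_mod (Xs ! k) (Xs ! l)"
      then have "iso_mod (Ys ! k') (Ys ! l')" using iso kl' by blast
      then show False using pn kl kl' unfolding pairwise_noniso_def by blast
    qed
  qed
qed

lemma card_iso_classes:
  assumes "set Xs \<subseteq> mods s" "pairwise_noniso Xs" shows "card (iso_class s ` set Xs) = length Xs"
proof -
  have "inj_on (\<lambda>i. iso_class s (Xs ! i)) {..<length Xs}"
  proof (rule inj_onI)
    fix i j assume ij: "i \<in> {..<length Xs}" "j \<in> {..<length Xs}" "iso_class s (Xs ! i) = iso_class s (Xs ! j)"
    moreover have "Xs ! i \<in> mods s" "Xs ! j \<in> mods s" using assms(1) ij by auto
    ultimately have "iso_mod (Xs ! i) (Xs ! j)" using iso_class_eq_iff by blast
    then show "i = j" using assms(2) ij unfolding pairwise_noniso_def by auto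
  qed
  then have "card ((\<lambda>i. iso_class s (Xs ! i)) ` {..<length Xs}) = length Xs"
    using card_image by fastforce
  moreover have "(\<lambda>i. iso_class s (Xs ! i)) ` {..<length Xs} = iso_class s ` set Xs"
    unfolding set_conv_nth by blast
  ultimately show ?thesis by simp
qed

end

section \<open>Projective modules\<close>

text \<open>The field as a vector space over itself, for linear forms on Hom spaces.\<close>

global_interpretation K: vspace "(*) :: 'k::field \<Rightarrow> 'k \<Rightarrow> 'k"
  by unfold_locales (auto simp: algebra_simps)

global_interpretation HK: vspace_pair hscale "(*)" ..

context fd_alg
begin

lemma direct_sum2:
  assumes M: "M \<in> mods s" and N: "N \<in> mods s"
  obtains D i j p q where "D \<in> mods s" "i \<in> hom M D" "j \<in> hom N D" "p \<in> hom D M" "q \<in> hom D N"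
    "\<forall>x\<in>carr M. p (i x) = x \<and> q (i x) = 0" "\<forall>y\<in>carr N. p (j y) = 0 \<and> q (j y) = y"
    "\<forall>d\<in>carr D. d = i (p d) + j (q d)" "biprod D [M, N] (\<lambda>n. if n = 0 then i else j) (\<lambda>n. if n = 0 then p else q)"
proof -
  have "set [M, N] \<subseteq> mods s" using assms by simp
  then obtain D i p where D: "D \<in> mods s" and b: "biprod D [M, N] i p" by (rule direct_sum)
  have e: "d = i 0 (p 0 d) + i 1 (p 1 d)" if "d \<in> carr D" for d
    using biprodD(4)[OF b that] by (simp add: lessThan_Suc add.commute)
  have b': "biprod D [M, N] (\<lambda>n. if n = 0 then i 0 else i 1) (\<lambda>n. if n = 0 then p 0 else p 1)"
    using b unfolding biprod_def by (auto simp: less_Suc_eq lessThan_Suc add.commute)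
  show thesis
    by (rule that[OF D _ _ _ _ _ _ _ b'])
      (use biprodD(1,2)[OF b, of 0] biprodD(1,2)[OF b, of 1] biprodD(3)[OF b, of 0 0]
        biprodD(3)[OF b, of 1 1] biprodD(3)[OF b, of 0 1] biprodD(3)[OF b, of 1 0] e in auto)
qed

lemma projective_lift:
  assumes "projective s P" "X \<in> mods s" "Y \<in> mods s" "epi X Y g" "f \<in> hom P Y"
  obtains h where "h \<in> hom P X" "\<forall>x. g (h x) = f x"
proof -
  obtain h where "h \<in> hom P X" "g \<circ> h = f" using assms unfolding projective_def by blast
  then show thesis using that by (metis comp_apply)
qed

lemma projectiveI:
  assumes "\<And>X Y g f. X \<in> mods s \<Longrightarrow> Y \<in> mods s \<Longrightarrow> epi X Y g \<Longrightarrow> f \<in> hom P Y \<Longrightarrow>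
    \<exists>h\<in>hom P X. \<forall>x\<in>carr P. g (h x) = f x"
  shows "projective s P"
  unfolding projective_def
proof (intro ballI allI impI)
  fix X Y g f assume XY: "X \<in> mods s" "Y \<in> mods s" and gf: "epi X Y g \<and> f \<in> hom P Y"
  then obtain h where h: "h \<in> hom P X" "\<forall>x\<in>carr P. g (h x) = f x" using assms by blast
  have "g \<circ> h = f"
    by (rule hom_eqI[OF hom_comp[OF mods_rmod[OF XY(1)] h(1) epi_hom]]) (use gf h in auto)
  then show "\<exists>h\<in>hom P X. g \<circ> h = f" using h by blast
qed

lemma projsD: "P \<in> projs s \<Longrightarrow> P \<in> mods s" "P \<in> projs s \<Longrightarrow> projective s P"
  unfolding projs_def by auto

lemma projective_retract:
  assumes Q: "right_module Q" and P: "right_module P" and r: "retract Q P" and p: "projective s P"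
  shows "projective s Q"
proof (rule projectiveI)
  obtain i q where iq: "i \<in> hom Q P" "q \<in> hom P Q" "\<forall>x\<in>carr Q. q (i x) = x" using r by (rule retractE)
  fix X Y g f assume a: "X \<in> mods s" "Y \<in> mods s" "epi X Y g" "f \<in> hom Q Y"
  obtain h where h: "h \<in> hom P X" "\<forall>x. g (h x) = f (q x)"
    by (rule projective_lift[OF p a(1-3) hom_comp_in[OF Q iq(2) a(4)]])
  show "\<exists>h\<in>hom Q X. \<forall>x\<in>carr Q. g (h x) = f x"
    by (rule bexI[of _ "\<lambda>x. h (i x)"]) (use h iq hom_comp_in[OF P iq(1) h(1)] in auto)
qed

lemma projective_biprod:
  assumes P: "right_module P" and b: "biprod P Xs i p"
    and Xs: "\<And>X. X \<in> set Xs \<Longrightarrow> right_module X \<and> projective s X"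
  shows "projective s P"
proof (rule projectiveI)
  fix X Y g f assume a: "X \<in> mods s" "Y \<in> mods s" "epi X Y g" "f \<in> hom P Y"
  have rX: "right_module X" using a by simp
  have "\<exists>h. h \<in> hom (Xs ! l) X \<and> (\<forall>x. g (h x) = f (i l x))" if l: "l < length Xs" for l
  proof -
    have "projective s (Xs ! l)" using Xs l by simp
    then show ?thesis
      by (rule projective_lift[OF _ a(1-3) hom_comp_in[OF P biprodD(1)[OF b l] a(4)]]) auto
  qed
  then obtain h where h: "\<And>l. l < length Xs \<Longrightarrow> h l \<in> hom (Xs ! l) X \<and> (\<forall>x. g (h l x) = f (i l x))"
    by metis
  have hp: "(\<lambda>x. h l (p l x)) \<in> hom P X" if "l < length Xs" for l
    using hom_comp_in[OF _ biprodD(2)[OF b that] conjunct1[OF h[OF that]]] Xs that by simp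
  then have k: "(\<lambda>x. \<Sum>l<length Xs. h l (p l x)) \<in> hom P X" by (intro hom_sum_fun[OF rX]) simp
  have "g (\<Sum>l<length Xs. h l (p l x)) = f x" if x: "x \<in> carr P" for x
  proof -
    have "g (\<Sum>l<length Xs. h l (p l x)) = (\<Sum>l<length Xs. g (h l (p l x)))"
      by (rule hom_sum[OF rX epi_hom[OF a(3)]]) (use hom_in[OF hp x] in simp)
    also have "\<dots> = (\<Sum>l<length Xs. f (i l (p l x)))" using h by (intro sum.cong) auto
    also have "\<dots> = f (\<Sum>l<length Xs. i l (p l x))"
      by (rule hom_sum[OF P a(4), symmetric])
        (use x in \<open>auto intro!: hom_in[OF biprodD(1)[OF b]] hom_in[OF biprodD(2)[OF b]]\<close>)
    finally show ?thesis using biprodD(4)[OF b x] by simp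
  qed
  then show "\<exists>h\<in>hom P X. \<forall>x\<in>carr P. g (h x) = f x" using k by (intro bexI[of _ "\<lambda>x. \<Sum>l<length Xs. h l (p l x)"]) auto
qed

section \<open>Free covers and dual bases\<close>

lemma carr_regular [simp]: "carr (regular :: ('b::ring_1, 'b) rmod) = UNIV"
  and act_regular [simp]: "act (regular :: ('b::ring_1, 'b) rmod) = (*)"
  by (simp_all add: regular_def)

lemma hom_from_regular:
  assumes X: "right_module X" and x: "x \<in> carr X"
  shows "act X x \<in> hom (regular :: ('a, 'a) rmod) X"
  by (rule homI) (use assms in \<open>auto simp: right_module.act_add_right[OF X x] right_module.act_mult[OF X x]\<close>)

lemma projective_regular: "projective s (regular :: ('a, 'a) rmod)"
proof (rule projectiveI)
  fix X Y g f assume a: "X \<in> mods s" "Y \<in> mods s" "epi X Y g" "f \<in> hom (regular :: ('a, 'a) rmod) Y"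
  have "f 1 \<in> carr Y" using hom_in[OF a(4)] by simp
  then obtain x where x: "x \<in> carr X" "g x = f 1" using epi_surj[OF a(3)] by blast
  have "g (act X x b) = f b" for b
    using hom_act[OF epi_hom[OF a(3)] x(1), of b] x(2) hom_act[OF a(4), of 1 b] by simp
  then show "\<exists>h\<in>hom regular X. \<forall>x\<in>carr regular. g (h x) = f x"
    using hom_from_regular[OF mods_rmod[OF a(1)] x(1)] by blast
qed

text \<open>Besides the cover itself, the coordinate maps \<open>c j\<close> to the regular module
  are recorded: they become dual bases of projectives, and their joint injectivity embeds submodules
  of projectives into powers of the regular module.\<close>

lemma free_cover:
  assumes M: "M \<in> mods s"
  obtains r :: nat and F e b c where "F \<in> projs s" "epi F M e" "\<forall>j<r. b j \<in> carr M"
    "\<forall>j<r. c j \<in> hom F (regular :: ('a, 'a) rmod)"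
    "\<forall>y\<in>carr F. e y = (\<Sum>j<r. act M (b j) (c j y))"
    "\<forall>y\<in>carr F. (\<forall>j<r. c j y = 0) \<longrightarrow> y = 0"
proof -
  have rM: "right_module M" using M by simp
  obtain G where G: "finite G" "G \<subseteq> carr M" "\<forall>U. submodule U M \<and> G \<subseteq> U \<longrightarrow> U = carr M"
    using M unfolding mods_def fin_gen_def by auto
  obtain gs where gs: "set gs = G" using finite_list[OF G(1)] by blast
  obtain L where L: "L \<in> mods s" "iso_mod (regular :: ('a, 'a) rmod) L" by (rule regular_in_mods)
  have rL: "right_module L" using L by simp
  obtain u t where ut: "u \<in> hom regular L" "t \<in> hom L (regular :: ('a, 'a) rmod)"
    "\<forall>x\<in>carr (regular :: ('a, 'a) rmod). t (u x) = x" "\<forall>y\<in>carr L. u (t y) = y"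
    by (rule iso_modE[OF L(2) right_module_regular rL])
  have pL: "projective s L"
    using projective_retract[OF rL right_module_regular iso_retract projective_regular]
      iso_mod_sym[OF L(2) right_module_regular rL] rL right_module_regular by blast
  let ?r = "length gs"
  have "set (replicate ?r L) \<subseteq> mods s" using L by auto
  then obtain F i p where F: "F \<in> mods s" and b: "biprod F (replicate ?r L) i p" by (rule direct_sum)
  have rF: "right_module F" using F by simp
  have "projective s F" by (rule projective_biprod[OF rF b]) (use pL rL in \<open>auto simp: set_replicate_conv_if split: if_splits\<close>)
  then have FP: "F \<in> projs s" using F by (simp add: projs_def)
  define c where "c = (\<lambda>j y. t (p j y))"
  define e where "e = (\<lambda>y. \<Sum>j<?r. act M (gs ! j) (c j y))"
  have p: "p j \<in> hom F L" and i: "i j \<in> hom L F" if "j < ?r" for j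
    using biprodD(1)[OF b, of j] biprodD(2)[OF b, of j] that by auto
  have c: "c j \<in> hom F regular" if "j < ?r" for j
    unfolding c_def by (rule hom_comp_in[OF rL p[OF that] ut(2)])
  have gM: "gs ! j \<in> carr M" if "j < ?r" for j using that gs G by auto
  have eh: "e \<in> hom F M"
    unfolding e_def
    by (rule hom_sum_fun[OF rM])
      (use hom_comp_in[OF right_module_regular c hom_from_regular[OF rM gM]] in simp)
  have im: "submodule (e ` carr F) M" using image_submodule[OF rF rM eh submodule_carr[OF rF]] .
  have "g \<in> e ` carr F" if g: "g \<in> G" for g
  proof -
    obtain j where j: "j < ?r" "gs ! j = g" using g unfolding gs[symmetric] in_set_conv_nth by blast
    let ?y = "i j (u 1)"
    have u1: "u 1 \<in> carr L" using hom_in[OF ut(1)] by simp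
    have "c l ?y = (if l = j then 1 else 0)" if "l < ?r" for l
      using biprodD(3)[OF b, of j l "u 1"] that j u1 ut(3) hom_zero[OF rL ut(2)] by (simp add: c_def)
    then have "e ?y = (\<Sum>l<?r. if l = j then act M (gs ! l) 1 else 0)"
      unfolding e_def using gM rM by (intro sum.cong) auto
    also have "\<dots> = g" using j gM[OF j(1)] right_module.act_one[OF rM] by simp
    finally show ?thesis using hom_in[OF i[OF j(1)] u1] by (metis imageI)
  qed
  then have "e ` carr F = carr M" using G(3) im by blast
  then have "epi F M e" using eh epi_def by blast
  moreover have "y = 0" if y: "y \<in> carr F" "\<forall>j<?r. c j y = 0" for y
  proof -
    have "p j y = 0" if j: "j < ?r" for j
      using bspec[OF ut(4) hom_in[OF p[OF j] y(1)]] y(2) j hom_zero[OF right_module_regular ut(1)]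
      by (simp add: c_def)
    then have "(\<Sum>j<length (replicate ?r L). i j (p j y)) = 0"
      using hom_zero[OF rL i] by (intro sum.neutral) simp
    then show ?thesis using biprodD(4)[OF b y(1)] by simp
  qed
  ultimately show thesis
    using that[of F e ?r "\<lambda>j. gs ! j" c] FP gM c e_def by blast
qed

lemma cover:
  assumes "M \<in> mods s" obtains F e where "F \<in> projs s" "epi F M e"
  using free_cover[OF assms] by metis

text \<open>The coordinates of a free cover, pulled back along a splitting \<open>h\<close> of
  it.\<close>

lemma dual_basis:
  assumes P: "P \<in> projs s"
  obtains r :: nat and b c where "\<forall>j<r. b j \<in> carr P" "\<forall>j<r. c j \<in> hom P (regular :: ('a, 'a) rmod)"
    "\<forall>x\<in>carr P. x = (\<Sum>j<r. act P (b j) (c j x))" "\<forall>x\<in>carr P. (\<forall>j<r. c j x = 0) \<longrightarrow> x = 0"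
proof -
  have rP: "right_module P" using projsD[OF P] by simp
  obtain r :: nat and F e b c where F: "F \<in> projs s" "epi F P e" "\<forall>j<r. b j \<in> carr P"
    "\<forall>j<r. c j \<in> hom F (regular :: ('a, 'a) rmod)"
    "\<forall>y\<in>carr F. e y = (\<Sum>j<r. act P (b j) (c j y))"
    "\<forall>y\<in>carr F. (\<forall>j<r. c j y = 0) \<longrightarrow> y = 0"
    by (rule free_cover[OF projsD(1)[OF P]])
  have rF: "right_module F" using projsD[OF F(1)] by simp
  obtain h where h: "h \<in> hom P F" "\<forall>x. e (h x) = idm P x"
    by (rule projective_lift[OF projsD(2)[OF P] projsD(1)[OF F(1)] projsD(1)[OF P] F(2) hom_idm[OF rP]])
  have 1: "\<forall>j<r. (\<lambda>x. c j (h x)) \<in> hom P regular" using F(4) hom_comp_in[OF rF h(1)] by blast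
  have 2: "\<forall>x\<in>carr P. x = (\<Sum>j<r. act P (b j) (c j (h x)))"
  proof
    fix x assume x: "x \<in> carr P"
    have "x = e (h x)" using h(2) x by simp
    then show "x = (\<Sum>j<r. act P (b j) (c j (h x)))" using F(5) hom_in[OF h(1) x] by simp
  qed
  have 3: "\<forall>x\<in>carr P. (\<forall>j<r. c j (h x) = 0) \<longrightarrow> x = 0"
  proof (intro ballI impI)
    fix x assume x: "x \<in> carr P" "\<forall>j<r. c j (h x) = 0"
    then have "h x = 0" using F(6) hom_in[OF h(1) x(1)] by blast
    then have "e (h x) = 0" using hom_zero[OF rF epi_hom[OF F(2)]] by simp
    then show "x = 0" using h(2) x by simp
  qed
  show thesis using that[OF F(3) 1 2 3] .
qed

text \<open>Projectivity of \<open>Q\<close> splits \<open>q\<close> by a section \<open>t\<close>,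
  so a map on \<open>M\<close> can be lifted separately on the parts \<open>x - t (q x)\<close> and
  \<open>q x\<close>.\<close>

lemma projective_extension:
  assumes M: "M \<in> mods s" and Q: "Q \<in> mods s" and q: "epi M Q q"
    and K: "projective s (submod M (ker M q))" and pQ: "projective s Q"
  shows "projective s M"
proof (rule projectiveI)
  have rM: "right_module M" and rQ: "right_module Q" using M Q by auto
  have qh: "q \<in> hom M Q" using epi_hom[OF q] .
  have sK: "submodule (ker M q) M" using ker_submodule[OF rM rQ qh] .
  obtain t where t: "t \<in> hom Q M" "\<forall>x. q (t x) = idm Q x"
    by (rule projective_lift[OF pQ M Q q hom_idm[OF rQ]])
  fix X Y g f assume a: "X \<in> mods s" "Y \<in> mods s" "epi X Y g" "f \<in> hom M Y"
  have rX: "right_module X" and gh: "g \<in> hom X Y" using a epi_hom by auto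
  obtain h1 where h1: "h1 \<in> hom (submod M (ker M q)) X" "\<forall>x. g (h1 x) = rst (ker M q) f x"
    by (rule projective_lift[OF K a(1-3) hom_rst[OF a(4) sK]])
  obtain h2 where h2: "h2 \<in> hom Q X" "\<forall>x. g (h2 x) = f (t x)"
    by (rule projective_lift[OF pQ a(1-3) hom_comp_in[OF rM t(1) a(4)]])
  have tq: "(\<lambda>x. t (q x)) \<in> hom M M" using hom_comp_in[OF rQ qh t(1)] .
  have inK: "idm M x - t (q x) \<in> ker M q" if x: "x \<in> carr M" for x
    using x hom_diff[OF rM qh, of x "t (q x)"] hom_in[OF tq x] t(2) hom_in[OF qh x] rM
    by (simp add: ker_def)
  have d: "(\<lambda>x. idm M x - t (q x)) \<in> hom M (submod M (ker M q))"
    by (rule hom_corestrict[OF hom_minus[OF rM hom_idm[OF rM] tq] inK])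
  have k: "(\<lambda>x. h1 (idm M x - t (q x)) + h2 (q x)) \<in> hom M X"
    by (rule hom_plus[OF rX hom_comp_in[OF submodule_right_module[OF sK] d h1(1)] hom_comp_in[OF rQ qh h2(1)]])
  have "g (h1 (idm M x - t (q x)) + h2 (q x)) = f x" if x: "x \<in> carr M" for x
  proof -
    have "g (h1 (idm M x - t (q x)) + h2 (q x)) = g (h1 (idm M x - t (q x))) + g (h2 (q x))"
      by (rule hom_add[OF gh]) (use hom_in[OF h1(1)] inK[OF x] hom_in[OF h2(1) hom_in[OF qh x]] in simp_all)
    also have "\<dots> = f (x - t (q x)) + f (t (q x))" using h1(2) h2(2) inK[OF x] x by simp
    also have "\<dots> = f x" using hom_diff[OF rM a(4) x hom_in[OF tq x]] by simp
    finally show ?thesis .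
  qed
  then show "\<exists>h\<in>hom M X. \<forall>x\<in>carr M. g (h x) = f x" using k by (intro bexI) auto
qed

section \<open>Vanishing of extensions\<close>

text \<open>
  Vanishing of \<open>Ext\<^sup>1(M, X)\<close>, in a form that quantifies over all modules onto \<open>M\<close> and so does not
  depend on the choice of a resolution.
\<close>

definition Ext0 :: "('a, nat \<Rightarrow> 'k) rmod \<Rightarrow> ('a, nat \<Rightarrow> 'k) rmod \<Rightarrow> bool" where
  "Ext0 M X \<longleftrightarrow> (\<forall>Z\<in>mods s. \<forall>z. epi Z M z \<longrightarrow>
     (\<forall>f\<in>hom (submod Z (ker Z z)) X. \<exists>h\<in>hom Z X. \<forall>x\<in>ker Z z. h x = f x))"

lemma Ext0D:
  assumes "Ext0 M X" "Z \<in> mods s" "epi Z M z" "f \<in> hom (submod Z (ker Z z)) X"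
  obtains h where "h \<in> hom Z X" "\<forall>x\<in>ker Z z. h x = f x"
  using assms unfolding Ext0_def by blast

lemma epi_ker_submodule: "epi Z M z \<Longrightarrow> Z \<in> mods s \<Longrightarrow> M \<in> mods s \<Longrightarrow> submodule (ker Z z) Z"
  using ker_submodule[OF mods_rmod mods_rmod epi_hom] by blast

text \<open>A projective cover suffices to test all epimorphisms onto \<open>M\<close>. Given
  \<open>z\<close>, lift \<open>e\<close> to \<open>t : P -> Z\<close>; then \<open>Z\<close> is a
  quotient of the sum \<open>D\<close> of \<open>ker Z z\<close> and \<open>P\<close>, and the
  required map is defined on \<open>D\<close> by \<open>f\<close> and \<open>h\<close> and descends
  to \<open>Z\<close>.\<close>

lemma Ext0I:
  assumes M: "M \<in> mods s" and X: "X \<in> mods s" and P: "P \<in> projs s" and e: "epi P M e"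
    and ext: "\<And>f. f \<in> hom (submod P (ker P e)) X \<Longrightarrow> \<exists>h\<in>hom P X. \<forall>x\<in>ker P e. h x = f x"
  shows "Ext0 M X"
  unfolding Ext0_def
proof (intro ballI allI impI)
  fix Z z f assume Z: "Z \<in> mods s" and z: "epi Z M z" and f: "f \<in> hom (submod Z (ker Z z)) X"
  have PM: "P \<in> mods s" using projsD[OF P] by blast
  have rM: "right_module M" and rX: "right_module X" and rZ: "right_module Z" and rP: "right_module P"
    using M X Z PM by auto
  have zh: "z \<in> hom Z M" and eh: "e \<in> hom P M" using z e epi_hom by auto
  let ?K = "ker Z z" and ?O = "ker P e"
  have K: "submodule ?K Z" using epi_ker_submodule[OF z Z M] .
  have O: "submodule ?O P" using epi_ker_submodule[OF e PM M] .
  have rK: "right_module (submod Z ?K)" using submodule_right_module[OF K] .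
  obtain t where t: "t \<in> hom P Z" "\<forall>x. z (t x) = e x"
    by (rule projective_lift[OF projsD(2)[OF P] Z M z eh])
  have "t x \<in> ?K" if "x \<in> ?O" for x
    using that t hom_in[OF t(1)] by (simp add: ker_def)
  then have tO: "rst ?O t \<in> hom (submod P ?O) (submod Z ?K)"
    by (intro hom_corestrict[OF hom_rst[OF t(1) O]]) simp
  obtain h where h: "h \<in> hom P X" "\<forall>x\<in>?O. h x = f (t x)"
    using ext[OF hom_comp_in[OF rK tO f]] by auto
  obtain D i j p q where D: "D \<in> mods s" "i \<in> hom (submod Z ?K) D" "j \<in> hom P D"
    "p \<in> hom D (submod Z ?K)" "q \<in> hom D P"
    "\<forall>x\<in>carr (submod Z ?K). p (i x) = x \<and> q (i x) = 0" "\<forall>y\<in>carr P. p (j y) = 0 \<and> q (j y) = y"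
    "\<forall>d\<in>carr D. d = i (p d) + j (q d)"
    by (rule direct_sum2[OF submod_mods[OF Z K] PM])
  have rD: "right_module D" using D by simp
  have pZ: "p \<in> hom D Z" using hom_submod_ext[OF D(4) submodule_subset[OF K]] .
  define u where "u = (\<lambda>d. p d + t (q d))"
  have uh: "u \<in> hom D Z" unfolding u_def
    by (rule hom_plus[OF rZ pZ hom_comp_in[OF rP D(5) t(1)]])
  have ueq: "u (i k + j x) = k + t x \<and> p (i k + j x) = k \<and> q (i k + j x) = x"
    if kx: "k \<in> ?K" "x \<in> carr P" for k x
  proof -
    have ik: "i k \<in> carr D" and jx: "j x \<in> carr D" using hom_in[OF D(2)] hom_in[OF D(3)] kx by auto
    have "p (i k + j x) = k" using hom_add[OF D(4) ik jx] D(6,7) kx by simp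
    moreover have "q (i k + j x) = x" using hom_add[OF D(5) ik jx] D(6,7) kx by simp
    ultimately show ?thesis unfolding u_def by simp
  qed
  have ijD: "i k + j x \<in> carr D" if "k \<in> ?K" "x \<in> carr P" for k x
    using hom_in[OF D(2)] hom_in[OF D(3)] that rD by auto
  have ue: "epi D Z u"
  proof (rule epiI[OF uh])
    fix y assume y: "y \<in> carr Z"
    obtain x where x: "x \<in> carr P" "e x = z y" using epi_surj[OF e hom_in[OF zh y]] by blast
    have k: "y - t x \<in> ?K"
      using y x t hom_in[OF t(1) x(1)] rZ by (simp add: ker_def hom_diff[OF rZ zh])
    then show "\<exists>d\<in>carr D. u d = y"
      using ueq[OF k x(1)] ijD[OF k x(1)] by (intro bexI[of _ "i (y - t x) + j x"]) simp_all
  qed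
  define v where "v = (\<lambda>d. f (p d) + h (q d))"
  have vh: "v \<in> hom D X" unfolding v_def
    by (rule hom_plus[OF rX hom_comp_in[OF rK D(4) f] hom_comp_in[OF rP D(5) h(1)]])
  \<comment> \<open>If \<open>p d + t (q d) = 0\<close>, then \<open>q d\<close> lies in
    \<open>ker P e\<close>, where \<open>h\<close> is \<open>f\<close> after \<open>t\<close>, so
    the two parts of \<open>v d\<close> cancel.\<close>
  have "v d = 0" if d: "d \<in> carr D" "u d = 0" for d
  proof -
    have pK: "p d \<in> ?K" using hom_in[OF D(4) d(1)] by simp
    have qP: "q d \<in> carr P" using hom_in[OF D(5) d(1)] .
    have tq: "t (q d) = - p d" using d(2) unfolding u_def by (simp add: eq_neg_iff_add_eq_0 add.commute)
    then have "e (q d) = z (- p d)" using t(2) by metis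
    also have "\<dots> = 0"
      using pK submodule_uminus[OF K pK] by (simp add: ker_def)
    finally have "q d \<in> ?O" using qP by (simp add: ker_def)
    then have "h (q d) = f (- p d)" using h(2) tq by simp
    also have "\<dots> = - f (p d)" using hom_uminus[OF rK f] pK by simp
    finally show ?thesis unfolding v_def by simp
  qed
  then obtain g where g: "g \<in> hom Z X" "\<forall>d\<in>carr D. g (u d) = v d"
    using epi_factor[OF rD rX ue vh] by blast
  have "g k = f k" if k: "k \<in> ?K" for k
  proof -
    have z0: "0 \<in> carr P" using rP by simp
    have "u (i k + j 0) = k" "p (i k + j 0) = k" "q (i k + j 0) = 0"
      using ueq[OF k z0] hom_zero[OF rP t(1)] by auto
    then show ?thesis
      using bspec[OF g(2) ijD[OF k z0]] hom_zero[OF rP h(1)] by (simp add: v_def)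
  qed
  then show "\<exists>h\<in>hom Z X. \<forall>x\<in>?K. h x = f x" using g(1) by blast
qed

lemma Ext0_projective:
  assumes P: "P \<in> projs s" and X: "X \<in> mods s" shows "Ext0 P X"
proof -
  have rP: "right_module P" using projsD[OF P] by simp
  have e: "epi P P (idm P)" by (rule epiI) (use rP in auto)
  have k: "ker P (idm P) = {0}" using rP by (auto simp: ker_def)
  show ?thesis
  proof (rule Ext0I[OF projsD(1)[OF P] X P e])
    fix f assume f: "f \<in> hom (submod P (ker P (idm P))) X"
    have "f = 0" using f hom_from_zero[OF mods_rmod[OF X], of "submod P {0}"] unfolding k by simp
    then show "\<exists>h\<in>hom P X. \<forall>x\<in>ker P (idm P). h x = f x"
      using X by (intro bexI[of _ "\<lambda>_. 0"]) auto
  qed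
qed

text \<open>Extension in two stages: from \<open>ker Z z\<close> to the preimage \<open>W\<close> of
  the submodule by \<open>U\<close>, and from \<open>W\<close> to \<open>Z\<close> by
  \<open>EQ\<close>, since \<open>W\<close> is the kernel of the composite onto
  \<open>Q\<close>.\<close>

lemma Ext0_extension_left:
  assumes M: "M \<in> mods s" and Q: "Q \<in> mods s" and X: "X \<in> mods s" and p: "epi M Q p"
    and U: "Ext0 (submod M (ker M p)) X" and EQ: "Ext0 Q X"
  shows "Ext0 M X"
  unfolding Ext0_def
proof (intro ballI allI impI)
  fix Z z f assume Z: "Z \<in> mods s" and z: "epi Z M z" and f: "f \<in> hom (submod Z (ker Z z)) X"
  have rM: "right_module M" and rQ: "right_module Q" and rZ: "right_module Z" using M Q Z by auto
  let ?U = "ker M p"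
  have sU: "submodule ?U M" using epi_ker_submodule[OF p M Q] .
  define W where "W = {x \<in> carr Z. z x \<in> ?U}"
  have sW: "submodule W Z" unfolding W_def using preimage_submodule[OF rZ rM epi_hom[OF z] sU] .
  have ze: "epi (submod Z W) (submod M ?U) (rst W z)"
  proof (rule epiI)
    show "rst W z \<in> hom (submod Z W) (submod M ?U)"
      by (rule hom_corestrict[OF hom_rst[OF epi_hom[OF z] sW]]) (simp add: W_def)
    fix y assume y: "y \<in> carr (submod M ?U)"
    then have "y \<in> carr M" using submodule_in[OF sU] by simp
    then obtain x where "x \<in> carr Z" "z x = y" using epi_surj[OF z] by blast
    then show "\<exists>x\<in>carr (submod Z W). rst W z x = y"
      using y by (intro bexI[of _ x]) (auto simp: W_def)
  qed
  have k1: "ker (submod Z W) (rst W z) = ker Z z"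
    using submodule_zero[OF sU] by (auto simp: ker_def W_def)
  have pz: "epi Z Q (\<lambda>x. p (z x))" using epi_comp[OF rM z p] .
  have k2: "ker Z (\<lambda>x. p (z x)) = W"
    using hom_in[OF epi_hom[OF z]] by (auto simp: ker_def W_def)
  have f': "f \<in> hom (submod (submod Z W) (ker (submod Z W) (rst W z))) X" using f k1 by simp
  obtain g where g: "g \<in> hom (submod Z W) X" "\<forall>x\<in>ker Z z. g x = f x"
    using Ext0D[OF U submod_mods[OF Z sW] ze f'] k1 by auto
  have g': "g \<in> hom (submod Z (ker Z (\<lambda>x. p (z x)))) X" using g(1) k2 by simp
  obtain h where h: "h \<in> hom Z X" "\<forall>x\<in>W. h x = g x"
    using Ext0D[OF EQ Z pz g'] k2 by auto
  have "ker Z z \<subseteq> W" using submodule_zero[OF sU] by (auto simp: ker_def W_def)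
  then have "\<forall>x\<in>ker Z z. h x = f x" using h(2) g(2) by auto
  then show "\<exists>h\<in>hom Z X. \<forall>x\<in>ker Z z. h x = f x" using h(1) by blast
qed

text \<open>First \<open>q f\<close> is extended to \<open>P\<close> and lifted to
  \<open>h' : P -> X\<close>; the difference of \<open>f\<close> and \<open>h'\<close> then takes
  values in \<open>ker X q\<close> and is extended by \<open>K\<close>.\<close>

lemma Ext0_extension_right:
  assumes M: "M \<in> mods s" and Q: "Q \<in> mods s" and X: "X \<in> mods s" and q: "epi X Q q"
    and K: "Ext0 M (submod X (ker X q))" and EQ: "Ext0 M Q"
  shows "Ext0 M X"
proof -
  obtain P e where P: "P \<in> projs s" and e: "epi P M e" by (rule cover[OF M])
  have PM: "P \<in> mods s" using projsD[OF P] by blast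
  have rX: "right_module X" and rP: "right_module P" using X PM by auto
  have sK: "submodule (ker X q) X" using epi_ker_submodule[OF q X Q] .
  have sO: "submodule (ker P e) P" using epi_ker_submodule[OF e PM M] .
  have qh: "q \<in> hom X Q" using epi_hom[OF q] .
  show ?thesis
  proof (rule Ext0I[OF M X P e])
    fix f assume f: "f \<in> hom (submod P (ker P e)) X"
    obtain h where h: "h \<in> hom P Q" "\<forall>x\<in>ker P e. h x = q (f x)"
      by (rule Ext0D[OF EQ PM e hom_comp_in[OF rX f qh]])
    obtain h' where h': "h' \<in> hom P X" "\<forall>x. q (h' x) = h x"
      by (rule projective_lift[OF projsD(2)[OF P] X Q q h(1)])
    have d: "(\<lambda>x. f x - rst (ker P e) h' x) \<in> hom (submod P (ker P e)) (submod X (ker X q))"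
    proof (rule hom_corestrict[OF hom_minus[OF rX f hom_rst[OF h'(1) sO]]])
      fix x assume x: "x \<in> carr (submod P (ker P e))"
      then have "x \<in> carr P" by (simp add: ker_def)
      then show "f x - rst (ker P e) h' x \<in> ker X q"
        using x h h' hom_in[OF f x] hom_in[OF h'(1)] rX by (simp add: ker_def hom_diff[OF rX qh])
    qed
    obtain k where k: "k \<in> hom P (submod X (ker X q))" "\<forall>x\<in>ker P e. k x = f x - rst (ker P e) h' x"
      by (rule Ext0D[OF K PM e d])
    have "(\<lambda>x. h' x + k x) \<in> hom P X"
      by (rule hom_plus[OF rX h'(1) hom_submod_ext[OF k(1) submodule_subset[OF sK]]])
    then show "\<exists>h\<in>hom P X. \<forall>x\<in>ker P e. h x = f x"
      using k(2) by (intro bexI[of _ "\<lambda>x. h' x + k x"]) auto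
  qed
qed

lemma Ext0_retract_right:
  assumes E: "Ext0 M X" and X: "X \<in> mods s" and r: "retract X' X" and X': "X' \<in> mods s"
  shows "Ext0 M X'"
  unfolding Ext0_def
proof (intro ballI allI impI)
  fix Z z f assume Z: "Z \<in> mods s" and z: "epi Z M z" and f: "f \<in> hom (submod Z (ker Z z)) X'"
  obtain i q where iq: "i \<in> hom X' X" "q \<in> hom X X'" "\<forall>x\<in>carr X'. q (i x) = x" using r by (rule retractE)
  obtain h where h: "h \<in> hom Z X" "\<forall>x\<in>ker Z z. h x = i (f x)"
    by (rule Ext0D[OF E Z z hom_comp_in[OF mods_rmod[OF X'] f iq(1)]])
  show "\<exists>h\<in>hom Z X'. \<forall>x\<in>ker Z z. h x = f x"
    by (rule bexI[of _ "\<lambda>x. q (h x)"])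
      (use h iq hom_in[OF f] hom_comp_in[OF mods_rmod[OF X] h(1) iq(2)] in auto)
qed

text \<open>Lift the idempotent \<open>i p\<close> of \<open>M\<close> to \<open>u : P -> P\<close>.
  Then \<open>x - u x\<close> lies in the kernel \<open>?K\<close> of \<open>p e\<close>, where
  \<open>f\<close> is already defined, while \<open>u\<close> maps \<open>?K\<close> into
  \<open>ker P e\<close>, where the extension \<open>h\<close> agrees with \<open>f\<close>. So
  \<open>h (u x) + f (x - u x)\<close> extends \<open>f\<close>.\<close>

lemma Ext0_retract_left:
  assumes E: "Ext0 M X" and M: "M \<in> mods s" and r: "retract M' M" and M': "M' \<in> mods s" and X: "X \<in> mods s"
  shows "Ext0 M' X"
proof -
  obtain i p where ip: "i \<in> hom M' M" "p \<in> hom M M'" "\<forall>x\<in>carr M'. p (i x) = x" using r by (rule retractE)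
  obtain P e where P: "P \<in> projs s" and e: "epi P M e" by (rule cover[OF M])
  have PM: "P \<in> mods s" using projsD[OF P] by blast
  have rX: "right_module X" and rP: "right_module P" and rM: "right_module M" and rM': "right_module M'"
    using X PM M M' by auto
  have eh: "e \<in> hom P M" using epi_hom[OF e] .
  have "epi M M' p" by (rule epiI[OF ip(2)]) (use ip hom_in[OF ip(1)] in blast)
  then have pe: "epi P M' (\<lambda>x. p (e x))" using epi_comp[OF rM e] by blast
  obtain u where u: "u \<in> hom P P" "\<forall>x. e (u x) = i (p (e x))"
    by (rule projective_lift[OF projsD(2)[OF P] PM M e
          hom_comp_in[OF rM' hom_comp_in[OF rM eh ip(2)] ip(1)]])
  let ?K = "ker P (\<lambda>x. p (e x))"
  have sK: "submodule ?K P" using epi_ker_submodule[OF pe PM M'] .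
  have sO: "submodule (ker P e) (submod P ?K)"
    by (rule submodule_submod[OF epi_ker_submodule[OF e PM M]])
      (use hom_zero[OF rM ip(2)] in \<open>auto simp: ker_def\<close>)
  show ?thesis
  proof (rule Ext0I[OF M' X P pe])
    fix f assume f: "f \<in> hom (submod P ?K) X"
    have "rst (ker P e) f \<in> hom (submod P (ker P e)) X" using hom_rst[OF f sO] by simp
    then obtain h where h: "h \<in> hom P X" "\<forall>x\<in>ker P e. h x = rst (ker P e) f x"
      by (rule Ext0D[OF E PM e])
    have dK: "idm P x - u x \<in> ?K" if x: "x \<in> carr P" for x
      using x hom_in[OF u(1) x] hom_diff[OF rP eh x hom_in[OF u(1) x]] u(2) ip(3)
        hom_diff[OF rM ip(2) hom_in[OF eh x] hom_in[OF ip(1) hom_in[OF ip(2) hom_in[OF eh x]]]]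
        hom_in[OF ip(2) hom_in[OF eh x]] rP
      by (simp add: ker_def)
    have d: "(\<lambda>x. idm P x - u x) \<in> hom P (submod P ?K)"
      by (rule hom_corestrict[OF hom_minus[OF rP hom_idm[OF rP] u(1)] dK])
    have k: "(\<lambda>x. h (u x) + f (idm P x - u x)) \<in> hom P X"
      by (rule hom_plus[OF rX hom_comp_in[OF rP u(1) h(1)] hom_comp_in[OF submodule_right_module[OF sK] d f]])
    have "h (u x) + f (idm P x - u x) = f x" if x: "x \<in> ?K" for x
    proof -
      have xP: "x \<in> carr P" using submodule_in[OF sK x] .
      have ux: "u x \<in> ker P e"
        using x u(2) hom_in[OF u(1) xP] hom_zero[OF rM' ip(1)] by (simp add: ker_def)
      then have uK: "u x \<in> ?K" using submodule_in[OF sO] by simp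
      have "f (x - u x) = f x - f (u x)"
        using hom_diff[OF submodule_right_module[OF sK] f] x uK by simp
      then show ?thesis using h(2) ux xP by simp
    qed
    then show "\<exists>h\<in>hom P X. \<forall>x\<in>?K. h x = f x"
      using k by (intro bexI[of _ "\<lambda>x. h (u x) + f (idm P x - u x)"]) auto
  qed
qed

lemma Ext0_biprod_right:
  assumes X: "X \<in> mods s" and b: "biprod X Xs i p" and Xs: "\<forall>Y\<in>set Xs. Y \<in> mods s \<and> Ext0 M Y"
  shows "Ext0 M X"
  unfolding Ext0_def
proof (intro ballI allI impI)
  fix Z z f assume Z: "Z \<in> mods s" and z: "epi Z M z" and f: "f \<in> hom (submod Z (ker Z z)) X"
  have rX: "right_module X" using X by simp
  have "\<exists>h. h \<in> hom Z (Xs ! l) \<and> (\<forall>x\<in>ker Z z. h x = p l (f x))" if l: "l < length Xs" for l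
  proof -
    have "Ext0 M (Xs ! l)" using Xs l by simp
    then show ?thesis by (rule Ext0D[OF _ Z z hom_comp_in[OF rX f biprodD(2)[OF b l]]]) blast
  qed
  then obtain h where h: "\<And>l. l < length Xs \<Longrightarrow> h l \<in> hom Z (Xs ! l) \<and> (\<forall>x\<in>ker Z z. h l x = p l (f x))"
    by metis
  have "(\<lambda>x. i l (h l x)) \<in> hom Z X" if l: "l < length Xs" for l
  proof -
    have "right_module (Xs ! l)" using Xs l by simp
    then show ?thesis using hom_comp_in[OF _ _ biprodD(1)[OF b l]] h[OF l] by blast
  qed
  then have "(\<lambda>x. \<Sum>l<length Xs. i l (h l x)) \<in> hom Z X" by (intro hom_sum_fun[OF rX]) simp
  moreover have "(\<Sum>l<length Xs. i l (h l x)) = f x" if x: "x \<in> ker Z z" for x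
  proof -
    have "(\<Sum>l<length Xs. i l (h l x)) = (\<Sum>l<length Xs. i l (p l (f x)))"
      using h x by (intro sum.cong) auto
    also have "\<dots> = f x" using biprodD(4)[OF b, of "f x"] hom_in[OF f] x by simp
    finally show ?thesis .
  qed
  ultimately show "\<exists>h\<in>hom Z X. \<forall>x\<in>ker Z z. h x = f x"
    by (intro bexI[of _ "\<lambda>x. \<Sum>l<length Xs. i l (h l x)"]) auto
qed

lemma Ext0_biprod_left:
  assumes "M \<in> mods s" "biprod M Ms i p" "\<forall>Y\<in>set Ms. Y \<in> mods s \<and> Ext0 Y X" "X \<in> mods s"
  shows "Ext0 M X"
  using assms
proof (induction Ms arbitrary: M i p)
  case Nil
  have "x = 0" if "x \<in> carr M" for x using biprodD(4)[OF Nil(2) that] by simp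
  moreover have "0 \<in> carr M" using Nil by simp
  ultimately have cM: "carr M = {0}" by blast
  have "projective s M"
  proof (rule projectiveI)
    fix X Y g f assume a: "X \<in> mods s" "Y \<in> mods s" "epi X Y g" "f \<in> hom M Y"
    have "f = 0" using hom_from_zero[OF mods_rmod[OF a(2)] cM] a(4) by blast
    then show "\<exists>h\<in>hom M X. \<forall>x\<in>carr M. g (h x) = f x"
      using hom_zero[OF mods_rmod[OF a(1)] epi_hom[OF a(3)]] a(1) by (intro bexI[of _ "\<lambda>_. 0"]) auto
  qed
  then show ?case using Ext0_projective Nil by (simp add: projs_def)
next
  case (Cons Y Ms)
  have r: "right_module M" "right_module Y" "\<And>N. N \<in> set Ms \<Longrightarrow> right_module N" using Cons by auto
  note C = biprod_Cons_ker[OF r(1) Cons(3) r(2,3)]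
  have Y: "Y \<in> mods s" "Ext0 Y X" using Cons(4) by auto
  have K: "submodule (ker M (p 0)) M" using ker_submodule[OF r(1,2) epi_hom[OF C(1)]] .
  have "Ext0 (submod M (ker M (p 0))) X"
    using Cons(1)[OF submod_mods[OF Cons(2) K] C(2) _ Cons(5)] Cons(4) by simp
  then show ?case using Ext0_extension_left[OF Cons(2) Y(1) Cons(5) C(1) _ Y(2)] by blast
qed

text \<open>The composite \<open>f e\<close> lifts to \<open>h : P -> X\<close>, and
  \<open>h\<close> maps \<open>ker P e\<close> into \<open>ker X q\<close>. Subtracting an extension
  \<open>k\<close> of this restriction keeps \<open>q h\<close> and lets the difference descend to
  \<open>T\<close>.\<close>

lemma Ext0_lift:
  assumes T: "T \<in> mods s" and X: "X \<in> mods s" and Q: "Q \<in> mods s" and q: "epi X Q q"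
    and E: "Ext0 T (submod X (ker X q))" and f: "f \<in> hom T Q"
  obtains g where "g \<in> hom T X" "\<forall>x\<in>carr T. q (g x) = f x"
proof -
  obtain P e where P: "P \<in> projs s" and e: "epi P T e" by (rule cover[OF T])
  have PM: "P \<in> mods s" using projsD[OF P] by blast
  have rX: "right_module X" and rP: "right_module P" and rT: "right_module T" using X PM T by auto
  have sK: "submodule (ker X q) X" using epi_ker_submodule[OF q X Q] .
  have sO: "submodule (ker P e) P" using epi_ker_submodule[OF e PM T] .
  have qh: "q \<in> hom X Q" using epi_hom[OF q] .
  obtain h where h: "h \<in> hom P X" "\<forall>x. q (h x) = f (e x)"
    by (rule projective_lift[OF projsD(2)[OF P] X Q q hom_comp_in[OF rT epi_hom[OF e] f]])
  have hO: "rst (ker P e) h \<in> hom (submod P (ker P e)) (submod X (ker X q))"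
  proof (rule hom_corestrict[OF hom_rst[OF h(1) sO]])
    fix x assume "x \<in> carr (submod P (ker P e))"
    then show "rst (ker P e) h x \<in> ker X q"
      using h hom_in[OF h(1)] hom_zero[OF rT f] by (simp add: ker_def)
  qed
  obtain k where k: "k \<in> hom P (submod X (ker X q))" "\<forall>x\<in>ker P e. k x = rst (ker P e) h x"
    by (rule Ext0D[OF E PM e hO])
  have kX: "k \<in> hom P X" using hom_submod_ext[OF k(1) submodule_subset[OF sK]] .
  have d: "(\<lambda>x. h x - k x) \<in> hom P X" using hom_minus[OF rX h(1) kX] .
  have "h x - k x = 0" if "x \<in> carr P" "e x = 0" for x
    using k(2) that by (simp add: ker_def)
  then obtain g where g: "g \<in> hom T X" "\<forall>x\<in>carr P. g (e x) = h x - k x"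
    using epi_factor[OF rP rX e d] by blast
  have "q (g y) = f y" if y: "y \<in> carr T" for y
  proof -
    obtain x where x: "x \<in> carr P" "e x = y" using epi_surj[OF e y] by blast
    have "q (k x) = 0" using hom_in[OF k(1) x(1)] by (simp add: ker_def)
    then have "q (h x - k x) = f y"
      using hom_diff[OF rX qh hom_in[OF h(1) x(1)] hom_in[OF kX x(1)]] h(2) x(2) by simp
    then show ?thesis using g(2) x by auto
  qed
  then show thesis using that g(1) by blast
qed

end

section \<open>The Auslander-Reiten formula\<close>

context fd_alg
begin

lemma hom_regular_plus:
  assumes "f \<in> hom M (regular :: ('a, 'a) rmod)" "g \<in> hom M regular" shows "f + g \<in> hom M regular"
  using hom_plus[OF right_module_regular assms] by (simp add: plus_fun_def)

lemma hom_regular_mult: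
  assumes "g \<in> hom M (regular :: ('a, 'a) rmod)" shows "(\<lambda>x. a * g x) \<in> hom M regular"
  by (rule homI) (use assms in \<open>auto simp: hom_add[OF assms] hom_act[OF assms] hom_out[OF assms] distrib_left mult.assoc\<close>)

lemma hom_regular_scale:
  assumes "g \<in> hom M (regular :: ('a, 'a) rmod)" shows "(\<lambda>x. s c (g x)) \<in> hom M regular"
  using hom_regular_mult[OF assms, of "s c 1"] by (simp add: scale_left)

lemma hom_regular_act:
  assumes X: "right_module X" and x: "x \<in> carr X" and g: "g \<in> hom M (regular :: ('a, 'a) rmod)"
  shows "(\<lambda>y. act X x (g y)) \<in> hom M X"
  using hom_comp_in[OF right_module_regular g hom_from_regular[OF X x]] .

lemma act_D_coker:
  "act (D_coker s P1 P0 d) \<phi> a g = (if g \<in> hom P1 regular then \<phi> (\<lambda>x. a * g x) else 0)"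
  unfolding D_coker_def by simp

lemma D_coker_carr:
  assumes "\<phi> \<in> carr (D_coker s P1 P0 d)"
  shows "\<And>g h. g \<in> hom P1 regular \<Longrightarrow> h \<in> hom P1 regular \<Longrightarrow> \<phi> (g + h) = \<phi> g + \<phi> h"
    "\<And>g. g \<notin> hom P1 regular \<Longrightarrow> \<phi> g = 0"
    "\<And>g. g \<in> hom P0 regular \<Longrightarrow> \<phi> (g \<circ> d) = 0"
  using assms unfolding D_coker_def by auto

lemma D_coker_sum:
  assumes \<phi>: "\<phi> \<in> carr (D_coker s P1 P0 d)" and g: "\<And>i. i \<in> S \<Longrightarrow> g i \<in> hom P1 regular" and S: "finite S"
  shows "\<phi> (\<lambda>x. \<Sum>i\<in>S. g i x) = (\<Sum>i\<in>S. \<phi> (g i))"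
  using S g
proof (induction S rule: finite_induct)
  case empty
  have "(\<lambda>x. 0) \<in> hom P1 (regular :: ('a, 'a) rmod)" by (rule hom_0[OF right_module_regular])
  then have "\<phi> ((\<lambda>x. 0) + (\<lambda>x. 0)) = \<phi> (\<lambda>x. 0) + \<phi> (\<lambda>x. 0)" using D_coker_carr(1)[OF \<phi>] by blast
  moreover have "(\<lambda>x. 0) + (\<lambda>x. 0) = (\<lambda>x :: nat \<Rightarrow> 'k. 0 :: 'a)" by (rule ext) simp
  ultimately have "\<phi> (\<lambda>x. 0) = \<phi> (\<lambda>x. 0) + \<phi> (\<lambda>x. 0)" by (simp only:)
  then have "\<phi> (\<lambda>x. 0) = 0" by (simp only: add_cancel_right_right)
  then show ?case by (simp only: sum.empty)
next
  case (insert i S)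
  have h: "(\<lambda>x. \<Sum>i\<in>S. g i x) \<in> hom P1 (regular :: ('a, 'a) rmod)"
    by (rule hom_sum_fun[OF right_module_regular]) (use insert in auto)
  have "(\<lambda>x. \<Sum>i\<in>insert i S. g i x) = g i + (\<lambda>x. \<Sum>i\<in>S. g i x)"
    using insert by (simp add: fun_eq_iff)
  then show ?case using D_coker_carr(1)[OF \<phi> _ h, of "g i"] insert by simp
qed

text \<open>
  With a dual basis \<open>b\<^sub>i, c\<^sub>i\<close> of \<open>P1\<close>, homomorphisms \<open>\<psi>: X \<rightarrow> D Coker\<close> correspond to the linear forms
  \<open>f \<mapsto> \<Sum>i. \<psi> (f b\<^sub>i) c\<^sub>i\<close> on \<open>Hom(P1, X)\<close> that vanish on the image of \<open>Hom(P0, X)\<close>.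
\<close>

lemma hom_D_coker_zero:
  assumes P1: "P1 \<in> projs s" and P0: "P0 \<in> projs s" and d: "d \<in> hom P1 P0" and X: "X \<in> mods s"
    and fac: "\<And>f. f \<in> hom P1 X \<Longrightarrow> \<exists>h\<in>hom P0 X. \<forall>x\<in>carr P1. f x = h (d x)"
    and \<psi>: "\<psi> \<in> hom X (D_coker s P1 P0 d)"
  shows "\<psi> = 0"
proof -
  have rX: "right_module X" and r1: "right_module P1" and r0: "right_module P0"
    using X projsD(1)[OF P1] projsD(1)[OF P0] by auto
  let ?D = "D_coker s P1 P0 d" and ?H = "hom P1 (regular :: ('a, 'a) rmod)"
  obtain r :: nat and b c where b: "\<forall>j<r. b j \<in> carr P1" "\<forall>j<r. c j \<in> ?H"
    "\<forall>x\<in>carr P1. x = (\<Sum>j<r. act P1 (b j) (c j x))" "\<forall>x\<in>carr P1. (\<forall>j<r. c j x = 0) \<longrightarrow> x = 0"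
    by (rule dual_basis[OF P1])
  obtain r' :: nat and b' c' where b': "\<forall>j<r'. b' j \<in> carr P0" "\<forall>j<r'. c' j \<in> hom P0 (regular :: ('a, 'a) rmod)"
    "\<forall>x\<in>carr P0. x = (\<Sum>j<r'. act P0 (b' j) (c' j x))" "\<forall>x\<in>carr P0. (\<forall>j<r'. c' j x = 0) \<longrightarrow> x = 0"
    by (rule dual_basis[OF P0])
  have \<psi>D: "\<psi> x \<in> carr ?D" if "x \<in> carr X" for x using hom_in[OF \<psi> that] .
  have \<psi>act: "\<psi> (act X x a) g = \<psi> x (\<lambda>y. a * g y)" if "x \<in> carr X" "g \<in> ?H" for x a g
    using hom_act[OF \<psi> that(1)] that(2) by (simp add: act_D_coker)
  have expand: "g y = (\<Sum>i<r. g (b i) * c i y)" if g: "g \<in> ?H" for g y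
  proof (cases "y \<in> carr P1")
    case True
    have "g y = g (\<Sum>i<r. act P1 (b i) (c i y))" using b(3) True by simp
    also have "\<dots> = (\<Sum>i<r. g (act P1 (b i) (c i y)))"
      by (rule hom_sum[OF r1 g]) (use b(1) r1 in simp)
    also have "\<dots> = (\<Sum>i<r. g (b i) * c i y)"
      by (intro sum.cong refl) (use b(1) hom_act[OF g] in simp)
    finally show ?thesis .
  next
    case False
    have "c i y = 0" if "i < r" for i using b(2) that hom_out False by blast
    then show ?thesis using hom_out[OF g False] by simp
  qed
  \<comment> \<open>The linear form attached to \<psi> is zero because every \<open>f\<close>
    factors over \<open>d\<close>: in the dual basis of \<open>P0\<close> the sum over
    \<open>i\<close> collects into values of \<psi> at \<open>c' j\<close> composed with
    \<open>d\<close>, and these vanish by the definition of \<open>D_coker\<close>.\<close>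
  have total: "(\<Sum>i<r. \<psi> (f (b i)) (c i)) = 0" if f: "f \<in> hom P1 X" for f
  proof -
    obtain h where h: "h \<in> hom P0 X" "\<forall>x\<in>carr P1. f x = h (d x)" using fac[OF f] by blast
    have hb: "h (b' j) \<in> carr X" if "j < r'" for j using hom_in[OF h(1)] b'(1) that by simp
    have cd: "(\<lambda>x. c' j (d x)) \<in> ?H" if "j < r'" for j
      using hom_comp_in[OF r0 d] b'(2) that by blast
    have "\<psi> (f (b i)) (c i) = (\<Sum>j<r'. \<psi> (h (b' j)) (\<lambda>y. c' j (d (b i)) * c i y))" if i: "i < r" for i
    proof -
      have db: "d (b i) \<in> carr P0" using hom_in[OF d] b(1) i by simp
      have "f (b i) = h (d (b i))" using h(2) b(1) i by simp
      also have "\<dots> = h (\<Sum>j<r'. act P0 (b' j) (c' j (d (b i))))" using b'(3) db by simp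
      also have "\<dots> = (\<Sum>j<r'. h (act P0 (b' j) (c' j (d (b i)))))"
        by (rule hom_sum[OF r0 h(1)]) (use b'(1) r0 in simp)
      also have "\<dots> = (\<Sum>j<r'. act X (h (b' j)) (c' j (d (b i))))"
        by (intro sum.cong refl) (use b'(1) hom_act[OF h(1)] in simp)
      finally have "\<psi> (f (b i)) = \<psi> (\<Sum>j<r'. act X (h (b' j)) (c' j (d (b i))))" by simp
      also have "\<dots> = (\<Sum>j<r'. \<psi> (act X (h (b' j)) (c' j (d (b i)))))"
        by (rule hom_sum[OF rX \<psi>]) (use hb rX in simp)
      finally show ?thesis using \<psi>act hb b(2) i by (simp add: sum_fun_apply)
    qed
    then have "(\<Sum>i<r. \<psi> (f (b i)) (c i)) = (\<Sum>i<r. \<Sum>j<r'. \<psi> (h (b' j)) (\<lambda>y. c' j (d (b i)) * c i y))"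
      by simp
    also have "\<dots> = (\<Sum>j<r'. \<Sum>i<r. \<psi> (h (b' j)) (\<lambda>y. c' j (d (b i)) * c i y))"
      by (rule sum.swap)
    also have "\<dots> = (\<Sum>j<r'. \<psi> (h (b' j)) (\<lambda>y. \<Sum>i<r. c' j (d (b i)) * c i y))"
      by (intro sum.cong refl D_coker_sum[OF \<psi>D, symmetric] hb hom_regular_mult) (use b(2) in auto)
    also have "\<dots> = (\<Sum>j<r'. \<psi> (h (b' j)) (c' j \<circ> d))"
      using expand[OF cd] by (intro sum.cong refl) (simp add: comp_def)
    also have "\<dots> = 0"
      using D_coker_carr(3)[OF \<psi>D[OF hb]] b'(2) by (intro sum.neutral) simp
    finally show ?thesis .
  qed
  have "\<psi> x g = 0" for x g
  proof (cases "x \<in> carr X")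
    case x: True
    show ?thesis
    proof (cases "g \<in> ?H")
      case g: True
      \<comment> \<open>Conversely \<psi> is recovered from its form: \<open>\<psi> x g\<close> is
        the value at the homomorphism sending \<open>y\<close> to
        \<open>act X x (g y)\<close>.\<close>
      have "g = (\<lambda>y. \<Sum>i<r. g (b i) * c i y)" by (rule ext) (rule expand[OF g])
      then have "\<psi> x g = \<psi> x (\<lambda>y. \<Sum>i<r. g (b i) * c i y)" by (rule arg_cong)
      also have "\<dots> = (\<Sum>i<r. \<psi> x (\<lambda>y. g (b i) * c i y))"
        by (rule D_coker_sum[OF \<psi>D[OF x] hom_regular_mult]) (use b(2) in auto)
      also have "\<dots> = (\<Sum>i<r. \<psi> (act X x (g (b i))) (c i))" using \<psi>act[OF x] b(2) by simp
      also have "\<dots> = 0" by (rule total[OF hom_regular_act[OF rX x g]])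
      finally show ?thesis .
    next
      case False
      then show ?thesis using D_coker_carr(2)[OF \<psi>D[OF x]] by simp
    qed
  next
    case False
    then show ?thesis using hom_out[OF \<psi> False] by simp
  qed
  then show ?thesis by (simp add: fun_eq_iff)
qed

text \<open>If \<open>f\<close> lay outside the subspace \<open>W\<close> of maps factoring over
  \<open>d\<close>, a linear form \<open>L\<close> that vanishes on \<open>W\<close> but not at
  \<open>f\<close> would correspond to a nonzero homomorphism from \<open>X\<close> to
  \<open>D_coker\<close>.\<close>

lemma factor_if_hom_D_coker_zero:
  assumes P1: "P1 \<in> projs s" and P0: "P0 \<in> projs s" and d: "d \<in> hom P1 P0" and X: "X \<in> mods s"
    and z: "hom X (D_coker s P1 P0 d) = {0}" and f: "f \<in> hom P1 X"
  shows "\<exists>h\<in>hom P0 X. \<forall>x\<in>carr P1. f x = h (d x)"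
proof (rule ccontr)
  assume neg: "\<not> ?thesis"
  have m1: "P1 \<in> mods s" and m0: "P0 \<in> mods s" using P1 P0 projsD by auto
  have rX: "right_module X" and r1: "right_module P1" and r0: "right_module P0" using X m1 m0 by auto
  let ?D = "D_coker s P1 P0 d" and ?H = "hom P1 (regular :: ('a, 'a) rmod)"
  define W where "W = (\<lambda>h. h \<circ> d) ` hom P0 X"
  have lin: "HH.linear_on (hom P0 X) (\<lambda>h. h \<circ> d)"
    unfolding HH.linear_on_def by (auto simp: hscale_def fun_eq_iff)
  have "H.subspace W"
    using HH.rank_nullity(1)[OF hom_fin_dim[OF m0 X] lin] unfolding W_def H.fin_dim_def by blast
  then have Wspan: "H.span W = W" using H.span_eq_iff by blast
  have fW: "f \<notin> W"
  proof
    assume "f \<in> W"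
    then obtain h where "h \<in> hom P0 X" "f = h \<circ> d" unfolding W_def by blast
    then show False using neg by auto
  qed
  obtain B where B: "B \<subseteq> W" "H.independent B" "W \<subseteq> H.span B" "card B = H.dim W"
    by (rule H.basis_exists)
  have "H.span B \<subseteq> W" using H.span_mono[OF B(1)] Wspan by simp
  then have fB: "f \<notin> H.span B" using fW by blast
  then have ind: "H.independent (insert f B)" using H.independent_insertI B(2) by blast
  obtain L where L: "Vector_Spaces.linear hscale (*) L" "\<forall>x\<in>insert f B. L x = (if x = f then 1 else 0)"
    using HK.linear_independent_extend[OF ind, of "\<lambda>x. if x = f then 1 else 0"] by blast
  interpret L: Vector_Spaces.linear hscale "(*)" L by (rule L(1))
  have LW: "L w = 0" if "w \<in> W" for w
  proof -
    have "w \<in> H.span B" using that B(3) by blast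
    moreover have "L b = 0" if "b \<in> B" for b
      using L(2) that fB H.span_base by auto
    ultimately show ?thesis
      by (rule L.eq_0_on_span[rotated])
  qed
  have Lf: "L f = 1" using L(2) by simp
  \<comment> \<open>The inverse of the correspondence between homomorphisms and forms. Vanishing of
    \<open>L\<close> on \<open>W\<close> is what puts the values of \<psi> into
    \<open>D_coker\<close>.\<close>
  define \<psi> where "\<psi> = rst (carr X) (\<lambda>x g. if g \<in> ?H then L (\<lambda>y. act X x (g y)) else 0)"
  have \<psi>: "\<psi> \<in> hom X ?D"
    unfolding \<psi>_def
  proof (rule rst_homI[OF rX])
    fix x assume x: "x \<in> carr X"
    have "L (\<lambda>y. act X x ((g + h) y)) = L (\<lambda>y. act X x (g y)) + L (\<lambda>y. act X x (h y))" for g h :: "_ \<Rightarrow> 'a"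
    proof -
      have "(\<lambda>y. act X x ((g + h) y)) = (\<lambda>y. act X x (g y)) + (\<lambda>y. act X x (h y))"
        by (rule ext) (simp only: plus_fun_apply right_module.act_add_right[OF rX x])
      then show ?thesis by (simp only: L.add)
    qed
    moreover have "L (\<lambda>y. act X x (s a (g y))) = a * L (\<lambda>y. act X x (g y))" for a and g :: "_ \<Rightarrow> 'a"
    proof -
      have "(\<lambda>y. act X x (s a (g y))) = hscale a (\<lambda>y. act X x (g y))"
        unfolding hscale_def using act_s[OF kmod_mods[OF X] x] by simp
      then show ?thesis by (simp only: L.scale)
    qed
    moreover have "L (\<lambda>y. act X x ((g \<circ> d) y)) = 0" if g: "g \<in> hom P0 (regular :: ('a, 'a) rmod)" for g
    proof -
      have "(\<lambda>y. act X x ((g \<circ> d) y)) \<in> W"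
        unfolding W_def using hom_regular_act[OF rX x g] by (intro image_eqI) (auto simp: comp_def)
      then show ?thesis by (rule LW)
    qed
    ultimately show "(\<lambda>g. if g \<in> ?H then L (\<lambda>y. act X x (g y)) else 0) \<in> carr ?D"
      unfolding D_coker_def by (simp add: hom_regular_plus hom_regular_scale)
    show "(\<lambda>g. if g \<in> ?H then L (\<lambda>y. act X (act X x a) (g y)) else 0) =
      act ?D (\<lambda>g. if g \<in> ?H then L (\<lambda>y. act X x (g y)) else 0) a" for a
      by (rule ext) (simp add: act_D_coker hom_regular_mult right_module.act_mult[OF rX x])
    fix y assume y: "y \<in> carr X"
    have "L (\<lambda>z. act X (x + y) (g z)) = L (\<lambda>z. act X x (g z)) + L (\<lambda>z. act X y (g z))" for g :: "_ \<Rightarrow> 'a"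
    proof -
      have "(\<lambda>z. act X (x + y) (g z)) = (\<lambda>z. act X x (g z)) + (\<lambda>z. act X y (g z))"
        by (rule ext) (simp only: plus_fun_apply right_module.act_add_left[OF rX x y])
      then show ?thesis by (simp only: L.add)
    qed
    then show "(\<lambda>g. if g \<in> ?H then L (\<lambda>z. act X (x + y) (g z)) else 0) =
      (\<lambda>g. if g \<in> ?H then L (\<lambda>z. act X x (g z)) else 0) + (\<lambda>g. if g \<in> ?H then L (\<lambda>z. act X y (g z)) else 0)"
      by (intro ext) simp
  qed
  then have \<psi>0: "\<psi> = 0" using z by blast
  obtain r :: nat and b c where b: "\<forall>j<r. b j \<in> carr P1" "\<forall>j<r. c j \<in> ?H"
    "\<forall>x\<in>carr P1. x = (\<Sum>j<r. act P1 (b j) (c j x))" "\<forall>x\<in>carr P1. (\<forall>j<r. c j x = 0) \<longrightarrow> x = 0"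
    by (rule dual_basis[OF P1])
  have fb: "f (b i) \<in> carr X" if "i < r" for i using hom_in[OF f] b(1) that by simp
  \<comment> \<open>In the dual basis, \<open>L f\<close> becomes the sum of the
    \<open>\<psi> (f (b i)) (c i)\<close>, which is 0 although \<open>L f = 1\<close>.\<close>
  have "f = (\<Sum>i<r. (\<lambda>y. act X (f (b i)) (c i y)))"
  proof
    fix y show "f y = (\<Sum>i<r. (\<lambda>y. act X (f (b i)) (c i y))) y"
    proof (cases "y \<in> carr P1")
      case True
      have "f y = f (\<Sum>i<r. act P1 (b i) (c i y))" using b(3) True by simp
      also have "\<dots> = (\<Sum>i<r. f (act P1 (b i) (c i y)))"
        by (rule hom_sum[OF r1 f]) (use b(1) r1 in simp)
      also have "\<dots> = (\<Sum>i<r. act X (f (b i)) (c i y))"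
        by (intro sum.cong refl) (use b(1) hom_act[OF f] in simp)
      finally show ?thesis by (simp add: sum_fun_apply)
    next
      case False
      have "act X (f (b i)) (c i y) = 0" if i: "i < r" for i
      proof -
        have "c i y = 0" using b(2) i hom_out[OF _ False, of "c i" regular] by blast
        then show ?thesis using act_zero_right[OF rX fb[OF i]] by (simp only:)
      qed
      then show ?thesis using hom_out[OF f False] by (simp add: sum_fun_apply)
    qed
  qed
  then have "L f = (\<Sum>i<r. L (\<lambda>y. act X (f (b i)) (c i y)))" using L.sum by metis
  also have "\<dots> = (\<Sum>i<r. \<psi> (f (b i)) (c i))"
    using b(2) fb by (intro sum.cong refl) (simp add: \<psi>_def)
  also have "\<dots> = 0" unfolding \<psi>0 by simp
  finally show False using Lf by simp
qed

end

section \<open>Hereditary algebras\<close>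

locale her_alg = fd_alg s for s :: "'k::field \<Rightarrow> 'a::ring_1 \<Rightarrow> 'a" +
  assumes her: "hereditary_algebra s"
begin

text \<open>Induction on the number of coordinates. The image of the last coordinate
  \<open>p\<close> is a right ideal, hence projective, and the kernel of \<open>p\<close> embeds by
  the remaining coordinates; then \<open>projective_extension\<close> applies.\<close>

lemma projective_if_embeds:
  fixes c :: "nat \<Rightarrow> (nat \<Rightarrow> 'k) \<Rightarrow> 'a"
  assumes "M \<in> mods s" "\<forall>j<r. c j \<in> hom M (regular :: ('a, 'a) rmod)"
    "\<forall>x\<in>carr M. (\<forall>j<r. c j x = 0) \<longrightarrow> x = 0"
  shows "projective s M"
  using assms
proof (induction r arbitrary: M c)
  case 0
  have "x = 0" if "x \<in> carr M" for x using 0(3) that by blast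
  then have cM: "carr M = {0}" using right_module.zero_closed[OF mods_rmod[OF 0(1)]] by blast
  show ?case
  proof (rule projectiveI)
    fix X Y g f assume a: "X \<in> mods s" "Y \<in> mods s" "epi X Y g" "f \<in> hom M Y"
    have "f = 0" using hom_from_zero[OF mods_rmod[OF a(2)] cM] a(4) by blast
    then show "\<exists>h\<in>hom M X. \<forall>x\<in>carr M. g (h x) = f x"
      using hom_zero[OF mods_rmod[OF a(1)] epi_hom[OF a(3)]] a(1) by (intro bexI[of _ "\<lambda>_. 0"]) auto
  qed
next
  case (Suc r)
  have rM: "right_module M" using Suc by simp
  have rR: "right_module (regular :: ('a, 'a) rmod)" by (rule right_module_regular)
  define p where "p = c r"
  have p: "p \<in> hom M regular" using Suc(3) by (simp add: p_def)
  let ?K = "ker M p" and ?I = "p ` carr M"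
  have sK: "submodule ?K M" using ker_submodule[OF rM rR p] .
  have sI: "submodule ?I regular" using image_submodule[OF rM rR p submodule_carr[OF rM]] .
  have pI: "projective s (submod regular ?I)"
    using her sI unfolding hereditary_algebra_def by blast
  have pK: "projective s (submod M ?K)"
  proof (rule Suc(1)[OF submod_mods[OF Suc(2) sK]])
    show "\<forall>j<r. rst ?K (c j) \<in> hom (submod M ?K) regular" using Suc(3) by (auto intro: hom_rst[OF _ sK])
    show "\<forall>x\<in>carr (submod M ?K). (\<forall>j<r. rst ?K (c j) x = 0) \<longrightarrow> x = 0"
    proof (intro ballI impI)
      fix x assume x: "x \<in> carr (submod M ?K)" "\<forall>j<r. rst ?K (c j) x = 0"
      then have "x \<in> carr M" "p x = 0" by (auto simp: ker_def)
      moreover have "c j x = 0" if "j < Suc r" for j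
        using x that \<open>p x = 0\<close> by (cases "j = r") (auto simp: p_def)
      ultimately show "x = 0" using Suc(4) by blast
    qed
  qed
  \<comment> \<open>The right ideal \<open>?I\<close> has carrier type \<open>'a\<close> and is not
    in \<open>mods s\<close>; the isomorphic quotient \<open>Q\<close> of \<open>M\<close> takes its
    place.\<close>
  obtain Q q where Q: "Q \<in> mods s" "epi M Q q" "\<forall>x\<in>carr M. q x = 0 \<longleftrightarrow> x \<in> ?K"
    by (rule quotient[OF Suc(2) sK])
  have rQ: "right_module Q" using Q by simp
  have pI': "p \<in> hom M (submod regular ?I)" by (rule hom_corestrict[OF p]) blast
  obtain u where u: "u \<in> hom Q (submod regular ?I)" "\<forall>x\<in>carr M. u (q x) = p x"
    using epi_factor[OF rM submodule_right_module[OF sI] Q(2) pI'] Q(3) by (auto simp: ker_def)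
  have "bij_betw u (carr Q) (carr (submod regular ?I))"
    unfolding bij_betw_def
  proof
    show "inj_on u (carr Q)"
      unfolding inj_on_hom_iff[OF rQ u(1)]
    proof (intro ballI impI)
      fix y assume y: "y \<in> carr Q" "u y = 0"
      obtain x where x: "x \<in> carr M" "q x = y" using epi_surj[OF Q(2) y(1)] by blast
      then have "x \<in> ?K" using u(2) y(2) by (auto simp: ker_def)
      then show "y = 0" using Q(3) x by blast
    qed
    show "u ` carr Q = carr (submod regular ?I)"
    proof
      show "u ` carr Q \<subseteq> carr (submod regular ?I)" using hom_in[OF u(1)] by blast
      show "carr (submod regular ?I) \<subseteq> u ` carr Q"
      proof
        fix y assume "y \<in> carr (submod regular ?I)"
        then obtain x where x: "x \<in> carr M" "y = p x" by auto
        then have "y = u (q x)" using u(2) by simp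
        then show "y \<in> u ` carr Q" using hom_in[OF epi_hom[OF Q(2)] x(1)] by blast
      qed
    qed
  qed
  then have "iso_mod Q (submod regular ?I)" using u(1) iso_mod_def by blast
  then have "retract Q (submod regular ?I)" using iso_retract rQ submodule_right_module[OF sI] by blast
  then have pQ: "projective s Q" using projective_retract rQ submodule_right_module[OF sI] pI by blast
  have "ker M q = ?K" using Q(3) by (auto simp: ker_def)
  then show ?case using projective_extension[OF Suc(2) Q(1,2) _ pQ] pK by simp
qed

lemma submod_projs:
  assumes P: "P \<in> projs s" and U: "submodule U P" shows "submod P U \<in> projs s"
proof -
  obtain r :: nat and b c where c: "\<forall>j<r. b j \<in> carr P" "\<forall>j<r. c j \<in> hom P (regular :: ('a, 'a) rmod)"
    "\<forall>x\<in>carr P. x = (\<Sum>j<r. act P (b j) (c j x))" "\<forall>x\<in>carr P. (\<forall>j<r. c j x = 0) \<longrightarrow> x = 0"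
    by (rule dual_basis[OF P])
  have m: "submod P U \<in> mods s" using submod_mods[OF projsD(1)[OF P] U] .
  have "projective s (submod P U)"
  proof (rule projective_if_embeds[OF m])
    show "\<forall>j<r. rst U (c j) \<in> hom (submod P U) regular" using c(2) hom_rst[OF _ U] by blast
    show "\<forall>x\<in>carr (submod P U). (\<forall>j<r. rst U (c j) x = 0) \<longrightarrow> x = 0"
      using c(4) submodule_in[OF U] by auto
  qed
  then show ?thesis using m by (simp add: projs_def)
qed

lemma ker_projs:
  assumes "P \<in> projs s" "M \<in> mods s" "epi P M e" shows "submod P (ker P e) \<in> projs s"
  using submod_projs[OF assms(1) epi_ker_submodule[OF assms(3) projsD(1)[OF assms(1)] assms(2)]] .

text \<open>Right exactness in the second argument: the kernel of a projective cover of
  \<open>M\<close> is projective, so maps from it to \<open>Y\<close> lift along \<open>q\<close>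
  and can be extended after lifting.\<close>

lemma Ext0_epi:
  assumes M: "M \<in> mods s" and X: "X \<in> mods s" and Y: "Y \<in> mods s" and q: "epi X Y q" and E: "Ext0 M X"
  shows "Ext0 M Y"
proof -
  obtain P e where P: "P \<in> projs s" and e: "epi P M e" by (rule cover[OF M])
  show ?thesis
  proof (rule Ext0I[OF M Y P e])
    fix f assume f: "f \<in> hom (submod P (ker P e)) Y"
    obtain g where g: "g \<in> hom (submod P (ker P e)) X" "\<forall>x. q (g x) = f x"
      by (rule projective_lift[OF projsD(2)[OF ker_projs[OF P M e]] X Y q f])
    obtain h where h: "h \<in> hom P X" "\<forall>x\<in>ker P e. h x = g x"
      by (rule Ext0D[OF E projsD(1)[OF P] e g(1)])
    show "\<exists>h\<in>hom P Y. \<forall>x\<in>ker P e. h x = f x"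
      by (rule bexI[of _ "\<lambda>x. q (h x)"]) (use h g hom_comp_in[OF mods_rmod[OF X] h(1) epi_hom[OF q]] in auto)
  qed
qed

lemma pd_le_1:
  assumes M: "M \<in> mods s" shows "pd_le_1 s M"
proof -
  obtain P e where P: "P \<in> projs s" and e: "epi P M e" by (rule cover[OF M])
  let ?K = "ker P e"
  have K: "submodule ?K P" using epi_ker_submodule[OF e projsD(1)[OF P] M] .
  have "idm (submod P ?K) ` carr (submod P ?K) = ?K" by (auto simp: image_iff)
  moreover have "inj_on (idm (submod P ?K)) (carr (submod P ?K))" by (auto simp: inj_on_def)
  ultimately show ?thesis
    unfolding pd_le_1_def using P e ker_projs[OF P M e] hom_idm_sub[OF K] by blast
qed

text \<open>From left to right the resolution is arbitrary, and \<open>Ext0I\<close> removes the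
  dependence on it. From right to left the resolution has length one, with \<open>P2 = 0\<close>,
  since kernels onto \<open>M\<close> are projective.\<close>

lemma Ext1_zero_iff:
  assumes M: "M \<in> mods s" and N: "N \<in> mods s" shows "Ext1_zero s M N \<longleftrightarrow> Ext0 M N"
proof
  assume "Ext1_zero s M N"
  then obtain P2 P1 P0 d2 d1 e where r: "proj_resolution s M P2 P1 P0 d2 d1 e"
    and ex: "{g \<in> hom P1 N. g \<circ> d2 = 0} = {h \<circ> d1 | h. h \<in> hom P0 N}"
    unfolding Ext1_zero_def by blast
  have P: "P0 \<in> projs s" "P1 \<in> projs s" "P2 \<in> projs s" and d: "d2 \<in> hom P2 P1" "d1 \<in> hom P1 P0"
    and e: "epi P0 M e" and im2: "d2 ` carr P2 = ker P1 d1" and im1: "d1 ` carr P1 = ker P0 e"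
    using r unfolding proj_resolution_def by auto
  have K: "submodule (ker P0 e) P0" using epi_ker_submodule[OF e projsD(1)[OF P(1)] M] .
  show "Ext0 M N"
  proof (rule Ext0I[OF M N P(1) e])
    fix f assume f: "f \<in> hom (submod P0 (ker P0 e)) N"
    have d1': "d1 \<in> hom P1 (submod P0 (ker P0 e))"
      using hom_corestrict[OF d(2)] im1 by blast
    have g: "f \<circ> d1 \<in> hom P1 N" using hom_comp[OF submodule_right_module[OF K] d1' f] .
    have "(f \<circ> d1) (d2 x) = 0" for x
    proof (cases "x \<in> carr P2")
      case True
      then have "d1 (d2 x) = 0" using im2 by (auto simp: ker_def)
      then show ?thesis using hom_zero[OF submodule_right_module[OF K] f] by simp
    next
      case False
      then have "d2 x = 0" using hom_out[OF d(1)] by blast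
      then show ?thesis using hom_zero[OF mods_rmod[OF projsD(1)[OF P(2)]] g] by simp
    qed
    then have "(f \<circ> d1) \<circ> d2 = 0" by (simp only: fun_eq_iff comp_apply zero_fun_apply simp_thms)
    then have "f \<circ> d1 \<in> {h \<circ> d1 | h. h \<in> hom P0 N}" using ex g by blast
    then obtain h where h: "h \<in> hom P0 N" "f \<circ> d1 = h \<circ> d1" by blast
    have "h x = f x" if "x \<in> ker P0 e" for x
    proof -
      have "x \<in> d1 ` carr P1" using that by (simp only: im1)
      then obtain y where "x = d1 y" by blast
      then show ?thesis using fun_cong[OF h(2), of y] by simp
    qed
    then show "\<exists>h\<in>hom P0 N. \<forall>x\<in>ker P0 e. h x = f x" using h(1) by blast
  qed
next
  assume E: "Ext0 M N"
  obtain P e where P: "P \<in> projs s" and e: "epi P M e" by (rule cover[OF M])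
  let ?K = "ker P e"
  let ?i = "idm (submod P ?K)"
  have mP: "P \<in> mods s" using projsD[OF P] by blast
  have K: "submodule ?K P" using epi_ker_submodule[OF e mP M] .
  have rP: "right_module P" and rN: "right_module N" and rK: "right_module (submod P ?K)"
    using mP N submodule_right_module[OF K] by auto
  have Z: "submod P {0} \<in> projs s" using submod_projs[OF P submodule_zero_set[OF rP]] .
  have "proj_resolution s M (submod P {0}) (submod P ?K) P (\<lambda>_. 0) ?i e"
    unfolding proj_resolution_def
    using Z ker_projs[OF P M e] P e hom_idm_sub[OF K] rK submodule_zero[OF K]
    by (auto simp: ker_def image_iff)
  moreover have "{g \<in> hom (submod P ?K) N. g \<circ> (\<lambda>_. 0) = (0 :: (nat \<Rightarrow> 'k) \<Rightarrow> nat \<Rightarrow> 'k)} = {h \<circ> ?i | h. h \<in> hom P N}"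
  proof (intro equalityI subsetI)
    fix g assume "g \<in> {g \<in> hom (submod P ?K) N. g \<circ> (\<lambda>_. 0) = (0 :: (nat \<Rightarrow> 'k) \<Rightarrow> nat \<Rightarrow> 'k)}"
    then have g: "g \<in> hom (submod P ?K) N" by blast
    obtain h where h: "h \<in> hom P N" "\<forall>x\<in>?K. h x = g x" by (rule Ext0D[OF E mP e g])
    have "g = h \<circ> ?i"
      by (rule hom_eqI[OF g hom_comp[OF rP hom_idm_sub[OF K] h(1)]]) (use h(2) in simp)
    then show "g \<in> {h \<circ> ?i | h. h \<in> hom P N}" using h(1) by blast
  next
    fix g assume "g \<in> {h \<circ> ?i | h. h \<in> hom P N}"
    then obtain h where h: "h \<in> hom P N" "g = h \<circ> ?i" by blast
    have g: "g \<in> hom (submod P ?K) N" unfolding h(2) by (rule hom_comp[OF rP hom_idm_sub[OF K] h(1)])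
    have "g \<circ> (\<lambda>_. 0) = (0 :: (nat \<Rightarrow> 'k) \<Rightarrow> nat \<Rightarrow> 'k)"
      using hom_zero[OF rK g] by (simp only: fun_eq_iff comp_apply zero_fun_apply simp_thms)
    then show "g \<in> {g \<in> hom (submod P ?K) N. g \<circ> (\<lambda>_. 0) = (0 :: (nat \<Rightarrow> 'k) \<Rightarrow> nat \<Rightarrow> 'k)}" using g by blast
  qed
  ultimately show "Ext1_zero s M N" unfolding Ext1_zero_def by blast
qed

text \<open>A projective module of least dimension mapping onto \<open>M\<close> is a projective cover, because its
  submodules are again projective.\<close>

lemma projective_cover_exists:
  assumes M: "M \<in> mods s" shows "\<exists>P e. projective_cover s P M e"
proof -
  let ?C = "\<lambda>(P, e). P \<in> projs s \<and> epi P M e"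
  obtain P0 e0 where "P0 \<in> projs s" "epi P0 M e0" by (rule cover[OF M])
  then have "\<exists>p. ?C p" by (intro exI[of _ "(P0, e0)"]) simp
  then obtain p where p: "?C p" "\<And>p'. ?C p' \<Longrightarrow> dm (fst p) \<le> dm (fst p')"
    using ex_has_least_nat[of ?C _ "\<lambda>p. dm (fst p)"] by blast
  obtain P e where pe: "p = (P, e)" by (cases p)
  have P: "P \<in> projs s" and e: "epi P M e" using p(1) pe by auto
  have mP: "P \<in> mods s" using projsD[OF P] by blast
  have K: "submodule (ker P e) P" using epi_ker_submodule[OF e mP M] .
  have "superfluous (ker P e) P" unfolding superfluous_def
  proof (intro conjI K allI impI)
    fix U assume U: "submodule U P \<and> {u + x |u x. u \<in> U \<and> x \<in> ker P e} = carr P"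
    then have sU: "submodule U P" by blast
    have "epi (submod P U) M (rst U e)"
    proof (rule epiI[OF hom_rst[OF epi_hom[OF e] sU]])
      fix y assume "y \<in> carr M"
      then obtain x where x: "x \<in> carr P" "e x = y" using epi_surj[OF e] by blast
      then obtain u k where uk: "u \<in> U" "k \<in> ker P e" "x = u + k" using U by blast
      have "e x = e u"
        using hom_add[OF epi_hom[OF e] submodule_in[OF sU uk(1)], of k] uk by (simp add: ker_def)
      then show "\<exists>x\<in>carr (submod P U). rst U e x = y" using uk x by (intro bexI[of _ u]) auto
    qed
    then have "?C (submod P U, rst U e)" using submod_projs[OF P sU] by simp
    then have "dm P \<le> dm (submod P U)" using p(2)[of "(submod P U, rst U e)"] pe by simp
    then show "U = carr P" using dm_sub_eq[OF mP sU] by blast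
  qed
  then show ?thesis unfolding projective_cover_def using P e by blast
qed

text \<open>The hereditary Auslander-Reiten formula. The kernel of \<open>e\<close> is projective,
  so its projective cover \<open>d\<close> is an isomorphism; factoring all maps
  \<open>P1 -> X\<close> over \<open>d\<close> then means extending all maps from
  \<open>ker P0 e\<close> to \<open>P0\<close>.\<close>

lemma hom_tau_zero_iff:
  assumes M: "M \<in> mods s" and X: "X \<in> mods s" shows "hom X (tau s M) = {0} \<longleftrightarrow> Ext0 M X"
proof -
  obtain Q0 e0 where q0: "projective_cover s Q0 M e0" using projective_cover_exists[OF M] by blast
  then have Q0: "Q0 \<in> projs s" "epi Q0 M e0" unfolding projective_cover_def by auto
  obtain Q1 d0 where "projective_cover s Q1 (submod Q0 (ker Q0 e0)) d0"
    using projective_cover_exists[OF projsD(1)[OF ker_projs[OF Q0(1) M Q0(2)]]] by blast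
  then have "min_presentation s M (Q1, Q0, d0, e0)" using q0 unfolding min_presentation_def by simp
  then have "min_presentation s M (SOME p. min_presentation s M p)" by (rule someI)
  moreover obtain P1 P0 d e where p: "(SOME p. min_presentation s M p) = (P1, P0, d, e)"
    by (cases "SOME p. min_presentation s M p") auto
  ultimately have mp: "min_presentation s M (P1, P0, d, e)" by simp
  have tau: "tau s M = D_coker s P1 P0 d" unfolding tau_def p by simp
  let ?O = "ker P0 e"
  have P: "P0 \<in> projs s" "P1 \<in> projs s" and e: "epi P0 M e" and d: "epi P1 (submod P0 ?O) d"
    and sf: "superfluous (ker P1 d) P1"
    using mp unfolding min_presentation_def projective_cover_def by auto
  have O: "submodule ?O P0" using epi_ker_submodule[OF e projsD(1)[OF P(1)] M] .
  have r1: "right_module P1" and r0: "right_module P0" and rO: "right_module (submod P0 ?O)"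
    using projsD(1)[OF P(1)] projsD(1)[OF P(2)] submodule_right_module[OF O] by auto
  have PO: "submod P0 ?O \<in> projs s" using ker_projs[OF P(1) M e] .
  have dO: "d \<in> hom P1 (submod P0 ?O)" using epi_hom[OF d] .
  have dP: "d \<in> hom P1 P0" using hom_submod_ext[OF dO submodule_subset[OF O]] .
  obtain t where t: "t \<in> hom (submod P0 ?O) P1" "\<forall>x. d (t x) = idm (submod P0 ?O) x"
    by (rule projective_lift[OF projsD(2)[OF PO] projsD(1)[OF P(2)] projsD(1)[OF PO] d hom_idm[OF rO]])
  have dt: "d (t x) = x" if "x \<in> ?O" for x using t(2) that by simp
  have U: "submodule (t ` ?O) P1"
    using image_submodule[OF rO r1 t(1) submodule_carr[OF rO]] by simp
  have "x \<in> {u + x |u x. u \<in> t ` ?O \<and> x \<in> ker P1 d}" if x: "x \<in> carr P1" for x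
  proof -
    have dx: "d x \<in> ?O" using hom_in[OF dO x] by simp
    have "x - t (d x) \<in> ker P1 d"
      using x dx dt hom_in[OF t(1)] r1 by (simp add: ker_def hom_diff[OF r1 dO])
    moreover have "x = t (d x) + (x - t (d x))" by simp
    ultimately show ?thesis using dx by blast
  qed
  moreover have "{u + x |u x. u \<in> t ` ?O \<and> x \<in> ker P1 d} \<subseteq> carr P1"
    using hom_in[OF t(1)] r1 by (auto simp: ker_def)
  ultimately have "{u + x |u x. u \<in> t ` ?O \<and> x \<in> ker P1 d} = carr P1" by blast
  then have tO: "t ` ?O = carr P1" using sf U unfolding superfluous_def by blast
  have td: "t (d x) = x" if x: "x \<in> carr P1" for x
  proof -
    obtain y where y: "y \<in> ?O" "x = t y" using tO x by blast
    then show ?thesis using dt by simp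
  qed
  have "hom X (tau s M) = {0} \<longleftrightarrow> (\<forall>f\<in>hom P1 X. \<exists>h\<in>hom P0 X. \<forall>x\<in>carr P1. f x = h (d x))"
  proof
    assume "hom X (tau s M) = {0}"
    then show "\<forall>f\<in>hom P1 X. \<exists>h\<in>hom P0 X. \<forall>x\<in>carr P1. f x = h (d x)"
      unfolding tau using factor_if_hom_D_coker_zero[OF P(2,1) dP X] by blast
  next
    assume a: "\<forall>f\<in>hom P1 X. \<exists>h\<in>hom P0 X. \<forall>x\<in>carr P1. f x = h (d x)"
    have "\<psi> = 0" if "\<psi> \<in> hom X (D_coker s P1 P0 d)" for \<psi>
      using hom_D_coker_zero[OF P(2,1) dP X _ that] a by blast
    moreover have "0 \<in> hom X (D_coker s P1 P0 d)"
      by (rule homI) (auto simp: D_coker_def fun_eq_iff)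
    ultimately show "hom X (tau s M) = {0}" unfolding tau by blast
  qed
  also have "\<dots> \<longleftrightarrow> Ext0 M X"
  proof
    assume a: "\<forall>f\<in>hom P1 X. \<exists>h\<in>hom P0 X. \<forall>x\<in>carr P1. f x = h (d x)"
    show "Ext0 M X"
    proof (rule Ext0I[OF M X P(1) e])
      fix f assume f: "f \<in> hom (submod P0 ?O) X"
      obtain h where h: "h \<in> hom P0 X" "\<forall>x\<in>carr P1. f (d x) = h (d x)"
        using bspec[OF a hom_comp_in[OF rO dO f]] by blast
      have "h x = f x" if x: "x \<in> ?O" for x
        using bspec[OF h(2), of "t x"] hom_in[OF t(1)] x dt[OF x] by simp
      then show "\<exists>h\<in>hom P0 X. \<forall>x\<in>?O. h x = f x" using h(1) by blast
    qed
  next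
    assume E: "Ext0 M X"
    show "\<forall>f\<in>hom P1 X. \<exists>h\<in>hom P0 X. \<forall>x\<in>carr P1. f x = h (d x)"
    proof
      fix f assume f: "f \<in> hom P1 X"
      obtain h where h: "h \<in> hom P0 X" "\<forall>x\<in>?O. h x = f (t x)"
        by (rule Ext0D[OF E projsD(1)[OF P(1)] e hom_comp_in[OF r1 t(1) f]])
      have "f x = h (d x)" if x: "x \<in> carr P1" for x
        using h(2) td[OF x] hom_in[OF dO x] by simp
      then show "\<exists>h\<in>hom P0 X. \<forall>x\<in>carr P1. f x = h (d x)" using h(1) by blast
    qed
  qed
  finally show ?thesis .
qed

end

lemma hom_zero_iff: "right_module N \<Longrightarrow> hom M N = {0} \<longleftrightarrow> (\<forall>f\<in>hom M N. \<forall>x\<in>carr M. f x = 0)"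
proof -
  assume N: "right_module N"
  have z: "0 \<in> hom M N" using hom_0[OF N, of M] by (simp add: zero_fun_def)
  show ?thesis
  proof
    assume "\<forall>f\<in>hom M N. \<forall>x\<in>carr M. f x = 0"
    then have "f = 0" if "f \<in> hom M N" for f using hom_eqI[OF that z] that by simp
    then show "hom M N = {0}" using z by blast
  qed auto
qed

lemma hom_zeroD: "hom M N = {0} \<Longrightarrow> f \<in> hom M N \<Longrightarrow> f x = 0"
  by auto

section \<open>Indecomposable projective modules and supports\<close>

context her_alg
begin

text \<open>Representatives are chosen among the summands of the regular module. For completeness,
  the dual basis writes the identity of an indecomposable projective as a sum of maps through the
  regular module, and locality makes one of these bijective.\<close>

lemma indecomposable_projectives:
  "\<exists>I. finite I \<and> I \<subseteq> projs s \<and> (\<forall>P\<in>I. indecomposable P) \<and> (\<forall>P\<in>I. \<forall>Q\<in>I. iso_mod P Q \<longrightarrow> P = Q) \<and>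
    (\<forall>P\<in>projs s. indecomposable P \<longrightarrow> (\<exists>Q\<in>I. iso_mod P Q)) \<and>
    card I = num_summands s (regular :: ('a, 'a) rmod)"
proof -
  let ?R = "regular :: ('a, 'a) rmod"
  obtain L where L: "L \<in> mods s" "iso_mod ?R L" by (rule regular_in_mods)
  have rL: "right_module L" using L by simp
  have LR: "iso_mod L ?R" by (rule iso_mod_sym[OF L(2) right_module_regular rL])
  have pL: "projective s L"
    by (rule projective_retract[OF rL right_module_regular iso_retract[OF LR rL right_module_regular] projective_regular])
  obtain Ys i p where Ys: "\<forall>X\<in>set Ys. X \<in> mods s \<and> indecomposable X" and b: "biprod L Ys i p"
    using decomposition[OF L(1)] by blast
  obtain I where I: "I \<subseteq> set Ys" "inj_on (iso_class s) I" "iso_class s ` set Ys = iso_class s ` I"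
    using subset_image_inj[of "iso_class s ` set Ys" "iso_class s" "set Ys"] by auto
  have "card I = card (iso_class s ` set Ys)" using I(2,3) card_image by metis
  also have "\<dots> = num_summands s ?R"
    using num_summands_biprod[OF rL b Ys] num_summands_iso[OF L(1) right_module_regular LR] by simp
  finally have card: "card I = num_summands s ?R" .
  have IP: "P \<in> projs s \<and> indecomposable P" if "P \<in> I" for P
  proof -
    have PY: "P \<in> set Ys" using that I(1) by blast
    then obtain j where j: "j < length Ys" "Ys ! j = P" unfolding in_set_conv_nth by blast
    have m: "P \<in> mods s" "indecomposable P" using PY Ys by auto
    have "retract P L" using biprod_retract[OF b j(1)] j(2) by simp
    then have "projective s P" by (rule projective_retract[OF mods_rmod[OF m(1)] rL _ pL])
    then show ?thesis using m by (simp add: projs_def)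
  qed
  have uniq: "P = Q" if "P \<in> I" "Q \<in> I" "iso_mod P Q" for P Q
  proof -
    have "iso_class s P = iso_class s Q"
      using iso_class_eq_iff[of P Q] that IP projsD(1) by blast
    then show ?thesis using I(2) that unfolding inj_on_def by blast
  qed
  have all: "\<exists>Q\<in>I. iso_mod P Q" if P: "P \<in> projs s" "indecomposable P" for P
  proof -
    have mP: "P \<in> mods s" and rP: "right_module P" using projsD(1)[OF P(1)] by auto
    obtain r :: nat and b' c where d: "\<forall>j<r. b' j \<in> carr P" "\<forall>j<r. c j \<in> hom P ?R"
      "\<forall>x\<in>carr P. x = (\<Sum>j<r. act P (b' j) (c j x))" "\<forall>x\<in>carr P. (\<forall>j<r. c j x = 0) \<longrightarrow> x = 0"
      by (rule dual_basis[OF P(1)])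
    have h: "(\<lambda>x. act P (b' j) (c j x)) \<in> hom P P" if "j \<in> {..<r}" for j
      using hom_regular_act[OF rP] d(1,2) that by blast
    have bs: "bij_betw (\<lambda>x. \<Sum>j\<in>{..<r}. act P (b' j) (c j x)) (carr P) (carr P)"
      by (rule bij_betw_byWitness[where f' = "\<lambda>x. x"]) (use d(3) in \<open>auto simp flip: bspec[OF d(3)]\<close>)
    have "\<exists>j\<in>{..<r}. bij_betw (\<lambda>x. act P (b' j) (c j x)) (carr P) (carr P)"
      by (rule indecomposable_local_sum[OF mP P(2) finite_lessThan h bs])
    then obtain j where j: "j < r" "bij_betw (\<lambda>x. act P (b' j) (c j x)) (carr P) (carr P)" by blast
    have hj: "(\<lambda>x. act P (b' j) (c j x)) \<in> hom P P" using h j(1) by simp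
    obtain t where t: "t \<in> hom P P" "\<forall>x\<in>carr P. t (act P (b' j) (c j x)) = x"
      "\<forall>x\<in>carr P. act P (b' j) (c j (t x)) = x"
      by (rule hom_inverse[OF rP rP hj j(2)])
    have bj: "b' j \<in> carr P" "c j \<in> hom P ?R" using d(1,2) j(1) by auto
    have "retract P ?R"
      by (rule retractI[OF bj(2) hom_comp_in[OF rP hom_from_regular[OF rP bj(1)] t(1)] t(2)])
    then have "retract P L"
      using retract_trans[OF _ iso_retract[OF L(2) right_module_regular rL] right_module_regular] by blast
    then obtain Y where Y: "Y \<in> set Ys" "iso_mod P Y"
      using krull_schmidt[OF mP P(2) rL b Ys] by blast
    then have "iso_class s P \<in> iso_class s ` I"
      using I(3) iso_class_eq_iff[OF mP, of Y] Ys by auto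
    then obtain Q where Q: "Q \<in> I" "iso_class s P = iso_class s Q" by blast
    then show ?thesis using iso_class_eq_iff[OF mP, of Q] IP projsD(1) by blast
  qed
  show ?thesis
    using finite_subset[OF I(1)] IP uniq all card by (intro exI[of _ I]) auto
qed

text \<open>The vertices of the quiver.\<close>

definition ind_proj :: "('a, nat \<Rightarrow> 'k) rmod set" where
  "ind_proj = (SOME I. finite I \<and> I \<subseteq> projs s \<and> (\<forall>P\<in>I. indecomposable P) \<and> (\<forall>P\<in>I. \<forall>Q\<in>I. iso_mod P Q \<longrightarrow> P = Q) \<and>
    (\<forall>P\<in>projs s. indecomposable P \<longrightarrow> (\<exists>Q\<in>I. iso_mod P Q)) \<and>
    card I = num_summands s (regular :: ('a, 'a) rmod))"

lemma ind_proj: "finite ind_proj" "ind_proj \<subseteq> projs s" "P \<in> ind_proj \<Longrightarrow> indecomposable P"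
  "P \<in> ind_proj \<Longrightarrow> Q \<in> ind_proj \<Longrightarrow> iso_mod P Q \<Longrightarrow> P = Q"
  "P \<in> projs s \<Longrightarrow> indecomposable P \<Longrightarrow> \<exists>Q\<in>ind_proj. iso_mod P Q"
  "card ind_proj = num_summands s (regular :: ('a, 'a) rmod)"
  using someI_ex[OF indecomposable_projectives] unfolding ind_proj_def[symmetric] by blast+

lemma ind_proj_mods: "P \<in> ind_proj \<Longrightarrow> P \<in> mods s" and ind_proj_projs: "P \<in> ind_proj \<Longrightarrow> P \<in> projs s"
  and ind_proj_proj: "P \<in> ind_proj \<Longrightarrow> projective s P" and ind_proj_rmod: "P \<in> ind_proj \<Longrightarrow> right_module P"
  using ind_proj(2) projsD by auto

text \<open>\<open>hom P M\<close> plays the role of the component of \<open>M\<close> at the vertex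
  \<open>P\<close>.\<close>

definition supp :: "('a, nat \<Rightarrow> 'k) rmod \<Rightarrow> ('a, nat \<Rightarrow> 'k) rmod set" where
  "supp M = {P \<in> ind_proj. hom P M \<noteq> {0}}"

lemma suppI: "P \<in> ind_proj \<Longrightarrow> f \<in> hom P M \<Longrightarrow> f x \<noteq> 0 \<Longrightarrow> P \<in> supp M"
  unfolding supp_def using hom_zeroD by blast

lemma suppE:
  assumes "P \<in> supp M" "M \<in> mods s"
  obtains f x where "P \<in> ind_proj" "f \<in> hom P M" "x \<in> carr P" "f x \<noteq> 0"
  using assms hom_zero_iff[OF mods_rmod[OF assms(2)]] unfolding supp_def by blast

lemma supp_sub: "submodule U M \<Longrightarrow> M \<in> mods s \<Longrightarrow> supp (submod M U) \<subseteq> supp M"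
proof
  fix P assume a: "submodule U M" "M \<in> mods s" "P \<in> supp (submod M U)"
  obtain f x where f: "P \<in> ind_proj" "f \<in> hom P (submod M U)" "x \<in> carr P" "f x \<noteq> 0"
    by (rule suppE[OF a(3) submod_mods[OF a(2,1)]])
  then show "P \<in> supp M" using suppI hom_submod_ext submodule_subset a(1) by blast
qed

lemma supp_quotient:
  assumes M: "M \<in> mods s" and Q: "Q \<in> mods s" and q: "epi M Q q" shows "supp Q \<subseteq> supp M"
proof
  fix P assume P: "P \<in> supp Q"
  obtain f x where f: "P \<in> ind_proj" "f \<in> hom P Q" "x \<in> carr P" "f x \<noteq> 0" by (rule suppE[OF P Q])
  obtain h where h: "h \<in> hom P M" "\<forall>x. q (h x) = f x"
    by (rule projective_lift[OF ind_proj_proj[OF f(1)] M Q q f(2)])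
  have "h x \<noteq> 0" using f(4) h(2) hom_zero[OF mods_rmod[OF M] epi_hom[OF q]] by metis
  then show "P \<in> supp M" using suppI[OF f(1) h(1)] by blast
qed

lemma supp_retract:
  assumes M: "M \<in> mods s" and X: "X \<in> mods s" and r: "retract X M" shows "supp X \<subseteq> supp M"
proof -
  obtain i p where ip: "i \<in> hom X M" "p \<in> hom M X" "\<forall>x\<in>carr X. p (i x) = x" using r by (rule retractE)
  have "epi M X p" by (rule epiI[OF ip(2)]) (use ip hom_in[OF ip(1)] in blast)
  then show ?thesis using supp_quotient[OF M X] by blast
qed

lemma supp_iso:
  assumes "M \<in> mods s" "N \<in> mods s" "iso_mod M N" shows "supp M = supp N"
  using supp_retract[OF assms(1,2)] supp_retract[OF assms(2,1)] iso_retract[OF assms(3)]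
    iso_retract[OF iso_mod_sym[OF assms(3)]] assms(1,2) by auto

lemma supp_biprod:
  assumes M: "M \<in> mods s" and b: "biprod M Xs i p" and Xs: "set Xs \<subseteq> mods s"
  shows "supp M = (\<Union>X\<in>set Xs. supp X)"
proof
  show "supp M \<subseteq> (\<Union>X\<in>set Xs. supp X)"
  proof
    fix P assume P: "P \<in> supp M"
    obtain f x where f: "P \<in> ind_proj" "f \<in> hom P M" "x \<in> carr P" "f x \<noteq> 0" by (rule suppE[OF P M])
    have "\<exists>l<length Xs. p l (f x) \<noteq> 0"
    proof (rule ccontr)
      assume "\<not> ?thesis"
      moreover have "i l 0 = 0" if "l < length Xs" for l
      proof -
        have "Xs ! l \<in> mods s" using Xs that by auto
        then show ?thesis using hom_zero[OF mods_rmod biprodD(1)[OF b that]] by blast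
      qed
      ultimately have "i l (p l (f x)) = 0" if "l < length Xs" for l using that by auto
      then have "(\<Sum>l<length Xs. i l (p l (f x))) = 0" by (intro sum.neutral) simp
      then show False using biprodD(4)[OF b hom_in[OF f(2,3)]] f(4) by simp
    qed
    then obtain l where l: "l < length Xs" "p l (f x) \<noteq> 0" by blast
    have "P \<in> supp (Xs ! l)"
      using suppI[OF f(1) hom_comp_in[OF mods_rmod[OF M] f(2) biprodD(2)[OF b l(1)]] l(2)] .
    then show "P \<in> (\<Union>X\<in>set Xs. supp X)" using l(1) by auto
  qed
  show "(\<Union>X\<in>set Xs. supp X) \<subseteq> supp M"
  proof
    fix P assume "P \<in> (\<Union>X\<in>set Xs. supp X)"
    then obtain l where l: "l < length Xs" "P \<in> supp (Xs ! l)" by (metis UN_E in_set_conv_nth)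
    have "Xs ! l \<in> mods s" using Xs l(1) by auto
    then show "P \<in> supp M" using supp_retract[OF M _ biprod_retract[OF b l(1)]] l(2) by blast
  qed
qed

text \<open>A nonzero map is nonzero on some indecomposable summand of \<open>X\<close>. This is how
  a map from a kernel that is merely known to be projective is referred to a vertex.\<close>

lemma supp_projective:
  assumes X: "X \<in> projs s" and M: "M \<in> mods s" and nz: "hom X M \<noteq> {0}"
  shows "\<exists>P\<in>supp M. \<exists>Y. retract Y X \<and> Y \<in> mods s \<and> iso_mod P Y"
proof -
  have mX: "X \<in> mods s" and rX: "right_module X" and rM: "right_module M" using projsD(1)[OF X] M by auto
  obtain f x where f: "f \<in> hom X M" "x \<in> carr X" "f x \<noteq> 0"
    using nz hom_zero_iff[OF rM] by blast
  obtain Ys i p where Ys: "\<forall>Y\<in>set Ys. Y \<in> mods s \<and> indecomposable Y" and b: "biprod X Ys i p"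
    using decomposition[OF mX] by blast
  have "\<exists>l<length Ys. f (i l (p l x)) \<noteq> 0"
  proof (rule ccontr)
    assume a: "\<not> ?thesis"
    have "f x = f (\<Sum>l<length Ys. i l (p l x))" using biprodD(4)[OF b f(2)] by simp
    also have "\<dots> = (\<Sum>l<length Ys. f (i l (p l x)))"
      by (rule hom_sum[OF rX f(1)])
        (use f(2) in \<open>auto intro!: hom_in[OF biprodD(1)[OF b]] hom_in[OF biprodD(2)[OF b]]\<close>)
    also have "\<dots> = 0" using a by (intro sum.neutral) simp
    finally show False using f(3) by simp
  qed
  then obtain l where l: "l < length Ys" "f (i l (p l x)) \<noteq> 0" by blast
  have Y: "Ys ! l \<in> mods s" "indecomposable (Ys ! l)" and rY: "right_module (Ys ! l)" using Ys l(1) by auto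
  have r: "retract (Ys ! l) X" using biprod_retract[OF b l(1)] .
  have "projective s (Ys ! l)" by (rule projective_retract[OF rY rX r projsD(2)[OF X]])
  then have "Ys ! l \<in> projs s" using Y by (simp add: projs_def)
  then obtain P where P: "P \<in> ind_proj" "iso_mod (Ys ! l) P" using ind_proj(5) Y(2) by blast
  have rP: "right_module P" using ind_proj_rmod[OF P(1)] .
  obtain u t where ut: "u \<in> hom (Ys ! l) P" "t \<in> hom P (Ys ! l)" "\<forall>x\<in>carr (Ys ! l). t (u x) = x"
    "\<forall>y\<in>carr P. u (t y) = y" by (rule iso_modE[OF P(2) rY rP])
  have h: "(\<lambda>y. f (i l (t y))) \<in> hom P M"
    using hom_comp_in[OF rX hom_comp_in[OF rY ut(2) biprodD(1)[OF b l(1)]] f(1)] .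
  have "f (i l (t (u (p l x)))) \<noteq> 0"
    using ut(3) hom_in[OF biprodD(2)[OF b l(1)] f(2)] l(2) by simp
  then have "P \<in> supp M" using suppI[OF P(1) h, of "u (p l x)"] by blast
  then show ?thesis using r Y(1) iso_mod_sym[OF P(2) rY rP] by blast
qed

lemma supp_empty_iff:
  assumes M: "M \<in> mods s" shows "supp M = {} \<longleftrightarrow> carr M = {0}"
proof
  assume "supp M = {}"
  obtain F e where F: "F \<in> projs s" and e: "epi F M e" by (rule cover[OF M])
  have "hom F M = {0}" using supp_projective[OF F M] \<open>supp M = {}\<close> by blast
  then have "e = 0" using epi_hom[OF e] by blast
  then have "y = 0" if "y \<in> carr M" for y using epi_surj[OF e that] by auto
  then show "carr M = {0}" using right_module.zero_closed[OF mods_rmod[OF M]] by blast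
next
  assume c: "carr M = {0}"
  show "supp M = {}"
  proof (rule ccontr)
    assume "supp M \<noteq> {}"
    then obtain P where P: "P \<in> supp M" by blast
    obtain f x where "P \<in> ind_proj" "f \<in> hom P M" "x \<in> carr P" "f x \<noteq> 0" by (rule suppE[OF P M])
    then show False using hom_in[of f P M x] c by auto
  qed
qed

text \<open>Lift the two epimorphisms along each other. The composite \<open>g f\<close> induces the
  identity on the nonzero module \<open>V\<close>, so it is not nilpotent and must be bijective by
  \<open>fitting\<close>.\<close>

lemma indecomposable_projective_top:
  assumes P: "P \<in> projs s" "indecomposable P" and P': "P' \<in> projs s" "indecomposable P'"
    and V: "V \<in> mods s" "carr V \<noteq> {0}" and q: "epi P V q" and q': "epi P' V q'"
  shows "iso_mod P P'"
proof -
  have mP: "P \<in> mods s" "P' \<in> mods s" and rP: "right_module P" "right_module P'"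
    using projsD(1)[OF P(1)] projsD(1)[OF P'(1)] by auto
  obtain f where f: "f \<in> hom P P'" "\<forall>x. q' (f x) = q x"
    by (rule projective_lift[OF projsD(2)[OF P(1)] mP(2) V(1) q' epi_hom[OF q]])
  obtain g where g: "g \<in> hom P' P" "\<forall>x. q (g x) = q' x"
    by (rule projective_lift[OF projsD(2)[OF P'(1)] mP(1) V(1) q epi_hom[OF q']])
  have gf: "(\<lambda>x. g (f x)) \<in> hom P P" using hom_comp_in[OF rP(2) f(1) g(1)] .
  have pow: "q (((\<lambda>x. g (f x)) ^^ n) x) = q x" for n x
    using f(2) g(2) by (induction n) auto
  have "bij_betw (\<lambda>x. g (f x)) (carr P) (carr P)"
  proof (rule ccontr)
    assume "\<not> ?thesis"
    then obtain n where n: "\<forall>x\<in>carr P. ((\<lambda>x. g (f x)) ^^ n) x = 0" using fitting[OF mP(1) P(2) gf] by blast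
    have "y = 0" if y: "y \<in> carr V" for y
    proof -
      obtain x where x: "x \<in> carr P" "q x = y" using epi_surj[OF q y] by blast
      then show ?thesis using pow[of n x] n hom_zero[OF rP(1) epi_hom[OF q]] by simp
    qed
    then show False using V right_module.zero_closed[OF mods_rmod[OF V(1)]] by blast
  qed
  then have "bij_betw f (carr P) (carr P')"
    by (rule split_mono_indecomposable[OF rP(1) indecomposable_nz[OF P(2)] rP(2) P'(2) f(1) g(1)])
  then show ?thesis using f(1) iso_mod_def by blast
qed

section \<open>Simple modules and traces\<close>

definition simple_mod :: "('a, nat \<Rightarrow> 'k) rmod \<Rightarrow> bool" where
  "simple_mod S \<longleftrightarrow> S \<in> mods s \<and> carr S \<noteq> {0} \<and> (\<forall>U. submodule U S \<longrightarrow> U = {0} \<or> U = carr S)"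

lemma simple_epi:
  assumes S: "simple_mod S" and M: "right_module M" and f: "f \<in> hom M S" and x: "x \<in> carr M" "f x \<noteq> 0"
  shows "epi M S f"
proof -
  have rS: "right_module S" using S unfolding simple_mod_def by simp
  have "submodule (f ` carr M) S" using image_submodule[OF M rS f submodule_carr[OF M]] .
  moreover have "f ` carr M \<noteq> {0}" using x by blast
  ultimately show ?thesis using S f unfolding simple_mod_def epi_def by blast
qed

lemma simple_quotient:
  assumes M: "M \<in> mods s" "carr M \<noteq> {0}"
  obtains S q where "simple_mod S" "epi M S q"
proof -
  have rM: "right_module M" using M by simp
  let ?P = "\<lambda>U. submodule U M \<and> U \<noteq> carr M"
  have P0: "?P {0}" using rM M(2) by auto
  obtain U where U: "?P U" "\<forall>U'. ?P U' \<longrightarrow> dm M - dm (submod M U) \<le> dm M - dm (submod M U')"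
    using ex_has_least_nat[of ?P "{0}" "\<lambda>U. dm M - dm (submod M U)"] P0 by blast
  have max: "dm (submod M U') \<le> dm (submod M U)" if "?P U'" for U'
    using spec[OF U(2), of U'] that dm_sub_less[OF M(1), of U'] by linarith
  obtain Q q where Q: "Q \<in> mods s" and q: "epi M Q q" and k: "\<forall>x\<in>carr M. q x = 0 \<longleftrightarrow> x \<in> U"
    using quotient[OF M(1)] U(1) by metis
  have rQ: "right_module Q" using Q by simp
  have qh: "q \<in> hom M Q" using epi_hom[OF q] .
  have "simple_mod Q" unfolding simple_mod_def
  proof (intro conjI Q allI impI)
    obtain x where "x \<in> carr M" "x \<notin> U" using U(1) submodule_subset by blast
    then show "carr Q \<noteq> {0}" using k hom_in[OF qh] by fastforce
    fix W assume W: "submodule W Q"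
    let ?W = "{x \<in> carr M. q x \<in> W}"
    have sW: "submodule ?W M" using preimage_submodule[OF rM rQ qh W] .
    have UW: "U \<subseteq> ?W"
    proof
      fix x assume x: "x \<in> U"
      then have xM: "x \<in> carr M" using U(1) submodule_in by blast
      then have "q x = 0" using k x by blast
      then show "x \<in> ?W" using xM submodule_zero[OF W] by simp
    qed
    show "W = {0} \<or> W = carr Q"
    proof (cases "?W = carr M")
      case True
      then have "W = carr Q" using epi_surj[OF q] submodule_subset[OF W] by fastforce
      then show ?thesis by blast
    next
      case False
      then have le: "dm (submod M ?W) \<le> dm (submod M U)" using max sW by blast
      have "U = carr (submod M ?W)"
        by (rule dm_sub_eq[OF submod_mods[OF M(1) sW] submodule_submod[OF _ UW]]) (use U(1) le in simp_all)
      then have "?W = U" by simp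
      then have "w = 0" if w: "w \<in> W" for w
      proof -
        obtain x where x: "x \<in> carr M" "q x = w" using epi_surj[OF q submodule_in[OF W w]] by blast
        then have "x \<in> U" using w \<open>?W = U\<close> by blast
        then show ?thesis using k x by blast
      qed
      then show ?thesis using submodule_zero[OF W] by blast
    qed
  qed
  then show thesis using that q by blast
qed

lemma simple_submodule:
  assumes M: "M \<in> mods s" "carr M \<noteq> {0}"
  obtains U where "submodule U M" "simple_mod (submod M U)"
proof -
  have rM: "right_module M" using M by simp
  let ?P = "\<lambda>U. submodule U M \<and> U \<noteq> {0}"
  have P0: "?P (carr M)" using rM M(2) by auto
  obtain U where U: "?P U" "\<forall>U'. ?P U' \<longrightarrow> dm (submod M U) \<le> dm (submod M U')"
    using ex_has_least_nat[of ?P "carr M" "\<lambda>U. dm (submod M U)"] P0 by blast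
  have sU: "submodule U M" using U(1) by blast
  have mU: "submod M U \<in> mods s" using submod_mods[OF M(1) sU] .
  have "simple_mod (submod M U)" unfolding simple_mod_def
  proof (intro conjI mU allI impI)
    show "carr (submod M U) \<noteq> {0}" using U(1) by simp
    fix W assume W: "submodule W (submod M U)"
    show "W = {0} \<or> W = carr (submod M U)"
    proof (cases "W = {0}")
      case False
      then have "dm (submod M U) \<le> dm (submod (submod M U) W)"
        using U(2) submodule_trans[OF sU W] by simp
      then show ?thesis using dm_sub_eq[OF mU W] by blast
    qed blast
  qed
  then show thesis using that sU by blast
qed

text \<open>Every vertex in the support maps onto \<open>S\<close>, and projective indecomposables
  with a common nonzero quotient are isomorphic.\<close>

lemma supp_simple:
  assumes S: "simple_mod S"
  obtains P q where "P \<in> ind_proj" "supp S = {P}" "epi P S q"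
proof -
  have mS: "S \<in> mods s" and nz: "carr S \<noteq> {0}" using S unfolding simple_mod_def by auto
  have ep: "\<exists>q. epi P S q" if P: "P \<in> supp S" for P
  proof -
    obtain f x where "P \<in> ind_proj" "f \<in> hom P S" "x \<in> carr P" "f x \<noteq> 0" by (rule suppE[OF P mS])
    then show ?thesis using simple_epi[OF S ind_proj_rmod] by blast
  qed
  obtain P where P: "P \<in> supp S" using supp_empty_iff[OF mS] nz by blast
  obtain q where q: "epi P S q" using ep[OF P] by blast
  have "P' = P" if P': "P' \<in> supp S" for P'
  proof -
    obtain q' where q': "epi P' S q'" using ep[OF P'] by blast
    have i: "P' \<in> ind_proj" "P \<in> ind_proj" using P P' supp_def by auto
    have "iso_mod P' P"
      by (rule indecomposable_projective_top[OF ind_proj_projs[OF i(1)] ind_proj(3)[OF i(1)]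
            ind_proj_projs[OF i(2)] ind_proj(3)[OF i(2)] mS nz q' q])
    then show ?thesis using ind_proj(4) i by blast
  qed
  then have "supp S = {P}" using P by blast
  then show thesis using that P q supp_def by blast
qed

text \<open>An image of largest dimension exists because dimensions are bounded by that of
  \<open>X\<close>; closure of \<open>C\<close> under sums makes it contain all other images. It is
  needed once for a projective modulo the part generated by other vertices and once for the order on
  tilting modules.\<close>

lemma trace:
  assumes C: "C \<subseteq> mods s" "T \<in> C" and X: "X \<in> mods s"
    and sum: "\<And>W W' D i p. W \<in> C \<Longrightarrow> W' \<in> C \<Longrightarrow> D \<in> mods s \<Longrightarrow> biprod D [W, W'] i p \<Longrightarrow> D \<in> C"
  obtains W g where "W \<in> C" "g \<in> hom W X"
    "\<forall>W'\<in>C. \<forall>g'\<in>hom W' X. \<forall>x\<in>carr W'. g' x \<in> g ` carr W"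
proof -
  have rX: "right_module X" using X by simp
  let ?P = "\<lambda>(W, g). W \<in> C \<and> g \<in> hom W X"
  let ?d = "\<lambda>(W, g). dm (submod X (g ` carr W))"
  have sub: "submodule (g ` carr W) X" if "?P (W, g)" for W g
  proof -
    have g: "g \<in> hom W X" and rW: "right_module W" using that C(1) by auto
    show ?thesis by (rule image_submodule[OF rW rX g submodule_carr[OF rW]])
  qed
  have P0: "?P (T, \<lambda>_. 0)" using C(2) rX by simp
  have bound: "\<forall>y. ?P y \<longrightarrow> ?d y \<le> dm X" using sub dm_sub_le[OF X] by auto
  obtain y where y: "?P y" "\<forall>y'. ?P y' \<longrightarrow> ?d y' \<le> ?d y"
    using Lattices_Big.ex_has_greatest_nat[of ?P "(T, \<lambda>_. 0)" ?d "Suc (dm X)"] P0 bound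
    by (metis (no_types, lifting) le_imp_less_Suc)
  obtain W g where Wg: "y = (W, g)" by (cases y)
  have W: "W \<in> C" "g \<in> hom W X" using y(1) Wg by auto
  have "g' x \<in> g ` carr W" if W': "W' \<in> C" "g' \<in> hom W' X" "x \<in> carr W'" for W' g' x
  proof -
    have m: "W \<in> mods s" "W' \<in> mods s" using W(1) W'(1) C(1) by auto
    have rm: "right_module W" "right_module W'" using m by auto
    obtain D i j p q where D: "D \<in> mods s" "i \<in> hom W D" "j \<in> hom W' D" "p \<in> hom D W" "q \<in> hom D W'"
      "\<forall>x\<in>carr W. p (i x) = x \<and> q (i x) = 0" "\<forall>y\<in>carr W'. p (j y) = 0 \<and> q (j y) = y"
      "\<forall>d\<in>carr D. d = i (p d) + j (q d)" "biprod D [W, W'] (\<lambda>n. if n = 0 then i else j) (\<lambda>n. if n = 0 then p else q)"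
      by (rule direct_sum2[OF m])
    have DC: "D \<in> C" using sum[OF W(1) W'(1) D(1,9)] .
    define h where "h = (\<lambda>d. g (p d) + g' (q d))"
    have h: "h \<in> hom D X" unfolding h_def
      by (rule hom_plus[OF rX hom_comp_in[OF rm(1) D(4) W(2)] hom_comp_in[OF rm(2) D(5) W'(2)]])
    have hi: "h (i w) = g w" if "w \<in> carr W" for w
      unfolding h_def using D(6) that hom_zero[OF rm(2) W'(2)] by simp
    have hj: "h (j w) = g' w" if "w \<in> carr W'" for w
      unfolding h_def using D(7) that hom_zero[OF rm(1) W(2)] by simp
    have s1: "submodule (h ` carr D) X" and s2: "submodule (g ` carr W) X" using sub DC h W by auto
    have le: "dm (submod X (h ` carr D)) \<le> dm (submod X (g ` carr W))"
      using spec[OF y(2), of "(D, h)"] DC h Wg by simp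
    have gh: "g ` carr W \<subseteq> h ` carr D"
    proof
      fix y assume "y \<in> g ` carr W"
      then obtain w where w: "w \<in> carr W" "y = g w" by blast
      then have "y = h (i w)" using hi by simp
      then show "y \<in> h ` carr D" using hom_in[OF D(2) w(1)] by blast
    qed
    \<comment> \<open>The image of the sum map \<open>h\<close> contains that of \<open>g\<close>,
      so it equals it by maximality and captures the values of \<open>g'\<close>.\<close>
    have "g ` carr W = carr (submod X (h ` carr D))"
      by (rule dm_sub_eq[OF submod_mods[OF X s1] submodule_submod[OF s2 gh]]) (use le in simp)
    moreover have "g' x \<in> h ` carr D" using hj[OF W'(3)] hom_in[OF D(3) W'(3)] by (metis imageI)
    ultimately show ?thesis by simp
  qed
  then show thesis using that[OF W] by blast
qed

text \<open>\<open>Q\<close> plays the role of the indecomposable projective at \<open>P\<close>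
  over the quotient of the algebra by the idempotent of the vertices in \<open>F\<close>. It is
  obtained inside \<open>mods s\<close> as a quotient of \<open>P\<close>, without forming another
  algebra.\<close>

lemma projective_mod_trace:
  assumes F: "F \<subseteq> ind_proj" and P: "P \<in> ind_proj" "P \<notin> F"
  shows "\<exists>Q q. Q \<in> mods s \<and> epi P Q q \<and> indecomposable Q \<and> supp Q \<inter> F = {} \<and>
    (\<forall>Y\<in>mods s. supp Y \<inter> F = {} \<longrightarrow> Ext0 Q Y)"
proof -
  note mP = ind_proj_mods[OF P(1)] and rP = ind_proj_rmod[OF P(1)] and pP = ind_proj_proj[OF P(1)]
  \<comment> \<open>This class contains the projectives in \<open>F\<close> and is closed under
    sums, so dividing by its trace removes \<open>F\<close> from the support, while maps from that
    trace to modules supported off \<open>F\<close> are zero.\<close>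
  define C where "C = {W \<in> mods s. \<forall>Y\<in>mods s. supp Y \<inter> F = {} \<longrightarrow> hom W Y = {0}}"
  obtain Z where Z: "Z \<in> mods s" "carr Z = {0}" by (rule zero_module)
  have ZC: "Z \<in> C" unfolding C_def using Z hom_from_zero[OF mods_rmod] by blast
  have CD: "f x = 0" if "W \<in> C" "Y \<in> mods s" "supp Y \<inter> F = {}" "f \<in> hom W Y" for W Y f x
    using that hom_zeroD unfolding C_def by blast
  have sum: "D \<in> C" if W: "W \<in> C" "W' \<in> C" and D: "D \<in> mods s" and b: "biprod D [W, W'] i p" for W W' D i p
  proof -
    have "f x = 0" if Y: "Y \<in> mods s" "supp Y \<inter> F = {}" and f: "f \<in> hom D Y" and x: "x \<in> carr D" for Y f x
    proof -
      have rD: "right_module D" using D by simp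
      have i: "i 0 \<in> hom W D" "i 1 \<in> hom W' D" "p 0 \<in> hom D W" "p 1 \<in> hom D W'"
        using biprodD(1,2)[OF b, of 0] biprodD(1,2)[OF b, of 1] by auto
      have "x = i 0 (p 0 x) + i 1 (p 1 x)" using biprodD(4)[OF b x] by (simp add: lessThan_Suc add.commute)
      then have "f x = f (i 0 (p 0 x)) + f (i 1 (p 1 x))"
        using hom_add[OF f hom_in[OF i(1) hom_in[OF i(3) x]] hom_in[OF i(2) hom_in[OF i(4) x]]] by simp
      then show ?thesis
        using CD[OF W(1) Y hom_comp_in[OF rD i(1) f]] CD[OF W(2) Y hom_comp_in[OF rD i(2) f]] by simp
    qed
    then have "hom D Y = {0}" if Y: "Y \<in> mods s" "supp Y \<inter> F = {}" for Y
      using hom_zero_iff[OF mods_rmod[OF Y(1)], of D] Y by blast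
    then show ?thesis unfolding C_def using D by blast
  qed
  have FC: "f \<in> C" if "f \<in> F" for f
    unfolding C_def supp_def using that F ind_proj_mods by auto
  have CM: "C \<subseteq> mods s" unfolding C_def by blast
  obtain W g where W: "W \<in> C" and g: "g \<in> hom W P"
    and max: "\<forall>W'\<in>C. \<forall>g'\<in>hom W' P. \<forall>x\<in>carr W'. g' x \<in> g ` carr W"
    using trace[OF CM ZC mP] sum by metis
  have rW: "right_module W" using W CM by auto
  let ?V = "g ` carr W"
  have V: "submodule ?V P" using image_submodule[OF rW rP g submodule_carr[OF rW]] .
  obtain Q q where Q: "Q \<in> mods s" and q: "epi P Q q" and k: "\<forall>x\<in>carr P. q x = 0 \<longleftrightarrow> x \<in> ?V"
    by (rule quotient[OF mP V])
  have rQ: "right_module Q" using Q by simp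
  have qh: "q \<in> hom P Q" using epi_hom[OF q] .
  have kq: "ker P q = ?V" using k submodule_in[OF V] by (auto simp: ker_def)
  have sQ: "supp Q \<inter> F = {}"
  proof (rule ccontr)
    assume "supp Q \<inter> F \<noteq> {}"
    then obtain f where f: "f \<in> supp Q" "f \<in> F" by blast
    obtain u x where u: "f \<in> ind_proj" "u \<in> hom f Q" "x \<in> carr f" "u x \<noteq> 0" by (rule suppE[OF f(1) Q])
    obtain h where h: "h \<in> hom f P" "\<forall>x. q (h x) = u x"
      by (rule projective_lift[OF ind_proj_proj[OF u(1)] mP Q q u(2)])
    have "h x \<in> ?V" using max FC[OF f(2)] h(1) u(3) by blast
    then have "q (h x) = 0" using k hom_in[OF h(1) u(3)] by blast
    then show False using h(2) u(4) by simp
  qed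
  have ext: "Ext0 Q Y" if Y: "Y \<in> mods s" "supp Y \<inter> F = {}" for Y
  proof (rule Ext0I[OF Q Y(1) ind_proj_projs[OF P(1)] q])
    fix f assume f: "f \<in> hom (submod P (ker P q)) Y"
    have gV: "g \<in> hom W (submod P ?V)" by (rule hom_corestrict[OF g]) (rule imageI)
    have fV: "f \<in> hom (submod P ?V) Y" using f unfolding kq .
    have "f v = 0" if v: "v \<in> ?V" for v
    proof -
      obtain w where "w \<in> carr W" "v = g w" using v by blast
      moreover have "f (g w) = 0" for w
        by (rule CD[OF W Y hom_comp_in[OF submodule_right_module[OF V] gV fV]])
      ultimately show ?thesis by simp
    qed
    then show "\<exists>h\<in>hom P Y. \<forall>x\<in>ker P q. h x = f x"
      unfolding kq using Y(1) by (intro bexI[of _ "\<lambda>_. 0"]) auto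
  qed
  \<comment> \<open>A simple quotient of \<open>P\<close> is supported at \<open>P\<close> alone,
    hence off \<open>F\<close>. Therefore \<open>r\<close> kills the trace, and \<open>Q\<close> is
    not zero.\<close>
  obtain S r where S: "simple_mod S" and r: "epi P S r"
    by (rule simple_quotient[OF mP indecomposable_nz[OF ind_proj(3)[OF P(1)]]])
  have mS: "S \<in> mods s" and nzS: "carr S \<noteq> {0}" using S unfolding simple_mod_def by auto
  obtain y where y: "y \<in> carr S" "y \<noteq> 0" using nzS right_module.zero_closed[OF mods_rmod[OF mS]] by blast
  obtain x where x: "x \<in> carr P" "r x = y" using epi_surj[OF r y(1)] by blast
  have PS: "P \<in> supp S" using suppI[OF P(1) epi_hom[OF r], of x] x y by blast
  obtain P' q' where P': "P' \<in> ind_proj" "supp S = {P'}" "epi P' S q'" by (rule supp_simple[OF S])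
  have SF: "supp S \<inter> F = {}" using PS P' P(2) by auto
  have "x \<notin> ?V"
  proof
    assume "x \<in> ?V"
    then obtain w where "w \<in> carr W" "x = g w" by blast
    then show False using CD[OF W mS SF hom_comp_in[OF rP g epi_hom[OF r]], of w] x y by simp
  qed
  then have qx: "q x \<noteq> 0" "q x \<in> carr Q" using k x hom_in[OF qh] by auto
  have "indecomposable Q" unfolding indecomposable_def
  proof (intro conjI allI impI)
    show "carr Q \<noteq> {0}" using qx by auto
    fix A B assume AB: "internal_sum Q A B"
    have sA: "submodule A Q" and sB: "submodule B Q" using AB unfolding internal_sum_def by auto
    obtain e f where e: "e \<in> hom Q (submod Q A)" "f \<in> hom Q (submod Q B)"
      "\<forall>x\<in>carr Q. x = e x + f x" "\<forall>u\<in>A. e u = u \<and> f u = 0" "\<forall>v\<in>B. e v = 0 \<and> f v = v"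
      by (rule internal_sum_projections[OF rQ AB])
    have eQ: "e \<in> hom Q Q" using hom_submod_ext[OF e(1) submodule_subset[OF sA]] .
    have eA: "e x \<in> A" if "x \<in> carr Q" for x using hom_in[OF e(1) that] by simp
    \<comment> \<open>The projection to the summand \<open>A\<close> of \<open>Q\<close> lifts to
      \<open>P\<close>. If \<open>t\<close> is bijective, then \<open>A\<close> is all of
      \<open>Q\<close>; if it is nilpotent, then \<open>A\<close> is zero.\<close>
    obtain t where t: "t \<in> hom P P" "\<forall>x. q (t x) = e (q x)"
      by (rule projective_lift[OF pP mP Q q hom_comp_in[OF rQ qh eQ]])
    have pow: "q ((t ^^ Suc n) x) = e (q x)" if "x \<in> carr P" for n x
    proof (induction n)
      case (Suc n)
      have "q ((t ^^ Suc (Suc n)) x) = e (q ((t ^^ Suc n) x))" using t(2) by simp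
      also have "\<dots> = e (e (q x))" using Suc by simp
      also have "\<dots> = e (q x)" using e(4) eA hom_in[OF qh that] by blast
      finally show ?case .
    qed (use t in simp)
    consider "bij_betw t (carr P) (carr P)" | n where "\<forall>x\<in>carr P. (t ^^ n) x = 0"
      using fitting[OF mP ind_proj(3)[OF P(1)] t(1)] by blast
    then show "A = {0} \<or> B = {0}"
    proof cases
      case 1
      have "b = 0" if b: "b \<in> B" for b
      proof -
        have bQ: "b \<in> carr Q" using submodule_in[OF sB b] .
        obtain x where x: "x \<in> carr P" "q x = b" using epi_surj[OF q bQ] by blast
        have "x \<in> t ` carr P" using 1 x(1) by (simp add: bij_betw_def)
        then obtain x' where x': "x' \<in> carr P" "t x' = x" by blast
        have "b = e (q x')" using t(2) x x' by metis
        then have "b \<in> A" using eA hom_in[OF qh x'(1)] by blast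
        then show ?thesis using AB b unfolding internal_sum_def by blast
      qed
      then show ?thesis using submodule_zero[OF sB] by blast
    next
      case 2
      have "a = 0" if a: "a \<in> A" for a
      proof -
        have aQ: "a \<in> carr Q" using submodule_in[OF sA a] .
        obtain x where x: "x \<in> carr P" "q x = a" using epi_surj[OF q aQ] by blast
        have "(t ^^ Suc n) x = 0" using 2 x(1) hom_zero[OF rP t(1)] by simp
        then have "e (q x) = 0" using pow[OF x(1), of n] hom_zero[OF rP qh] by simp
        then show ?thesis using e(4) a x(2) by simp
      qed
      then show ?thesis using submodule_zero[OF sA] by blast
    qed
  qed
  then show ?thesis using Q q sQ ext by blast
qed

section \<open>The Happel-Ringel lemma and linear independence of index vectors\<close>

text \<open>
  Let \<open>I\<close> be the image of \<open>f\<close>, let \<open>P\<close> be a projective module onto \<open>C = B/I\<close> with kernel \<open>O\<close>, and lift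
  \<open>P \<rightarrow> C\<close> to \<open>u: P \<rightarrow> B\<close>. As \<open>O\<close> is projective, \<open>u\<close> on \<open>O\<close> is \<open>f \<circ> v\<close> for some \<open>v: O \<rightarrow> A\<close>. The
  kernel of \<open>I \<oplus> P \<rightarrow> B\<close> is \<open>O\<close>, and extending \<open>v\<close> to \<open>I \<oplus> P\<close> gives maps \<open>g: I \<rightarrow> A\<close> and \<open>\<beta>: P \<rightarrow> A\<close> with
  \<open>\<beta> = (1 + g \<circ> f) \<circ> v\<close> on \<open>O\<close>. As \<open>End A\<close> is local, either \<open>g \<circ> f\<close> is bijective, or \<open>1 + g \<circ> f\<close> is, and
  then \<open>B \<rightarrow> C\<close> splits.
\<close>

lemma happel_ringel:
  assumes A: "A \<in> mods s" "indecomposable A" and B: "B \<in> mods s" "indecomposable B"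
    and E: "Ext0 B A" and f: "f \<in> hom A B" and nz: "x0 \<in> carr A" "f x0 \<noteq> 0"
  shows "inj_on f (carr A) \<or> epi A B f"
proof -
  have rA: "right_module A" and rB: "right_module B" using A B by auto
  let ?I = "f ` carr A"
  have I: "submodule ?I B" using image_submodule[OF rA rB f submodule_carr[OF rA]] .
  have mI: "submod B ?I \<in> mods s" and rI: "right_module (submod B ?I)"
    using submod_mods[OF B(1) I] submodule_right_module[OF I] by auto
  obtain C q where C: "C \<in> mods s" and q: "epi B C q" and k: "\<forall>x\<in>carr B. q x = 0 \<longleftrightarrow> x \<in> ?I"
    by (rule quotient[OF B(1) I])
  have rC: "right_module C" using C by simp
  have qh: "q \<in> hom B C" using epi_hom[OF q] .
  obtain P e where P: "P \<in> projs s" and e: "epi P C e" by (rule cover[OF C])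
  have mP: "P \<in> mods s" and rP: "right_module P" using projsD(1)[OF P] by auto
  obtain u where u: "u \<in> hom P B" "\<forall>x. q (u x) = e x"
    by (rule projective_lift[OF projsD(2)[OF P] B(1) C q epi_hom[OF e]])
  let ?O = "ker P e"
  have O: "submodule ?O P" using epi_ker_submodule[OF e mP C] .
  have uO: "rst ?O u \<in> hom (submod P ?O) (submod B ?I)"
  proof (rule hom_corestrict[OF hom_rst[OF u(1) O]])
    fix x assume "x \<in> carr (submod P ?O)"
    then show "rst ?O u x \<in> ?I" using k u(2) hom_in[OF u(1), of x] by (auto simp: ker_def)
  qed
  have fI: "epi A (submod B ?I) f" using hom_corestrict[OF f] unfolding epi_def by simp
  obtain v where v: "v \<in> hom (submod P ?O) A" "\<forall>x. f (v x) = rst ?O u x"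
    by (rule projective_lift[OF projsD(2)[OF ker_projs[OF P C e]] A(1) mI fI uO])
  obtain D i j p r where D: "D \<in> mods s" "i \<in> hom (submod B ?I) D" "j \<in> hom P D"
    "p \<in> hom D (submod B ?I)" "r \<in> hom D P"
    "\<forall>x\<in>carr (submod B ?I). p (i x) = x \<and> r (i x) = 0" "\<forall>y\<in>carr P. p (j y) = 0 \<and> r (j y) = y"
    "\<forall>d\<in>carr D. d = i (p d) + j (r d)"
    by (rule direct_sum2[OF mI mP])
  have rD: "right_module D" using D by simp
  have pB: "p \<in> hom D B" using hom_submod_ext[OF D(4) submodule_subset[OF I]] .
  define z where "z = (\<lambda>d. p d + u (r d))"
  have zh: "z \<in> hom D B" unfolding z_def by (rule hom_plus[OF rB pB hom_comp_in[OF rP D(5) u(1)]])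
  have ij: "i a + j y \<in> carr D \<and> p (i a + j y) = a \<and> r (i a + j y) = y" if ay: "a \<in> ?I" "y \<in> carr P" for a y
  proof -
    have ia: "i a \<in> carr D" and jy: "j y \<in> carr D" using hom_in[OF D(2)] hom_in[OF D(3)] ay by auto
    have "p (i a + j y) = a" using hom_add[OF D(4) ia jy] D(6,7) ay by simp
    moreover have "r (i a + j y) = y" using hom_add[OF D(5) ia jy] D(6,7) ay by simp
    ultimately show ?thesis using ia jy rD by simp
  qed
  have ze: "epi D B z"
  proof (rule epiI[OF zh])
    fix b assume b: "b \<in> carr B"
    obtain x where x: "x \<in> carr P" "e x = q b" using epi_surj[OF e hom_in[OF qh b]] by blast
    have "q (b - u x) = 0" using hom_diff[OF rB qh b hom_in[OF u(1) x(1)]] u(2) x(2) by simp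
    then have a: "b - u x \<in> ?I" using k b hom_in[OF u(1) x(1)] rB by simp
    show "\<exists>d\<in>carr D. z d = b"
      by (rule bexI[of _ "i (b - u x) + j x"]) (use ij[OF a x(1)] in \<open>auto simp: z_def\<close>)
  qed
  have sz: "submodule (ker D z) D" using epi_ker_submodule[OF ze D(1) B(1)] .
  have "r d \<in> ?O" if d: "d \<in> ker D z" for d
  proof -
    have dD: "d \<in> carr D" and "z d = 0" using d by (auto simp: ker_def)
    then have "u (r d) = - p d" unfolding z_def by (simp add: eq_neg_iff_add_eq_0 add.commute)
    moreover have "p d \<in> ?I" using hom_in[OF D(4) dD] by simp
    ultimately have "u (r d) \<in> ?I" using submodule_uminus[OF I] by metis
    then have "q (u (r d)) = 0" using k hom_in[OF u(1) hom_in[OF D(5) dD]] by blast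
    then show ?thesis using u(2) hom_in[OF D(5) dD] by (simp add: ker_def)
  qed
  then have "rst (ker D z) r \<in> hom (submod D (ker D z)) (submod P ?O)"
    by (intro hom_corestrict[OF hom_rst[OF D(5) sz]]) simp
  then obtain H where H: "H \<in> hom D A" "\<forall>d\<in>ker D z. H d = v (rst (ker D z) r d)"
    using Ext0D[OF E D(1) ze hom_comp_in[OF submodule_right_module[OF O] _ v(1)]] by blast
  define g where "g = (\<lambda>b. H (i b))"
  define \<beta> where "\<beta> = (\<lambda>y. H (j y))"
  have g: "g \<in> hom (submod B ?I) A" unfolding g_def using hom_comp_in[OF rD D(2) H(1)] .
  have \<beta>: "\<beta> \<in> hom P A" unfolding \<beta>_def using hom_comp_in[OF rD D(3) H(1)] .
  have fi: "f \<in> hom A (submod B ?I)" using epi_hom[OF fI] .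
  have gf: "(\<lambda>x. g (f x)) \<in> hom A A" using hom_comp_in[OF rI fi g] .
  have key: "\<beta> w = v w + g (f (v w))" if w: "w \<in> ?O" for w
  proof -
    have wP: "w \<in> carr P" using submodule_in[OF O w] .
    have uw: "f (v w) = u w" using v(2) w by simp
    have vw: "v w \<in> carr A" using hom_in[OF v(1)] w by simp
    have uI: "u w \<in> ?I" using uw vw by (metis imageI)
    have mI': "- u w \<in> ?I" using submodule_uminus[OF I uI] .
    \<comment> \<open>The element of the kernel of \<open>z\<close> that corresponds to
      \<open>w\<close>; evaluating \<open>H\<close> there relates \<open>v w\<close>,
      \<open>g (u w)\<close> and \<open>\<beta> w\<close>.\<close>
    let ?d = "i (- u w) + j w"
    have dz: "?d \<in> ker D z" using ij[OF mI' wP] by (simp add: ker_def z_def)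
    have "v w = H ?d" using H(2) dz ij[OF mI' wP] by simp
    also have "\<dots> = H (i (- u w)) + H (j w)"
      by (rule hom_add[OF H(1)]) (use hom_in[OF D(2)] hom_in[OF D(3) wP] mI' in auto)
    also have "H (i (- u w)) = - g (u w)" using hom_uminus[OF rI g] uI by (simp add: g_def)
    finally have "v w = - g (u w) + \<beta> w" unfolding \<beta>_def .
    then have "\<beta> w = g (u w) + v w" by (simp only: add_minus_cancel)
    also have "\<dots> = v w + g (f (v w))" unfolding uw by (rule add.commute)
    finally show ?thesis .
  qed
  define \<alpha> where "\<alpha> = (\<lambda>x. idm A x + g (f x))"
  have \<alpha>: "\<alpha> \<in> hom A A" unfolding \<alpha>_def by (rule hom_plus[OF rA hom_idm[OF rA] gf])
  have ngf: "(\<lambda>x. - g (f x)) \<in> hom A A" by (rule hom_neg[OF rA gf])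
  have "bij_betw (\<lambda>x. \<alpha> x + - g (f x)) (carr A) (carr A)"
    by (rule bij_betw_byWitness[where f' = "\<lambda>x. x"]) (auto simp: \<alpha>_def)
  then consider "bij_betw \<alpha> (carr A) (carr A)" | "bij_betw (\<lambda>x. - g (f x)) (carr A) (carr A)"
    using indecomposable_local[OF A \<alpha> ngf] by blast
  then show ?thesis
  proof cases
    case 2
    then have inj: "inj_on (\<lambda>x. - g (f x)) (carr A)" unfolding bij_betw_def by blast
    have "inj_on f (carr A)"
    proof (rule inj_onI)
      fix x y assume xy: "x \<in> carr A" "y \<in> carr A" "f x = f y"
      then have "- g (f x) = - g (f y)" by simp
      then show "x = y" using inj_onD[OF inj _ xy(1,2)] by blast
    qed
    then show ?thesis by blast
  next
    case 1
    obtain \<alpha>' where \<alpha>': "\<alpha>' \<in> hom A A" "\<forall>x\<in>carr A. \<alpha>' (\<alpha> x) = x" "\<forall>x\<in>carr A. \<alpha> (\<alpha>' x) = x"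
      by (rule hom_inverse[OF rA rA \<alpha> 1])
    have b': "(\<lambda>y. \<alpha>' (\<beta> y)) \<in> hom P A" using hom_comp_in[OF rA \<beta> \<alpha>'(1)] .
    have fb: "(\<lambda>y. f (\<alpha>' (\<beta> y))) \<in> hom P B" using hom_comp_in[OF rA b' f] .
    have t: "(\<lambda>y. u y - f (\<alpha>' (\<beta> y))) \<in> hom P B" by (rule hom_minus[OF rB u(1) fb])
    have "u w - f (\<alpha>' (\<beta> w)) = 0" if w: "w \<in> carr P" "e w = 0" for w
    proof -
      have wO: "w \<in> ?O" using w by (simp add: ker_def)
      have vw: "v w \<in> carr A" using hom_in[OF v(1)] wO by simp
      have "\<beta> w = \<alpha> (v w)" using key[OF wO] vw by (simp add: \<alpha>_def)
      then have "\<alpha>' (\<beta> w) = v w" using \<alpha>'(2) vw by simp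
      then show ?thesis using v(2) wO by simp
    qed
    \<comment> \<open>With the inverse of \<open>1 + g f\<close>, the map \<open>u\<close> is
      corrected by values in \<open>?I\<close> so that it vanishes on \<open>ker P e\<close>; what
      descends to \<open>C\<close> is a section of \<open>q\<close>.\<close>
    then obtain \<sigma> where \<sigma>: "\<sigma> \<in> hom C B" "\<forall>y\<in>carr P. \<sigma> (e y) = u y - f (\<alpha>' (\<beta> y))"
      using epi_factor[OF rP rB e t] by blast
    have q\<sigma>: "q (\<sigma> c) = c" if c: "c \<in> carr C" for c
    proof -
      obtain y where y: "y \<in> carr P" "e y = c" using epi_surj[OF e c] by blast
      have fy: "f (\<alpha>' (\<beta> y)) \<in> ?I" "f (\<alpha>' (\<beta> y)) \<in> carr B" using hom_in[OF b' y(1)] hom_in[OF fb y(1)] by auto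
      have "\<sigma> c = u y - f (\<alpha>' (\<beta> y))" using \<sigma>(2) y by blast
      then have "q (\<sigma> c) = q (u y) - q (f (\<alpha>' (\<beta> y)))"
        using hom_diff[OF rB qh hom_in[OF u(1) y(1)] fy(2)] by simp
      also have "\<dots> = c" using u(2) y(2) k fy by simp
      finally show ?thesis .
    qed
    have sq: "(\<lambda>b. \<sigma> (q b)) \<in> hom B B" using hom_comp_in[OF rC qh \<sigma>(1)] .
    \<comment> \<open>The section yields an idempotent of the indecomposable \<open>B\<close>. If it
      is zero, then \<open>q\<close> is zero and \<open>f\<close> is onto; if it is the identity,
      then \<open>q\<close> is injective, against \<open>f x0\<close> being nonzero.\<close>
    consider "\<forall>b\<in>carr B. \<sigma> (q b) = 0" | "\<forall>b\<in>carr B. \<sigma> (q b) = b"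
      using indecomposable_idempotent[OF rB B(2) sq] q\<sigma> hom_in[OF qh] by auto
    then show ?thesis
    proof cases
      case 1
      have "b \<in> ?I" if b: "b \<in> carr B" for b
      proof -
        have "q b = q (\<sigma> (q b))" using q\<sigma>[OF hom_in[OF qh b]] by simp
        then have "q b = 0" using 1 b hom_zero[OF rB qh] by simp
        then show ?thesis using k b by blast
      qed
      then have "epi A B f" using f hom_in[OF f] unfolding epi_def by blast
      then show ?thesis by blast
    next
      case 2
      have fx: "f x0 \<in> ?I" "f x0 \<in> carr B" using nz hom_in[OF f] by auto
      then have "q (f x0) = 0" using k by blast
      then have "f x0 = 0" using bspec[OF 2 fx(2)] hom_zero[OF rC \<sigma>(1)] by simp
      then show ?thesis using nz by simp
    qed
  qed
qed

definition rigid_set :: "('a, nat \<Rightarrow> 'k) rmod set \<Rightarrow> bool" where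
  "rigid_set K \<longleftrightarrow> finite K \<and> (\<forall>M\<in>K. M \<in> mods s \<and> indecomposable M) \<and>
    (\<forall>M\<in>K. \<forall>N\<in>K. Ext0 M N) \<and> (\<forall>M\<in>K. \<forall>N\<in>K. iso_mod M N \<longrightarrow> M = N)"

text \<open>By the Happel-Ringel lemma no composition of a proper epimorphism and a proper monomorphism
  occurs, which excludes cycles.\<close>

lemma rigid_source:
  assumes K: "rigid_set K" "K \<noteq> {}"
  shows "\<exists>X\<in>K. \<forall>M\<in>K. M \<noteq> X \<longrightarrow> hom M X = {0}"
proof -
  have fin: "finite K" and m: "\<And>M. M \<in> K \<Longrightarrow> M \<in> mods s" "\<And>M. M \<in> K \<Longrightarrow> indecomposable M"
    and E: "\<And>M N. M \<in> K \<Longrightarrow> N \<in> K \<Longrightarrow> Ext0 M N"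
    and uniq: "\<And>M N. M \<in> K \<Longrightarrow> N \<in> K \<Longrightarrow> iso_mod M N \<Longrightarrow> M = N"
    using K(1) unfolding rigid_set_def by auto
  have nobij: "\<not> bij_betw f (carr M) (carr N)" if "M \<in> K" "N \<in> K" "M \<noteq> N" "f \<in> hom M N" for M N f
    using uniq that iso_mod_def by blast
  have nonzero: "\<exists>f x. f \<in> hom M N \<and> x \<in> carr M \<and> f x \<noteq> 0" if "M \<in> K" "N \<in> K" "hom M N \<noteq> {0}" for M N
    using that hom_zero_iff[OF mods_rmod[OF m(1)]] by blast
  \<comment> \<open>The members that embed into another one. If there are none, all nonzero maps
    between distinct members are epimorphisms, so a member of largest dimension is a source;
    otherwise a member of \<open>S\<close> of least dimension is one.\<close>
  define S where "S = {Z \<in> K. \<exists>Y\<in>K. Z \<noteq> Y \<and> (\<exists>f\<in>hom Z Y. inj_on f (carr Z))}"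
  show ?thesis
  proof (cases "S = {}")
    case True
    obtain X where X: "X \<in> K" "\<And>Y. Y \<in> K \<Longrightarrow> dm Y \<le> dm X"
      using Max_in[of "dm ` K"] Max_ge[of "dm ` K"] fin K(2) by (metis (no_types, lifting) finite_imageI image_iff image_is_empty)
    have "hom M X = {0}" if M: "M \<in> K" "M \<noteq> X" for M
    proof (rule ccontr)
      assume "hom M X \<noteq> {0}"
      then obtain f x where f: "f \<in> hom M X" "x \<in> carr M" "f x \<noteq> 0" using nonzero[OF M(1) X(1)] by blast
      have "\<not> inj_on f (carr M)" using True M X(1) f(1) unfolding S_def by blast
      then have "epi M X f"
        using happel_ringel[OF m[OF M(1)] m[OF X(1)] E[OF X(1) M(1)] f] by blast
      then have "bij_betw f (carr M) (carr X)"
        using epi_inj[OF m(1)[OF M(1)] m(1)[OF X(1)]] X(2)[OF M(1)] by blast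
      then show False using nobij[OF M(1) X(1) M(2) f(1)] by blast
    qed
    then show ?thesis using X(1) by blast
  next
    case False
    have finS: "finite S" using fin S_def by simp
    obtain Z where Z: "Z \<in> S" "\<And>Y. Y \<in> S \<Longrightarrow> dm Z \<le> dm Y"
      using Min_in[of "dm ` S"] Min_le[of "dm ` S"] finS False by (metis (no_types, lifting) finite_imageI image_iff image_is_empty)
    obtain Y g where Y: "Z \<in> K" "Y \<in> K" "Z \<noteq> Y" "g \<in> hom Z Y" "inj_on g (carr Z)" using Z(1) unfolding S_def by blast
    have rZ: "right_module Z" using m(1)[OF Y(1)] by simp
    have "hom M Z = {0}" if M: "M \<in> K" "M \<noteq> Z" for M
    proof (rule ccontr)
      assume "hom M Z \<noteq> {0}"
      then obtain f x where f: "f \<in> hom M Z" "x \<in> carr M" "f x \<noteq> 0" using nonzero[OF M(1) Y(1)] by blast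
      have rM: "right_module M" using m(1)[OF M(1)] by simp
      consider "inj_on f (carr M)" | "epi M Z f"
        using happel_ringel[OF m[OF M(1)] m[OF Y(1)] E[OF Y(1) M(1)] f] by blast
      then show False
      proof cases
        case 1
        then have "M \<in> S" using M Y(1) f(1) unfolding S_def by blast
        then have "bij_betw f (carr M) (carr Z)"
          using inj_surj[OF m(1)[OF M(1)] m(1)[OF Y(1)] f(1) 1] Z(2) by blast
        then show False using nobij[OF M(1) Y(1) M(2) f(1)] by blast
      next
        case 2
        \<comment> \<open>An epimorphism onto \<open>Z\<close> followed by the embedding into
          \<open>Y\<close>: injectivity of the composite makes \<open>f\<close> bijective, and
          surjectivity makes \<open>g\<close> bijective; either contradicts pairwise
          non-isomorphism.\<close>
        have gf: "(\<lambda>x. g (f x)) \<in> hom M Y" using hom_comp_in[OF rZ f(1) Y(4)] .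
        have "g (f x) \<noteq> 0"
          using Y(5) f hom_in[OF f(1,2)] inj_on_hom_iff[OF rZ Y(4)] by blast
        then consider "inj_on (\<lambda>x. g (f x)) (carr M)" | "epi M Y (\<lambda>x. g (f x))"
          using happel_ringel[OF m[OF M(1)] m[OF Y(2)] E[OF Y(2) M(1)] gf f(2)] by blast
        then show False
        proof cases
          case 1
          then have "inj_on f (carr M)" unfolding inj_on_def by metis
          then have "bij_betw f (carr M) (carr Z)" using 2 unfolding bij_betw_def epi_def by blast
          then show False using nobij[OF M(1) Y(1) M(2) f(1)] by blast
        next
          case 2
          have "epi Z Y g"
          proof (rule epiI[OF Y(4)])
            fix y assume "y \<in> carr Y"
            then obtain x where "x \<in> carr M" "g (f x) = y" using epi_surj[OF 2] by blast
            then show "\<exists>x\<in>carr Z. g x = y" using hom_in[OF f(1)] by blast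
          qed
          then have "bij_betw g (carr Z) (carr Y)" using Y(5) unfolding bij_betw_def epi_def by blast
          then show False using nobij[OF Y(1-4)] by blast
        qed
      qed
    qed
    then show ?thesis using Y(1) by blast
  qed
qed

section \<open>Index vectors\<close>

lemma dhom_projective:
  assumes "P \<in> projs s"
  shows "\<exists>m. \<forall>X\<in>mods s. real (dhom P X) = (\<Sum>Q\<in>ind_proj. m Q * real (dhom Q X))"
  using assms
proof (induction "dm P" arbitrary: P rule: less_induct)
  case less
  have mP: "P \<in> mods s" and rP: "right_module P" using projsD(1)[OF less(2)] by auto
  show ?case
  proof (cases "carr P = {0}")
    case True
    have "dhom P X = 0" if "X \<in> mods s" for X
      using dhom_zero_iff[OF mP that] hom_from_zero[OF _ True, of X] that by simp
    then show ?thesis by (intro exI[of _ "\<lambda>_. 0"]) simp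
  next
    case nz: False
    show ?thesis
    proof (cases "indecomposable P")
      case True
      then obtain Q where Q: "Q \<in> ind_proj" "iso_mod P Q" using ind_proj(5)[OF less(2)] by blast
      have "real (dhom P X) = (\<Sum>Q'\<in>ind_proj. (if Q' = Q then 1 else 0) * real (dhom Q' X))" if X: "X \<in> mods s" for X
      proof -
        have "(\<Sum>Q'\<in>ind_proj. (if Q' = Q then 1 else 0) * real (dhom Q' X))
            = (\<Sum>Q'\<in>ind_proj. if Q' = Q then real (dhom Q' X) else 0)" by (intro sum.cong) auto
        also have "\<dots> = real (dhom Q X)" using Q ind_proj(1) by simp
        finally show ?thesis using dhom_iso[OF mP ind_proj_mods[OF Q(1)] X Q(2)] by simp
      qed
      then show ?thesis by (intro exI[of _ "\<lambda>Q'. if Q' = Q then 1 else 0"]) blast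
    next
      case False
      then obtain U V where UV: "internal_sum P U V" "U \<noteq> {0}" "V \<noteq> {0}"
        using nz unfolding indecomposable_def by blast
      have U: "submodule U P" and V: "submodule V P" and int: "U \<inter> V = {0}"
        using UV(1) unfolding internal_sum_def by auto
      have "U \<noteq> carr P" using int UV submodule_subset[OF V] by blast
      then have "dm (submod P U) < dm P" using dm_sub_less[OF mP U] by blast
      then obtain m1 where 1: "\<forall>X\<in>mods s. real (dhom (submod P U) X) = (\<Sum>Q\<in>ind_proj. m1 Q * real (dhom Q X))"
        using less(1)[of "submod P U"] submod_projs[OF less(2) U] by blast
      have "V \<noteq> carr P" using int UV submodule_subset[OF U] by blast
      then have "dm (submod P V) < dm P" using dm_sub_less[OF mP V] by blast
      then obtain m2 where 2: "\<forall>X\<in>mods s. real (dhom (submod P V) X) = (\<Sum>Q\<in>ind_proj. m2 Q * real (dhom Q X))"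
        using less(1)[of "submod P V"] submod_projs[OF less(2) V] by blast
      have "real (dhom P X) = (\<Sum>Q\<in>ind_proj. (m1 Q + m2 Q) * real (dhom Q X))" if X: "X \<in> mods s" for X
        using dhom_internal_sum[OF mP X UV(1)] 1 2 X by (simp add: distrib_right sum.distrib)
      then show ?thesis by (intro exI[of _ "\<lambda>Q. m1 Q + m2 Q"]) blast
    qed
  qed
qed

text \<open>The coefficients are the multiplicities of the vertices in a projective cover minus
  those in its kernel. They serve all \<open>X\<close> with vanishing Ext at once, where the
  dimension of Hom is the Euler form.\<close>

lemma euler_form:
  assumes M: "M \<in> mods s"
  shows "\<exists>g. \<forall>X\<in>mods s. Ext0 M X \<longrightarrow> real (dhom M X) = (\<Sum>Q\<in>ind_proj. g Q * real (dhom Q X))"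
proof -
  obtain P e where P: "P \<in> projs s" and e: "epi P M e" by (rule cover[OF M])
  obtain m0 where 0: "\<forall>X\<in>mods s. real (dhom P X) = (\<Sum>Q\<in>ind_proj. m0 Q * real (dhom Q X))"
    using dhom_projective[OF P] by blast
  obtain m1 where 1: "\<forall>X\<in>mods s. real (dhom (submod P (ker P e)) X) = (\<Sum>Q\<in>ind_proj. m1 Q * real (dhom Q X))"
    using dhom_projective[OF ker_projs[OF P M e]] by blast
  have "real (dhom M X) = (\<Sum>Q\<in>ind_proj. (m0 Q - m1 Q) * real (dhom Q X))" if X: "X \<in> mods s" "Ext0 M X" for X
  proof -
    have "dhom P X = dhom M X + dhom (submod P (ker P e)) X"
      by (rule dhom_exact[OF projsD(1)[OF P] M X(1) e]) (use Ext0D[OF X(2) projsD(1)[OF P] e] in blast)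
    then have "real (dhom P X) = real (dhom M X) + real (dhom (submod P (ker P e)) X)" by simp
    then show ?thesis
      unfolding left_diff_distrib sum_subtractf using bspec[OF 0 X(1)] bspec[OF 1 X(1)] by linarith
  qed
  then show ?thesis by (intro exI[of _ "\<lambda>Q. m0 Q - m1 Q"]) blast
qed

text \<open>Models the class of \<open>M\<close> in the Grothendieck group of projectives. Only the
  pairing with dimensions of Hom is used, so no canonical choice is made.\<close>

definition gvec :: "('a, nat \<Rightarrow> 'k) rmod \<Rightarrow> ('a, nat \<Rightarrow> 'k) rmod \<Rightarrow> real" where
  "gvec M = (SOME g. \<forall>X\<in>mods s. Ext0 M X \<longrightarrow> real (dhom M X) = (\<Sum>Q\<in>ind_proj. g Q * real (dhom Q X)))"

lemma gvec:
  "M \<in> mods s \<Longrightarrow> X \<in> mods s \<Longrightarrow> Ext0 M X \<Longrightarrow> real (dhom M X) = (\<Sum>Q\<in>ind_proj. gvec M Q * real (dhom Q X))"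
  using someI_ex[OF euler_form] unfolding gvec_def[symmetric] by blast

lemma gvec_combination:
  assumes K: "rigid_set K" "K' \<subseteq> K" and X: "X \<in> mods s" "\<And>M. M \<in> K' \<Longrightarrow> Ext0 M X"
  shows "(\<Sum>M\<in>K'. a M * real (dhom M X)) = (\<Sum>Q\<in>ind_proj. (\<Sum>M\<in>K'. a M * gvec M Q) * real (dhom Q X))"
proof -
  have "(\<Sum>M\<in>K'. a M * real (dhom M X)) = (\<Sum>M\<in>K'. \<Sum>Q\<in>ind_proj. a M * gvec M Q * real (dhom Q X))"
  proof (rule sum.cong[OF refl])
    fix M assume M: "M \<in> K'"
    then have "M \<in> mods s" using K unfolding rigid_set_def by blast
    then have e: "real (dhom M X) = (\<Sum>Q\<in>ind_proj. gvec M Q * real (dhom Q X))"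
      by (rule gvec[OF _ X(1) X(2)[OF M]])
    show "a M * real (dhom M X) = (\<Sum>Q\<in>ind_proj. a M * gvec M Q * real (dhom Q X))"
      unfolding e sum_distrib_left by (simp only: mult.assoc)
  qed
  also have "\<dots> = (\<Sum>Q\<in>ind_proj. \<Sum>M\<in>K'. a M * gvec M Q * real (dhom Q X))" by (rule sum.swap)
  finally show ?thesis by (simp add: sum_distrib_right)
qed

text \<open>Among the members with nonzero coefficient take a source \<open>X\<close>. Pairing the
  relation with \<open>X\<close> leaves the single term \<open>a X\<close> times the dimension of
  the endomorphism ring of \<open>X\<close>, which is not zero. A coordinate \<open>Q\<close> at
  which all members vanish drops out of the pairing, hence the alternative in
  \<open>rel\<close>.\<close>

lemma gvec_independent:
  assumes K: "rigid_set K" and nz: "\<exists>k\<in>K. a k \<noteq> 0"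
    and rel: "\<And>Q. Q \<in> ind_proj \<Longrightarrow> (\<Sum>M\<in>K. a M * gvec M Q) = 0 \<or> (\<forall>M\<in>K. hom Q M = {0})"
  shows False
proof -
  have fin: "finite K" using K unfolding rigid_set_def by blast
  let ?K = "{k \<in> K. a k \<noteq> 0}"
  have "rigid_set ?K" using K unfolding rigid_set_def by auto
  then obtain X where X: "X \<in> ?K" "\<forall>M\<in>?K. M \<noteq> X \<longrightarrow> hom M X = {0}" using rigid_source nz by blast
  have mX: "X \<in> mods s" "indecomposable X" and E: "\<And>M. M \<in> K \<Longrightarrow> Ext0 M X"
    using X(1) K unfolding rigid_set_def by auto
  have mK: "M \<in> mods s" if "M \<in> K" for M using that K unfolding rigid_set_def by blast
  have "(\<Sum>M\<in>K. a M * real (dhom M X)) = (\<Sum>Q\<in>ind_proj. (\<Sum>M\<in>K. a M * gvec M Q) * real (dhom Q X))"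
    by (rule gvec_combination[OF K order.refl mX(1) E])
  also have "\<dots> = 0"
  proof (rule sum.neutral, rule ballI)
    fix Q assume Q: "Q \<in> ind_proj"
    show "(\<Sum>M\<in>K. a M * gvec M Q) * real (dhom Q X) = 0"
      using rel[OF Q] dhom_zero_iff[OF ind_proj_mods[OF Q] mX(1)] X(1) by auto
  qed
  also have "(\<Sum>M\<in>K. a M * real (dhom M X)) = (\<Sum>M\<in>K. if M = X then a X * real (dhom X X) else 0)"
  proof (rule sum.cong[OF refl])
    fix M assume M: "M \<in> K"
    show "a M * real (dhom M X) = (if M = X then a X * real (dhom X X) else 0)"
    proof (cases "M = X \<or> a M = 0")
      case False
      then have "hom M X = {0}" using X(2) M by blast
      then show ?thesis using dhom_zero_iff[OF mK[OF M] mX(1)] False by simp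
    qed (use X(1) in auto)
  qed
  also have "\<dots> = a X * real (dhom X X)" using X(1) fin by simp
  finally have "dhom X X = 0" using X(1) by simp
  then have z: "hom X X = {0}" using dhom_zero_iff[OF mX(1) mX(1)] by simp
  have "x = 0" if "x \<in> carr X" for x
    using hom_zeroD[OF z hom_idm[OF mods_rmod[OF mX(1)]], of x] that by simp
  then show False
    using indecomposable_nz[OF mX(2)] right_module.zero_closed[OF mods_rmod[OF mX(1)]] by blast
qed

text \<open>With more members than vertices outside \<open>F\<close>,
  \<open>nontrivial_relation\<close> would produce a relation that \<open>gvec_independent\<close>
  excludes; the vertices in \<open>F\<close> fall under its second alternative.\<close>

lemma rigid_card:
  assumes K: "rigid_set K" and F: "\<And>f M. f \<in> F \<Longrightarrow> M \<in> K \<Longrightarrow> hom f M = {0}"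
  shows "card K \<le> card (ind_proj - F)"
proof (rule ccontr)
  assume "\<not> ?thesis"
  moreover have "finite K" using K unfolding rigid_set_def by blast
  ultimately obtain a where a: "\<exists>k\<in>K. a k \<noteq> 0" "\<forall>Q\<in>ind_proj - F. (\<Sum>M\<in>K. a M * gvec M Q) = 0"
    using nontrivial_relation[of "ind_proj - F" K gvec] ind_proj(1) by auto
  show False by (rule gvec_independent[OF K a(1)]) (use a(2) F in blast)
qed

text \<open>Take a vertex \<open>Q0\<close> in the support of \<open>Y\<close> and a relation
  between the index vectors in all other coordinates, which exists by counting. Pairing it with
  \<open>Y\<close> gives 0, so the coordinate at \<open>Q0\<close> vanishes too, against
  independence.\<close>

lemma rigid_perpendicular_zero:
  assumes K: "rigid_set K" "card K = card ind_proj" and Y: "Y \<in> mods s"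
    and perp: "\<And>M. M \<in> K \<Longrightarrow> hom M Y = {0} \<and> Ext0 M Y"
  shows "carr Y = {0}"
proof (rule ccontr)
  assume "carr Y \<noteq> {0}"
  then obtain Q0 where Q0: "Q0 \<in> ind_proj" "hom Q0 Y \<noteq> {0}" using supp_empty_iff[OF Y] unfolding supp_def by blast
  have fin: "finite K" and mK: "\<And>M. M \<in> K \<Longrightarrow> M \<in> mods s" using K unfolding rigid_set_def by auto
  have "card (ind_proj - {Q0}) < card K" using card_Diff1_less[OF ind_proj(1) Q0(1)] K(2) by simp
  then obtain a where a: "\<exists>k\<in>K. a k \<noteq> 0" "\<forall>Q\<in>ind_proj - {Q0}. (\<Sum>M\<in>K. a M * gvec M Q) = 0"
    using nontrivial_relation[of "ind_proj - {Q0}" K gvec] ind_proj(1) fin by auto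
  have "0 = (\<Sum>M\<in>K. a M * real (dhom M Y))"
    using perp dhom_zero_iff[OF mK Y] by simp
  also have "\<dots> = (\<Sum>Q\<in>ind_proj. (\<Sum>M\<in>K. a M * gvec M Q) * real (dhom Q Y))"
    by (rule gvec_combination[OF K(1) order.refl Y]) (use perp in blast)
  also have "\<dots> = (\<Sum>M\<in>K. a M * gvec M Q0) * real (dhom Q0 Y) +
      (\<Sum>Q\<in>ind_proj - {Q0}. (\<Sum>M\<in>K. a M * gvec M Q) * real (dhom Q Y))"
    using Q0(1) ind_proj(1) by (simp add: sum.remove)
  also have "(\<Sum>Q\<in>ind_proj - {Q0}. (\<Sum>M\<in>K. a M * gvec M Q) * real (dhom Q Y)) = 0"
    using a(2) by (intro sum.neutral) simp
  finally have "(\<Sum>M\<in>K. a M * gvec M Q0) = 0"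
    using dhom_zero_iff[OF ind_proj_mods[OF Q0(1)] Y] Q0(2) by simp
  then show False using gvec_independent[OF K(1) a(1)] a(2) by blast
qed

end

section \<open>Support tau-tilting modules over hereditary algebras\<close>

lemma retract_biprod:
  assumes X: "right_module X" and D: "right_module D" and b: "biprod X Ys i p" and c: "biprod D Ps j q"
    and len: "length Ps = length Ys"
    and Ys: "\<And>l. l < length Ys \<Longrightarrow> right_module (Ys ! l) \<and> right_module (Ps ! l) \<and> retract (Ys ! l) (Ps ! l)"
  shows "retract X D"
proof -
  have "\<exists>a. \<exists>e. a \<in> hom (Ys ! l) (Ps ! l) \<and> e \<in> hom (Ps ! l) (Ys ! l) \<and> (\<forall>x\<in>carr (Ys ! l). e (a x) = x)"
    if "l < length Ys" for l using Ys[OF that] unfolding retract_def by blast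
  then obtain a e where ae: "\<And>l. l < length Ys \<Longrightarrow> a l \<in> hom (Ys ! l) (Ps ! l)"
    "\<And>l. l < length Ys \<Longrightarrow> e l \<in> hom (Ps ! l) (Ys ! l)"
    "\<And>l x. l < length Ys \<Longrightarrow> x \<in> carr (Ys ! l) \<Longrightarrow> e l (a l x) = x"
    by metis
  have rY: "right_module (Ys ! l)" "right_module (Ps ! l)" if "l < length Ys" for l using Ys[OF that] by auto
  have jl: "j l \<in> hom (Ps ! l) D" "q l \<in> hom D (Ps ! l)" if "l < length Ys" for l
    using biprodD(1,2)[OF c] that len by auto
  have u: "(\<lambda>x. j l (a l (p l x))) \<in> hom X D" if l: "l < length Ys" for l
    by (rule hom_comp_in[OF rY(2)[OF l] hom_comp_in[OF rY(1)[OF l] biprodD(2)[OF b l] ae(1)[OF l]] jl(1)[OF l]])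
  have v: "(\<lambda>x. i l (e l (q l x))) \<in> hom D X" if l: "l < length Ys" for l
    by (rule hom_comp_in[OF rY(1)[OF l] hom_comp_in[OF rY(2)[OF l] jl(2)[OF l] ae(2)[OF l]] biprodD(1)[OF b l]])
  show ?thesis
  proof (rule retractI)
    show "(\<lambda>x. \<Sum>l<length Ys. j l (a l (p l x))) \<in> hom X D" by (rule hom_sum_fun[OF D]) (use u in auto)
    show "(\<lambda>x. \<Sum>l<length Ys. i l (e l (q l x))) \<in> hom D X" by (rule hom_sum_fun[OF X]) (use v in auto)
    show "\<forall>x\<in>carr X. (\<Sum>l<length Ys. i l (e l (q l (\<Sum>l<length Ys. j l (a l (p l x)))))) = x"
    proof
      fix x assume x: "x \<in> carr X"
      have px: "p l x \<in> carr (Ys ! l)" if "l < length Ys" for l using hom_in[OF biprodD(2)[OF b that] x] .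
      have apx: "a l (p l x) \<in> carr (Ps ! l)" if "l < length Ys" for l using hom_in[OF ae(1)[OF that] px[OF that]] .
      have "q l (\<Sum>k<length Ys. j k (a k (p k x))) = a l (p l x)" if l: "l < length Ys" for l
      proof -
        have "q l (\<Sum>k<length Ys. j k (a k (p k x))) = (\<Sum>k<length Ys. q l (j k (a k (p k x))))"
          by (rule hom_sum[OF D jl(2)[OF l]]) (use hom_in[OF jl(1) apx] in simp)
        also have "\<dots> = (\<Sum>k<length Ys. if k = l then a k (p k x) else 0)"
          using biprodD(3)[OF c] apx l len by (intro sum.cong refl) auto
        finally show ?thesis using l by simp
      qed
      then have "(\<Sum>l<length Ys. i l (e l (q l (\<Sum>l<length Ys. j l (a l (p l x)))))) = (\<Sum>l<length Ys. i l (p l x))"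
        using ae(3) px by (intro sum.cong refl) simp
      then show "(\<Sum>l<length Ys. i l (e l (q l (\<Sum>l<length Ys. j l (a l (p l x)))))) = x"
        using biprodD(4)[OF b x] by simp
    qed
  qed
qed

context her_alg
begin

lemma rigid_representatives:
  assumes M: "M \<in> mods s" "Ext0 M M"
  obtains K where "rigid_set K" "card K = num_summands s M" "\<forall>X\<in>K. X \<in> mods s \<and> retract X M"
proof -
  have rM: "right_module M" using M by simp
  obtain Xs i p where Xs: "\<forall>X\<in>set Xs. X \<in> mods s \<and> indecomposable X" and b: "biprod M Xs i p"
    using decomposition[OF M(1)] by blast
  obtain K where K: "K \<subseteq> set Xs" "inj_on (iso_class s) K" "iso_class s ` set Xs = iso_class s ` K"
    using subset_image_inj[of "iso_class s ` set Xs" "iso_class s" "set Xs"] by auto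
  have "card K = card (iso_class s ` set Xs)" using K(2,3) card_image by metis
  then have c: "card K = num_summands s M" using num_summands_biprod[OF rM b Xs] by simp
  have r: "X \<in> mods s \<and> retract X M" if "X \<in> K" for X
  proof -
    have "X \<in> set Xs" using that K(1) by blast
    then obtain j where "j < length Xs" "Xs ! j = X" unfolding in_set_conv_nth by blast
    then show ?thesis using biprod_retract[OF b, of j] that K(1) Xs by auto
  qed
  have "Ext0 X Y" if "X \<in> K" "Y \<in> K" for X Y
    using Ext0_retract_left[OF Ext0_retract_right[OF M(2,1)] M(1)] r that by blast
  moreover have "X = Y" if "X \<in> K" "Y \<in> K" "iso_mod X Y" for X Y
    using iso_class_eq_iff[of X Y] r that K(2) unfolding inj_on_def by blast
  ultimately have "rigid_set K"
    unfolding rigid_set_def using finite_subset[OF K(1)] K(1) Xs by blast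
  then show thesis using that c r by blast
qed

lemma supp_subset: "supp M \<subseteq> ind_proj"
  unfolding supp_def by blast

lemma num_summands_le_supp:
  assumes M: "M \<in> mods s" "Ext0 M M" shows "num_summands s M \<le> card (supp M)"
proof -
  obtain K where K: "rigid_set K" "card K = num_summands s M" "\<forall>X\<in>K. X \<in> mods s \<and> retract X M"
    by (rule rigid_representatives[OF M])
  have "card K \<le> card (ind_proj - (ind_proj - supp M))"
  proof (rule rigid_card[OF K(1)])
    fix f X assume f: "f \<in> ind_proj - supp M" and X: "X \<in> K"
    have "supp X \<subseteq> supp M" using supp_retract[OF M(1)] K(3) X by blast
    then show "hom f X = {0}" using f unfolding supp_def by blast
  qed
  moreover have "ind_proj - (ind_proj - supp M) = supp M" using supp_subset by blast
  ultimately show ?thesis using K(2) by simp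
qed

text \<open>The vertices occurring in \<open>P\<close>. In a support tau-tilting pair they turn out
  to be exactly those outside the support of the module.\<close>

definition psum :: "('a, nat \<Rightarrow> 'k) rmod \<Rightarrow> ('a, nat \<Rightarrow> 'k) rmod set" where
  "psum P = {Q \<in> ind_proj. retract Q P}"

lemma num_summands_projective:
  assumes P: "P \<in> projs s" shows "num_summands s P = card (psum P)"
proof -
  have mP: "P \<in> mods s" and rP: "right_module P" using projsD(1)[OF P] by auto
  obtain Xs i p where Xs: "\<forall>X\<in>set Xs. X \<in> mods s \<and> indecomposable X" and b: "biprod P Xs i p"
    using decomposition[OF mP] by blast
  have "iso_class s ` set Xs = iso_class s ` psum P"
  proof (intro equalityI subsetI)
    fix c assume "c \<in> iso_class s ` set Xs"
    then obtain l where l: "l < length Xs" "c = iso_class s (Xs ! l)" unfolding image_iff by (metis in_set_conv_nth)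
    have X: "Xs ! l \<in> mods s" "indecomposable (Xs ! l)" using Xs l(1) by auto
    have rX: "right_module (Xs ! l)" using X by simp
    have r: "retract (Xs ! l) P" using biprod_retract[OF b l(1)] .
    have "projective s (Xs ! l)" by (rule projective_retract[OF rX rP r projsD(2)[OF P]])
    then have "Xs ! l \<in> projs s" using X by (simp add: projs_def)
    then obtain Q where Q: "Q \<in> ind_proj" "iso_mod (Xs ! l) Q" using ind_proj(5) X(2) by blast
    have "retract Q P"
      by (rule retract_trans[OF iso_retract[OF iso_mod_sym[OF Q(2) rX ind_proj_rmod[OF Q(1)]] ind_proj_rmod[OF Q(1)] rX] r rX])
    then have "Q \<in> psum P" using Q(1) unfolding psum_def by blast
    then show "c \<in> iso_class s ` psum P" using iso_class_eq_iff[OF X(1) ind_proj_mods[OF Q(1)]] Q(2) l(2) by blast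
  next
    fix c assume "c \<in> iso_class s ` psum P"
    then obtain Q where Q: "Q \<in> ind_proj" "retract Q P" "c = iso_class s Q" unfolding psum_def by blast
    obtain X where X: "X \<in> set Xs" "iso_mod Q X"
      using krull_schmidt[OF ind_proj_mods[OF Q(1)] ind_proj(3)[OF Q(1)] rP b Xs Q(2)] by blast
    then have "c = iso_class s X" using iso_class_eq_iff[OF ind_proj_mods[OF Q(1)], of X] Xs Q(3) by blast
    then show "c \<in> iso_class s ` set Xs" using X(1) by blast
  qed
  moreover have "inj_on (iso_class s) (psum P)"
    by (rule inj_onI) (use ind_proj(4) iso_class_eq_iff ind_proj_mods in \<open>auto simp: psum_def\<close>)
  ultimately show ?thesis using num_summands_biprod[OF rP b Xs] card_image by metis
qed

lemma hom_dsum_zero: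
  assumes D: "right_module D" and b: "biprod D Ps i p" and M: "right_module M"
    and z: "\<And>P. P \<in> set Ps \<Longrightarrow> hom P M = {0}"
  shows "hom D M = {0}"
  unfolding hom_zero_iff[OF M]
proof (intro ballI)
  fix f x assume f: "f \<in> hom D M" and x: "x \<in> carr D"
  have "f x = f (\<Sum>l<length Ps. i l (p l x))" using biprodD(4)[OF b x] by simp
  also have "\<dots> = (\<Sum>l<length Ps. f (i l (p l x)))"
    by (rule hom_sum[OF D f])
      (use x in \<open>auto intro!: hom_in[OF biprodD(1)[OF b]] hom_in[OF biprodD(2)[OF b]]\<close>)
  also have "\<dots> = 0"
  proof (intro sum.neutral ballI)
    fix l assume "l \<in> {..<length Ps}"
    then have l: "l < length Ps" by simp
    have "hom (Ps ! l) M = {0}" using z l by simp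
    then show "f (i l (p l x)) = 0" by (rule hom_zeroD[OF _ hom_comp_in[OF D biprodD(1)[OF b l] f]])
  qed
  finally show "f x = 0" .
qed

lemma hom_retract_zero:
  assumes "retract X D" "right_module D" "right_module X" "hom D M = {0}" "right_module M" shows "hom X M = {0}"
  unfolding hom_zero_iff[OF assms(5)]
proof (intro ballI)
  fix f x assume f: "f \<in> hom X M" and x: "x \<in> carr X"
  obtain i p where ip: "i \<in> hom X D" "p \<in> hom D X" "\<forall>x\<in>carr X. p (i x) = x" using assms(1) by (rule retractE)
  have "f (p (i x)) = 0" by (rule hom_zeroD[OF assms(4) hom_comp_in[OF assms(3) ip(2) f]])
  then show "f x = 0" using ip(3) x by simp
qed

text \<open>By rigidity \<open>M\<close> has at most as many summands as vertices in its support,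
  and by \<open>hom P M = {0}\<close> all summands of \<open>P\<close> lie outside it. As the two
  counts add up to the number of vertices, both bounds are attained.\<close>

lemma stau_pairD:
  assumes "stau_pair s M P"
  shows "M \<in> mods s" "P \<in> projs s" "Ext0 M M" "hom P M = {0}" "num_summands s M = card (supp M)"
    "psum P = ind_proj - supp M"
proof -
  show M: "M \<in> mods s" and P: "P \<in> projs s" and z: "hom P M = {0}"
    using assms unfolding stau_pair_def by auto
  show E: "Ext0 M M" using assms hom_tau_zero_iff[OF M M] unfolding stau_pair_def by blast
  have sub: "psum P \<subseteq> ind_proj - supp M"
  proof
    fix Q assume "Q \<in> psum P"
    then have Q: "Q \<in> ind_proj" "retract Q P" unfolding psum_def by auto
    have "hom Q M = {0}"
      using hom_retract_zero[OF Q(2) _ ind_proj_rmod[OF Q(1)] z] projsD(1)[OF P] M by simp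
    then show "Q \<in> ind_proj - supp M" using Q(1) unfolding supp_def by blast
  qed
  have f: "finite (ind_proj - supp M)" using ind_proj(1) by simp
  have c: "card (ind_proj - supp M) = card ind_proj - card (supp M)" "card (supp M) \<le> card ind_proj"
    using card_Diff_subset[OF finite_subset[OF supp_subset ind_proj(1)] supp_subset]
      card_mono[OF ind_proj(1) supp_subset] by auto
  have "num_summands s M + card (psum P) = card ind_proj"
    using assms num_summands_projective[OF P] ind_proj(6) unfolding stau_pair_def by simp
  moreover have "card (psum P) \<le> card (ind_proj - supp M)" using card_mono[OF f sub] .
  moreover have "num_summands s M \<le> card (supp M)" by (rule num_summands_le_supp[OF M E])
  ultimately have "num_summands s M = card (supp M)" "card (psum P) = card (ind_proj - supp M)" using c by auto
  then show "num_summands s M = card (supp M)" "psum P = ind_proj - supp M"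
    using card_subset_eq[OF f sub] by auto
qed

text \<open>The projective part of the pair has disappeared, since the support determines
  it.\<close>

definition supp_tilting :: "('a, nat \<Rightarrow> 'k) rmod \<Rightarrow> bool" where
  "supp_tilting M \<longleftrightarrow> M \<in> mods s \<and> Ext0 M M \<and> num_summands s M = card (supp M) \<and> basic s M"

lemma pairwise_noniso_distinct:
  assumes "distinct Xs" "set Xs \<subseteq> ind_proj" shows "pairwise_noniso Xs"
  unfolding pairwise_noniso_def
proof (intro allI impI notI)
  fix i j assume a: "i < length Xs" "j < length Xs" "i \<noteq> j" "iso_mod (Xs ! i) (Xs ! j)"
  have "Xs ! i = Xs ! j" by (rule ind_proj(4)[OF _ _ a(4)]) (use a assms(2) in auto)
  then show False using a assms(1) nth_eq_iff_index_eq by blast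
qed

lemma stau_pair_exists:
  assumes M: "M \<in> mods s" "Ext0 M M" "num_summands s M = card (supp M)"
  shows "\<exists>P. stau_pair s M P \<and> basic s P"
proof -
  obtain Ps where Ps: "set Ps = ind_proj - supp M" "distinct Ps"
    using finite_distinct_list[of "ind_proj - supp M"] ind_proj(1) by auto
  have mPs: "set Ps \<subseteq> mods s" using Ps(1) ind_proj_mods by blast
  obtain P i p where P: "P \<in> mods s" and b: "biprod P Ps i p" by (rule direct_sum[OF mPs])
  have rP: "right_module P" using P by simp
  have ind: "\<forall>Q\<in>set Ps. Q \<in> mods s \<and> indecomposable Q" using Ps(1) ind_proj_mods ind_proj(3) by auto
  have "projective s P" by (rule projective_biprod[OF rP b]) (use Ps(1) ind_proj_proj ind_proj_rmod in auto)
  then have PP: "P \<in> projs s" using P by (simp add: projs_def)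
  have pn: "pairwise_noniso Ps" by (rule pairwise_noniso_distinct[OF Ps(2)]) (use Ps(1) in blast)
  have "num_summands s P = card (ind_proj - supp M)"
    using num_summands_biprod[OF rP b ind] card_iso_classes[OF mPs pn] distinct_card[OF Ps(2)] Ps(1) by simp
  moreover have "card (ind_proj - supp M) = card ind_proj - card (supp M)" "card (supp M) \<le> card ind_proj"
    using card_Diff_subset[OF finite_subset[OF supp_subset ind_proj(1)] supp_subset]
      card_mono[OF ind_proj(1) supp_subset] by auto
  moreover have "hom P M = {0}"
    by (rule hom_dsum_zero[OF rP b mods_rmod[OF M(1)]]) (use Ps(1) in \<open>auto simp: supp_def\<close>)
  ultimately have "stau_pair s M P"
    unfolding stau_pair_def using M PP hom_tau_zero_iff[OF M(1) M(1)] ind_proj(6) by simp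
  moreover have "basic s P" using basic_biprod[OF P b ind] pn by blast
  ultimately show ?thesis by blast
qed

lemma supp_tilting_iff: "supp_tilting M \<longleftrightarrow> stau_tilting s M \<and> basic s M"
proof
  assume "supp_tilting M"
  then show "stau_tilting s M \<and> basic s M"
    using stau_pair_exists[of M] unfolding supp_tilting_def stau_tilting_def by blast
next
  assume a: "stau_tilting s M \<and> basic s M"
  then obtain P where P: "stau_pair s M P" unfolding stau_tilting_def by blast
  show "supp_tilting M" unfolding supp_tilting_def using stau_pairD(1,3,5)[OF P] a by blast
qed

text \<open>The projective parts consist of the vertices outside the supports, so the inclusion is
  reversed. A summand of a power of \<open>P'\<close> has no map to \<open>M'\<close>, which sends
  its indecomposable summands to vertices outside \<open>supp M'\<close>.\<close>

lemma add_cl_subset_iff: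
  assumes p: "stau_pair s M P" and p': "stau_pair s M' P'"
  shows "add_cl s P' \<subseteq> add_cl s P \<longleftrightarrow> supp M \<subseteq> supp M'"
proof -
  note D = stau_pairD[OF p] and D' = stau_pairD[OF p']
  have rP: "right_module P" "right_module P'" and rM: "right_module M" "right_module M'"
    using projsD(1)[OF D(2)] projsD(1)[OF D'(2)] D(1) D'(1) by auto
  have ds: "right_module (dsum (replicate n A))" "biprod (dsum (replicate n A)) (replicate n A)
     (\<lambda>j. rst (carr (replicate n A ! j)) (\<lambda>x l. if l = j then x else 0)) (\<lambda>j. rst (carr (dsum (replicate n A))) (\<lambda>x. x j))"
    if "right_module A" for n and A :: "('a, nat \<Rightarrow> 'k) rmod"
    using right_module_dsum[of "replicate n A"] biprod_dsum[of "replicate n A"] that by auto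
  have homz: "hom X N = {0}" if "retract X (dsum (replicate n A))" "hom A N = {0}" "right_module A"
    "right_module N" "right_module X"
    for X :: "('a, nat \<Rightarrow> 'k) rmod" and N :: "('a, nat \<Rightarrow> 'k) rmod" and n and A :: "('a, nat \<Rightarrow> 'k) rmod"
  proof (rule hom_retract_zero[OF that(1) ds(1)[OF that(3)] that(5) _ that(4)])
    show "hom (dsum (replicate n A)) N = {0}"
      by (rule hom_dsum_zero[OF ds[OF that(3)] that(4)]) (use that(2) in auto)
  qed
  show ?thesis
  proof
    assume sub: "add_cl s P' \<subseteq> add_cl s P"
    show "supp M \<subseteq> supp M'"
    proof
      fix Q assume Q: "Q \<in> supp M"
      show "Q \<in> supp M'"
      proof (rule ccontr)
        assume "Q \<notin> supp M'"
        then have "Q \<in> psum P'" using D'(6) Q supp_subset by blast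
        then have Qi: "Q \<in> ind_proj" and r: "retract Q P'" unfolding psum_def by auto
        have "retract P' (dsum (replicate 1 P'))"
          using biprod_retract[OF ds(2)[OF rP(2)], of 0 1] by simp
        then have "retract Q (dsum (replicate 1 P'))" by (rule retract_trans[OF r _ rP(2)])
        then have "is_summand Q (dsum (replicate 1 P'))"
          using is_summand_iff[OF ind_proj_rmod[OF Qi] ds(1)[OF rP(2)]] by blast
        then have "Q \<in> add_cl s P'" unfolding add_cl_def using ind_proj_mods[OF Qi] by blast
        then obtain n where "is_summand Q (dsum (replicate n P))" using sub unfolding add_cl_def by blast
        then have "retract Q (dsum (replicate n P))"
          using is_summand_iff[OF ind_proj_rmod[OF Qi] ds(1)[OF rP(1)]] by blast
        then have "hom Q M = {0}" by (rule homz[OF _ D(4) rP(1) rM(1) ind_proj_rmod[OF Qi]])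
        then show False using Q unfolding supp_def by blast
      qed
    qed
  next
    assume sub: "supp M \<subseteq> supp M'"
    show "add_cl s P' \<subseteq> add_cl s P"
    proof
      fix X assume "X \<in> add_cl s P'"
      then obtain n where X: "X \<in> mods s" and "is_summand X (dsum (replicate n P'))" unfolding add_cl_def by blast
      then have r: "retract X (dsum (replicate n P'))" using is_summand_iff[OF mods_rmod[OF X] ds(1)[OF rP(2)]] by blast
      have rX: "right_module X" using X by simp
      have zX: "hom X M' = {0}" by (rule homz[OF r D'(4) rP(2) rM(2) rX])
      have "projective s (dsum (replicate n P'))"
        by (rule projective_biprod[OF ds[OF rP(2)]]) (use rP(2) projsD(2)[OF D'(2)] in auto)
      then have pX: "projective s X" by (rule projective_retract[OF rX ds(1)[OF rP(2)] r])
      obtain Ys i p where Ys: "\<forall>Y\<in>set Ys. Y \<in> mods s \<and> indecomposable Y" and b: "biprod X Ys i p"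
        using decomposition[OF X] by blast
      have Y: "retract (Ys ! l) P" "right_module (Ys ! l)" if l: "l < length Ys" for l
      proof -
        have Y: "Ys ! l \<in> mods s" "indecomposable (Ys ! l)" using Ys l by auto
        show rY: "right_module (Ys ! l)" using Y by simp
        have rYX: "retract (Ys ! l) X" by (rule biprod_retract[OF b l])
        have "projective s (Ys ! l)" by (rule projective_retract[OF rY rX rYX pX])
        then have "Ys ! l \<in> projs s" using Y by (simp add: projs_def)
        then obtain Q where Q: "Q \<in> ind_proj" "iso_mod (Ys ! l) Q" using ind_proj(5) Y(2) by blast
        have rQ: "right_module Q" by (rule ind_proj_rmod[OF Q(1)])
        have "retract Q X"
          by (rule retract_trans[OF iso_retract[OF iso_mod_sym[OF Q(2) rY rQ] rQ rY] rYX rY])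
        then have "hom Q M' = {0}" by (rule hom_retract_zero[OF _ rX rQ zX rM(2)])
        then have "Q \<notin> supp M" using sub unfolding supp_def by blast
        then have "retract Q P" using D(6) Q(1) unfolding psum_def by blast
        then show "retract (Ys ! l) P" by (rule retract_trans[OF iso_retract[OF Q(2) rY rQ] _ rQ])
      qed
      have "retract X (dsum (replicate (length Ys) P))"
        by (rule retract_biprod[OF rX ds(1)[OF rP(1)] b ds(2)[OF rP(1)]]) (use Y rP(1) in auto)
      then have "is_summand X (dsum (replicate (length Ys) P))"
        using is_summand_iff[OF rX ds(1)[OF rP(1)]] by blast
      then show "X \<in> add_cl s P" unfolding add_cl_def using X by blast
    qed
  qed
qed

definition supp_tilting_le :: "('a, nat \<Rightarrow> 'k) rmod \<Rightarrow> ('a, nat \<Rightarrow> 'k) rmod \<Rightarrow> bool" where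
  "supp_tilting_le M N \<longleftrightarrow> Ext0 N M \<and> supp M \<subseteq> supp N"

lemma Ext0_iso:
  assumes "Ext0 M X" "M \<in> mods s" "X \<in> mods s" "M' \<in> mods s" "X' \<in> mods s" "iso_mod M M'" "iso_mod X X'"
  shows "Ext0 M' X'"
proof -
  have "iso_mod M' M" "iso_mod X' X" using iso_mod_sym[OF assms(6)] iso_mod_sym[OF assms(7)] assms by auto
  then have "retract M' M" "retract X' X" using iso_retract[of M' M] iso_retract[of X' X] assms by auto
  then show ?thesis
    using Ext0_retract_left[OF Ext0_retract_right[OF assms(1,3) _ assms(5)] assms(2) _ assms(4,5)] by blast
qed

lemma stau_le_iff:
  assumes M: "supp_tilting M" and N: "supp_tilting N"
  shows "stau_le s (iso_class s M) (iso_class s N) \<longleftrightarrow> supp_tilting_le M N"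
proof
  have m: "M \<in> mods s" "N \<in> mods s" using M N unfolding supp_tilting_def by auto
  assume "stau_le s (iso_class s M) (iso_class s N)"
  then obtain M' N' P P' where i: "M' \<in> iso_class s M" "N' \<in> iso_class s N"
    and p: "stau_pair s M' P" "stau_pair s N' P'" "hom M' (tau s N') = {0}" "add_cl s P' \<subseteq> add_cl s P"
    unfolding stau_le_def by blast
  have i': "M' \<in> mods s" "iso_mod M M'" "N' \<in> mods s" "iso_mod N N'" using i unfolding iso_class_def by auto
  have "Ext0 N' M'" using hom_tau_zero_iff[OF i'(3,1)] p(3) by blast
  then have "Ext0 N M"
    using Ext0_iso[OF _ i'(3,1) m(2,1)] iso_mod_sym[OF i'(2)] iso_mod_sym[OF i'(4)] m i' by simp
  moreover have "supp M' \<subseteq> supp N'" using add_cl_subset_iff[OF p(1,2)] p(4) by blast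
  ultimately show "supp_tilting_le M N"
    unfolding supp_tilting_le_def using supp_iso[OF m(1) i'(1,2)] supp_iso[OF m(2) i'(3,4)] by simp
next
  assume le: "supp_tilting_le M N"
  obtain P where P: "stau_pair s M P" "basic s P" using stau_pair_exists M unfolding supp_tilting_def by blast
  obtain P' where P': "stau_pair s N P'" "basic s P'" using stau_pair_exists N unfolding supp_tilting_def by blast
  have m: "M \<in> mods s" "N \<in> mods s" "basic s M" "basic s N" using M N unfolding supp_tilting_def by auto
  have "hom M (tau s N) = {0}" using hom_tau_zero_iff[OF m(2,1)] le unfolding supp_tilting_le_def by blast
  moreover have "add_cl s P' \<subseteq> add_cl s P"
    using add_cl_subset_iff[OF P(1) P'(1)] le unfolding supp_tilting_le_def by blast
  ultimately show "stau_le s (iso_class s M) (iso_class s N)"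
    unfolding stau_le_def using iso_class_self[OF m(1)] iso_class_self[OF m(2)] P P' m(3,4) by blast
qed

lemma stau_tilt_eq: "stau_tilt s = iso_class s ` {M. supp_tilting M}"
  unfolding stau_tilt_def supp_tilting_iff by blast

text \<open>A tilting module has as many summands as there are vertices, and by the rank bound its
  support cannot be smaller.\<close>

lemma tilt_eq: "tilt s = iso_class s ` {M. supp_tilting M \<and> supp M = ind_proj}"
proof -
  have "tilting s T \<and> basic s T \<longleftrightarrow> supp_tilting T \<and> supp T = ind_proj" for T
  proof
    assume a: "tilting s T \<and> basic s T"
    then have T: "T \<in> mods s" "Ext1_zero s T T" and n: "num_summands s T = card ind_proj"
      using ind_proj(6) unfolding tilting_def by auto
    have E: "Ext0 T T" using Ext1_zero_iff[OF T(1) T(1)] T(2) by blast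
    have "card ind_proj \<le> card (supp T)" using num_summands_le_supp[OF T(1) E] n by simp
    then have "supp T = ind_proj"
      using card_seteq[OF ind_proj(1) supp_subset] by blast
    then show "supp_tilting T \<and> supp T = ind_proj" unfolding supp_tilting_def using T E n a by simp
  next
    assume a: "supp_tilting T \<and> supp T = ind_proj"
    then show "tilting s T \<and> basic s T"
      unfolding tilting_def supp_tilting_def using pd_le_1[of T] Ext1_zero_iff[of T T] ind_proj(6) by simp
  qed
  then show ?thesis unfolding tilt_def by blast
qed

section \<open>The order on tilting modules\<close>

lemma perp1_eq: "T \<in> mods s \<Longrightarrow> perp1 s T = {X \<in> mods s. Ext0 T X}"
  unfolding perp1_def using Ext1_zero_iff by blast

text \<open>\<open>X\<close> is shown to be a quotient of a module \<open>W\<close> that inherits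
  vanishing of Ext from \<open>T\<close>. The quotient of \<open>X\<close> by the largest image of
  such a \<open>W\<close> is orthogonal to \<open>T\<close> for Hom and for Ext, hence zero by
  \<open>rigid_perpendicular_zero\<close>.\<close>

lemma tilting_perp:
  assumes T: "supp_tilting T" "supp T = ind_proj" and X: "X \<in> mods s" "Ext0 T X" and T2: "T2 \<in> mods s" "Ext0 T2 T"
  shows "Ext0 T2 X"
proof -
  have mT: "T \<in> mods s" and ET: "Ext0 T T" and nT: "num_summands s T = card ind_proj"
    using T unfolding supp_tilting_def by auto
  \<comment> \<open>This class contains \<open>T\<close> and is closed under sums, so it contains
    the powers of \<open>T\<close>, which need not be handled explicitly.\<close>
  define C where "C = {W \<in> mods s. \<forall>M\<in>mods s. Ext0 M T \<longrightarrow> Ext0 M W}"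
  have CM: "C \<subseteq> mods s" and TC: "T \<in> C" unfolding C_def using mT by auto
  have sum: "D \<in> C" if W: "W \<in> C" "W' \<in> C" "D \<in> mods s" and b: "biprod D [W, W'] i p" for W W' D i p
  proof -
    have "Ext0 M D" if M: "M \<in> mods s" "Ext0 M T" for M
      by (rule Ext0_biprod_right[OF W(3) b]) (use W(1,2) M in \<open>auto simp: C_def\<close>)
    then show ?thesis using W(3) unfolding C_def by blast
  qed
  obtain W g where W: "W \<in> C" and g: "g \<in> hom W X"
    and max: "\<forall>W'\<in>C. \<forall>g'\<in>hom W' X. \<forall>x\<in>carr W'. g' x \<in> g ` carr W"
    using trace[OF CM TC X(1)] sum by metis
  have mW: "W \<in> mods s" and rW: "right_module W" and rX: "right_module X" using W CM X by auto
  let ?V = "g ` carr W"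
  have V: "submodule ?V X" using image_submodule[OF rW rX g submodule_carr[OF rW]] .
  have mV: "submod X ?V \<in> mods s" by (rule submod_mods[OF X(1) V])
  have gV: "epi W (submod X ?V) g" using hom_corestrict[OF g] unfolding epi_def by simp
  have "Ext0 T W" using W ET mT unfolding C_def by blast
  then have EV: "Ext0 T (submod X ?V)" by (rule Ext0_epi[OF mT mW mV gV])
  obtain Q q where Q: "Q \<in> mods s" and q: "epi X Q q" and k: "\<forall>x\<in>carr X. q x = 0 \<longleftrightarrow> x \<in> ?V"
    by (rule quotient[OF X(1) V])
  have kq: "ker X q = ?V" using k submodule_in[OF V] by (auto simp: ker_def)
  have EQ: "Ext0 T Q" by (rule Ext0_epi[OF mT X(1) Q q X(2)])
  \<comment> \<open>Since Ext from \<open>T\<close> to the trace vanishes, a map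
    \<open>T -> Q\<close> lifts to \<open>X\<close>; as \<open>T\<close> is in \<open>C\<close>, the
    lift lands in the trace and becomes zero in \<open>Q\<close>.\<close>
  have hQ: "hom T Q = {0}"
    unfolding hom_zero_iff[OF mods_rmod[OF Q]]
  proof (intro ballI)
    fix f x assume f: "f \<in> hom T Q" and x: "x \<in> carr T"
    have EV': "Ext0 T (submod X (ker X q))" unfolding kq by (rule EV)
    obtain h where h: "h \<in> hom T X" "\<forall>x\<in>carr T. q (h x) = f x"
      by (rule Ext0_lift[OF mT X(1) Q q EV' f])
    have "h x \<in> ?V" using max TC h(1) x by blast
    then have "q (h x) = 0" using k hom_in[OF h(1) x] by blast
    then show "f x = 0" using h(2) x by simp
  qed
  obtain K where K: "rigid_set K" "card K = num_summands s T" "\<forall>X\<in>K. X \<in> mods s \<and> retract X T"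
    by (rule rigid_representatives[OF mT ET])
  have "carr Q = {0}"
  proof (rule rigid_perpendicular_zero[OF K(1) _ Q])
    show "card K = card ind_proj" using K(2) nT by simp
    fix M assume "M \<in> K"
    then have M: "M \<in> mods s" "retract M T" using K(3) by auto
    show "hom M Q = {0} \<and> Ext0 M Q"
      using hom_retract_zero[OF M(2) _ _ hQ] Ext0_retract_left[OF EQ mT M(2,1) Q] mT M(1) Q by simp
  qed
  then have "x \<in> ?V" if "x \<in> carr X" for x using k hom_in[OF epi_hom[OF q] that] that by blast
  then have "epi W X g" using g hom_in[OF g] unfolding epi_def by blast
  moreover have "Ext0 T2 W" using W T2 unfolding C_def by blast
  ultimately show ?thesis using Ext0_epi[OF T2(1) mW X(1)] by blast
qed

text \<open>Rigidity puts \<open>M\<close> into its own perpendicular category, so the inclusion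
  yields \<open>Ext0 N M\<close>; the converse is \<open>tilting_perp\<close>.\<close>

lemma tilt_le_iff:
  assumes M: "supp_tilting M" "supp M = ind_proj" and N: "supp_tilting N" "supp N = ind_proj"
  shows "tilt_le s (iso_class s M) (iso_class s N) \<longleftrightarrow> supp_tilting_le M N"
proof -
  have m: "M \<in> mods s" "N \<in> mods s" and E: "Ext0 M M" using M N unfolding supp_tilting_def by auto
  have inv: "perp1 s T' = perp1 s T" if T: "T \<in> mods s" and T': "T' \<in> iso_class s T" for T T'
  proof -
    have mT': "T' \<in> mods s" and i: "iso_mod T T'" using T' unfolding iso_class_def by auto
    have "Ext0 T X \<longleftrightarrow> Ext0 T' X" if X: "X \<in> mods s" for X
      using Ext0_iso[OF _ T X mT' X i] Ext0_iso[OF _ mT' X T X iso_mod_sym[OF i]]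
        iso_mod_refl[of X] T mT' X by auto
    then show ?thesis unfolding perp1_eq[OF T] perp1_eq[OF mT'] by blast
  qed
  have "tilt_le s (iso_class s M) (iso_class s N) \<longleftrightarrow> perp1 s M \<subseteq> perp1 s N"
  proof
    assume "tilt_le s (iso_class s M) (iso_class s N)"
    then obtain T1 T2 where "T1 \<in> iso_class s M" "T2 \<in> iso_class s N" "perp1 s T1 \<subseteq> perp1 s T2"
      unfolding tilt_le_def by blast
    then show "perp1 s M \<subseteq> perp1 s N" using inv[OF m(1), of T1] inv[OF m(2), of T2] by simp
  next
    assume "perp1 s M \<subseteq> perp1 s N"
    then show "tilt_le s (iso_class s M) (iso_class s N)"
      unfolding tilt_le_def by (intro bexI[of _ M] bexI[of _ N] iso_class_self m)
  qed
  also have "\<dots> \<longleftrightarrow> Ext0 N M"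
    unfolding perp1_eq[OF m(1)] perp1_eq[OF m(2)] using E m tilting_perp[OF M] by blast
  finally show ?thesis unfolding supp_tilting_le_def using M(2) N(2) by simp
qed

section \<open>Supports and the order\<close>

lemma Ext0_to_zero:
  assumes "carr X = {0}" "right_module X" shows "Ext0 M X"
  unfolding Ext0_def
proof (intro ballI allI impI)
  fix Z z f assume "Z \<in> mods s" "epi Z M z" and f: "f \<in> hom (submod Z (ker Z z)) X"
  have "f x = 0" if "x \<in> ker Z z" for x using hom_in[OF f] that assms(1) by auto
  then show "\<exists>h\<in>hom Z X. \<forall>x\<in>ker Z z. h x = f x" using assms(2) by (intro bexI[of _ "\<lambda>_. 0"]) auto
qed

text \<open>There are no loops: the kernel of \<open>P -> S\<close> is projective of smaller
  dimension than \<open>P\<close>, so \<open>P\<close> is not a summand of it, and it has no nonzero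
  map to a module supported at \<open>P\<close> alone.\<close>

lemma Ext0_simple:
  assumes S: "simple_mod S" "supp S = {P}" and Y: "Y \<in> mods s" "supp Y \<subseteq> {P}"
  shows "Ext0 S Y"
proof -
  have mS: "S \<in> mods s" and nz: "carr S \<noteq> {0}" using S(1) unfolding simple_mod_def by auto
  obtain P' q where "P' \<in> ind_proj" "supp S = {P'}" "epi P' S q" by (rule supp_simple[OF S(1)])
  then have P: "P \<in> ind_proj" and q: "epi P S q" using S(2) by auto
  have K: "submodule (ker P q) P" by (rule epi_ker_submodule[OF q ind_proj_mods[OF P] mS])
  have mK: "submod P (ker P q) \<in> mods s" by (rule submod_mods[OF ind_proj_mods[OF P] K])
  have "dm S \<noteq> 0" using dm_zero_iff[OF mS] nz by simp
  then have less: "dm (submod P (ker P q)) < dm P" using dm_epi[OF ind_proj_mods[OF P] mS q] by simp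
  have z: "hom (submod P (ker P q)) Y = {0}"
  proof (rule ccontr)
    assume "hom (submod P (ker P q)) Y \<noteq> {0}"
    then obtain P'' Z where Z: "P'' \<in> supp Y" "retract Z (submod P (ker P q))" "Z \<in> mods s" "iso_mod P'' Z"
      using supp_projective[OF ker_projs[OF ind_proj_projs[OF P] mS q] Y(1)] by blast
    then have "dm P = dm Z" using dm_iso[OF ind_proj_mods[OF P] Z(3)] Y(2) by auto
    obtain i p where ip: "i \<in> hom Z (submod P (ker P q))" "\<forall>x\<in>carr Z. p (i x) = x" using Z(2) retract_def by blast
    have "inj_on i (carr Z)" by (rule inj_on_inverseI[of _ p]) (use ip in simp)
    then have "dm Z \<le> dm (submod P (ker P q))" by (rule dm_inj(2)[OF Z(3) mK ip(1)])
    then show False using less \<open>dm P = dm Z\<close> by simp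
  qed
  show ?thesis
  proof (rule Ext0I[OF mS Y(1) ind_proj_projs[OF P] q])
    fix f assume "f \<in> hom (submod P (ker P q)) Y"
    then have "f = 0" using z by blast
    then show "\<exists>h\<in>hom P Y. \<forall>x\<in>ker P q. h x = f x" using Y(1) by (intro bexI[of _ "\<lambda>_. 0"]) auto
  qed
qed

lemma biprod_self: "right_module M \<Longrightarrow> biprod M [M] (\<lambda>_. idm M) (\<lambda>_. idm M)"
  unfolding biprod_def by simp

lemma simple_supp_tilting:
  assumes S: "simple_mod S" shows "supp_tilting S"
proof -
  have mS: "S \<in> mods s" and nz: "carr S \<noteq> {0}" using S unfolding simple_mod_def by auto
  obtain P q where P: "P \<in> ind_proj" "supp S = {P}" "epi P S q" by (rule supp_simple[OF S])
  have "indecomposable S" unfolding indecomposable_def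
  proof (intro conjI nz allI impI)
    fix U V assume UV: "internal_sum S U V"
    have U: "submodule U S" and V: "submodule V S" and int: "U \<inter> V = {0}"
      using UV unfolding internal_sum_def by auto
    show "U = {0} \<or> V = {0}"
    proof (cases "U = {0}")
      case False
      then have "U = carr S" using S U unfolding simple_mod_def by blast
      then show ?thesis using int submodule_subset[OF V] by blast
    qed blast
  qed
  then have ind: "\<forall>Y\<in>set [S]. Y \<in> mods s \<and> indecomposable Y" using mS by simp
  have pn: "pairwise_noniso [S]" unfolding pairwise_noniso_def by simp
  have b: "biprod S [S] (\<lambda>_. idm S) (\<lambda>_. idm S)" using biprod_self[OF mods_rmod[OF mS]] .
  have "num_summands s S = card (supp S)"
    using num_summands_biprod[OF mods_rmod[OF mS] b ind] P(2) by simp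
  moreover have "basic s S" using basic_biprod[OF mS b ind] pn by blast
  moreover have "Ext0 S S" using Ext0_simple[OF S P(2) mS] P(2) by simp
  ultimately show ?thesis unfolding supp_tilting_def using mS by blast
qed

lemma zero_supp_tilting:
  assumes Z: "Z \<in> mods s" "carr Z = {0}" shows "supp_tilting Z" "supp Z = {}"
proof -
  show e: "supp Z = {}" using supp_empty_iff[OF Z(1)] Z(2) by blast
  have b: "biprod Z [] (\<lambda>_ _. 0) (\<lambda>_ _. 0)" unfolding biprod_def using Z(2) by simp
  have "basic s Z" using basic_biprod[OF Z(1) b] unfolding pairwise_noniso_def by simp
  then show "supp_tilting Z"
    unfolding supp_tilting_def using Z e num_summands_biprod[OF mods_rmod[OF Z(1)] b] Ext0_to_zero[OF Z(2)] by simp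
qed

text \<open>\<open>Ext0_simple\<close> propagates along a filtration of \<open>M\<close> by simple
  submodules. Consequently modules supported at one common vertex are comparable in both
  directions.\<close>

lemma Ext0_single_support:
  assumes "M \<in> mods s" "supp M \<subseteq> {P}" "Y \<in> mods s" "supp Y \<subseteq> {P}"
  shows "Ext0 M Y"
  using assms(1,2)
proof (induction "dm M" arbitrary: M rule: less_induct)
  case less
  have rM: "right_module M" using less(2) by simp
  show ?case
  proof (cases "carr M = {0}")
    case True
    then have b: "biprod M [] (\<lambda>_ _. 0) (\<lambda>_ _. 0)" unfolding biprod_def by simp
    show ?thesis by (rule Ext0_biprod_left[OF less(2) b _ assms(3)]) simp
  next
    case False
    obtain U where U: "submodule U M" and S: "simple_mod (submod M U)" by (rule simple_submodule[OF less(2) False])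
    obtain Q q where Q: "Q \<in> mods s" and q: "epi M Q q" and k: "\<forall>x\<in>carr M. q x = 0 \<longleftrightarrow> x \<in> U"
      by (rule quotient[OF less(2) U])
    have kq: "ker M q = U" using k submodule_in[OF U] by (auto simp: ker_def)
    have mU: "submod M U \<in> mods s" and nz: "carr (submod M U) \<noteq> {0}" using S unfolding simple_mod_def by auto
    have "supp (submod M U) \<subseteq> {P}" using supp_sub[OF U less(2)] less(3) by blast
    then have "supp (submod M U) = {P}" using supp_empty_iff[OF mU] nz by blast
    then have EU: "Ext0 (submod M (ker M q)) Y" unfolding kq using Ext0_simple[OF S _ assms(3,4)] by blast
    have "dm (submod M U) \<noteq> 0" using dm_zero_iff[OF mU] nz by simp
    then have "dm Q < dm M" using dm_epi[OF less(2) Q q] kq by simp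
    moreover have "supp Q \<subseteq> {P}" using supp_quotient[OF less(2) Q q] less(3) by blast
    ultimately have "Ext0 Q Y" using less(1) Q by blast
    then show ?thesis by (rule Ext0_extension_left[OF less(2) Q assms(3) q EU])
  qed
qed

text \<open>Induction along a filtration of \<open>M\<close> with simple submodules. This turns a
  bound on atoms into a bound on \<open>M\<close>.\<close>

lemma Ext0_by_simples:
  assumes N: "N \<in> mods s" and M: "M \<in> mods s"
    and S: "\<And>S. simple_mod S \<Longrightarrow> supp S \<subseteq> supp M \<Longrightarrow> Ext0 N S"
  shows "Ext0 N M"
  using M S
proof (induction "dm M" arbitrary: M rule: less_induct)
  case less
  show ?case
  proof (cases "carr M = {0}")
    case True
    then show ?thesis using Ext0_to_zero less(2) by simp
  next
    case False
    obtain U where U: "submodule U M" and S: "simple_mod (submod M U)" by (rule simple_submodule[OF less(2) False])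
    obtain Q q where Q: "Q \<in> mods s" and q: "epi M Q q" and k: "\<forall>x\<in>carr M. q x = 0 \<longleftrightarrow> x \<in> U"
      by (rule quotient[OF less(2) U])
    have kq: "ker M q = U" using k submodule_in[OF U] by (auto simp: ker_def)
    have mU: "submod M U \<in> mods s" and nz: "carr (submod M U) \<noteq> {0}" using S unfolding simple_mod_def by auto
    have EU: "Ext0 N (submod M (ker M q))" unfolding kq by (rule less(3)[OF S supp_sub[OF U less(2)]])
    have "dm (submod M U) \<noteq> 0" using dm_zero_iff[OF mU] nz by simp
    then have "dm Q < dm M" using dm_epi[OF less(2) Q q] kq by simp
    moreover have "Ext0 N S" if "simple_mod S" "supp S \<subseteq> supp Q" for S
      using less(3) that supp_quotient[OF less(2) Q q] by blast
    ultimately have "Ext0 N Q" using less(1) Q by blast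
    then show ?thesis by (rule Ext0_extension_right[OF N Q less(2) q EU])
  qed
qed

text \<open>The sum of the modules of \<open>projective_mod_trace\<close>, one for each vertex of
  \<open>J\<close>, corresponds to the quotient algebra on \<open>J\<close> as a module over itself.
  It is relatively projective, and its summands are pairwise non-isomorphic because they determine
  the projectives mapping onto them.\<close>

lemma relative_generator:
  assumes J: "J \<subseteq> ind_proj"
  obtains N where "supp_tilting N" "supp N = J" "\<forall>Y\<in>mods s. supp Y \<subseteq> J \<longrightarrow> Ext0 N Y"
proof -
  have "\<exists>Q. \<exists>q. Q \<in> mods s \<and> epi P Q q \<and> indecomposable Q \<and> supp Q \<inter> (ind_proj - J) = {} \<and>
    (\<forall>Y\<in>mods s. supp Y \<inter> (ind_proj - J) = {} \<longrightarrow> Ext0 Q Y)" if "P \<in> J" for P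
    using projective_mod_trace[of "ind_proj - J" P] that J by blast
  then obtain Q q where Qq: "\<And>P. P \<in> J \<Longrightarrow> Q P \<in> mods s \<and> epi P (Q P) (q P) \<and> indecomposable (Q P) \<and>
    supp (Q P) \<inter> (ind_proj - J) = {} \<and> (\<forall>Y\<in>mods s. supp Y \<inter> (ind_proj - J) = {} \<longrightarrow> Ext0 (Q P) Y)"
    by metis
  have disj: "supp Y \<inter> (ind_proj - J) = {} \<longleftrightarrow> supp Y \<subseteq> J" for Y using supp_subset by blast
  have Q: "Q P \<in> mods s" "epi P (Q P) (q P)" "indecomposable (Q P)" "supp (Q P) \<subseteq> J"
    "\<And>Y. Y \<in> mods s \<Longrightarrow> supp Y \<subseteq> J \<Longrightarrow> Ext0 (Q P) Y" if "P \<in> J" for P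
    using Qq[OF that] unfolding disj by blast+
  have PQ: "P \<in> supp (Q P)" if P: "P \<in> J" for P
  proof -
    have rQ: "right_module (Q P)" using Q(1)[OF P] by simp
    obtain y where y: "y \<in> carr (Q P)" "y \<noteq> 0"
      using indecomposable_nz[OF Q(3)[OF P]] right_module.zero_closed[OF rQ] by blast
    obtain x where "x \<in> carr P" "q P x = y" using epi_surj[OF Q(2)[OF P] y(1)] by blast
    then show ?thesis using suppI[OF _ epi_hom[OF Q(2)[OF P]], of x] y(2) P J by blast
  qed
  have noniso: "P = P'" if P: "P \<in> J" "P' \<in> J" and i: "iso_mod (Q P) (Q P')" for P P'
  proof -
    have Pi: "P \<in> ind_proj" "P' \<in> ind_proj" using P J by auto
    obtain f where f: "f \<in> hom (Q P) (Q P')" "bij_betw f (carr (Q P)) (carr (Q P'))"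
      using i iso_mod_def by blast
    have "epi (Q P) (Q P') f" using f unfolding epi_def bij_betw_def by blast
    then have e: "epi P (Q P') (\<lambda>x. f (q P x))" using epi_comp[OF mods_rmod[OF Q(1)[OF P(1)]] Q(2)[OF P(1)]] by blast
    have "iso_mod P P'"
      by (rule indecomposable_projective_top[OF ind_proj_projs[OF Pi(1)] ind_proj(3)[OF Pi(1)] ind_proj_projs[OF Pi(2)]
            ind_proj(3)[OF Pi(2)] Q(1)[OF P(2)] indecomposable_nz[OF Q(3)[OF P(2)]] e Q(2)[OF P(2)]])
    then show ?thesis using ind_proj(4) Pi by blast
  qed
  obtain js where js: "set js = J" "distinct js"
    using finite_distinct_list[OF finite_subset[OF J ind_proj(1)]] by blast
  let ?Xs = "map Q js"
  have mX: "set ?Xs \<subseteq> mods s" using Q(1) js(1) by auto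
  have ind: "\<forall>Y\<in>set ?Xs. Y \<in> mods s \<and> indecomposable Y" using Q(1,3) js(1) by auto
  obtain N i p where N: "N \<in> mods s" and b: "biprod N ?Xs i p" by (rule direct_sum[OF mX])
  have pn: "pairwise_noniso ?Xs" unfolding pairwise_noniso_def
  proof (intro allI impI notI)
    fix k l assume a: "k < length ?Xs" "l < length ?Xs" "k \<noteq> l" "iso_mod (?Xs ! k) (?Xs ! l)"
    then have "js ! k = js ! l" using noniso[of "js ! k" "js ! l"] js(1) by auto
    then show False using a js(2) nth_eq_iff_index_eq[of js k l] by simp
  qed
  have sN: "supp N = J" using supp_biprod[OF N b mX] PQ Q(4) js(1) by auto
  have ext: "Ext0 N Y" if Y: "Y \<in> mods s" "supp Y \<subseteq> J" for Y
    by (rule Ext0_biprod_left[OF N b _ Y(1)]) (use Q(1,5) Y js(1) in auto)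
  have "num_summands s N = card (supp N)"
    using num_summands_biprod[OF mods_rmod[OF N] b ind] card_iso_classes[OF mX pn] distinct_card[OF js(2)] js(1) sN
    by simp
  moreover have "basic s N" using basic_biprod[OF N b ind] pn by blast
  ultimately have "supp_tilting N" unfolding supp_tilting_def using N ext[OF N] sN by blast
  then show thesis using that sN ext by blast
qed

lemma simple_with_support:
  assumes P: "P \<in> ind_proj" obtains S where "simple_mod S" "supp S = {P}"
proof -
  obtain S q where S: "simple_mod S" and q: "epi P S q"
    by (rule simple_quotient[OF ind_proj_mods[OF P] indecomposable_nz[OF ind_proj(3)[OF P]]])
  have mS: "S \<in> mods s" and nz: "carr S \<noteq> {0}" using S unfolding simple_mod_def by auto
  obtain y where y: "y \<in> carr S" "y \<noteq> 0" using nz right_module.zero_closed[OF mods_rmod[OF mS]] by blast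
  obtain x where x: "x \<in> carr P" "q x = y" using epi_surj[OF q y(1)] by blast
  have "P \<in> supp S" using suppI[OF P epi_hom[OF q], of x] x y by blast
  moreover obtain P' q' where "P' \<in> ind_proj" "supp S = {P'}" "epi P' S q'" by (rule supp_simple[OF S])
  ultimately show thesis using that S by auto
qed

end

section \<open>An order-theoretic description of the tilting modules\<close>

definition bottom :: "'x set \<Rightarrow> ('x \<Rightarrow> 'x \<Rightarrow> bool) \<Rightarrow> 'x \<Rightarrow> bool" where
  "bottom A le x \<longleftrightarrow> x \<in> A \<and> (\<forall>y\<in>A. le x y)"

text \<open>Minimality above the bottom in the form suited to a preorder: \<open>le a x\<close> in
  place of equality.\<close>

definition atom :: "'x set \<Rightarrow> ('x \<Rightarrow> 'x \<Rightarrow> bool) \<Rightarrow> 'x \<Rightarrow> bool" where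
  "atom A le a \<longleftrightarrow> a \<in> A \<and> \<not> bottom A le a \<and> (\<forall>x\<in>A. \<not> bottom A le x \<and> le x a \<longrightarrow> le a x)"

text \<open>
  For some atom \<open>a\<close> the element \<open>m\<close> lies below all upper bounds of the other atoms; \<open>\<not> le b a\<close> stands for
  \<open>b \<noteq> a\<close>, which avoids proving antisymmetry.
\<close>

definition below_coatomic_join :: "'x set \<Rightarrow> ('x \<Rightarrow> 'x \<Rightarrow> bool) \<Rightarrow> 'x \<Rightarrow> bool" where
  "below_coatomic_join A le m \<longleftrightarrow>
     (\<exists>a\<in>A. atom A le a \<and> (\<forall>n\<in>A. (\<forall>b\<in>A. atom A le b \<and> \<not> le b a \<longrightarrow> le b n) \<longrightarrow> le m n))"

lemma poset_iso_invariant: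
  assumes f: "poset_iso A leA B leB f"
  shows "x \<in> A \<Longrightarrow> bottom B leB (f x) \<longleftrightarrow> bottom A leA x"
    and "x \<in> A \<Longrightarrow> atom B leB (f x) \<longleftrightarrow> atom A leA x"
    and "x \<in> A \<Longrightarrow> below_coatomic_join B leB (f x) \<longleftrightarrow> below_coatomic_join A leA x"
proof -
  have B: "B = f ` A" and le: "\<And>x y. x \<in> A \<Longrightarrow> y \<in> A \<Longrightarrow> leB (f x) (f y) \<longleftrightarrow> leA x y"
    using f unfolding poset_iso_def bij_betw_def by auto
  show bot: "bottom B leB (f x) \<longleftrightarrow> bottom A leA x" if "x \<in> A" for x
    unfolding bottom_def B using that le by auto
  show at: "atom B leB (f x) \<longleftrightarrow> atom A leA x" if "x \<in> A" for x
    unfolding atom_def unfolding B ball_simps using that le bot unfolding B by auto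
  show "below_coatomic_join B leB (f x) \<longleftrightarrow> below_coatomic_join A leA x" if "x \<in> A" for x
    unfolding below_coatomic_join_def using that le at unfolding B by auto
qed

context her_alg
begin

lemma bottom_iff:
  assumes M: "supp_tilting M"
  shows "bottom (stau_tilt s) (stau_le s) (iso_class s M) \<longleftrightarrow> supp M = {}"
proof -
  have mM: "M \<in> mods s" using M unfolding supp_tilting_def by blast
  obtain Z where Z: "Z \<in> mods s" "carr Z = {0}" by (rule zero_module)
  note zs = zero_supp_tilting[OF Z]
  have "bottom (stau_tilt s) (stau_le s) (iso_class s M) \<longleftrightarrow> (\<forall>N. supp_tilting N \<longrightarrow> supp_tilting_le M N)"
    unfolding bottom_def stau_tilt_eq using M stau_le_iff[OF M] by auto
  also have "\<dots> \<longleftrightarrow> supp M = {}"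
  proof
    assume "\<forall>N. supp_tilting N \<longrightarrow> supp_tilting_le M N"
    then have "supp_tilting_le M Z" using zs(1) by blast
    then show "supp M = {}" using zs(2) unfolding supp_tilting_le_def by simp
  next
    assume e: "supp M = {}"
    then have "carr M = {0}" using supp_empty_iff[OF mM] by blast
    then show "\<forall>N. supp_tilting N \<longrightarrow> supp_tilting_le M N"
      unfolding supp_tilting_le_def using Ext0_to_zero[OF _ mods_rmod[OF mM]] e by simp
  qed
  finally show ?thesis .
qed

text \<open>A nonzero \<open>M\<close> lies above each of its simple quotients, so minimality
  confines its support to one vertex. Conversely everything nonzero below a module supported at
  \<open>P\<close> is itself supported at \<open>P\<close> alone and thus comparable both
  ways.\<close>

lemma atom_iff:
  assumes M: "supp_tilting M"
  shows "atom (stau_tilt s) (stau_le s) (iso_class s M) \<longleftrightarrow> (\<exists>P. supp M = {P})"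
proof -
  have mM: "M \<in> mods s" and E: "Ext0 M M" using M unfolding supp_tilting_def by auto
  have "atom (stau_tilt s) (stau_le s) (iso_class s M) \<longleftrightarrow>
    supp M \<noteq> {} \<and> (\<forall>N. supp_tilting N \<longrightarrow> supp N \<noteq> {} \<and> supp_tilting_le N M \<longrightarrow> supp_tilting_le M N)"
    unfolding atom_def using bottom_iff[OF M] M unfolding stau_tilt_eq
    using bottom_iff[unfolded stau_tilt_eq] stau_le_iff[OF M] stau_le_iff[OF _ M] by auto
  also have "\<dots> \<longleftrightarrow> (\<exists>P. supp M = {P})"
  proof
    assume a: "supp M \<noteq> {} \<and> (\<forall>N. supp_tilting N \<longrightarrow> supp N \<noteq> {} \<and> supp_tilting_le N M \<longrightarrow> supp_tilting_le M N)"
    then have nz: "carr M \<noteq> {0}" using supp_empty_iff[OF mM] by blast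
    obtain S q where S: "simple_mod S" and q: "epi M S q" by (rule simple_quotient[OF mM nz])
    have mS: "S \<in> mods s" using S unfolding simple_mod_def by blast
    obtain P r where P: "P \<in> ind_proj" "supp S = {P}" "epi P S r" by (rule supp_simple[OF S])
    have "supp_tilting_le S M" unfolding supp_tilting_le_def using Ext0_epi[OF mM mM mS q E] supp_quotient[OF mM mS q] by blast
    then have "supp_tilting_le M S" using a simple_supp_tilting[OF S] P(2) by blast
    then have "supp M \<subseteq> {P}" unfolding supp_tilting_le_def using P(2) by blast
    then show "\<exists>P. supp M = {P}" using a by blast
  next
    assume "\<exists>P. supp M = {P}"
    then obtain P where P: "supp M = {P}" by blast
    have "supp_tilting_le M N" if N: "supp_tilting N" "supp N \<noteq> {}" "supp_tilting_le N M" for N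
    proof -
      have "N \<in> mods s" using N(1) unfolding supp_tilting_def by blast
      moreover have "supp N \<subseteq> {P}" using N(3) P unfolding supp_tilting_le_def by blast
      ultimately show ?thesis
        unfolding supp_tilting_le_def using Ext0_single_support[of N P M] mM P N(2) by auto
    qed
    then show "supp M \<noteq> {} \<and> (\<forall>N. supp_tilting N \<longrightarrow> supp N \<noteq> {} \<and> supp_tilting_le N M \<longrightarrow> supp_tilting_le M N)" using P by blast
  qed
  finally show ?thesis .
qed

lemma below_coatomic_join_iff:
  assumes M: "supp_tilting M"
  shows "below_coatomic_join (stau_tilt s) (stau_le s) (iso_class s M) \<longleftrightarrow> supp M \<noteq> ind_proj"
proof -
  have mM: "M \<in> mods s" using M unfolding supp_tilting_def by auto
  let ?up = "\<lambda>A N. \<forall>B. supp_tilting B \<longrightarrow> (\<exists>P. supp B = {P}) \<and> \<not> supp_tilting_le B A \<longrightarrow> supp_tilting_le B N"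
  have up: "(\<forall>b\<in>stau_tilt s. atom (stau_tilt s) (stau_le s) b \<and> \<not> stau_le s b (iso_class s A) \<longrightarrow> stau_le s b (iso_class s N))
    \<longleftrightarrow> ?up A N" if "supp_tilting A" "supp_tilting N" for A N
    using atom_iff stau_le_iff that by (auto simp: stau_tilt_eq)
  have "below_coatomic_join (stau_tilt s) (stau_le s) (iso_class s M) \<longleftrightarrow>
    (\<exists>A. supp_tilting A \<and> (\<exists>P. supp A = {P}) \<and> (\<forall>N. supp_tilting N \<longrightarrow> ?up A N \<longrightarrow> supp_tilting_le M N))"
    (is "?lhs \<longleftrightarrow> ?rhs")
  proof
    assume ?lhs
    then obtain a where a: "a \<in> stau_tilt s" "atom (stau_tilt s) (stau_le s) a"
      "\<forall>n\<in>stau_tilt s. (\<forall>b\<in>stau_tilt s. atom (stau_tilt s) (stau_le s) b \<and> \<not> stau_le s b a \<longrightarrow> stau_le s b n) \<longrightarrow> stau_le s (iso_class s M) n"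
      unfolding below_coatomic_join_def by blast
    obtain A where A: "supp_tilting A" "a = iso_class s A" using a(1) unfolding stau_tilt_eq by blast
    have "supp_tilting_le M N" if N: "supp_tilting N" "?up A N" for N
    proof -
      have "iso_class s N \<in> stau_tilt s" using N(1) unfolding stau_tilt_eq by blast
      then have "stau_le s (iso_class s M) (iso_class s N)"
        using a(3) up[OF A(1) N(1)] N(2) unfolding A(2) by blast
      then show ?thesis using stau_le_iff[OF M N(1)] by blast
    qed
    then show ?rhs using A a(2) atom_iff[OF A(1)] by blast
  next
    assume ?rhs
    then obtain A where A: "supp_tilting A" "\<exists>P. supp A = {P}" "\<forall>N. supp_tilting N \<longrightarrow> ?up A N \<longrightarrow> supp_tilting_le M N" by blast
    have "stau_le s (iso_class s M) n" if n: "n \<in> stau_tilt s"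
      "\<forall>b\<in>stau_tilt s. atom (stau_tilt s) (stau_le s) b \<and> \<not> stau_le s b (iso_class s A) \<longrightarrow> stau_le s b n" for n
    proof -
      obtain N where N: "supp_tilting N" "n = iso_class s N" using n(1) unfolding stau_tilt_eq by blast
      have "?up A N" using up[OF A(1) N(1)] n(2) unfolding N(2) by blast
      then have "supp_tilting_le M N" using A(3) N(1) by blast
      then show ?thesis using stau_le_iff[OF M N(1)] N(2) by blast
    qed
    moreover have "iso_class s A \<in> stau_tilt s" using A(1) unfolding stau_tilt_eq by blast
    moreover have "atom (stau_tilt s) (stau_le s) (iso_class s A)" using atom_iff[OF A(1)] A(2) by blast
    ultimately show ?lhs unfolding below_coatomic_join_def by blast
  qed
  also have "\<dots> \<longleftrightarrow> supp M \<noteq> ind_proj"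
  proof
    assume ?rhs
    then obtain A P where A: "supp_tilting A" "supp A = {P}" "\<forall>N. supp_tilting N \<longrightarrow> ?up A N \<longrightarrow> supp_tilting_le M N" by blast
    have mA: "A \<in> mods s" using A(1) unfolding supp_tilting_def by blast
    have Pi: "P \<in> ind_proj" using A(2) supp_subset[of A] by blast
    \<comment> \<open>The concrete upper bound: a relative generator for the modules not supported
      at \<open>P\<close>.\<close>
    obtain N where N: "supp_tilting N" "supp N = ind_proj - {P}" "\<forall>Y\<in>mods s. supp Y \<subseteq> ind_proj - {P} \<longrightarrow> Ext0 N Y"
      by (rule relative_generator[of "ind_proj - {P}"]) blast
    have "?up A N"
    proof (intro allI impI)
      fix B assume B: "supp_tilting B" "(\<exists>P. supp B = {P}) \<and> \<not> supp_tilting_le B A"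
      have mB: "B \<in> mods s" using B(1) unfolding supp_tilting_def by blast
      obtain Q where Q: "supp B = {Q}" using B(2) by blast
      \<comment> \<open>A module supported at \<open>P\<close> alone would lie below
        \<open>A\<close>, since any two such modules are comparable in both directions.\<close>
      have "Q \<noteq> P"
      proof
        assume "Q = P"
        then have "supp_tilting_le B A"
          unfolding supp_tilting_le_def using Ext0_single_support[OF mA _ mB, of P] A(2) Q by simp
        then show False using B(2) by blast
      qed
      then have "supp B \<subseteq> ind_proj - {P}" using supp_subset[of B] unfolding Q by auto
      then show "supp_tilting_le B N" unfolding supp_tilting_le_def using N(2,3) mB by blast
    qed
    then have "supp_tilting_le M N" using A(3) N(1) by blast
    then show "supp M \<noteq> ind_proj" using N(2) Pi unfolding supp_tilting_le_def by blast
  next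
    assume "supp M \<noteq> ind_proj"
    then obtain P where P: "P \<in> ind_proj" "P \<notin> supp M" using supp_subset by blast
    \<comment> \<open>The exceptional atom is the simple module at a vertex missing from the support
      of \<open>M\<close>; the simple modules in a filtration of \<open>M\<close> then all count
      among the other atoms.\<close>
    obtain A where A: "simple_mod A" "supp A = {P}" by (rule simple_with_support[OF P(1)])
    have "supp_tilting_le M N" if N: "supp_tilting N" "?up A N" for N
    proof -
      have mN: "N \<in> mods s" using N(1) unfolding supp_tilting_def by blast
      have le: "supp_tilting_le S N" if S: "simple_mod S" "supp S \<subseteq> supp M" for S
      proof -
        obtain Q r where Q: "Q \<in> ind_proj" "supp S = {Q}" "epi Q S r" by (rule supp_simple[OF S(1)])
        have "Q \<noteq> P" using Q(2) S(2) P(2) by auto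
        then have "\<not> supp_tilting_le S A" unfolding supp_tilting_le_def Q(2) A(2) by simp
        then show ?thesis using N(2) simple_supp_tilting[OF S(1)] Q(2) by blast
      qed
      have "supp M \<subseteq> supp N"
      proof
        fix Q assume Q: "Q \<in> supp M"
        then have "Q \<in> ind_proj" using supp_subset by blast
        then obtain S where S: "simple_mod S" "supp S = {Q}" by (rule simple_with_support)
        then have "supp_tilting_le S N" using le[of S] Q by simp
        then show "Q \<in> supp N" unfolding supp_tilting_le_def using S(2) by blast
      qed
      moreover have "Ext0 N M"
        by (rule Ext0_by_simples[OF mN mM]) (use le in \<open>auto simp: supp_tilting_le_def\<close>)
      ultimately show ?thesis unfolding supp_tilting_le_def by blast
    qed
    then show ?rhs using simple_supp_tilting[OF A(1)] A(2) by blast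
  qed
  finally show ?thesis .
qed

text \<open>The right-hand side is formulated in the poset alone, so poset isomorphisms transport it
  by \<open>poset_iso_invariant\<close>.\<close>

lemma tilt_characterization:
  "tilt s = {x \<in> stau_tilt s. \<not> below_coatomic_join (stau_tilt s) (stau_le s) x}"
  unfolding tilt_eq using below_coatomic_join_iff unfolding stau_tilt_eq by auto

lemma tilt_le_stau_le:
  assumes "x \<in> tilt s" "y \<in> tilt s" shows "tilt_le s x y \<longleftrightarrow> stau_le s x y"
  using assms tilt_le_iff stau_le_iff unfolding tilt_eq by auto

end

theorem theorem1p2:
  fixes scL :: "'k::alg_closed_field \<Rightarrow> 'a::ring_1 \<Rightarrow> 'a"
    and scG :: "'k \<Rightarrow> 'b::ring_1 \<Rightarrow> 'b"
    and \<rho> :: "('a, nat \<Rightarrow> 'k) rmod set \<Rightarrow> ('b, nat \<Rightarrow> 'k) rmod set"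
  assumes "fd_algebra scL" "basic_algebra scL" "indecomposable_algebra scL" "hereditary_algebra scL"
    and "fd_algebra scG" "basic_algebra scG" "indecomposable_algebra scG" "hereditary_algebra scG"
    and "poset_iso (stau_tilt scL) (stau_le scL) (stau_tilt scG) (stau_le scG) \<rho>"
  shows "tilt scL \<subseteq> stau_tilt scL \<and> \<rho> ` tilt scL = tilt scG \<and>
    poset_iso (tilt scL) (tilt_le scL) (tilt scG) (tilt_le scG) \<rho>"
proof -
  interpret L: her_alg scL by unfold_locales (use assms in auto)
  interpret G: her_alg scG by unfold_locales (use assms in auto)
  note iso = assms(9)
  have sub: "tilt scL \<subseteq> stau_tilt scL" unfolding L.tilt_characterization by blast
  have bij: "bij_betw \<rho> (stau_tilt scL) (stau_tilt scG)"
    and le: "\<And>x y. x \<in> stau_tilt scL \<Longrightarrow> y \<in> stau_tilt scL \<Longrightarrow> stau_le scL x y \<longleftrightarrow> stau_le scG (\<rho> x) (\<rho> y)"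
    using iso unfolding poset_iso_def by auto
  have im: "\<rho> ` stau_tilt scL = stau_tilt scG" and inj: "inj_on \<rho> (stau_tilt scL)"
    using bij unfolding bij_betw_def by auto
  have image: "\<rho> ` tilt scL = tilt scG"
  proof
    show "\<rho> ` tilt scL \<subseteq> tilt scG"
      unfolding L.tilt_characterization G.tilt_characterization
      using poset_iso_invariant(3)[OF iso] im by auto
    show "tilt scG \<subseteq> \<rho> ` tilt scL"
    proof
      fix y assume y: "y \<in> tilt scG"
      then have "y \<in> \<rho> ` stau_tilt scL" unfolding im G.tilt_characterization by blast
      then obtain x where x: "x \<in> stau_tilt scL" "y = \<rho> x" by blast
      \<comment> \<open>The criterion is reflected by \<rho> as well as preserved, so the preimage
        of a tilting class is a tilting class.\<close>
      then have "x \<in> tilt scL"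
        using y poset_iso_invariant(3)[OF iso x(1)]
        unfolding L.tilt_characterization G.tilt_characterization by simp
      then show "y \<in> \<rho> ` tilt scL" using x(2) by blast
    qed
  qed
  have "bij_betw \<rho> (tilt scL) (tilt scG)"
    unfolding bij_betw_def using image inj_on_subset[OF inj sub] by blast
  moreover have "tilt_le scL x y \<longleftrightarrow> tilt_le scG (\<rho> x) (\<rho> y)" if xy: "x \<in> tilt scL" "y \<in> tilt scL" for x y
  proof -
    have "\<rho> x \<in> tilt scG" "\<rho> y \<in> tilt scG" using xy image by auto
    then show ?thesis using L.tilt_le_stau_le[OF xy] G.tilt_le_stau_le le[of x y] xy sub by blast
  qed
  ultimately show ?thesis unfolding poset_iso_def using sub image by blast
qed

end
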